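(* Let $M$ be a hyperbolic 3-manifold with finitely generated fundamental group, and let $f\colon X\to M$ and $g\colon X\to M$ be carrier graphs (with the same domain graph $X$), which either each have minimal length within their equivalence classes or each have minimal length globally (that is, are minimal length carrier graphs for $M$). If $f$ and $g$ are homotopic, then they are essentially equivalent.
   Context: A hyperbolic 3-manifold is a complete one, i.e. a quotient of $\mathbb{H}^3$ by a discrete torsion-free group of isometries. The rank of a finitely generated group is the minimal cardinality of a generating set. A carrier graph for $M$ is a finite (connected) graph $X$ along with a map $f\colon X\to M$ such that $f_*\colon\pi_1(X)\to\pi_1(M)$ is surjective; it is assumed that $f$ takes edges to rectifiable paths in $M$, and only carrier graphs with $\mathrm{rank}(\pi_1(X))=\mathrm{rank}(\pi_1(M))$ are considered. The length $\mathrm{len}_f(e)$ of an edge $e$ of $X$ is the length of the path $f|_e$, and the length $\mathrm{len}_f(X)$ of the carrier graph is the sum of the lengths of the edges of $X$. A minimal length carrier graph for $M$ is a carrier graph with length less than or equal to the length of any other (minimal rank) carrier graph for $M$. Two carrier graphs $f\colon X\to M$ and $g\colon Y\to M$ are equivalent if there exists a homotopy equivalence $\eta\colon X\to Y$ such that $f$ and $g\eta$ are freely homotopic. A carrier graph has minimal length within its equivalence class if its length is less than or equal to that of every carrier graph equivalent to it. Two carrier graphs $f,g\colon X\to M$ are essentially equivalent if $f=g\eta$, where $\eta\colon X\to X$ is a homeomorphism that fixes vertices and leaves edges and their orientations invariant; in other words, $f$ and $g$ are the same except for reparameterizing the edges. Homotopies of maps $X\to M$ are free (vertices may move).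
   Formalization: Added: every vertex of X has valence at least 3 (else a vertex can slide along a closed geodesic or a subdivided edge), and f, g are not constant on a subinterval of an edge unless constant on the whole edge (else f = gη can fail for a homeomorphism η). *)

theory Defs
  imports
    "HOL-Analysis.Analysis"
    "HOL-Algebra.Generated_Groups"
    "Graph_Theory.Digraph_Component"
begin

section \<open>Hyperbolic 3-space\<close>

text \<open>The hyperboloid model: the upper sheet of the unit hyperboloid in Minkowski space, where the
  hyperbolic distance is determined by \<open>cosh (dist x y) = - \<langle>x, y\<rangle>\<close>.\<close>

definition minkowski :: "(real ^ 3) \<times> real \<Rightarrow> (real ^ 3) \<times> real \<Rightarrow> real" where
  "minkowski p q = fst p \<bullet> fst q - snd p * snd q"

typedef hyp3 = "{p :: (real ^ 3) \<times> real. minkowski p p = - 1 \<and> snd p > 0}"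
  by (rule exI[of _ "(0, 1)"]) (simp add: minkowski_def)

lemma minkowski_commute: "minkowski p q = minkowski q p"
  by (simp add: minkowski_def inner_commute mult.commute)

lemma minkowski_lincomb:
  "minkowski (p - a *\<^sub>R r) (q - b *\<^sub>R s) =
     minkowski p q - b * minkowski p s - a * minkowski r q + a * b * minkowski r s"
  by (simp add: minkowski_def inner_diff_left inner_diff_right algebra_simps)

lemma minkowski_orthogonal_aux:
  assumes y: "minkowski y y = - 1" "snd y > 0" and u: "minkowski u y = 0"
  shows "(norm (fst u))\<^sup>2 \<le> minkowski u u * (snd y)\<^sup>2"
proof -
  have 1: "(snd u * snd y)\<^sup>2 \<le> (norm (fst u))\<^sup>2 * (norm (fst y))\<^sup>2"
  proof -
    have "snd u * snd y = fst u \<bullet> fst y" using u by (simp add: minkowski_def)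
    then show ?thesis
      using Cauchy_Schwarz_ineq[of "fst u" "fst y"] by (simp add: power2_norm_eq_inner)
  qed
  have 2: "(norm (fst y))\<^sup>2 = (snd y)\<^sup>2 - 1"
    using y(1) by (simp add: minkowski_def power2_norm_eq_inner flip: power2_eq_square)
  have 3: "minkowski u u = (norm (fst u))\<^sup>2 - (snd u)\<^sup>2"
    by (simp add: minkowski_def power2_norm_eq_inner flip: power2_eq_square)
  from 1 show ?thesis
    unfolding 2 3 power_mult_distrib by (simp add: algebra_simps)
qed

lemma minkowski_orthogonal_nonneg:
  assumes "minkowski y y = - 1" "snd y > 0" "minkowski u y = 0"
  shows "0 \<le> minkowski u u"
proof -
  have "0 \<le> minkowski u u * (snd y)\<^sup>2"
    using minkowski_orthogonal_aux[OF assms] zero_le_power2[of "norm (fst u)"] by linarith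
  then show ?thesis
    using assms(2) by (simp add: zero_le_mult_iff)
qed

lemma minkowski_orthogonal_Cauchy_Schwarz:
  assumes y: "minkowski y y = - 1" "snd y > 0"
    and u: "minkowski u y = 0" and w: "minkowski w y = 0"
  shows "(minkowski u w)\<^sup>2 \<le> minkowski u u * minkowski w w"
proof -
  have nonneg: "0 \<le> minkowski u u - 2 * b * minkowski u w + b\<^sup>2 * minkowski w w" for b
  proof -
    have "minkowski (u - b *\<^sub>R w) y = 0"
      using minkowski_lincomb[of u b w y 0 0] u w by simp
    then have "0 \<le> minkowski (u - b *\<^sub>R w) (u - b *\<^sub>R w)"
      using minkowski_orthogonal_nonneg[OF y] by blast
    then show ?thesis
      unfolding minkowski_lincomb by (simp add: minkowski_commute[of w u] power2_eq_square)
  qed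
  show ?thesis
  proof (cases "minkowski w w = 0")
    case True
    have "minkowski u w = 0"
    proof (rule ccontr)
      assume ne: "minkowski u w \<noteq> 0"
      show False
        using nonneg[of "(minkowski u u + 1) / (2 * minkowski u w)"] ne True by simp
    qed
    then show ?thesis by (simp add: True)
  next
    case False
    then have pos: "0 < minkowski w w"
      using minkowski_orthogonal_nonneg[OF y w] by simp
    have "0 \<le> minkowski w w *
        (minkowski u u - 2 * (minkowski u w / minkowski w w) * minkowski u w
          + (minkowski u w / minkowski w w)\<^sup>2 * minkowski w w)"
      using nonneg[of "minkowski u w / minkowski w w"] pos by (intro mult_nonneg_nonneg) simp_all
    also have "\<dots> = minkowski u u * minkowski w w - (minkowski u w)\<^sup>2"
      using pos by (simp add: field_simps power2_eq_square)
    finally show ?thesis by simp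
  qed
qed

lemma minkowski_hyp3:
  "minkowski (Rep_hyp3 x) (Rep_hyp3 x) = - 1" "snd (Rep_hyp3 x) > 0"
  using Rep_hyp3[of x] by auto

lemma minkowski_hyp3_component:
  fixes x y :: hyp3
  defines "u \<equiv> Rep_hyp3 x + minkowski (Rep_hyp3 x) (Rep_hyp3 y) *\<^sub>R Rep_hyp3 y"
  shows "minkowski u (Rep_hyp3 y) = 0"
    and "minkowski u u = (minkowski (Rep_hyp3 x) (Rep_hyp3 y))\<^sup>2 - 1"
  by (simp_all add: u_def minkowski_hyp3 minkowski_commute[of "Rep_hyp3 y" "Rep_hyp3 x"]
      minkowski_lincomb[of "Rep_hyp3 x" "- minkowski (Rep_hyp3 x) (Rep_hyp3 y)" "Rep_hyp3 y"
        "Rep_hyp3 y" 0 0, simplified]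
      minkowski_lincomb[of "Rep_hyp3 x" "- minkowski (Rep_hyp3 x) (Rep_hyp3 y)" "Rep_hyp3 y"
        "Rep_hyp3 x" "- minkowski (Rep_hyp3 x) (Rep_hyp3 y)" "Rep_hyp3 y", simplified]
      power2_eq_square)

lemma minkowski_hyp3_le: "minkowski (Rep_hyp3 x) (Rep_hyp3 y) \<le> - 1"
proof -
  let ?x = "Rep_hyp3 x" and ?y = "Rep_hyp3 y"
  have sq: "1 \<le> (minkowski ?x ?y)\<^sup>2"
    using minkowski_orthogonal_nonneg[OF minkowski_hyp3[of y] minkowski_hyp3_component(1)[of x y]]
      minkowski_hyp3_component(2)[of x y] by simp
  have lt: "norm (fst (Rep_hyp3 z)) < snd (Rep_hyp3 z)" for z
  proof (rule power2_less_imp_less)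
    show "(norm (fst (Rep_hyp3 z)))\<^sup>2 < (snd (Rep_hyp3 z))\<^sup>2"
      using minkowski_hyp3(1)[of z]
      unfolding minkowski_def power2_norm_eq_inner power2_eq_square[of "snd (Rep_hyp3 z)"]
      by linarith
    show "0 \<le> snd (Rep_hyp3 z)"
      using minkowski_hyp3(2)[of z] by simp
  qed
  have "fst ?x \<bullet> fst ?y \<le> norm (fst ?x) * norm (fst ?y)"
    by (rule norm_cauchy_schwarz)
  also have "\<dots> \<le> snd ?x * snd ?y"
    using lt[of x] lt[of y] minkowski_hyp3(2)[of x] by (intro mult_mono) simp_all
  finally have "minkowski ?x ?y \<le> 0" by (simp add: minkowski_def)
  then show ?thesis
    using sq abs_le_square_iff[of 1 "minkowski ?x ?y"] by simp
qed

instantiation hyp3 :: metric_space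
begin

definition dist_hyp3 :: "hyp3 \<Rightarrow> hyp3 \<Rightarrow> real" where
  "dist_hyp3 x y = arcosh (- minkowski (Rep_hyp3 x) (Rep_hyp3 y))"

definition uniformity_hyp3 :: "(hyp3 \<times> hyp3) filter" where
  "uniformity_hyp3 = (INF e\<in>{0 <..}. principal {(x, y). dist x y < e})"

definition open_hyp3 :: "hyp3 set \<Rightarrow> bool" where
  "open_hyp3 U \<longleftrightarrow> (\<forall>x\<in>U. eventually (\<lambda>(x', y). x' = x \<longrightarrow> y \<in> U) uniformity)"

instance
proof
  show "uniformity = (INF e\<in>{0 <..}. principal {(x :: hyp3, y). dist x y < e})"
    by (rule uniformity_hyp3_def)
  show "open U \<longleftrightarrow> (\<forall>x\<in>U. eventually (\<lambda>(x', y). x' = x \<longrightarrow> y \<in> U) uniformity)"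
    for U :: "hyp3 set"
    by (rule open_hyp3_def)
  have cosh_dist: "cosh (dist x y) = - minkowski (Rep_hyp3 x) (Rep_hyp3 y)" for x y :: hyp3
    using minkowski_hyp3_le[of x y] by (simp add: dist_hyp3_def)
  have dist_ge0: "0 \<le> dist x y" for x y :: hyp3
    using minkowski_hyp3_le[of x y] by (simp add: dist_hyp3_def arcosh_nonneg_real)
  have sinh_dist: "sinh (dist x y) = sqrt ((minkowski (Rep_hyp3 x) (Rep_hyp3 y))\<^sup>2 - 1)"
    for x y :: hyp3
  proof -
    have "(sinh (dist x y))\<^sup>2 = (minkowski (Rep_hyp3 x) (Rep_hyp3 y))\<^sup>2 - 1"
      by (simp add: sinh_square_eq cosh_dist)
    then show ?thesis
      using dist_ge0[of x y] by (intro real_sqrt_unique[symmetric]) simp_all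
  qed
  show "dist x y = 0 \<longleftrightarrow> x = y" for x y :: hyp3
  proof
    assume "dist x y = 0"
    then have m: "minkowski (Rep_hyp3 x) (Rep_hyp3 y) = - 1"
      using cosh_dist[of x y] by simp
    define u where "u = Rep_hyp3 x - Rep_hyp3 y"
    have u: "minkowski u (Rep_hyp3 y) = 0" "minkowski u u = 0"
      using minkowski_hyp3_component[where x = x and y = y] by (simp_all add: m u_def)
    have "fst u = 0"
      using minkowski_orthogonal_aux[OF minkowski_hyp3[of y] u(1)] u(2) by simp
    moreover from this have "snd u = 0"
      using u(2) by (simp add: minkowski_def)
    ultimately have "Rep_hyp3 x = Rep_hyp3 y"
      by (simp add: u_def prod_eq_iff)
    then show "x = y" by (simp add: Rep_hyp3_inject)
  next
    assume "x = y"
    then show "dist x y = 0" by (simp add: dist_hyp3_def minkowski_hyp3)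
  qed
  have dist_sym: "dist x y = dist y x" for x y :: hyp3
    by (simp add: dist_hyp3_def minkowski_commute)
  show "dist x y \<le> dist x z + dist y z" for x y z :: hyp3
  proof -
    let ?x = "Rep_hyp3 x" and ?y = "Rep_hyp3 y" and ?z = "Rep_hyp3 z"
    define a where "a = minkowski ?x ?z"
    define b where "b = minkowski ?y ?z"
    define u where "u = ?x + a *\<^sub>R ?z"
    define w where "w = ?y + b *\<^sub>R ?z"
    have u: "minkowski u ?z = 0" "minkowski u u = a\<^sup>2 - 1"
      unfolding u_def a_def by (rule minkowski_hyp3_component)+
    have w: "minkowski w ?z = 0" "minkowski w w = b\<^sup>2 - 1"
      unfolding w_def b_def by (rule minkowski_hyp3_component)+
    have uw: "minkowski u w = minkowski ?x ?y + a * b"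
      using minkowski_lincomb[of ?x "- a" ?z ?y "- b" ?z]
      by (simp add: u_def w_def a_def b_def minkowski_hyp3 minkowski_commute[of ?z ?y])
    have "\<bar>minkowski u w\<bar> \<le> sqrt (minkowski u u * minkowski w w)"
      using minkowski_orthogonal_Cauchy_Schwarz[OF minkowski_hyp3[of z] u(1) w(1)]
      by (intro real_le_rsqrt) simp
    then have "- minkowski ?x ?y \<le> a * b + sqrt (a\<^sup>2 - 1) * sqrt (b\<^sup>2 - 1)"
      unfolding uw u(2) w(2) by (simp add: real_sqrt_mult)
    then have "cosh (dist x y) \<le> cosh (dist x z + dist y z)"
      by (simp add: cosh_add cosh_dist sinh_dist a_def b_def)
    then show ?thesis
      using dist_ge0 by (simp add: cosh_real_nonneg_le_iff)
  qed
qed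

end


section \<open>Hyperbolic 3-manifolds\<close>

definition hyp3_isometries :: "(hyp3 \<Rightarrow> hyp3) monoid" where
  "hyp3_isometries =
     \<lparr>carrier = {\<gamma>. surj \<gamma> \<and> (\<forall>x y. dist (\<gamma> x) (\<gamma> y) = dist x y)}, mult = (\<circ>), one = id\<rparr>"

text \<open>Here \<open>discrete\<close> refers to the topology of pointwise convergence on \<open>hyp3 \<Rightarrow> hyp3\<close>; on the
  isometry group it coincides with the compact-open topology.\<close>

definition discrete_torsion_free :: "(hyp3 \<Rightarrow> hyp3) set \<Rightarrow> bool" where
  "discrete_torsion_free \<Gamma> \<longleftrightarrow>
     subgroup \<Gamma> hyp3_isometries \<and> discrete \<Gamma> \<and>
     (\<forall>\<gamma>\<in>\<Gamma>. \<forall>n>0. \<gamma> ^^ n = id \<longrightarrow> \<gamma> = id)"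

text \<open>The manifold \<open>\<real>H\<^sup>3 / \<Gamma>\<close> is the set of orbits with the quotient metric, which is the
  infimum \<open>setdist\<close> of the distances between representatives.\<close>

definition hyp3_quotient :: "(hyp3 \<Rightarrow> hyp3) set \<Rightarrow> hyp3 set set" where
  "hyp3_quotient \<Gamma> = range (\<lambda>x. (\<lambda>\<gamma>. \<gamma> x) ` \<Gamma>)"

definition hyp3_quotient_top :: "(hyp3 \<Rightarrow> hyp3) set \<Rightarrow> hyp3 set topology" where
  "hyp3_quotient_top \<Gamma> = Metric_space.mtopology (hyp3_quotient \<Gamma>) setdist"


section \<open>Length of paths\<close>

text \<open>Supremum of the lengths of inscribed polygons; a path is rectifiable if it is finite.\<close>

definition path_length :: "('m \<Rightarrow> 'm \<Rightarrow> real) \<Rightarrow> (real \<Rightarrow> 'm) \<Rightarrow> ennreal" where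
  "path_length d p =
     (SUP ts\<in>{ts. sorted ts \<and> set ts \<subseteq> {0..1}}.
        \<Sum>i<length ts - 1. ennreal (d (p (ts ! i)) (p (ts ! Suc i))))"


section \<open>Fundamental group and rank\<close>

definition loop_in :: "'p topology \<Rightarrow> 'p \<Rightarrow> (real \<Rightarrow> 'p) \<Rightarrow> bool" where
  "loop_in T x p \<longleftrightarrow> pathin T p \<and> p 0 = x \<and> p 1 = x"

definition loop_class :: "'p topology \<Rightarrow> 'p \<Rightarrow> (real \<Rightarrow> 'p) \<Rightarrow> (real \<Rightarrow> 'p) set" where
  "loop_class T x p =
     {q. homotopic_with (\<lambda>r. r 0 = x \<and> r 1 = x) (top_of_set {0..1}) T p q}"

definition loop_join :: "(real \<Rightarrow> 'p) \<Rightarrow> (real \<Rightarrow> 'p) \<Rightarrow> real \<Rightarrow> 'p" where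
  "loop_join p q = (\<lambda>t. if t \<le> 1/2 then p (2 * t) else q (2 * t - 1))"

definition fundamental_group :: "'p topology \<Rightarrow> 'p \<Rightarrow> (real \<Rightarrow> 'p) set monoid" where
  "fundamental_group T x =
     \<lparr>carrier = loop_class T x ` {p. loop_in T x p},
      mult = (\<lambda>A B. \<Union>p\<in>A. \<Union>q\<in>B. loop_class T x (loop_join p q)),
      one = loop_class T x (\<lambda>_. x)\<rparr>"

text \<open>The union in the next definition is over equal sets if \<open>f\<close> is continuous.\<close>

definition induced_hom ::
    "'q topology \<Rightarrow> ('p \<Rightarrow> 'q) \<Rightarrow> 'p \<Rightarrow> (real \<Rightarrow> 'p) set \<Rightarrow> (real \<Rightarrow> 'q) set" where
  "induced_hom T f x A = (\<Union>p\<in>A. loop_class T (f x) (f \<circ> p))"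

definition generating_set :: "('g, 'r) monoid_scheme \<Rightarrow> 'g set \<Rightarrow> bool" where
  "generating_set G S \<longleftrightarrow> S \<subseteq> carrier G \<and> generate G S = carrier G"

definition finitely_generated :: "('g, 'r) monoid_scheme \<Rightarrow> bool" where
  "finitely_generated G \<longleftrightarrow> (\<exists>S. finite S \<and> generating_set G S)"

definition group_rank :: "('g, 'r) monoid_scheme \<Rightarrow> nat" where
  "group_rank G = (LEAST n. \<exists>S. finite S \<and> generating_set G S \<and> card S = n)"


section \<open>Graphs as topological spaces\<close>

text \<open>A finite graph, with loops and multiple edges allowed, is given by a \<open>fin_digraph\<close>: the arcs
  are the edges, each with a chosen orientation. In the realization, \<open>Inl v\<close> is the vertex \<open>v\<close> and
  \<open>Inr (e, t)\<close>, for \<open>0 < t < 1\<close>, is an interior point of the edge \<open>e\<close>; the topology is the quotient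
  topology of the disjoint union of the vertices and of a copy of \<open>[0, 1]\<close> for each edge.\<close>

definition edge_point :: "('v, 'e) pre_digraph \<Rightarrow> 'e \<Rightarrow> real \<Rightarrow> 'v + 'e \<times> real" where
  "edge_point X e t =
     (if t \<le> 0 then Inl (tail X e) else if t \<ge> 1 then Inl (head X e) else Inr (e, t))"

definition graph_points :: "('v, 'e) pre_digraph \<Rightarrow> ('v + 'e \<times> real) set" where
  "graph_points X = Inl ` verts X \<union> Inr ` (arcs X \<times> {0<..<1})"

definition graph_top :: "('v, 'e) pre_digraph \<Rightarrow> ('v + 'e \<times> real) topology" where
  "graph_top X = topology (\<lambda>U. U \<subseteq> graph_points X \<and>
     (\<forall>e\<in>arcs X. openin (top_of_set {0..1}) {t\<in>{0..1}. edge_point X e t \<in> U}))"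

lemma openin_graph_top:
  "openin (graph_top X) U \<longleftrightarrow> U \<subseteq> graph_points X \<and>
     (\<forall>e\<in>arcs X. openin (top_of_set {0..1}) {t\<in>{0..1}. edge_point X e t \<in> U})"
proof -
  let ?pre = "\<lambda>e U. {t\<in>{0..1}. edge_point X e t \<in> U}"
  let ?open = "\<lambda>U. U \<subseteq> graph_points X \<and> (\<forall>e\<in>arcs X. openin (top_of_set {0..1}) (?pre e U))"
  have "istopology ?open"
    unfolding istopology_def
  proof (intro conjI allI impI ballI)
    fix S T e assume "?open S" "?open T" "e \<in> arcs X"
    moreover have "?pre e (S \<inter> T) = ?pre e S \<inter> ?pre e T" by blast
    ultimately show "openin (top_of_set {0..1}) (?pre e (S \<inter> T))"
      by (simp only: openin_Int)
  next
    fix K e assume "\<forall>U\<in>K. ?open U" "e \<in> arcs X"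
    then have "openin (top_of_set {0..1}) (\<Union>U\<in>K. ?pre e U)"
      by (intro openin_Union) blast
    moreover have "?pre e (\<Union>K) = (\<Union>U\<in>K. ?pre e U)" by blast
    ultimately show "openin (top_of_set {0..1}) (?pre e (\<Union>K))"
      by (simp only:)
  qed blast+
  then show ?thesis
    unfolding graph_top_def by (simp only: topology_inverse')
qed

lemma topspace_graph_top:
  assumes "wf_digraph X"
  shows "topspace (graph_top X) = graph_points X"
proof -
  interpret wf_digraph X by fact
  have "edge_point X e t \<in> graph_points X" if "e \<in> arcs X" for e t
    using that by (auto simp: edge_point_def graph_points_def)
  then have "{t\<in>{0..1}. edge_point X e t \<in> graph_points X} = {0..1}" if "e \<in> arcs X" for e
    using that by auto
  then have "openin (graph_top X) (graph_points X)"
    by (simp add: openin_graph_top)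
  moreover have "topspace (graph_top X) \<subseteq> graph_points X"
    using openin_topspace[of "graph_top X"] by (simp only: openin_graph_top)
  ultimately show ?thesis
    by (intro subset_antisym openin_subset)
qed

text \<open>Both ends of a loop count.\<close>

definition valence :: "('v, 'e) pre_digraph \<Rightarrow> 'v \<Rightarrow> nat" where
  "valence X v = in_degree X v + out_degree X v"

definition homotopy_equivalence_map :: "'p topology \<Rightarrow> 'q topology \<Rightarrow> ('p \<Rightarrow> 'q) \<Rightarrow> bool" where
  "homotopy_equivalence_map S T \<eta> \<longleftrightarrow>
     continuous_map S T \<eta> \<and>
     (\<exists>\<theta>. continuous_map T S \<theta> \<and>
        homotopic_with (\<lambda>_. True) S S (\<theta> \<circ> \<eta>) id \<and>
        homotopic_with (\<lambda>_. True) T T (\<eta> \<circ> \<theta>) id)"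


section \<open>Carrier graphs\<close>

definition edge_length :: "('v, 'e) pre_digraph \<Rightarrow> ('v + 'e \<times> real \<Rightarrow> hyp3 set) \<Rightarrow> 'e \<Rightarrow> ennreal" where
  "edge_length X f e = path_length setdist (f \<circ> edge_point X e)"

definition graph_length :: "('v, 'e) pre_digraph \<Rightarrow> ('v + 'e \<times> real \<Rightarrow> hyp3 set) \<Rightarrow> ennreal" where
  "graph_length X f = (\<Sum>e\<in>arcs X. edge_length X f e)"

definition carrier_graph ::
    "(hyp3 \<Rightarrow> hyp3) set \<Rightarrow> ('v, 'e) pre_digraph \<Rightarrow> ('v + 'e \<times> real \<Rightarrow> hyp3 set) \<Rightarrow> bool" where
  "carrier_graph \<Gamma> X f \<longleftrightarrow>
     fin_digraph X \<and> Digraph_Component.connected X \<and>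
     continuous_map (graph_top X) (hyp3_quotient_top \<Gamma>) f \<and>
     (\<forall>e\<in>arcs X. edge_length X f e < \<infinity>) \<and>
     (\<forall>x\<in>graph_points X.
        induced_hom (hyp3_quotient_top \<Gamma>) f x ` carrier (fundamental_group (graph_top X) x) =
          carrier (fundamental_group (hyp3_quotient_top \<Gamma>) (f x)) \<and>
        group_rank (fundamental_group (graph_top X) x) =
          group_rank (fundamental_group (hyp3_quotient_top \<Gamma>) (f x)))"

definition equivalent_carrier_graphs ::
    "(hyp3 \<Rightarrow> hyp3) set \<Rightarrow> ('v, 'e) pre_digraph \<Rightarrow> ('v + 'e \<times> real \<Rightarrow> hyp3 set) \<Rightarrow>
      ('w, 'd) pre_digraph \<Rightarrow> ('w + 'd \<times> real \<Rightarrow> hyp3 set) \<Rightarrow> bool" where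
  "equivalent_carrier_graphs \<Gamma> X f Y g \<longleftrightarrow>
     (\<exists>\<eta>. homotopy_equivalence_map (graph_top X) (graph_top Y) \<eta> \<and>
        homotopic_with (\<lambda>_. True) (graph_top X) (hyp3_quotient_top \<Gamma>) f (g \<circ> \<eta>))"

text \<open>In the two notions of minimality, the competitors \<open>Y\<close> range over graphs whose vertices and
  edges are natural numbers; every finite graph is isomorphic to such a graph.\<close>

definition minimal_length_carrier_graph ::
    "(hyp3 \<Rightarrow> hyp3) set \<Rightarrow> ('v, 'e) pre_digraph \<Rightarrow> ('v + 'e \<times> real \<Rightarrow> hyp3 set) \<Rightarrow> bool" where
  "minimal_length_carrier_graph \<Gamma> X f \<longleftrightarrow>
     carrier_graph \<Gamma> X f \<and>
     (\<forall>(Y :: (nat, nat) pre_digraph) g. carrier_graph \<Gamma> Y g \<longrightarrow>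
        graph_length X f \<le> graph_length Y g)"

definition minimal_length_in_class ::
    "(hyp3 \<Rightarrow> hyp3) set \<Rightarrow> ('v, 'e) pre_digraph \<Rightarrow> ('v + 'e \<times> real \<Rightarrow> hyp3 set) \<Rightarrow> bool" where
  "minimal_length_in_class \<Gamma> X f \<longleftrightarrow>
     carrier_graph \<Gamma> X f \<and>
     (\<forall>(Y :: (nat, nat) pre_digraph) g.
        carrier_graph \<Gamma> Y g \<and> equivalent_carrier_graphs \<Gamma> X f Y g \<longrightarrow>
        graph_length X f \<le> graph_length Y g)"

text \<open>The function \<open>\<phi>\<close> expresses that \<open>\<eta>\<close> maps each edge to itself and preserves its orientation.
  The last equation is restricted to the points of the graph, as are all maps here.\<close>

definition essentially_equivalent ::
    "('v, 'e) pre_digraph \<Rightarrow> ('v + 'e \<times> real \<Rightarrow> hyp3 set) \<Rightarrow> ('v + 'e \<times> real \<Rightarrow> hyp3 set) \<Rightarrow> bool"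
  where
  "essentially_equivalent X f g \<longleftrightarrow>
     (\<exists>\<eta>. homeomorphic_map (graph_top X) (graph_top X) \<eta> \<and>
        (\<forall>v\<in>verts X. \<eta> (Inl v) = Inl v) \<and>
        (\<forall>e\<in>arcs X. \<exists>\<phi> :: real \<Rightarrow> real. strict_mono_on {0..1} \<phi> \<and> \<phi> ` {0..1} = {0..1} \<and>
           (\<forall>t\<in>{0..1}. \<eta> (edge_point X e t) = edge_point X e (\<phi> t))) \<and>
        (\<forall>x\<in>graph_points X. f x = g (\<eta> x)))"

text \<open>No edge is parameterized with a pause, that is, an edge path that is not constant is not
  constant on any nondegenerate subinterval either. A path with a pause is not of the form
  \<open>p \<circ> \<phi>\<close> with \<open>p\<close> injective and \<open>\<phi>\<close> a homeomorphism.\<close>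

definition no_pauses :: "('v, 'e) pre_digraph \<Rightarrow> ('v + 'e \<times> real \<Rightarrow> 'm) \<Rightarrow> bool" where
  "no_pauses X f \<longleftrightarrow>
     (\<forall>e\<in>arcs X. (f \<circ> edge_point X e) constant_on {0..1} \<or>
        (\<forall>a b. 0 \<le> a \<and> a < b \<and> b \<le> 1 \<longrightarrow> \<not> (f \<circ> edge_point X e) constant_on {a..b}))"

end

theory Submission
  imports Defs "HOL-Complex_Analysis.Winding_Numbers"
begin

text \<open>Lift \<open>f\<close> and, along the homotopy, \<open>g\<close> to \<open>hyp3\<close>. Both are then described by the same deck
  transformations on the edges, and by the positions of the lifted vertices; by minimality the edges
  are geodesics. The graph with the same deck transformations whose vertices are the midpoints of
  the two positions is no longer than the average, by convexity of the distance, hence it is minimal as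
  well. If some vertex is displaced, the equality case of convexity forces all edges of the
  midpoint graph at this vertex onto one line. Since there are at least three of them, two overlap
  near the vertex, and sliding one along the other gives a shorter equivalent carrier graph.
  Edges of length zero are collapsed first; a loop of length zero would be null-homotopic and would
  contradict the minimality of the rank. So the vertices of \<open>f\<close> and \<open>g\<close> coincide, and both maps
  parameterize the same geodesic edges.\<close>

section \<open>Homotopy of paths relative to endpoints, concatenation, change of base point\<close>

section \<open>Path homotopy in abstract topological spaces\<close>

text \<open>Fixing the labels of the edges turns minimality into a statement about a function of
  finitely many points of \<open>hyp3\<close>: every placement \<open>b\<close> of the vertices
  gives an equivalent carrier graph, whose straight representative has at most the sum of the
  distances from \<open>b (tail e)\<close> to \<open>lab e (b (head e))\<close> as its length. Each
  term is convex in \<open>b\<close>, but not strictly so, because two ends of a segment can be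
  shifted along their common line. Shortening alters the graph and not only the placement; therefore
  reversing, sliding and collapsing an edge are treated as moves, each with a homotopy equivalence
  and a rule for the new labels. Collapsing cannot be avoided: a slide along an edge shortens only
  if that edge has positive length, and the midpoint placement may have degenerate edges.
  Torsion-freeness is used twice: it makes the action free, and it excludes that the two ends of one
  loop leave a vertex in the same direction, since the square of the label would then fix a
  point.\<close>

notation loop_join (infixr "\<star>" 70)

text \<open>Homotopy relative to the endpoints. Only the endpoints of \<open>p\<close> are named;
  \<open>q\<close> is itself a stage of the homotopy, so it shares them.\<close>

definition path_htpy :: "'a topology \<Rightarrow> (real \<Rightarrow> 'a) \<Rightarrow> (real \<Rightarrow> 'a) \<Rightarrow> bool" where
  "path_htpy T p q \<longleftrightarrow>
     homotopic_with (\<lambda>r. r 0 = p 0 \<and> r 1 = p 1) (top_of_set {0..1}) T p q"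

definition path_rev :: "(real \<Rightarrow> 'a) \<Rightarrow> real \<Rightarrow> 'a" where
  "path_rev p = (\<lambda>t. p (1 - t))"

lemma path_rev_simps [simp]: "path_rev p 0 = p 1" "path_rev p 1 = p 0" "path_rev (path_rev p) = p"
  by (simp_all add: path_rev_def)

lemma loop_join_simps [simp]: "(p \<star> q) 0 = p 0" "(p \<star> q) 1 = q 1"
  by (simp_all add: loop_join_def)

lemma comp_loop_join: "f \<circ> (p \<star> q) = (f \<circ> p) \<star> (f \<circ> q)"
  by (auto simp: loop_join_def)

lemma comp_path_rev: "f \<circ> path_rev p = path_rev (f \<circ> p)"
  by (auto simp: path_rev_def)

lemma path_htpyD:
  assumes "path_htpy T p q"
  shows "pathin T p" "pathin T q" "q 0 = p 0" "q 1 = p 1"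
  using assms homotopic_with_imp_continuous_maps homotopic_with_imp_property
  unfolding path_htpy_def pathin_def by (blast+)

lemma path_htpy_refl: "pathin T p \<Longrightarrow> path_htpy T p p"
  by (simp add: path_htpy_def pathin_def)

lemma path_htpy_sym: "path_htpy T p q \<Longrightarrow> path_htpy T q p"
  using path_htpyD[of T p q] by (simp add: path_htpy_def homotopic_with_sym)

lemma path_htpy_trans [trans]: "path_htpy T p q \<Longrightarrow> path_htpy T q r \<Longrightarrow> path_htpy T p r"
  using path_htpyD[of T p q] unfolding path_htpy_def by (auto intro: homotopic_with_trans)

lemma path_htpyI:
  assumes "continuous_map (top_of_set ({0..1::real} \<times> {0..1::real})) T h"
    and "\<And>t. t \<in> {0..1} \<Longrightarrow> h (0, t) = p t" "\<And>t. t \<in> {0..1} \<Longrightarrow> h (1, t) = q t"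
    and "\<And>s. s \<in> {0..1} \<Longrightarrow> h (s, 0) = p 0" "\<And>s. s \<in> {0..1} \<Longrightarrow> h (s, 1) = p 1"
  shows "path_htpy T p q"
  unfolding path_htpy_def
  by (subst homotopic_with) (use assms in \<open>auto intro!: exI[of _ h]\<close>)

lemma path_htpyE:
  assumes "path_htpy T p q"
  obtains h where "continuous_map (top_of_set ({0..1::real} \<times> {0..1::real})) T h"
    "\<And>t. h (0, t) = p t" "\<And>t. h (1, t) = q t"
    "\<And>s. s \<in> {0..1} \<Longrightarrow> h (s, 0) = p 0" "\<And>s. s \<in> {0..1} \<Longrightarrow> h (s, 1) = p 1"
  using assms unfolding path_htpy_def homotopic_with_def by (auto 4 4)

lemma path_htpy_cong:
  assumes "pathin T p" "\<And>t. t \<in> {0..1} \<Longrightarrow> p t = q t"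
  shows "path_htpy T p q"
  unfolding path_htpy_def
  by (rule homotopic_with_equal) (use assms in \<open>auto simp: pathin_def\<close>)

lemma path_htpy_image:
  assumes "continuous_map S T f" "path_htpy S p q"
  shows "path_htpy T (f \<circ> p) (f \<circ> q)"
  using assms unfolding path_htpy_def
  by (auto intro!: homotopic_with_compose_continuous_map_left[where p = "\<lambda>r. r 0 = p 0 \<and> r 1 = p 1"])

lemma path_htpy_convex:
  fixes C :: "'a::real_normed_vector set"
  assumes "convex C" "pathin (top_of_set C) p" "pathin (top_of_set C) q" "p 0 = q 0" "p 1 = q 1"
  shows "path_htpy (top_of_set C) p q"
proof (rule path_htpyI)
  have p: "continuous_on {0..1} p" "p ` {0..1} \<subseteq> C" and q: "continuous_on {0..1} q" "q ` {0..1} \<subseteq> C"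
    using assms by (auto simp: pathin_def image_subset_iff_funcset)
  let ?h = "\<lambda>z. (1 - fst z) *\<^sub>R p (snd z) + fst z *\<^sub>R q (snd z)"
  have "continuous_on ({0..1} \<times> {0..1}) ?h"
    by (intro continuous_intros continuous_on_compose2[OF p(1)] continuous_on_compose2[OF q(1)]) auto
  moreover have "?h \<in> {0..1} \<times> {0..1} \<rightarrow> C"
    using p(2) q(2) \<open>convex C\<close> by (auto intro!: convexD_alt)
  ultimately show "continuous_map (top_of_set ({0..1::real} \<times> {0..1::real})) (top_of_set C) ?h"
    by simp
qed (use assms in \<open>auto simp: algebra_simps\<close>)

text \<open>Two paths in the unit interval with the same ends are homotopic there by convexity, and
  \<open>p\<close> carries the homotopy along. The laws of associativity, units and inverses for
  concatenation follow by choosing \<phi> and \<psi>.\<close>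

lemma path_htpy_reparam:
  assumes "pathin T p" "continuous_on {0..1} \<phi>" "\<phi> \<in> {0..1} \<rightarrow> {0..1}"
    "continuous_on {0..1} \<psi>" "\<psi> \<in> {0..1} \<rightarrow> {0..1}" "\<phi> 0 = \<psi> 0" "\<phi> 1 = \<psi> 1"
  shows "path_htpy T (p \<circ> \<phi>) (p \<circ> \<psi>)"
  using assms unfolding pathin_def
  by (intro path_htpy_image[where S = "top_of_set {0..1}"] path_htpy_convex) (auto simp: pathin_def)

lemma pathin_compose_map: "pathin S p \<Longrightarrow> continuous_map S T f \<Longrightarrow> pathin T (f \<circ> p)"
  unfolding pathin_def by (rule continuous_map_compose)

lemma pathin_reparam:
  assumes "pathin T p" "continuous_on {0..1} \<phi>" "\<phi> \<in> {0..1} \<rightarrow> {0..1}"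
  shows "pathin T (p \<circ> \<phi>)"
  using path_htpyD(1)[OF path_htpy_reparam[OF assms assms(2,3)]] by simp

lemma pathin_rev: "pathin T p \<Longrightarrow> pathin T (path_rev p)"
  unfolding path_rev_def
  by (rule pathin_reparam[where \<phi> = "\<lambda>t. 1 - t", unfolded o_def]) (auto intro!: continuous_intros)

lemma pathin_loop_join:
  assumes "pathin T p" "pathin T q" "p 1 = q 0"
  shows "pathin T (p \<star> q)"
proof -
  have "continuous_map (top_of_set {0..1}) T (\<lambda>t. if t \<le> 1/2 then p (2 * t) else q (2 * t - 1))"
  proof (rule continuous_map_cases_le)
    show "continuous_map (subtopology (top_of_set {0..1}) {x \<in> topspace (top_of_set {0..1}). x \<le> 1 / 2}) T (\<lambda>x. p (2 * x))"
      using assms(1) unfolding pathin_def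
      by (intro continuous_map_compose[where g = p and f = "\<lambda>x. 2 * x", unfolded o_def])
        (auto simp: subtopology_subtopology intro!: continuous_intros)
    show "continuous_map (subtopology (top_of_set {0..1}) {x \<in> topspace (top_of_set {0..1}). 1 / 2 \<le> x}) T (\<lambda>x. q (2 * x - 1))"
      using assms(2) unfolding pathin_def
      by (intro continuous_map_compose[where g = q and f = "\<lambda>x. 2 * x - 1", unfolded o_def])
        (auto simp: subtopology_subtopology intro!: continuous_intros)
    show "p (2 * t) = q (2 * t - 1)" if "t = 1/2" for t :: real
      unfolding that using assms(3) by simp
  qed (auto intro!: continuous_intros)
  then show ?thesis by (simp add: pathin_def loop_join_def)
qed

lemma path_htpy_join:
  assumes "path_htpy T p p'" "path_htpy T q q'" "p 1 = q 0"
  shows "path_htpy T (p \<star> q) (p' \<star> q')"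
proof -
  obtain h where h: "continuous_map (top_of_set ({0..1::real} \<times> {0..1::real})) T h"
    "\<And>t. h (0, t) = p t" "\<And>t. h (1, t) = p' t"
    "\<And>s. s \<in> {0..1} \<Longrightarrow> h (s, 0) = p 0" "\<And>s. s \<in> {0..1} \<Longrightarrow> h (s, 1) = p 1"
    using path_htpyE[OF assms(1)] by metis
  obtain k where k: "continuous_map (top_of_set ({0..1::real} \<times> {0..1::real})) T k"
    "\<And>t. k (0, t) = q t" "\<And>t. k (1, t) = q' t"
    "\<And>s. s \<in> {0..1} \<Longrightarrow> k (s, 0) = q 0" "\<And>s. s \<in> {0..1} \<Longrightarrow> k (s, 1) = q 1"
    using path_htpyE[OF assms(2)] by metis
  let ?I2 = "top_of_set ({0..1::real} \<times> {0..1::real})"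
  let ?f = "\<lambda>z. if snd z \<le> 1/2 then h (fst z, 2 * snd z) else k (fst z, 2 * snd z - 1)"
  have "continuous_map ?I2 T ?f"
  proof (rule continuous_map_cases_le)
    show "continuous_map (subtopology ?I2 {x \<in> topspace ?I2. snd x \<le> 1 / 2}) T (\<lambda>x. h (fst x, 2 * snd x))"
      using h(1) 
      by (intro continuous_map_compose[where g = h and f = "\<lambda>x. (fst x, 2 * snd x)", unfolded o_def])
        (auto simp: subtopology_subtopology intro!: continuous_intros)
    show "continuous_map (subtopology ?I2 {x \<in> topspace ?I2. 1 / 2 \<le> snd x}) T (\<lambda>x. k (fst x, 2 * snd x - 1))"
      using k(1) 
      by (intro continuous_map_compose[where g = k and f = "\<lambda>x. (fst x, 2 * snd x - 1)", unfolded o_def])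
        (auto simp: subtopology_subtopology intro!: continuous_intros)
    show "h (fst x, 2 * snd x) = k (fst x, 2 * snd x - 1)" if "x \<in> topspace ?I2" "snd x = 1/2" for x
    proof -
      have "fst x \<in> {0..1}" using that by auto
      then show ?thesis unfolding that(2) using h(5) k(4) assms(3) by simp
    qed
  qed (auto intro!: continuous_intros)
  then show ?thesis
       by (rule path_htpyI) (auto simp: h k loop_join_def)
qed

lemma path_htpy_rev:
  assumes "path_htpy T p q"
  shows "path_htpy T (path_rev p) (path_rev q)"
proof -
  obtain h where h: "continuous_map (top_of_set ({0..1::real} \<times> {0..1::real})) T h"
    "\<And>t. h (0, t) = p t" "\<And>t. h (1, t) = q t"
    "\<And>s. s \<in> {0..1} \<Longrightarrow> h (s, 0) = p 0" "\<And>s. s \<in> {0..1} \<Longrightarrow> h (s, 1) = p 1"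
    using path_htpyE[OF assms(1)] by metis
  have "continuous_map (top_of_set ({0..1} \<times> {0..1})) T (\<lambda>x. h (fst x, 1 - snd x))"
    using h(1) 
    by (intro continuous_map_compose[where g = h and f = "\<lambda>x. (fst x, 1 - snd x)", unfolded o_def])
      (auto intro!: continuous_intros)
  then show ?thesis
       by (rule path_htpyI) (auto simp: h path_rev_def)
qed

lemma path_htpy_assoc:
  assumes "pathin T p" "pathin T q" "pathin T r" "p 1 = q 0" "q 1 = r 0"
  shows "path_htpy T ((p \<star> q) \<star> r) (p \<star> q \<star> r)"
proof -
  \<comment> \<open>The piecewise linear map that takes the breakpoints 1/4 and 1/2 to 1/2 and 3/4.
    Its slopes 2, 1, 1/2 decrease, so it is the minimum of its three linear pieces.\<close>
  define \<phi> :: "real \<Rightarrow> real" where "\<phi> t = min (2 * t) (min (t + 1/4) ((t + 1) / 2))" for t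
  have "pathin T (p \<star> q \<star> r)"
    using assms by (intro pathin_loop_join) auto
  then have "path_htpy T ((p \<star> q \<star> r) \<circ> \<phi>) ((p \<star> q \<star> r) \<circ> (\<lambda>t. t))"
    by (intro path_htpy_reparam) (auto simp: \<phi>_def min_le_iff_disj intro!: continuous_intros)
  moreover have "((p \<star> q) \<star> r) t = ((p \<star> q \<star> r) \<circ> \<phi>) t" if "t \<in> {0..1}" for t
  proof -
    consider "t \<le> 1/4" | "1/4 < t" "t \<le> 1/2" | "1/2 < t" by linarith
    then show ?thesis
    proof cases
      case 1
      then have "\<phi> t = 2 * t" by (simp add: \<phi>_def)
      then show ?thesis using 1 by (simp add: loop_join_def)
    next
      case 2
      then have "\<phi> t = t + 1/4" by (simp add: \<phi>_def)
      then show ?thesis using 2 by (simp add: loop_join_def algebra_simps)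
    next
      case 3
      then have "\<phi> t = (t + 1) / 2" by (simp add: \<phi>_def min_def field_simps)
      then show ?thesis using 3 that by (simp add: loop_join_def field_simps)
    qed
  qed
  moreover have "pathin T ((p \<star> q) \<star> r)"
    using assms by (intro pathin_loop_join) auto
  ultimately have "path_htpy T ((p \<star> q) \<star> r) ((p \<star> q \<star> r) \<circ> \<phi>)"
    by (intro path_htpy_cong)
  then show ?thesis
    using \<open>path_htpy T ((p \<star> q \<star> r) \<circ> \<phi>) ((p \<star> q \<star> r) \<circ> (\<lambda>t. t))\<close>
    by (simp add: o_def path_htpy_trans)
qed

lemma path_htpy_const_right:
  assumes "pathin T p" "p 1 = x"
  shows "path_htpy T (p \<star> (\<lambda>_. x)) p"
proof -
  have "path_htpy T (p \<circ> (\<lambda>t. min 1 (2 * t))) (p \<circ> (\<lambda>t. t))"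
    using assms(1) by (intro path_htpy_reparam) (auto intro!: continuous_intros)
  moreover have "p \<star> (\<lambda>_. x) = p \<circ> (\<lambda>t. min 1 (2 * t))"
    using assms(2) by (auto simp: loop_join_def min_def fun_eq_iff intro!: arg_cong[of _ _ p])
  ultimately show ?thesis by (simp add: o_def)
qed

lemma path_htpy_const_left:
  assumes "pathin T p" "p 0 = x"
  shows "path_htpy T ((\<lambda>_. x) \<star> p) p"
proof -
  have "path_htpy T (p \<circ> (\<lambda>t. max 0 (2 * t - 1))) (p \<circ> (\<lambda>t. t))"
    using assms(1) by (intro path_htpy_reparam) (auto intro!: continuous_intros)
  moreover have "(\<lambda>_. x) \<star> p = p \<circ> (\<lambda>t. max 0 (2 * t - 1))"
    using assms(2) by (auto simp: loop_join_def max_def fun_eq_iff intro!: arg_cong[of _ _ p])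
  ultimately show ?thesis by (simp add: o_def)
qed

lemma path_htpy_rev_right:
  assumes "pathin T p"
  shows "path_htpy T (p \<star> path_rev p) (\<lambda>_. p 0)"
proof -
  \<comment> \<open>The tent map runs along \<open>p\<close> and back; like the constant 0 it starts
    and ends at 0.\<close>
  have "path_htpy T (p \<circ> (\<lambda>t. min (2 * t) (2 - 2 * t))) (p \<circ> (\<lambda>t. 0))"
    using assms(1) by (intro path_htpy_reparam) (auto intro!: continuous_intros simp: min_le_iff_disj)
  moreover have "p \<star> path_rev p = p \<circ> (\<lambda>t. min (2 * t) (2 - 2 * t))"
    by (auto simp: loop_join_def min_def path_rev_def fun_eq_iff)
  ultimately show ?thesis by (simp add: o_def)
qed

lemma path_htpy_rev_left:
  assumes "pathin T p"
  shows "path_htpy T (path_rev p \<star> p) (\<lambda>_. p 1)"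
  using path_htpy_rev_right[OF pathin_rev[OF assms]] by simp

lemma path_htpy_cancel_rev:
  assumes "pathin T p" "pathin T q" "p 0 = q 0"
  shows "path_htpy T (p \<star> path_rev p \<star> q) q"
proof -
  have "path_htpy T (p \<star> path_rev p \<star> q) ((p \<star> path_rev p) \<star> q)"
    using assms by (intro path_htpy_sym[OF path_htpy_assoc]) (auto simp: pathin_rev)
  also have "path_htpy T \<dots> ((\<lambda>_. q 0) \<star> q)"
    using assms path_htpy_rev_right[OF assms(1)] by (intro path_htpy_join path_htpy_refl) auto
  also have "path_htpy T \<dots> q"
    using assms by (intro path_htpy_const_left) auto
  finally show ?thesis .
qed

lemma path_htpy_cancel_rev':
  assumes "pathin T p" "pathin T q" "p 1 = q 0"
  shows "path_htpy T (path_rev p \<star> p \<star> q) q"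
  using path_htpy_cancel_rev[OF pathin_rev[OF assms(1)] assms(2)] assms(3) by simp

text \<open>The two ways around the boundary of the square from one corner to the opposite one are
  homotopic in the convex square.\<close>

lemma square_path_htpy:
  assumes "continuous_map (top_of_set ({0..1::real} \<times> {0..1::real})) T S"
  shows "path_htpy T ((\<lambda>t. S (0, t)) \<star> (\<lambda>s. S (s, 1))) ((\<lambda>s. S (s, 0)) \<star> (\<lambda>t. S (1, t)))"
proof -
  have pin: "pathin (top_of_set ({0..1} \<times> {0..1})) p"
    if "continuous_on {0..1} p" "p \<in> {0..1} \<rightarrow> {0..1} \<times> {0..1}" for p :: "real \<Rightarrow> real \<times> real"
    using that by (simp add: pathin_def)
  have "path_htpy (top_of_set ({0..1::real} \<times> {0..1::real}))
      ((\<lambda>t. (0, t)) \<star> (\<lambda>s. (s, 1))) ((\<lambda>s. (s, 0)) \<star> (\<lambda>t. (1, t)))"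
    by (intro path_htpy_convex convex_Times pathin_loop_join pin) (auto intro!: continuous_intros)
  from path_htpy_image[OF assms this]
  show ?thesis unfolding comp_loop_join by (simp add: o_def)
qed

subsection \<open>Conjugation by a path\<close>

text \<open>Change of base point: it takes loops at \<open>c 1\<close> to loops at
  \<open>c 0\<close>.\<close>

definition path_conj :: "(real \<Rightarrow> 'a) \<Rightarrow> (real \<Rightarrow> 'a) \<Rightarrow> real \<Rightarrow> 'a" where
  "path_conj c p = c \<star> p \<star> path_rev c"

lemma comp_path_conj: "f \<circ> path_conj c p = path_conj (f \<circ> c) (f \<circ> p)"
  by (simp add: path_conj_def comp_loop_join comp_path_rev)

lemma path_conj_simps [simp]: "path_conj c p 0 = c 0" "path_conj c p 1 = c 0"
  by (simp_all add: path_conj_def)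

lemma loop_in_conj:
  assumes "pathin T c" "loop_in T (c 1) p"
  shows "loop_in T (c 0) (path_conj c p)"
  using assms by (auto simp: loop_in_def path_conj_def intro!: pathin_loop_join pathin_rev)

lemma path_htpy_conj:
  assumes "path_htpy T c c'" "path_htpy T p p'" "p 0 = c 1" "p 1 = c 1"
  shows "path_htpy T (path_conj c p) (path_conj c' p')"
  using assms unfolding path_conj_def by (intro path_htpy_join path_htpy_rev) auto

lemma path_htpy_conj_join:
  assumes "pathin T c" "loop_in T (c 1) p" "loop_in T (c 1) q"
  shows "path_htpy T (path_conj c (p \<star> q)) (path_conj c p \<star> path_conj c q)"
proof -
  have p: "pathin T p" "p 0 = c 1" "p 1 = c 1" and q: "pathin T q" "q 0 = c 1" "q 1 = c 1"
    using assms by (auto simp: loop_in_def)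
  note [simp] = p q assms(1) pathin_rev pathin_loop_join path_htpy_refl
  have "path_htpy T (path_conj c p \<star> path_conj c q) (c \<star> (p \<star> path_rev c) \<star> (c \<star> q \<star> path_rev c))"
    unfolding path_conj_def by (rule path_htpy_assoc) simp_all
  also have "path_htpy T \<dots> (c \<star> p \<star> path_rev c \<star> (c \<star> q \<star> path_rev c))"
    by (intro path_htpy_join path_htpy_assoc) simp_all
  also have "path_htpy T \<dots> (c \<star> p \<star> q \<star> path_rev c)"
    by (intro path_htpy_join path_htpy_cancel_rev') simp_all
  also have "path_htpy T \<dots> (c \<star> (p \<star> q) \<star> path_rev c)"
    by (intro path_htpy_join path_htpy_sym[OF path_htpy_assoc]) simp_all
  finally show ?thesis
    unfolding path_conj_def by (rule path_htpy_sym)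
qed

lemma path_htpy_rev_join:
  assumes "pathin T p" "pathin T q" "p 1 = q 0"
  shows "path_htpy T (path_rev (p \<star> q)) (path_rev q \<star> path_rev p)"
proof (rule path_htpy_cong)
  show "pathin T (path_rev (p \<star> q))"
    using assms by (intro pathin_rev pathin_loop_join)
  show "path_rev (p \<star> q) t = (path_rev q \<star> path_rev p) t" if "t \<in> {0..1}" for t
  \<comment> \<open>At 1/2 the two sides evaluate different factors, namely \<open>p 1\<close> and
    \<open>q 0\<close>.\<close>
  proof (cases "t = 1/2")
    case True
    show ?thesis unfolding True using assms(3) by (simp add: path_rev_def loop_join_def)
  next
    case False
    then show ?thesis using that by (auto simp: path_rev_def loop_join_def algebra_simps)
  qed
qed

lemma path_htpy_conj_conj:
  assumes "pathin T c" "pathin T d" "c 1 = d 0" "loop_in T (d 1) p"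
  shows "path_htpy T (path_conj c (path_conj d p)) (path_conj (c \<star> d) p)"
proof -
  have p: "pathin T p" "p 0 = d 1" "p 1 = d 1" 
    using assms by (auto simp: loop_in_def)
  note [simp] = p assms(1-3) pathin_rev pathin_loop_join path_htpy_refl
  have "path_htpy T (path_conj (c \<star> d) p) ((c \<star> d) \<star> p \<star> (path_rev d \<star> path_rev c))"
    unfolding path_conj_def by (intro path_htpy_join path_htpy_rev_join) simp_all
  also have "path_htpy T \<dots> (c \<star> d \<star> p \<star> path_rev d \<star> path_rev c)"
    by (intro path_htpy_assoc) simp_all
  also have "path_htpy T \<dots> (c \<star> d \<star> (p \<star> path_rev d) \<star> path_rev c)"
    by (intro path_htpy_join path_htpy_sym[OF path_htpy_assoc]) simp_all
  also have "path_htpy T \<dots> (c \<star> (d \<star> p \<star> path_rev d) \<star> path_rev c)"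
    by (intro path_htpy_join path_htpy_sym[OF path_htpy_assoc]) simp_all
  finally show ?thesis
    unfolding path_conj_def by (rule path_htpy_sym)
qed

lemma path_htpy_conj_const:
  assumes "loop_in T x p"
  shows "path_htpy T (path_conj (\<lambda>_. x) p) p"
proof -
  have p: "pathin T p" "p 0 = x" "p 1 = x" "path_rev (\<lambda>_. x) = (\<lambda>_. x)"
    using assms by (auto simp: loop_in_def path_rev_def)
  moreover have "x \<in> topspace T"
    using p path_start_in_topspace[of T p] by simp
  ultimately show ?thesis
    unfolding path_conj_def p(4)
    by (intro path_htpy_trans[OF path_htpy_const_left path_htpy_const_right] pathin_loop_join) simp_all
qed

lemma path_htpy_conj_rev:
  assumes "pathin T c" "loop_in T (c 1) p"
  shows "path_htpy T (path_conj (path_rev c) (path_conj c p)) p"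
proof -
  have "path_htpy T (path_conj (path_rev c) (path_conj c p)) (path_conj (path_rev c \<star> c) p)"
    using assms by (intro path_htpy_conj_conj) (auto simp: pathin_rev)
  also have "path_htpy T \<dots> (path_conj (\<lambda>_. c 1) p)"
    using assms by (intro path_htpy_conj path_htpy_rev_left path_htpy_refl) (auto simp: loop_in_def)
  also have "path_htpy T \<dots> p"
    using assms by (intro path_htpy_conj_const)
  finally show ?thesis .
qed

lemma path_htpy_conj_rev':
  assumes "pathin T c" "loop_in T (c 0) p"
  shows "path_htpy T (path_conj c (path_conj (path_rev c) p)) p"
  using path_htpy_conj_rev[OF pathin_rev[OF assms(1)], of p] assms by simp

lemma path_htpy_conj_cancel:
  assumes "pathin T c" "loop_in T (c 1) p" "loop_in T (c 1) q"
    "path_htpy T (path_conj c p) (path_conj c q)"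
  shows "path_htpy T p q"
proof -
  have "path_htpy T p (path_conj (path_rev c) (path_conj c p))"
    using assms by (intro path_htpy_sym[OF path_htpy_conj_rev])
  also have "path_htpy T \<dots> (path_conj (path_rev c) (path_conj c q))"
    using assms by (intro path_htpy_conj[OF path_htpy_refl assms(4)]) (auto simp: pathin_rev)
  also have "path_htpy T \<dots> q"
    using assms by (intro path_htpy_conj_rev)
  finally show ?thesis .
qed

text \<open>A free homotopy changes the effect on loops only by a change of base point along the
  track \<open>c\<close> of the base point: the square \<open>h (s, p t)\<close> has
  \<open>f \<circ> p\<close> and \<open>g \<circ> p\<close> as opposite sides and \<open>c\<close>
  as both other sides.\<close>

lemma homotopic_track:
  assumes "homotopic_with (\<lambda>_. True) S T f g" "x \<in> topspace S"
  obtains c where "pathin T c" "c 0 = f x" "c 1 = g x"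
    "\<And>p. loop_in S x p \<Longrightarrow> path_htpy T (f \<circ> p) (path_conj c (g \<circ> p))"
proof -
  obtain h :: "real \<times> 'a \<Rightarrow> 'b" where h: "continuous_map (prod_topology (top_of_set {0..1}) S) T h"
    "\<And>x. h (0, x) = f x" "\<And>x. h (1, x) = g x"
    using assms(1) unfolding homotopic_with_def by auto
  define c where "c s = h (s, x)" for s
  have pc: "pathin T c"
    unfolding pathin_def c_def using assms(2)
    by (intro continuous_map_compose[where g = h and f = "\<lambda>s. (s, x)", unfolded o_def, OF _ h(1)])
       (simp add: continuous_map_pairwise o_def)
  show thesis
  proof
    fix p assume p: "loop_in S x p"
    then have p': "continuous_map (top_of_set {0..1}) S p"
      by (simp add: loop_in_def pathin_def)
    have "continuous_map (top_of_set ({0..1} \<times> {0..1})) (prod_topology (top_of_set {0..1}) S) (\<lambda>z. (fst z, p (snd z)))"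
      by (auto simp: continuous_map_pairwise o_def intro!: continuous_intros
          continuous_map_compose[OF _ p', unfolded o_def])
    from continuous_map_compose[OF this h(1)]
    have cont: "continuous_map (top_of_set ({0..1} \<times> {0..1})) T (\<lambda>z. h (fst z, p (snd z)))"
      by (simp add: o_def)
    have p01: "p 0 = x" "p 1 = x" using p by (auto simp: loop_in_def)
    have sq: "path_htpy T ((f \<circ> p) \<star> c) (c \<star> (g \<circ> p))"
      using square_path_htpy[OF cont] by (simp add: h p01 c_def[abs_def] o_def)
    have fp: "pathin T (f \<circ> p)" "(f \<circ> p) 1 = c 0" and gp: "pathin T (g \<circ> p)" "(g \<circ> p) 0 = c 1" "(g \<circ> p) 1 = c 1"
      using p homotopic_with_imp_continuous_maps[OF assms(1)] p01
      by (auto simp: loop_in_def c_def h intro: pathin_compose_map)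
    have "path_htpy T (f \<circ> p) ((f \<circ> p) \<star> (\<lambda>_. c 0))"
      by (rule path_htpy_sym[OF path_htpy_const_right[OF fp]])
    also have "path_htpy T \<dots> ((f \<circ> p) \<star> c \<star> path_rev c)"
      using fp(2) by (intro path_htpy_join path_htpy_sym[OF path_htpy_rev_right] path_htpy_refl fp pc)
    also have "path_htpy T \<dots> (((f \<circ> p) \<star> c) \<star> path_rev c)"
      using fp(2) by (intro path_htpy_sym[OF path_htpy_assoc] fp pc pathin_rev) simp_all
    also have "path_htpy T \<dots> ((c \<star> (g \<circ> p)) \<star> path_rev c)"
      by (intro path_htpy_join sq path_htpy_refl pathin_rev pc) simp
    also have "path_htpy T \<dots> (path_conj c (g \<circ> p))"
      unfolding path_conj_def using gp by (intro path_htpy_assoc pc pathin_rev) simp_all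
    finally show "path_htpy T (f \<circ> p) (path_conj c (g \<circ> p))" .
  qed (auto simp: pc, auto simp: c_def h)
qed

section \<open>Fundamental groups, generating sets and rank under homotopy equivalence\<close>

section \<open>The fundamental group\<close>

lemma loop_class_iff:
  assumes "loop_in T x p"
  shows "q \<in> loop_class T x p \<longleftrightarrow> path_htpy T p q"
  using assms by (simp add: loop_class_def path_htpy_def loop_in_def)

lemma loop_in_htpy: "loop_in T x p \<Longrightarrow> path_htpy T p q \<Longrightarrow> loop_in T x q"
  using path_htpyD[of T p q] by (simp add: loop_in_def)

lemma loop_class_eq_iff:
  assumes "loop_in T x p" "loop_in T x q"
  shows "loop_class T x p = loop_class T x q \<longleftrightarrow> path_htpy T p q"
  using assms by (auto simp: set_eq_iff loop_class_iff loop_in_def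
      intro: path_htpy_refl path_htpy_trans path_htpy_sym)

lemma loop_class_eqI: "loop_in T x p \<Longrightarrow> path_htpy T p q \<Longrightarrow> loop_class T x p = loop_class T x q"
  using loop_class_eq_iff loop_in_htpy by metis

lemma loop_class_refl: "loop_in T x p \<Longrightarrow> p \<in> loop_class T x p"
  by (simp add: loop_class_iff loop_in_def path_htpy_refl)

lemma loop_in_join: "loop_in T x p \<Longrightarrow> loop_in T x q \<Longrightarrow> loop_in T x (p \<star> q)"
  by (auto simp: loop_in_def pathin_loop_join)

lemma loop_in_const: "x \<in> topspace T \<Longrightarrow> loop_in T x (\<lambda>_. x)"
  by (simp add: loop_in_def)

lemma loop_in_rev: "loop_in T x p \<Longrightarrow> loop_in T x (path_rev p)"
  by (simp add: loop_in_def pathin_rev)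

lemma loop_in_image: "continuous_map S T f \<Longrightarrow> loop_in S x p \<Longrightarrow> loop_in T (f x) (f \<circ> p)"
  by (auto simp: loop_in_def intro: pathin_compose_map)

lemma carrier_fundamental_group:
  "carrier (fundamental_group T x) = loop_class T x ` {p. loop_in T x p}"
  by (simp add: fundamental_group_def)

lemma one_fundamental_group: "\<one>\<^bsub>fundamental_group T x\<^esub> = loop_class T x (\<lambda>_. x)"
  by (simp add: fundamental_group_def)

text \<open>A homotopy-invariant operation \<open>\<Phi>\<close> on loops descends to classes; \<open>induced_hom\<close> is the case
  \<open>\<Phi> = (\<circ>) f\<close>.\<close>

definition class_map :: "'b topology \<Rightarrow> 'b \<Rightarrow> ((real \<Rightarrow> 'a) \<Rightarrow> real \<Rightarrow> 'b) \<Rightarrow> (real \<Rightarrow> 'a) set \<Rightarrow> (real \<Rightarrow> 'b) set" where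
  "class_map T y \<Phi> A = (\<Union>p\<in>A. loop_class T y (\<Phi> p))"

lemma class_map_loop_class:
  assumes "\<And>q. loop_in S x q \<Longrightarrow> path_htpy S p q \<Longrightarrow> path_htpy T (\<Phi> p) (\<Phi> q)"
    "loop_in S x p" "loop_in T y (\<Phi> p)"
  shows "class_map T y \<Phi> (loop_class S x p) = loop_class T y (\<Phi> p)"
proof -
  have "loop_class T y (\<Phi> q) = loop_class T y (\<Phi> p)" if "q \<in> loop_class S x p" for q
  proof -
    have "path_htpy T (\<Phi> p) (\<Phi> q)"
      using that assms loop_in_htpy by (metis loop_class_iff)
    then show ?thesis using loop_class_eqI assms(3) by metis
  qed
  then show ?thesis
    using loop_class_refl[OF assms(2)] unfolding class_map_def by blast
qed

text \<open>The product is a union over all representatives; by homotopy invariance of concatenation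
  all the sets in the union coincide.\<close>

lemma mult_fundamental_group:
  assumes "loop_in T x p" "loop_in T x q"
  shows "loop_class T x p \<otimes>\<^bsub>fundamental_group T x\<^esub> loop_class T x q = loop_class T x (p \<star> q)"
proof -
  let ?A = "loop_class T x p" and ?B = "loop_class T x q" and ?C = "loop_class T x (p \<star> q)"
  have *: "loop_class T x (p' \<star> q') = ?C" if "p' \<in> ?A" "q' \<in> ?B" for p' q'
  proof -
    have "path_htpy T (p \<star> q) (p' \<star> q')"
      using that assms by (intro path_htpy_join) (auto simp: loop_class_iff loop_in_def)
    then show ?thesis using loop_class_eqI[OF loop_in_join[OF assms]] by simp
  qed
  have "(\<Union>p'\<in>?A. \<Union>q'\<in>?B. loop_class T x (p' \<star> q')) = (\<Union>p'\<in>?A. \<Union>q'\<in>?B. ?C)"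
    by (intro SUP_cong refl *)
  also have "\<dots> = ?C"
    using loop_class_refl[OF assms(1)] loop_class_refl[OF assms(2)] by blast
  finally show ?thesis by (simp add: fundamental_group_def)
qed

lemma group_fundamental_group:
  assumes "x \<in> topspace T"
  shows "group (fundamental_group T x)"
proof (rule groupI)
  let ?G = "fundamental_group T x"
  show "\<one>\<^bsub>?G\<^esub> \<in> carrier ?G"
    using assms by (auto simp: carrier_fundamental_group one_fundamental_group loop_in_const)
  fix A assume "A \<in> carrier ?G"
  then obtain p where p: "loop_in T x p" "A = loop_class T x p"
    by (auto simp: carrier_fundamental_group)
  show "\<one>\<^bsub>?G\<^esub> \<otimes>\<^bsub>?G\<^esub> A = A"
    using p assms path_htpy_const_left[of T p x]
    by (simp add: one_fundamental_group mult_fundamental_group loop_in_const)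
       (auto simp: loop_in_def intro!: loop_class_eqI pathin_loop_join)
  show "\<exists>B\<in>carrier ?G. B \<otimes>\<^bsub>?G\<^esub> A = \<one>\<^bsub>?G\<^esub>"
  proof (rule bexI[of _ "loop_class T x (path_rev p)"])
    show "loop_class T x (path_rev p) \<otimes>\<^bsub>?G\<^esub> A = \<one>\<^bsub>?G\<^esub>"
      using p path_htpy_rev_left[of T p]
      by (simp add: one_fundamental_group mult_fundamental_group loop_in_rev)
         (auto simp: loop_in_def pathin_rev intro!: loop_class_eqI pathin_loop_join)
  qed (use p in \<open>auto simp: carrier_fundamental_group loop_in_rev\<close>)
  fix B assume "B \<in> carrier ?G"
  then obtain q where q: "loop_in T x q" "B = loop_class T x q"
    by (auto simp: carrier_fundamental_group)
  show "A \<otimes>\<^bsub>?G\<^esub> B \<in> carrier ?G"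
    using p q by (auto simp: carrier_fundamental_group mult_fundamental_group loop_in_join)
  fix C assume "C \<in> carrier ?G"
  then obtain r where r: "loop_in T x r" "C = loop_class T x r"
    by (auto simp: carrier_fundamental_group)
  have "path_htpy T ((p \<star> q) \<star> r) (p \<star> q \<star> r)"
    using p q r by (intro path_htpy_assoc) (auto simp: loop_in_def)
  then show "A \<otimes>\<^bsub>?G\<^esub> B \<otimes>\<^bsub>?G\<^esub> C = A \<otimes>\<^bsub>?G\<^esub> (B \<otimes>\<^bsub>?G\<^esub> C)"
    using p q r by (simp add: mult_fundamental_group loop_in_join loop_class_eqI)
qed

text \<open>One criterion for both the change of base point and a homotopy inverse: \<Phi> has to be
  faithful, multiplicative and onto only up to homotopy.\<close>

lemma class_map_iso:
  assumes loop: "\<And>p. loop_in S x p \<Longrightarrow> loop_in T y (\<Phi> p)"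
    and htpy: "\<And>p q. loop_in S x p \<Longrightarrow> loop_in S x q \<Longrightarrow> path_htpy S p q \<longleftrightarrow> path_htpy T (\<Phi> p) (\<Phi> q)"
    and join: "\<And>p q. loop_in S x p \<Longrightarrow> loop_in S x q \<Longrightarrow> path_htpy T (\<Phi> (p \<star> q)) (\<Phi> p \<star> \<Phi> q)"
    and onto: "\<And>r. loop_in T y r \<Longrightarrow> \<exists>p. loop_in S x p \<and> path_htpy T (\<Phi> p) r"
  shows "class_map T y \<Phi> \<in> iso (fundamental_group S x) (fundamental_group T y)"
proof -
  have *: "class_map T y \<Phi> (loop_class S x p) = loop_class T y (\<Phi> p)" if "loop_in S x p" for p
    using that htpy loop_in_htpy by (intro class_map_loop_class[of S x] loop) blast+
  have "class_map T y \<Phi> (loop_class S x p \<otimes>\<^bsub>fundamental_group S x\<^esub> loop_class S x q) =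
      loop_class T y (\<Phi> p) \<otimes>\<^bsub>fundamental_group T y\<^esub> loop_class T y (\<Phi> q)"
    if "loop_in S x p" "loop_in S x q" for p q
    using that loop_class_eqI[OF loop[OF loop_in_join[OF that]] join[OF that]]
    by (simp add: mult_fundamental_group * loop loop_in_join)
  then have "class_map T y \<Phi> \<in> hom (fundamental_group S x) (fundamental_group T y)"
    by (auto simp: hom_def carrier_fundamental_group * loop)
  moreover have "inj_on (class_map T y \<Phi>) (carrier (fundamental_group S x))"
    unfolding inj_on_def carrier_fundamental_group by (clarsimp simp: * loop loop_class_eq_iff) (metis htpy)
  moreover have "class_map T y \<Phi> ` carrier (fundamental_group S x) = carrier (fundamental_group T y)"
  proof -
    have "loop_class T y r \<in> class_map T y \<Phi> ` loop_class S x ` {p. loop_in S x p}" if r: "loop_in T y r" for r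
    proof -
      obtain p where p: "loop_in S x p" "path_htpy T (\<Phi> p) r" using onto[OF r] by blast
      then have "loop_class T y r = class_map T y \<Phi> (loop_class S x p)"
        using loop_class_eqI[OF loop[OF p(1)] p(2)] * by simp
      then show ?thesis using p(1) by blast
    qed
    then show ?thesis using loop * by (auto simp: carrier_fundamental_group)
  qed
  ultimately show ?thesis
    by (simp add: iso_def bij_betw_def)
qed

lemma iso_generating_set:
  assumes "group G" "group H" "h \<in> iso G H" "\<exists>S. finite S \<and> generating_set G S \<and> card S = n"
  shows "\<exists>S. finite S \<and> generating_set H S \<and> card S = n"
proof -
  interpret group_hom G H h
    using assms by (simp add: group_hom_def group_hom_axioms_def iso_imp_homomorphism)
  obtain S where S: "finite S" "S \<subseteq> carrier G" "generate G S = carrier G" "card S = n"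
    using assms(4) unfolding generating_set_def by blast
  have h: "inj_on h (carrier G)" "h ` carrier G = carrier H"
    using assms(3) by (auto simp: iso_def bij_betw_def)
  have "card (h ` S) = n"
    using S h card_image inj_on_subset by metis
  moreover have "generating_set H (h ` S)"
    using S h generate_img[OF S(2)] by (auto simp: generating_set_def)
  ultimately show ?thesis using S(1) by blast
qed

text \<open>The predicates under the two \<open>LEAST\<close> operators agree, so the ranks are
  equal even when no finite generating set exists.\<close>

lemma group_rank_iso:
  assumes "group G" "group H" "h \<in> iso G H"
  shows "group_rank G = group_rank H"
proof -
  obtain k where k: "k \<in> iso H G"
    using group.iso_set_sym[OF assms(1,3)] by blast
  have "(\<exists>S. finite S \<and> generating_set G S \<and> card S = n) \<longleftrightarrow> (\<exists>S. finite S \<and> generating_set H S \<and> card S = n)" for n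
    using iso_generating_set[OF assms, of n] iso_generating_set[OF assms(2,1) k, of n] by blast
  then show ?thesis by (simp add: group_rank_def)
qed

lemma group_rank_base_point:
  assumes "pathin T c"
  shows "group_rank (fundamental_group T (c 0)) = group_rank (fundamental_group T (c 1))"
proof -
  have "class_map T (c 0) (path_conj c) \<in> iso (fundamental_group T (c 1)) (fundamental_group T (c 0))"
  proof (rule class_map_iso)
    fix p q assume pq: "loop_in T (c 1) p" "loop_in T (c 1) q"
    show "path_htpy T p q \<longleftrightarrow> path_htpy T (path_conj c p) (path_conj c q)"
      using assms pq path_htpy_conj_cancel[OF assms pq]
      by (auto intro!: path_htpy_conj path_htpy_refl simp: loop_in_def)
    show "path_htpy T (path_conj c (p \<star> q)) (path_conj c p \<star> path_conj c q)"
      using assms pq by (rule path_htpy_conj_join)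
  next
    fix r assume r: "loop_in T (c 0) r"
    show "\<exists>p. loop_in T (c 1) p \<and> path_htpy T (path_conj c p) r"
      using assms r path_htpy_conj_rev'[OF assms r] loop_in_conj[OF pathin_rev[OF assms], of r]
      by auto
  qed (use assms in \<open>auto intro: loop_in_conj\<close>)
  then show ?thesis
    using assms path_start_in_topspace path_finish_in_topspace
    by (metis group_rank_iso group_fundamental_group)
qed

text \<open>Both composites of \<theta> and \<eta> act on loops as changes of base point, along the
  tracks \<kappa> and \<open>l\<close>. The composite on \<open>T\<close> makes \<theta> injective
  on classes, the composite on \<open>S\<close> makes it surjective.\<close>

lemma homotopy_inverse_iso:
  assumes \<theta>: "continuous_map T S \<theta>" and \<eta>: "continuous_map S T \<eta>"
    and \<theta>\<eta>: "homotopic_with (\<lambda>_. True) S S (\<theta> \<circ> \<eta>) id"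
    and \<eta>\<theta>: "homotopic_with (\<lambda>_. True) T T (\<eta> \<circ> \<theta>) id"
    and y: "y \<in> topspace T"
  shows "class_map S (\<theta> y) ((\<circ>) \<theta>) \<in> iso (fundamental_group T y) (fundamental_group S (\<theta> y))"
proof (rule class_map_iso)
  obtain \<kappa> where \<kappa>: "pathin T \<kappa>" "\<kappa> 0 = \<eta> (\<theta> y)" "\<kappa> 1 = y"
    "\<And>p. loop_in T y p \<Longrightarrow> path_htpy T (\<eta> \<circ> \<theta> \<circ> p) (path_conj \<kappa> p)"
    using homotopic_track[OF \<eta>\<theta> y] by auto
  obtain l where l: "pathin S l" "l 0 = \<theta> (\<eta> (\<theta> y))" "l 1 = \<theta> y"
    "\<And>p. loop_in S (\<theta> y) p \<Longrightarrow> path_htpy S (\<theta> \<circ> \<eta> \<circ> p) (path_conj l p)"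
    using homotopic_track[OF \<theta>\<eta>, of "\<theta> y"] continuous_map_image_subset_topspace[OF \<theta>] y by auto
  show "loop_in S (\<theta> y) (\<theta> \<circ> p)" if "loop_in T y p" for p
    using that \<theta> by (rule loop_in_image[rotated])
  fix p q assume p: "loop_in T y p" and q: "loop_in T y q"
  show "path_htpy S (\<theta> \<circ> (p \<star> q)) ((\<theta> \<circ> p) \<star> (\<theta> \<circ> q))"
    unfolding comp_loop_join using p q loop_in_image[OF \<theta>] loop_in_join path_htpy_refl
    by (metis loop_in_def)
  show "path_htpy T p q \<longleftrightarrow> path_htpy S (\<theta> \<circ> p) (\<theta> \<circ> q)"
  proof
    assume "path_htpy S (\<theta> \<circ> p) (\<theta> \<circ> q)"
    then have *: "path_htpy T (\<eta> \<circ> \<theta> \<circ> p) (\<eta> \<circ> \<theta> \<circ> q)"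
      using path_htpy_image[OF \<eta>] by (metis comp_assoc)
    have "path_htpy T (path_conj \<kappa> p) (path_conj \<kappa> q)"
      using \<kappa>(4)[OF p] * \<kappa>(4)[OF q] path_htpy_sym path_htpy_trans by metis
    then show "path_htpy T p q"
      using path_htpy_conj_cancel[OF \<kappa>(1)] \<kappa>(3) p q by simp
  qed (rule path_htpy_image[OF \<theta>])
next
  fix r assume r: "loop_in S (\<theta> y) r"
  obtain \<kappa> where \<kappa>: "pathin T \<kappa>" "\<kappa> 0 = \<eta> (\<theta> y)" "\<kappa> 1 = y"
    using homotopic_track[OF \<eta>\<theta> y] by auto
  obtain l where l: "pathin S l" "l 0 = \<theta> (\<eta> (\<theta> y))" "l 1 = \<theta> y"
    "\<And>p. loop_in S (\<theta> y) p \<Longrightarrow> path_htpy S (\<theta> \<circ> \<eta> \<circ> p) (path_conj l p)"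
    using homotopic_track[OF \<theta>\<eta>, of "\<theta> y"] continuous_map_image_subset_topspace[OF \<theta>] y by auto
  \<comment> \<open>\<open>d \<star> l\<close> is a loop at \<open>\<theta> y\<close> that measures
    how far the two tracks fail to match; conjugating \<open>r\<close> by its reverse beforehand
    compensates for it.\<close>
  define d where "d = path_rev (\<theta> \<circ> \<kappa>)"
  have d: "pathin S d" "d 0 = \<theta> y" "d 1 = l 0"
    using \<kappa> l(2) pathin_compose_map[OF \<kappa>(1) \<theta>] by (auto simp: d_def pathin_rev)
  have dl: "pathin S (d \<star> l)"
    using d l(1) by (simp add: pathin_loop_join)
  define r' where "r' = path_conj (path_rev (d \<star> l)) r"
  have r': "loop_in S (\<theta> y) r'"
    using loop_in_conj[OF pathin_rev[OF dl], of r] r d l by (simp add: r'_def)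
  define p where "p = path_conj (path_rev \<kappa>) (\<eta> \<circ> r')"
  have \<eta>r': "loop_in T (\<kappa> 0) (\<eta> \<circ> r')"
    using loop_in_image[OF \<eta> r'] \<kappa>(2) by simp
  have p: "loop_in T y p"
    using loop_in_conj[OF pathin_rev[OF \<kappa>(1)], of "\<eta> \<circ> r'"] \<eta>r' \<kappa>(3) by (simp add: p_def)
  have "path_htpy S (\<theta> \<circ> p) (path_conj d (\<theta> \<circ> \<eta> \<circ> r'))"
    using loop_in_image[OF \<theta> p]
    by (simp add: p_def comp_path_conj comp_path_rev d_def comp_assoc loop_in_def path_htpy_refl)
  also have "path_htpy S \<dots> (path_conj d (path_conj l r'))"
    using l(4)[OF r'] d l r' by (intro path_htpy_conj path_htpy_refl) (auto simp: loop_in_def)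
  also have "path_htpy S \<dots> (path_conj (d \<star> l) r')"
    using d l r' by (intro path_htpy_conj_conj) auto
  also have "path_htpy S \<dots> r"
    using path_htpy_conj_rev'[OF dl, of r] r d by (simp add: r'_def)
  finally show "\<exists>p. loop_in T y p \<and> path_htpy S (\<theta> \<circ> p) r"
    using p by blast
qed

lemma induced_hom_eq: "induced_hom T f x = class_map T (f x) ((\<circ>) f)"
  by (auto simp: induced_hom_def class_map_def fun_eq_iff)

lemma induced_hom_loop_class:
  assumes "continuous_map S T f" "loop_in S x p"
  shows "induced_hom T f x (loop_class S x p) = loop_class T (f x) (f \<circ> p)"
  unfolding induced_hom_eq using assms
  by (intro class_map_loop_class[where S = S]) (auto intro: path_htpy_image loop_in_image)

lemma induced_hom_onto_iff:
  assumes "continuous_map S T f"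
  shows "induced_hom T f x ` carrier (fundamental_group S x) = carrier (fundamental_group T (f x)) \<longleftrightarrow>
    (\<forall>q. loop_in T (f x) q \<longrightarrow> (\<exists>p. loop_in S x p \<and> path_htpy T (f \<circ> p) q))"
proof -
  have img: "induced_hom T f x ` carrier (fundamental_group S x) = (\<lambda>p. loop_class T (f x) (f \<circ> p)) ` {p. loop_in S x p}"
    using induced_hom_loop_class[OF assms] by (auto simp: carrier_fundamental_group image_image)
  show ?thesis
    unfolding img unfolding carrier_fundamental_group
  proof (intro iffI allI impI)
    fix q assume eq: "(\<lambda>p. loop_class T (f x) (f \<circ> p)) ` {p. loop_in S x p} = loop_class T (f x) ` {p. loop_in T (f x) p}"
      and q: "loop_in T (f x) q"
    then have "loop_class T (f x) q \<in> (\<lambda>p. loop_class T (f x) (f \<circ> p)) ` {p. loop_in S x p}"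
      by blast
    then obtain p where "loop_in S x p" "loop_class T (f x) (f \<circ> p) = loop_class T (f x) q"
      by auto
    then show "\<exists>p. loop_in S x p \<and> path_htpy T (f \<circ> p) q"
      using loop_class_eq_iff[OF loop_in_image[OF assms] q] by blast
  next
    assume *: "\<forall>q. loop_in T (f x) q \<longrightarrow> (\<exists>p. loop_in S x p \<and> path_htpy T (f \<circ> p) q)"
    show "(\<lambda>p. loop_class T (f x) (f \<circ> p)) ` {p. loop_in S x p} = loop_class T (f x) ` {p. loop_in T (f x) p}"
    proof (intro subset_antisym subsetI)
      fix A assume "A \<in> loop_class T (f x) ` {p. loop_in T (f x) p}"
      then obtain q where q: "loop_in T (f x) q" "A = loop_class T (f x) q" by blast
      then obtain p where p: "loop_in S x p" "path_htpy T (f \<circ> p) q" using * by blast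
      then show "A \<in> (\<lambda>p. loop_class T (f x) (f \<circ> p)) ` {p. loop_in S x p}"
        using q loop_class_eqI[OF loop_in_image[OF assms p(1)] p(2)] by auto
    qed (use loop_in_image[OF assms] in blast)
  qed
qed

text \<open>The conditions on fundamental groups in \<open>carrier_graph\<close> are invariant under
  equivalence, so no competitor has to be checked for them separately. The groups of the two graphs
  are isomorphic, and the actions of \<open>f\<close> and \<open>g \<circ> \<eta>\<close> on loops
  differ by a change of base point.\<close>

lemma pi1_onto_homotopy_equivalence:
  assumes "homotopy_equivalence_map S S' \<eta>" and g: "continuous_map S' T g"
    and fg: "homotopic_with (\<lambda>_. True) S T f (g \<circ> \<eta>)"
    and f: "\<forall>x\<in>topspace S. induced_hom T f x ` carrier (fundamental_group S x) = carrier (fundamental_group T (f x)) \<and>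
       group_rank (fundamental_group S x) = group_rank (fundamental_group T (f x))"
    and y: "y \<in> topspace S'"
  shows "induced_hom T g y ` carrier (fundamental_group S' y) = carrier (fundamental_group T (g y)) \<and>
    group_rank (fundamental_group S' y) = group_rank (fundamental_group T (g y))"
proof -
  obtain \<theta> where \<eta>: "continuous_map S S' \<eta>" and \<theta>: "continuous_map S' S \<theta>"
    and \<theta>\<eta>: "homotopic_with (\<lambda>_. True) S S (\<theta> \<circ> \<eta>) id"
    and \<eta>\<theta>: "homotopic_with (\<lambda>_. True) S' S' (\<eta> \<circ> \<theta>) id"
    using assms(1) unfolding homotopy_equivalence_map_def by blast
  have x: "\<theta> y \<in> topspace S"
    using continuous_map_image_subset_topspace[OF \<theta>] y by auto
  have cf: "continuous_map S T f"
    using homotopic_with_imp_continuous_maps[OF fg] by blast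
  obtain \<kappa> where \<kappa>: "pathin S' \<kappa>" "\<kappa> 0 = \<eta> (\<theta> y)" "\<kappa> 1 = y"
    using homotopic_track[OF \<eta>\<theta> y] by auto
  obtain l where l: "pathin T l" "l 0 = f (\<theta> y)" "l 1 = g (\<eta> (\<theta> y))"
    "\<And>p. loop_in S (\<theta> y) p \<Longrightarrow> path_htpy T (f \<circ> p) (path_conj l (g \<circ> \<eta> \<circ> p))"
    using homotopic_track[OF fg x] by auto
  \<comment> \<open>A path from \<open>f (\<theta> y)\<close> to \<open>g y\<close>: first the track
    of the homotopy from \<open>f\<close> to \<open>g \<circ> \<eta>\<close>, then the image of the
    track of \<open>y\<close>.\<close>
  define d where "d = l \<star> (g \<circ> \<kappa>)"
  have d: "pathin T d" "d 0 = f (\<theta> y)" "d 1 = g y"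
    using l \<kappa> pathin_compose_map[OF \<kappa>(1) g] by (auto simp: d_def intro: pathin_loop_join)
  have "group_rank (fundamental_group S' y) = group_rank (fundamental_group S (\<theta> y))"
    using group_rank_iso[OF _ _ homotopy_inverse_iso[OF \<theta> \<eta> \<theta>\<eta> \<eta>\<theta> y]] x y
    by (simp add: group_fundamental_group)
  also have "\<dots> = group_rank (fundamental_group T (g y))"
    using f x group_rank_base_point[OF d(1)] d by simp
  finally have rank: "group_rank (fundamental_group S' y) = group_rank (fundamental_group T (g y))" .
  have "\<exists>p. loop_in S' y p \<and> path_htpy T (g \<circ> p) q" if q: "loop_in T (g y) q" for q
  proof -
    have "loop_in T (f (\<theta> y)) (path_conj d q)"
      using loop_in_conj[OF d(1), of q] q d by simp
    then obtain p where p: "loop_in S (\<theta> y) p" "path_htpy T (f \<circ> p) (path_conj d q)"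
      using f x induced_hom_onto_iff[OF cf] by meson
    define r where "r = path_conj (path_rev \<kappa>) (\<eta> \<circ> p)"
    have \<eta>p: "loop_in S' (\<kappa> 0) (\<eta> \<circ> p)"
      using loop_in_image[OF \<eta> p(1)] \<kappa>(2) by simp
    have r: "loop_in S' y r"
      using loop_in_conj[OF pathin_rev[OF \<kappa>(1)], of "\<eta> \<circ> p"] \<eta>p \<kappa>(3) by (simp add: r_def)
    have gr: "loop_in T (g y) (g \<circ> r)" by (rule loop_in_image[OF g r])
    have g\<kappa>: "pathin T (g \<circ> \<kappa>)" by (rule pathin_compose_map[OF \<kappa>(1) g])
    have "path_htpy T (path_conj d (g \<circ> r)) (path_conj l (path_conj (g \<circ> \<kappa>) (g \<circ> r)))"
      unfolding d_def using l \<kappa> g\<kappa> gr by (intro path_htpy_sym[OF path_htpy_conj_conj]) auto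
    also have "path_htpy T \<dots> (path_conj l (g \<circ> \<eta> \<circ> p))"
    proof (intro path_htpy_conj path_htpy_refl l(1))
      have "path_htpy T (path_conj (g \<circ> \<kappa>) (path_conj (path_rev (g \<circ> \<kappa>)) (g \<circ> (\<eta> \<circ> p)))) (g \<circ> (\<eta> \<circ> p))"
        using loop_in_image[OF g \<eta>p] g\<kappa> by (intro path_htpy_conj_rev') auto
      then show "path_htpy T (path_conj (g \<circ> \<kappa>) (g \<circ> r)) (g \<circ> \<eta> \<circ> p)"
        by (simp add: r_def comp_path_conj comp_path_rev comp_assoc)
    qed (use l \<kappa> in auto)
    also have "path_htpy T \<dots> (f \<circ> p)"
      using l(4)[OF p(1)] by (rule path_htpy_sym)
    also have "path_htpy T \<dots> (path_conj d q)" by (rule p(2))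
    finally have "path_htpy T (g \<circ> r) q"
      using path_htpy_conj_cancel[OF d(1)] gr q d(3) by simp
    then show ?thesis using r by blast
  qed
  then show ?thesis
    using rank induced_hom_onto_iff[OF g] by blast
qed

lemma homotopy_equivalence_map_compose:
  assumes "homotopy_equivalence_map S T \<eta>" "homotopy_equivalence_map T U \<eta>'"
  shows "homotopy_equivalence_map S U (\<eta>' \<circ> \<eta>)"
proof -
  obtain \<theta> where \<eta>: "continuous_map S T \<eta>" and \<theta>: "continuous_map T S \<theta>"
    and 1: "homotopic_with (\<lambda>_. True) S S (\<theta> \<circ> \<eta>) id" "homotopic_with (\<lambda>_. True) T T (\<eta> \<circ> \<theta>) id"
    using assms(1) unfolding homotopy_equivalence_map_def by blast
  obtain \<theta>' where \<eta>': "continuous_map T U \<eta>'" and \<theta>': "continuous_map U T \<theta>'"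
    and 2: "homotopic_with (\<lambda>_. True) T T (\<theta>' \<circ> \<eta>') id" "homotopic_with (\<lambda>_. True) U U (\<eta>' \<circ> \<theta>') id"
    using assms(2) unfolding homotopy_equivalence_map_def by blast
  have sandwich: "homotopic_with (\<lambda>_. True) A A (c \<circ> (b \<circ> a)) id"
    if "continuous_map A B a" "continuous_map B A c" "homotopic_with (\<lambda>_. True) B B b id"
      "homotopic_with (\<lambda>_. True) A A (c \<circ> a) id" for A :: "'x topology" and B :: "'y topology" and a b c
  proof -
    have "homotopic_with (\<lambda>_. True) A B (b \<circ> a) (id \<circ> a)"
      using that by (intro homotopic_with_compose_continuous_map_right[where p = "\<lambda>_. True"]) auto
    then have "homotopic_with (\<lambda>_. True) A A (c \<circ> (b \<circ> a)) (c \<circ> (id \<circ> a))"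
      using that by (intro homotopic_with_compose_continuous_map_left[where p = "\<lambda>_. True"]) auto
    then show ?thesis using that(4) homotopic_with_trans by fastforce
  qed
  show ?thesis
    unfolding homotopy_equivalence_map_def
    using sandwich[OF \<eta> \<theta> 2(1) 1(1)] sandwich[OF \<theta>' \<eta>' 1(2) 2(2)]
    by (intro conjI exI[of _ "\<theta> \<circ> \<theta>'"])
       (use \<eta> \<eta>' \<theta> \<theta>' in \<open>auto simp: comp_assoc intro: continuous_map_compose\<close>)
qed

section \<open>The hyperboloid model: continuity, segments, convexity of the distance, lines\<close>

section \<open>Hyperbolic geometry\<close>

abbreviation mink :: "hyp3 \<Rightarrow> hyp3 \<Rightarrow> real" where
  "mink x y \<equiv> minkowski (Rep_hyp3 x) (Rep_hyp3 y)"

lemma minkowski_add_left: "minkowski (p + q) r = minkowski p r + minkowski q r"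
  by (simp add: minkowski_def inner_add_left algebra_simps)

lemma minkowski_add_right: "minkowski r (p + q) = minkowski r p + minkowski r q"
  by (simp add: minkowski_def inner_add_right algebra_simps)

lemma minkowski_scale_left: "minkowski (a *\<^sub>R p) r = a * minkowski p r"
  by (simp add: minkowski_def algebra_simps)

lemma minkowski_scale_right: "minkowski r (a *\<^sub>R p) = a * minkowski r p"
  by (simp add: minkowski_def algebra_simps)

lemmas minkowski_bilinear =
  minkowski_add_left minkowski_add_right minkowski_scale_left minkowski_scale_right

lemma continuous_on_minkowski [continuous_intros]:
  "continuous_on S f \<Longrightarrow> continuous_on S g \<Longrightarrow> continuous_on S (\<lambda>x. minkowski (f x) (g x))"
  unfolding minkowski_def by (intro continuous_intros)

lemma cosh_dist_hyp3: "cosh (dist x y) = - mink x y"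
  using minkowski_hyp3_le[of x y] by (simp add: dist_hyp3_def)

lemma mink_eq: "mink x y = - cosh (dist x y)"
  by (simp add: cosh_dist_hyp3)

lemma mink_self: "mink x x = - 1"
  by (simp add: minkowski_hyp3)

text \<open>The projection of \<open>q\<close> to the tangent space at \<open>p\<close>; for
  \<open>q \<noteq> p\<close> it is \<open>sinh (dist p q)\<close> times the unit vector at
  \<open>p\<close> that points to \<open>q\<close>.\<close>

definition tangent :: "hyp3 \<Rightarrow> hyp3 \<Rightarrow> (real ^ 3) \<times> real" where
  "tangent p q = Rep_hyp3 q + mink q p *\<^sub>R Rep_hyp3 p"

lemma minkowski_tangent_base: "minkowski (tangent p q) (Rep_hyp3 p) = 0"
  unfolding tangent_def by (rule minkowski_hyp3_component(1))

text \<open>The hyperbolic law of cosines.\<close>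

lemma minkowski_tangent_tangent:
  "minkowski (tangent p q) (tangent p r) = cosh (dist p q) * cosh (dist p r) - cosh (dist q r)"
proof -
  have "minkowski (tangent p q) (tangent p r) = mink q r + mink q p * mink r p"
    using minkowski_lincomb[of "Rep_hyp3 q" "- mink q p" "Rep_hyp3 p" "Rep_hyp3 r" "- mink r p" "Rep_hyp3 p"]
    by (simp add: tangent_def mink_self minkowski_commute[of "Rep_hyp3 p" "Rep_hyp3 r"])
  then show ?thesis by (simp add: mink_eq dist_commute)
qed

lemma minkowski_tangent_self: "minkowski (tangent p q) (tangent p q) = (sinh (dist p q))\<^sup>2"
  unfolding minkowski_tangent_tangent sinh_square_eq by (simp add: power2_eq_square)

text \<open>The form is definite on the tangent space at a point of the hyperboloid.\<close>

lemma minkowski_orthogonal_eq_0: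
  assumes "minkowski u (Rep_hyp3 p) = 0" "minkowski u u = 0"
  shows "u = 0"
proof -
  have "fst u = 0"
    using minkowski_orthogonal_aux[OF minkowski_hyp3[of p] assms(1)] assms(2) by simp
  moreover from this have "snd u = 0"
    using assms(2) by (simp add: minkowski_def)
  ultimately show ?thesis by (simp add: prod_eq_iff)
qed

text \<open>Tangent vectors are spacelike, so the last coordinate is bounded by the first three and
  the Euclidean norm by the square root of 2, here rounded up to 2, times the norm of these three.
  The bound makes \<open>Rep_hyp3\<close> continuous for the hyperbolic metric.\<close>

lemma norm_tangent_le: "norm (tangent p q) \<le> 2 * snd (Rep_hyp3 p) * sinh (dist p q)"
proof -
  let ?u = "tangent p q" and ?s = "snd (Rep_hyp3 p)"
  have s: "?s > 0" by (rule minkowski_hyp3(2))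
  have 1: "(norm (fst ?u))\<^sup>2 \<le> (sinh (dist p q))\<^sup>2 * ?s\<^sup>2"
    using minkowski_orthogonal_aux[OF minkowski_hyp3[of p] minkowski_tangent_base]
    by (simp add: minkowski_tangent_self)
  have "(norm (fst ?u))\<^sup>2 - (snd ?u)\<^sup>2 = (sinh (dist p q))\<^sup>2"
    using minkowski_tangent_self[of p q]
    unfolding minkowski_def power2_norm_eq_inner power2_eq_square[of "snd ?u"] .
  then have "(snd ?u)\<^sup>2 \<le> (norm (fst ?u))\<^sup>2"
    using zero_le_power2[of "sinh (dist p q)"] by linarith
  moreover have "(norm ?u)\<^sup>2 = (norm (fst ?u))\<^sup>2 + (snd ?u)\<^sup>2"
    by (simp add: norm_prod_def)
  moreover have "0 \<le> (sinh (dist p q))\<^sup>2 * ?s\<^sup>2" by simp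
  moreover have "(2 * ?s * sinh (dist p q))\<^sup>2 = 4 * ((sinh (dist p q))\<^sup>2 * ?s\<^sup>2)"
    by (simp add: power_mult_distrib)
  ultimately have "(norm ?u)\<^sup>2 \<le> (2 * ?s * sinh (dist p q))\<^sup>2"
    using 1 by linarith
  moreover have "0 \<le> 2 * ?s * sinh (dist p q)"
    using s by (intro mult_nonneg_nonneg) simp_all
  ultimately show ?thesis by (rule power2_le_imp_le)
qed

lemma norm_Rep_diff_le:
  "norm (Rep_hyp3 q - Rep_hyp3 p) \<le>
     2 * snd (Rep_hyp3 p) * sinh (dist p q) + (cosh (dist p q) - 1) * norm (Rep_hyp3 p)"
proof -
  have "Rep_hyp3 q - Rep_hyp3 p = tangent p q + (cosh (dist p q) - 1) *\<^sub>R Rep_hyp3 p"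
    unfolding tangent_def mink_eq[of q p] dist_commute[of q p] by (simp add: scaleR_left_diff_distrib)
  then have "norm (Rep_hyp3 q - Rep_hyp3 p) \<le> norm (tangent p q) + norm ((cosh (dist p q) - 1) *\<^sub>R Rep_hyp3 p)"
    by (simp only: norm_triangle_ineq)
  also have "norm ((cosh (dist p q) - 1) *\<^sub>R Rep_hyp3 p) = (cosh (dist p q) - 1) * norm (Rep_hyp3 p)"
    using cosh_real_ge_1[of "dist p q"] by simp
  finally show ?thesis using norm_tangent_le[of p q] by linarith
qed

lemma continuous_on_Rep_hyp3_UNIV: "continuous_on UNIV Rep_hyp3"
proof (simp add: continuous_on_def, intro allI)
  fix p :: hyp3
  have "((\<lambda>q. 2 * snd (Rep_hyp3 p) * sinh (dist p q) + (cosh (dist p q) - 1) * norm (Rep_hyp3 p)) \<longlongrightarrow>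
      2 * snd (Rep_hyp3 p) * sinh (dist p p) + (cosh (dist p p) - 1) * norm (Rep_hyp3 p)) (at p)"
    by (intro tendsto_intros)
  then have "((\<lambda>q. Rep_hyp3 q - Rep_hyp3 p) \<longlongrightarrow> 0) (at p)"
    by (intro Lim_null_comparison[OF always_eventually[OF allI[OF norm_Rep_diff_le]]]) simp
  then show "(Rep_hyp3 \<longlongrightarrow> Rep_hyp3 p) (at p)"
    by (simp add: LIM_zero_iff)
qed

lemmas continuous_on_Rep_hyp3 [continuous_intros] =
  continuous_on_compose2[OF continuous_on_Rep_hyp3_UNIV _ subset_UNIV]

abbreviation hyperboloid :: "((real ^ 3) \<times> real) set" where
  "hyperboloid \<equiv> {p. minkowski p p = - 1 \<and> snd p > 0}"

lemma Rep_Abs_hyp3: "p \<in> hyperboloid \<Longrightarrow> Rep_hyp3 (Abs_hyp3 p) = p"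
  by (rule Abs_hyp3_inverse)

lemma continuous_on_Abs_hyp3_hyperboloid: "continuous_on hyperboloid Abs_hyp3"
proof (simp only: continuous_on_def, intro ballI)
  fix p assume p: "p \<in> hyperboloid"
  have 1: "((\<lambda>q. - minkowski q p) \<longlongrightarrow> - minkowski p p) (at p within hyperboloid)"
    unfolding minkowski_def by (intro tendsto_intros)
  have ev: "eventually (\<lambda>q. q \<in> hyperboloid) (at p within hyperboloid)"
    by (simp add: eventually_at_filter)
  have ge: "- minkowski q p \<ge> 1" and d: "arcosh (- minkowski q p) = dist (Abs_hyp3 q) (Abs_hyp3 p)"
    if "q \<in> hyperboloid" for q
    using minkowski_hyp3_le[of "Abs_hyp3 q" "Abs_hyp3 p"]
    unfolding dist_hyp3_def Rep_Abs_hyp3[OF p] Rep_Abs_hyp3[OF that] by simp_all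
  \<comment> \<open>The limit is taken at 1, the end of the domain of \<open>arcosh\<close>, so the
    argument must be known to stay at or above 1.\<close>
  have "((\<lambda>q. arcosh (- minkowski q p)) \<longlongrightarrow> arcosh (- minkowski p p)) (at p within hyperboloid)"
    using ev by (intro tendsto_arcosh_strong[OF 1]) (use p ge in \<open>auto elim: eventually_mono\<close>)
  then have "((\<lambda>q. arcosh (- minkowski q p)) \<longlongrightarrow> 0) (at p within hyperboloid)"
    using p by simp
  then have "((\<lambda>q. dist (Abs_hyp3 q) (Abs_hyp3 p)) \<longlongrightarrow> 0) (at p within hyperboloid)"
    by (rule Lim_transform_eventually) (use ev d in \<open>auto elim: eventually_mono\<close>)
  then show "(Abs_hyp3 \<longlongrightarrow> Abs_hyp3 p) (at p within hyperboloid)"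
    by (subst tendsto_dist_iff)
qed

lemmas continuous_on_Abs_hyp3 = continuous_on_compose2[OF continuous_on_Abs_hyp3_hyperboloid]

text \<open>Properness of \<open>hyp3\<close>. It turns discreteness of the group into proper
  discontinuity in \<open>finite_displacement\<close>.\<close>

lemma compact_cball_hyp3: "compact (cball (x::hyp3) r)"
proof -
  let ?K = "{p \<in> hyperboloid. - minkowski p (Rep_hyp3 x) \<le> cosh r}"
  define R where "R = sinh \<bar>r\<bar>"
  define R' where "R' = cosh \<bar>r\<bar>"
  have snd_pos: "snd p > 0" if "minkowski p p = - 1" "snd p \<ge> 0" for p :: "(real ^ 3) \<times> real"
    using that inner_ge_zero[of "fst p"] by (cases "snd p = 0") (auto simp: minkowski_def)
  \<comment> \<open>The strict condition on the last coordinate is not closed, but on the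
    hyperboloid it is equivalent to the weak one.\<close>
  have K_eq: "?K = {p. minkowski p p = - 1} \<inter> {p. snd p \<ge> 0} \<inter> {p. - minkowski p (Rep_hyp3 x) \<le> cosh r}"
    by (auto intro: snd_pos)
  have "closed ?K"
    unfolding K_eq
    by (intro closed_Int closed_Collect_eq closed_Collect_le continuous_on_minkowski continuous_on_id
        continuous_on_const continuous_on_snd continuous_on_minus)
  moreover have "bounded ?K"
  proof (rule boundedI)
    fix p assume p: "p \<in> ?K"
    let ?d = "dist x (Abs_hyp3 p)"
    have "cosh ?d \<le> cosh \<bar>r\<bar>"
      using p by (simp add: cosh_dist_hyp3 Rep_Abs_hyp3 minkowski_commute)
    then have d: "?d \<le> \<bar>r\<bar>" by (simp only: cosh_real_nonneg_le_iff zero_le_dist abs_ge_zero)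
    have "norm (p - Rep_hyp3 x) \<le> 2 * snd (Rep_hyp3 x) * sinh ?d + (cosh ?d - 1) * norm (Rep_hyp3 x)"
      using norm_Rep_diff_le[of "Abs_hyp3 p" x] p by (simp add: Rep_Abs_hyp3)
    also have "\<dots> \<le> 2 * snd (Rep_hyp3 x) * R + (R' - 1) * norm (Rep_hyp3 x)"
      using sinh_real_le_iff[of ?d "\<bar>r\<bar>"] d \<open>cosh ?d \<le> cosh \<bar>r\<bar>\<close> minkowski_hyp3(2)[of x] unfolding R_def R'_def
      by (intro add_mono mult_left_mono mult_right_mono diff_right_mono) (simp_all only: mult_nonneg_nonneg less_imp_le zero_le_numeral norm_ge_zero)
    finally show "norm p \<le> 2 * snd (Rep_hyp3 x) * R + (R' - 1) * norm (Rep_hyp3 x) + norm (Rep_hyp3 x)"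
      using norm_triangle_ineq[of "p - Rep_hyp3 x" "Rep_hyp3 x"] by simp
  qed
  ultimately have "compact (Abs_hyp3 ` ?K)"
    by (intro compact_continuous_image continuous_on_subset[OF continuous_on_Abs_hyp3_hyperboloid])
       (auto simp: compact_eq_bounded_closed)
  moreover have "cball x r = Abs_hyp3 ` ?K" if "r \<ge> 0"
  proof -
    have *: "y \<in> cball x r \<longleftrightarrow> Rep_hyp3 y \<in> ?K" for y
      using that Rep_hyp3[of y] cosh_real_nonneg_le_iff[of "dist x y" r]
      by (simp add: cosh_dist_hyp3 minkowski_commute)
    show ?thesis
    proof (intro equalityI subsetI)
      fix y assume "y \<in> cball x r"
      then have "Rep_hyp3 y \<in> ?K" by (rule *[THEN iffD1])
      then show "y \<in> Abs_hyp3 ` ?K" by (rule image_eqI[where x = "Rep_hyp3 y", rotated]) (simp add: Rep_hyp3_inverse)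
    next
      fix y assume "y \<in> Abs_hyp3 ` ?K"
      then obtain p where p: "y = Abs_hyp3 p" "p \<in> ?K" by (rule imageE)
      then have "Rep_hyp3 y = p" using Rep_Abs_hyp3[of p] by simp
      then show "y \<in> cball x r" using *[of y] p(2) by simp
    qed
  qed
  ultimately show ?thesis
    by (cases "r \<ge> 0") simp_all
qed

subsection \<open>Geodesic segments\<close>

text \<open>The parameterization is the affine one in Minkowski space, not the one by arc length: it is
  jointly continuous without a case distinction for degenerate segments.\<close>

definition seg_norm :: "real \<Rightarrow> real \<Rightarrow> real" where
  "seg_norm c t = (1 - t)\<^sup>2 + t\<^sup>2 + 2 * t * (1 - t) * c"

definition hseg :: "hyp3 \<Rightarrow> hyp3 \<Rightarrow> real \<Rightarrow> hyp3" where
  "hseg x y t = Abs_hyp3 ((1 / sqrt (seg_norm (cosh (dist x y)) t)) *\<^sub>R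
     ((1 - t) *\<^sub>R Rep_hyp3 x + t *\<^sub>R Rep_hyp3 y))"

text \<open>\<open>seg_norm c t\<close> is minus the Minkowski square of an affine combination of
  two points with \<open>cosh\<close> of the distance equal to \<open>c\<close>. It never vanishes,
  so the combination can be projected centrally to the hyperboloid.\<close>

lemma seg_norm_ge_1:
  assumes "t \<in> {0..1}" "c \<ge> 1"
  shows "seg_norm c t \<ge> 1"
proof -
  have "t * (1 - t) * (c - 1) \<ge> 0" using assms by simp
  moreover have "seg_norm c t = 1 + 2 * (t * (1 - t) * (c - 1))"
    by (simp add: seg_norm_def power2_eq_square algebra_simps)
  ultimately show ?thesis by linarith
qed

lemma seg_norm_pos: "t \<in> {0..1} \<Longrightarrow> seg_norm (cosh (dist x y)) t > 0"
  using seg_norm_ge_1[of t "cosh (dist x y)"] cosh_real_ge_1[of "dist x y"] by linarith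

lemma hseg_in_hyperboloid:
  assumes "t \<in> {0..1}"
  shows "(1 / sqrt (seg_norm (cosh (dist x y)) t)) *\<^sub>R
     ((1 - t) *\<^sub>R Rep_hyp3 x + t *\<^sub>R Rep_hyp3 y) \<in> hyperboloid"
proof -
  let ?N = "seg_norm (cosh (dist x y)) t"
  let ?p = "(1 - t) *\<^sub>R Rep_hyp3 x + t *\<^sub>R Rep_hyp3 y"
  have N: "?N > 0" using seg_norm_pos[OF assms] .
  have "minkowski ?p ?p = - ?N"
    unfolding minkowski_bilinear mink_eq dist_commute[of y x]
    by (simp add: seg_norm_def power2_eq_square algebra_simps)
  then have "minkowski ((1 / sqrt ?N) *\<^sub>R ?p) ((1 / sqrt ?N) *\<^sub>R ?p) = (1 / sqrt ?N) * (1 / sqrt ?N) * (- ?N)"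
    by (simp add: minkowski_scale_left minkowski_scale_right)
  also have "\<dots> = - 1" using N by simp
  moreover have "snd ?p > 0"
    using minkowski_hyp3(2)[of x] minkowski_hyp3(2)[of y] assms
    by (cases "t = 0") (auto intro!: add_nonneg_pos)
  ultimately show ?thesis using N by simp
qed

lemma Rep_hseg:
  "t \<in> {0..1} \<Longrightarrow> Rep_hyp3 (hseg x y t) = (1 / sqrt (seg_norm (cosh (dist x y)) t)) *\<^sub>R
     ((1 - t) *\<^sub>R Rep_hyp3 x + t *\<^sub>R Rep_hyp3 y)"
  unfolding hseg_def by (rule Rep_Abs_hyp3[OF hseg_in_hyperboloid])

lemma hseg_0 [simp]: "hseg x y 0 = x" and hseg_1 [simp]: "hseg x y 1 = y"
  by (simp_all add: hseg_def seg_norm_def Rep_hyp3_inverse)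

lemma hseg_same [simp]: "t \<in> {0..1} \<Longrightarrow> hseg x x t = x"
proof -
  have "seg_norm (cosh (dist x x)) t = 1"
    by (simp add: seg_norm_def power2_eq_square algebra_simps)
  then show ?thesis by (simp add: hseg_def Rep_hyp3_inverse flip: scaleR_left.add)
qed

lemma continuous_on_hseg [continuous_intros]:
  assumes "continuous_on S f" "continuous_on S g" "continuous_on S h" "h \<in> S \<rightarrow> {0..1}"
  shows "continuous_on S (\<lambda>s. hseg (f s) (g s) (h s))"
  unfolding hseg_def
proof (rule continuous_on_Abs_hyp3)
  have "continuous_on S (\<lambda>s. cosh (dist (f s) (g s)))"
    using assms by (intro continuous_intros) auto
  then have "continuous_on S (\<lambda>s. seg_norm (cosh (dist (f s) (g s))) (h s))"
    unfolding seg_norm_def using assms by (intro continuous_intros)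
  moreover have "seg_norm (cosh (dist (f s) (g s))) (h s) > 0" if "s \<in> S" for s
    using that assms(4) by (intro seg_norm_pos) auto
  ultimately show "continuous_on S (\<lambda>s. (1 / sqrt (seg_norm (cosh (dist (f s) (g s))) (h s))) *\<^sub>R
      ((1 - h s) *\<^sub>R Rep_hyp3 (f s) + h s *\<^sub>R Rep_hyp3 (g s)))"
    using assms by (intro continuous_intros) (auto simp: less_imp_neq[THEN not_sym])
  show "(\<lambda>s. (1 / sqrt (seg_norm (cosh (dist (f s) (g s))) (h s))) *\<^sub>R
      ((1 - h s) *\<^sub>R Rep_hyp3 (f s) + h s *\<^sub>R Rep_hyp3 (g s))) ` S \<subseteq> hyperboloid"
    using hseg_in_hyperboloid assms(4) by (fastforce simp: Pi_iff)
qed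

text \<open>The distance from the initial point to the point with affine parameter \<open>t\<close>
  on a segment of length \<open>d\<close>. The argument of \<open>arsinh\<close> is the coordinate
  of that point along the unit tangent vector at the initial point.\<close>

definition seg_dist :: "real \<Rightarrow> real \<Rightarrow> real" where
  "seg_dist d t = arsinh (t * sinh d / sqrt (seg_norm (cosh d) t))"

lemma sinh_seg_dist: "sinh (seg_dist d t) = t * sinh d / sqrt (seg_norm (cosh d) t)"
  by (simp add: seg_dist_def)

lemma cosh_seg_dist:
  assumes "t \<in> {0..1}"
  shows "cosh (seg_dist d t) = (1 - t + t * cosh d) / sqrt (seg_norm (cosh d) t)"
proof -
  have N: "seg_norm (cosh d) t > 0"
    using seg_norm_ge_1[OF assms cosh_real_ge_1[of d]] by linarith
  have "(cosh (seg_dist d t))\<^sup>2 = 1 + (sinh (seg_dist d t))\<^sup>2"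
    by (simp add: cosh_square_eq)
  also have "\<dots> = (seg_norm (cosh d) t + t\<^sup>2 * (sinh d)\<^sup>2) / seg_norm (cosh d) t"
    using N by (simp add: sinh_seg_dist power_divide power_mult_distrib field_simps)
  also have "seg_norm (cosh d) t + t\<^sup>2 * (sinh d)\<^sup>2 = (1 - t + t * cosh d)\<^sup>2"
    unfolding seg_norm_def sinh_square_eq by (simp add: power2_eq_square algebra_simps)
  also have "\<dots> / seg_norm (cosh d) t = ((1 - t + t * cosh d) / sqrt (seg_norm (cosh d) t))\<^sup>2"
    using N by (simp add: power_divide)
  finally show ?thesis
    by (rule power2_eq_imp_eq) (use assms N in auto)
qed

lemma seg_dist_mono:
  assumes "0 \<le> s" "s \<le> t" "t \<le> 1" "d \<ge> 0"
  shows "seg_dist d s \<le> seg_dist d t"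
proof -
  let ?N = "seg_norm (cosh d)"
  have N: "?N s > 0" "?N t > 0"
    using seg_norm_ge_1[of s "cosh d"] seg_norm_ge_1[of t "cosh d"] cosh_real_ge_1[of d] assms by auto
  have "t\<^sup>2 * ?N s - s\<^sup>2 * ?N t = (t - s) * (t * (1 - s) + s * (1 - t)) + 2 * cosh d * (t * s * (t - s))"
    by (simp add: seg_norm_def power2_eq_square algebra_simps)
  moreover have "(t - s) * (t * (1 - s) + s * (1 - t)) \<ge> 0" "2 * cosh d * (t * s * (t - s)) \<ge> 0"
    using assms by (auto intro!: mult_nonneg_nonneg add_nonneg_nonneg)
  ultimately have "s\<^sup>2 * ?N t \<le> t\<^sup>2 * ?N s" by linarith
  then have "s\<^sup>2 / ?N s \<le> t\<^sup>2 / ?N t"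
    using N by (simp add: field_simps)
  then have "sqrt (s\<^sup>2 / ?N s) \<le> sqrt (t\<^sup>2 / ?N t)" by simp
  then have "s / sqrt (?N s) \<le> t / sqrt (?N t)"
    using assms by (simp add: real_sqrt_divide)
  then have "s / sqrt (?N s) * sinh d \<le> t / sqrt (?N t) * sinh d"
    using assms by (intro mult_right_mono) auto
  then have "sinh (seg_dist d s) \<le> sinh (seg_dist d t)"
    by (simp add: sinh_seg_dist)
  then show ?thesis by simp
qed

text \<open>In the plane spanned by \<open>x\<close> and \<open>y\<close>, the coordinates of the
  point with parameter \<open>t\<close> are \<open>cosh\<close> and \<open>sinh\<close> of
  \<open>seg_dist d t\<close>, so this is the subtraction theorem for \<open>cosh\<close>.\<close>

lemma dist_hseg_hseg:
  assumes "0 \<le> s" "s \<le> t" "t \<le> 1"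
  shows "dist (hseg x y s) (hseg x y t) = seg_dist (dist x y) t - seg_dist (dist x y) s"
proof -
  let ?d = "dist x y"
  let ?N = "seg_norm (cosh ?d)"
  have st: "s \<in> {0..1}" "t \<in> {0..1}" using assms by auto
  have N: "?N s > 0" "?N t > 0" using seg_norm_pos st by blast+
  define ns where "ns = 1 / sqrt (?N s)"
  define nt where "nt = 1 / sqrt (?N t)"
  have "cosh (seg_dist ?d t - seg_dist ?d s) =
      nt * ns * ((1 - t + t * cosh ?d) * (1 - s + s * cosh ?d) - t * s * (sinh ?d)\<^sup>2)"
    unfolding cosh_diff cosh_seg_dist[OF st(1)] cosh_seg_dist[OF st(2)] sinh_seg_dist
    by (simp add: ns_def nt_def power2_eq_square diff_divide_distrib mult_ac)
  also have "\<dots> = cosh (dist (hseg x y s) (hseg x y t))"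
    unfolding cosh_dist_hyp3[of "hseg x y s"] Rep_hseg[OF st(1)] Rep_hseg[OF st(2)] minkowski_bilinear
      ns_def[symmetric] nt_def[symmetric] mink_eq dist_commute[of y x] sinh_square_eq
    by (simp add: power2_eq_square algebra_simps)
  finally have "cosh (dist (hseg x y s) (hseg x y t)) = cosh (seg_dist ?d t - seg_dist ?d s)" ..
  moreover have "seg_dist ?d t - seg_dist ?d s \<ge> 0"
    using seg_dist_mono[OF assms, of ?d] by simp
  ultimately show ?thesis
    by (metis cosh_real_nonneg_le_iff order_antisym order_refl zero_le_dist)
qed

lemma seg_dist_0 [simp]: "seg_dist d 0 = 0"
  by (simp add: seg_dist_def)

lemma seg_dist_1 [simp]: "seg_dist d 1 = d"
  by (simp add: seg_dist_def seg_norm_def arsinh_sinh_real)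

text \<open>Balls are strictly convex: \<open>cosh (dist x _)\<close> is linear on the affine
  segment, and the projection back to the hyperboloid divides by a number greater than 1.\<close>

lemma hyp3_dist_mid_less:
  fixes x z w :: hyp3
  assumes "dist x z = dist x w" "z \<noteq> w"
  shows "dist x (hseg z w (1/2)) < dist x z"
proof -
  let ?D = "cosh (dist z w)"
  have half: "1 / 2 \<in> {0..1::real}" by simp
  have D: "?D > 1" using assms(2) cosh_real_nonneg_less_iff[of 0 "dist z w"] by simp
  have N: "seg_norm ?D (1/2) = (1 + ?D) / 2"
    by (simp add: seg_norm_def power2_eq_square field_simps)
  have N1: "sqrt (seg_norm ?D (1/2)) > 1" using D N by simp
  have "cosh (dist x (hseg z w (1/2))) = (cosh (dist x z) / 2 + cosh (dist x w) / 2) / sqrt (seg_norm ?D (1/2))"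
    unfolding cosh_dist_hyp3[of x] Rep_hseg[OF half] minkowski_bilinear
    by (simp add: add_divide_distrib diff_divide_distrib)
  also have "\<dots> = cosh (dist x z) / sqrt (seg_norm ?D (1/2))"
    by (simp add: assms(1))
  also have "\<dots> < cosh (dist x z)"
    using N1 cosh_real_pos[of "dist x z"] by (simp add: divide_less_eq)
  finally show ?thesis
    by (simp add: cosh_real_nonneg_less_iff)
qed

text \<open>The midpoint of two different candidates would be nearer to both \<open>x\<close> and
  \<open>y\<close>, against the triangle inequality.\<close>

lemma geodesic_point_unique:
  fixes x y z w :: hyp3
  assumes "dist x z + dist z y = dist x y" "dist x w = dist x z" "dist w y = dist z y"
  shows "w = z"
proof (rule ccontr)
  assume "w \<noteq> z"
  let ?m = "hseg z w (1/2)"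
  have "dist x ?m < dist x z" "dist y ?m < dist y z"
    using \<open>w \<noteq> z\<close> assms by (auto intro!: hyp3_dist_mid_less simp: dist_commute)
  then show False
    using dist_triangle[of x y ?m] assms(1) by (simp add: dist_commute)
qed

text \<open>An isometry is given only by its effect on distances; no linear extension is used,
  because a point of a segment is determined by its distances from the ends.\<close>

lemma hseg_isometry:
  assumes \<gamma>: "\<And>x y. dist (\<gamma> x) (\<gamma> y) = dist x (y::hyp3)" and t: "t \<in> {0..1}"
  shows "\<gamma> (hseg x y t) = hseg (\<gamma> x) (\<gamma> y) t"
proof -
  have d: "dist x' (hseg x' y' t) = seg_dist (dist x' y') t"
    "dist (hseg x' y' t) y' = dist x' y' - seg_dist (dist x' y') t" for x' y'
    using dist_hseg_hseg[of 0 t x' y'] dist_hseg_hseg[of t 1 x' y'] t by auto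
  show ?thesis
    using \<gamma>[of x "hseg x y t"] \<gamma>[of "hseg x y t" y] \<gamma>[of x y]
    by (intro geodesic_point_unique[of "\<gamma> x" _ "\<gamma> y"]) (simp_all add: d)
qed

subsection \<open>Convexity of the distance\<close>

abbreviation hmid :: "hyp3 \<Rightarrow> hyp3 \<Rightarrow> hyp3" where
  "hmid x y \<equiv> hseg x y (1/2)"

text \<open>The determinant of the matrix of hyperbolic cosines of the mutual distances, which is
  minus the Minkowski Gram determinant of the three points. It is nonnegative, and zero for points
  on a line.\<close>

definition hgram :: "hyp3 \<Rightarrow> hyp3 \<Rightarrow> hyp3 \<Rightarrow> real" where
  "hgram x y z = 1 + 2 * cosh (dist x y) * cosh (dist x z) * cosh (dist y z)
     - (cosh (dist x y))\<^sup>2 - (cosh (dist x z))\<^sup>2 - (cosh (dist y z))\<^sup>2"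

lemma hgram_eq:
  "hgram x y z = (sinh (dist x y))\<^sup>2 * (sinh (dist x z))\<^sup>2 - (minkowski (tangent x y) (tangent x z))\<^sup>2"
  unfolding minkowski_tangent_tangent hgram_def sinh_square_eq
  by (simp add: power2_eq_square algebra_simps)

lemma hgram_nonneg: "hgram x y z \<ge> 0"
  using minkowski_orthogonal_Cauchy_Schwarz[OF minkowski_hyp3[of x] minkowski_tangent_base minkowski_tangent_base, of y z]
  by (simp add: hgram_eq minkowski_tangent_self)

lemma cosh_half: "cosh (d / 2 :: real) = sqrt ((1 + cosh d) / 2)"
proof -
  have "cosh d = 2 * (cosh (d / 2))\<^sup>2 - 1"
    using cosh_double[of "d / 2"] by (simp add: sinh_square_eq)
  then have "(cosh (d / 2))\<^sup>2 = (1 + cosh d) / 2" by simp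
  then show ?thesis by (intro real_sqrt_unique[symmetric]) auto
qed

text \<open>A midline of a triangle is at most half the base. The difference of the squared
  hyperbolic cosines is a positive multiple of the Gram determinant, so equality means
  degeneracy.\<close>

lemma dist_hmid_triangle:
  shows "dist (hmid x y) (hmid x w) \<le> dist y w / 2"
    and "dist (hmid x y) (hmid x w) = dist y w / 2 \<Longrightarrow> hgram x y w = 0"
proof -
  let ?A = "cosh (dist x y)" and ?B = "cosh (dist x w)" and ?C = "cosh (dist y w)"
  let ?s = "1 + ?A + ?B + ?C" and ?q = "2 * (1 + ?A) * (1 + ?B)"
  have half: "1 / 2 \<in> {0..1::real}" by simp
  have ge1: "?A \<ge> 1" "?B \<ge> 1" "?C \<ge> 1" by (simp_all add: cosh_real_ge_1)
  have N: "seg_norm c (1/2) = (1 + c) / 2" for c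
    by (simp add: seg_norm_def power2_eq_square field_simps)
  define s1 where "s1 = 1 / sqrt ((1 + ?A) / 2)"
  define s2 where "s2 = 1 / sqrt ((1 + ?B) / 2)"
  have R: "Rep_hyp3 (hmid x y) = s1 *\<^sub>R ((1 - 1/2) *\<^sub>R Rep_hyp3 x + (1/2) *\<^sub>R Rep_hyp3 y)"
    "Rep_hyp3 (hmid x w) = s2 *\<^sub>R ((1 - 1/2) *\<^sub>R Rep_hyp3 x + (1/2) *\<^sub>R Rep_hyp3 w)"
    unfolding Rep_hseg[OF half] N s1_def s2_def by (rule refl)+
  have "cosh (dist (hmid x y) (hmid x w)) = s1 * s2 * (?s / 4)"
    unfolding cosh_dist_hyp3[of "hmid x y"] R minkowski_bilinear mink_eq dist_commute[of y x]
    by (simp add: algebra_simps)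
  also have "\<dots> = ?s / 4 / (sqrt ((1 + ?A) / 2) * sqrt ((1 + ?B) / 2))"
    by (simp add: s1_def s2_def)
  also have "\<dots> = ?s / 4 / sqrt ((1 + ?A) / 2 * ((1 + ?B) / 2))"
    by (simp only: real_sqrt_mult)
  finally have "(cosh (dist (hmid x y) (hmid x w)))\<^sup>2 = (?s / 4)\<^sup>2 / ((1 + ?A) / 2 * ((1 + ?B) / 2))"
    using ge1 by (simp add: power_divide)
  also have "\<dots> = ?s\<^sup>2 / (2 * ?q)"
  proof -
    have "(u / 4)\<^sup>2 / (a / 2 * (b / 2)) = u\<^sup>2 / (2 * (2 * a * b))" for u a b :: real
      by (simp add: power2_eq_square)
    then show ?thesis .
  qed
  finally have 1: "(cosh (dist (hmid x y) (hmid x w)))\<^sup>2 = ?s\<^sup>2 / (2 * ?q)" .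
  have 2: "(cosh (dist y w / 2))\<^sup>2 = (1 + ?C) / 2"
    using ge1 by (simp add: cosh_half)
  have q: "?q > 0" using ge1 by (intro mult_pos_pos) auto
  \<comment> \<open>This polynomial identity contains both the inequality and its case of
    equality.\<close>
  have 3: "?q * (1 + ?C) = ?s\<^sup>2 + hgram x y w"
    by (simp add: hgram_def power2_eq_square algebra_simps)
  have "(cosh (dist (hmid x y) (hmid x w)))\<^sup>2 \<le> (cosh (dist y w / 2))\<^sup>2"
    unfolding 1 2 using 3 hgram_nonneg[of x y w] q by (simp add: field_simps)
  then have "cosh (dist (hmid x y) (hmid x w)) \<le> cosh (dist y w / 2)"
    by (rule power2_le_imp_le) simp
  then show "dist (hmid x y) (hmid x w) \<le> dist y w / 2"
    using cosh_real_nonneg_le_iff[of "dist (hmid x y) (hmid x w)" "dist y w / 2"] by simp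
  assume "dist (hmid x y) (hmid x w) = dist y w / 2"
  then have "?s\<^sup>2 / (2 * ?q) = (1 + ?C) / 2"
    unfolding 1[symmetric] 2[symmetric] by (simp only:)
  then have "?s\<^sup>2 = ?q * (1 + ?C)" using q by (simp add: field_simps)
  then show "hgram x y w = 0" using 3 by simp
qed

lemma hseg_half_commute: "hmid x y = hmid y x"
  by (simp add: hseg_def dist_commute add.commute)

text \<open>The quadrangle is cut along either diagonal into two triangles. In the case of equality
  both chains of inequalities are tight, and the two triangles that contain the side from
  \<open>x\<close> to \<open>y\<close> are degenerate.\<close>

lemma dist_hmid_quadrangle:
  shows "dist (hmid x y) (hmid z w) \<le> (dist x z + dist y w) / 2"
    and "dist (hmid x y) (hmid z w) = (dist x z + dist y w) / 2 \<Longrightarrow> hgram x y w = 0 \<and> hgram y x z = 0"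
proof -
  have a: "dist (hmid x y) (hmid x w) \<le> dist y w / 2" "dist (hmid x w) (hmid z w) \<le> dist x z / 2"
    using dist_hmid_triangle(1)[of x y w] dist_hmid_triangle(1)[of w x z] by (simp_all add: hseg_half_commute[of w])
  have b: "dist (hmid x y) (hmid z y) \<le> dist x z / 2" "dist (hmid z y) (hmid z w) \<le> dist y w / 2"
    using dist_hmid_triangle(1)[of y x z] dist_hmid_triangle(1)[of z y w] by (simp_all add: hseg_half_commute[of y])
  have t: "dist (hmid x y) (hmid z w) \<le> dist (hmid x y) (hmid x w) + dist (hmid x w) (hmid z w)"
    "dist (hmid x y) (hmid z w) \<le> dist (hmid x y) (hmid z y) + dist (hmid z y) (hmid z w)"
    by (rule dist_triangle)+
  show "dist (hmid x y) (hmid z w) \<le> (dist x z + dist y w) / 2"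
    using a t by simp
  assume eq: "dist (hmid x y) (hmid z w) = (dist x z + dist y w) / 2"
  have "dist (hmid x y) (hmid x w) = dist y w / 2" "dist (hmid y x) (hmid y z) = dist x z / 2"
    using a b t eq by (simp_all add: hseg_half_commute[of y])
  then show "hgram x y w = 0 \<and> hgram y x z = 0"
    using dist_hmid_triangle(2) by blast
qed

subsection \<open>Points on a line\<close>

text \<open>For \<open>x \<noteq> y\<close> the geodesic line through both, as the section of the
  hyperboloid by the plane that they span. In this linear form it is visibly closed under
  midpoints.\<close>

definition on_line :: "hyp3 \<Rightarrow> hyp3 \<Rightarrow> hyp3 \<Rightarrow> bool" where
  "on_line x y z \<longleftrightarrow> (\<exists>a b. Rep_hyp3 z = a *\<^sub>R Rep_hyp3 x + b *\<^sub>R Rep_hyp3 y)"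

lemma on_line_commute: "on_line x y z \<longleftrightarrow> on_line y x z"
  unfolding on_line_def by (metis add.commute)

lemma hgram_0_imp_on_line:
  assumes "hgram x y z = 0" "x \<noteq> y"
  shows "on_line x y z"
proof -
  define c where "c = minkowski (tangent x y) (tangent x z) / (sinh (dist x y))\<^sup>2"
  \<comment> \<open>The component of \<open>tangent x z\<close> orthogonal to
    \<open>tangent x y\<close>. The Gram determinant is its Minkowski square up to a factor, so it
    vanishes by definiteness.\<close>
  define u where "u = tangent x z - c *\<^sub>R tangent x y"
  have s: "(sinh (dist x y))\<^sup>2 \<noteq> 0" using assms(2) by simp
  have "minkowski u (Rep_hyp3 x) = 0"
    using minkowski_lincomb[of "tangent x z" c "tangent x y" "Rep_hyp3 x" 0 0]
    by (simp add: u_def minkowski_tangent_base)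
  moreover have "minkowski u u = 0"
  proof -
    have "minkowski u u = (sinh (dist x z))\<^sup>2 - 2 * c * minkowski (tangent x y) (tangent x z) + c\<^sup>2 * (sinh (dist x y))\<^sup>2"
      unfolding u_def minkowski_lincomb
      by (simp add: minkowski_tangent_self minkowski_commute[of "tangent x z"] power2_eq_square)
    also have "\<dots> = ((sinh (dist x y))\<^sup>2 * (sinh (dist x z))\<^sup>2 - (minkowski (tangent x y) (tangent x z))\<^sup>2) / (sinh (dist x y))\<^sup>2"
      using s by (simp add: c_def power2_eq_square field_simps)
    also have "\<dots> = 0" using assms(1) by (simp add: hgram_eq)
    finally show ?thesis .
  qed
  ultimately have "tangent x z = c *\<^sub>R tangent x y"
    using minkowski_orthogonal_eq_0[of u x] by (simp add: u_def)
  then have "Rep_hyp3 z = (c * mink y x - mink z x) *\<^sub>R Rep_hyp3 x + c *\<^sub>R Rep_hyp3 y"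
    unfolding tangent_def by (simp add: algebra_simps eq_diff_eq)
  then show ?thesis unfolding on_line_def by blast
qed

lemma on_line_hmid:
  assumes "on_line x y z" "on_line x y w"
  shows "on_line x y (hmid z w)"
proof -
  obtain a b a' b' where "Rep_hyp3 z = a *\<^sub>R Rep_hyp3 x + b *\<^sub>R Rep_hyp3 y"
    "Rep_hyp3 w = a' *\<^sub>R Rep_hyp3 x + b' *\<^sub>R Rep_hyp3 y"
    using assms unfolding on_line_def by blast
  then have "Rep_hyp3 (hmid z w) = (1 / sqrt (seg_norm (cosh (dist z w)) (1/2)) * (a + a') / 2) *\<^sub>R Rep_hyp3 x +
      (1 / sqrt (seg_norm (cosh (dist z w)) (1/2)) * (b + b') / 2) *\<^sub>R Rep_hyp3 y"
    by (simp add: Rep_hseg algebra_simps add_divide_distrib)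
  then show ?thesis unfolding on_line_def by blast
qed

lemma on_line_self: "on_line x y x" "on_line x y y"
  unfolding on_line_def by (metis add.right_neutral scaleR_one scaleR_zero_left, metis add.left_neutral scaleR_one scaleR_zero_left)

text \<open>The Gram determinant of three vectors in the span of two vanishes; \<open>xx\<close>,
  \<open>xy\<close>, \<open>yy\<close> are the products of the spanning vectors.\<close>

lemma gram_plane:
  fixes a b :: "nat \<Rightarrow> real" and g :: "nat \<Rightarrow> nat \<Rightarrow> real" and xx xy yy :: real
  assumes "\<And>i j. g i j = a i * a j * xx + (a i * b j + a j * b i) * xy + b i * b j * yy"
  shows "g 0 0 * (g 1 1 * g 2 2 - (g 1 2)\<^sup>2) - g 0 1 * (g 0 1 * g 2 2 - g 1 2 * g 0 2)
    + g 0 2 * (g 0 1 * g 1 2 - g 1 1 * g 0 2) = 0"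
  unfolding assms power2_eq_square by algebra

lemma on_line_imp_hgram_0:
  assumes "on_line x y p" "on_line x y q" "on_line x y r"
  shows "hgram p q r = 0"
proof -
  obtain a0 b0 a1 b1 a2 b2 where R: "Rep_hyp3 p = a0 *\<^sub>R Rep_hyp3 x + b0 *\<^sub>R Rep_hyp3 y"
    "Rep_hyp3 q = a1 *\<^sub>R Rep_hyp3 x + b1 *\<^sub>R Rep_hyp3 y"
    "Rep_hyp3 r = a2 *\<^sub>R Rep_hyp3 x + b2 *\<^sub>R Rep_hyp3 y"
    using assms unfolding on_line_def by blast
  define P where "P = (\<lambda>i::nat. if i = 0 then p else if i = 1 then q else r)"
  define a where "a = (\<lambda>i::nat. if i = 0 then a0 else if i = 1 then a1 else a2)"
  define b where "b = (\<lambda>i::nat. if i = 0 then b0 else if i = 1 then b1 else b2)"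
  have P: "Rep_hyp3 (P i) = a i *\<^sub>R Rep_hyp3 x + b i *\<^sub>R Rep_hyp3 y" for i
    using R by (simp add: P_def a_def b_def)
  have "mink (P i) (P j) = a i * a j * mink x x + (a i * b j + a j * b i) * mink x y + b i * b j * mink y y" for i j
    unfolding P minkowski_bilinear minkowski_commute[of "Rep_hyp3 y" "Rep_hyp3 x"] by (simp add: algebra_simps)
  from gram_plane[where g = "\<lambda>i j. mink (P i) (P j)", OF this]
  show ?thesis
    by (simp add: P_def mink_self hgram_def mink_eq power2_eq_square algebra_simps)
qed

text \<open>Equality in the Cauchy-Schwarz inequality for the two tangent vectors at
  \<open>p\<close>: either they point the same way, and the distances from \<open>p\<close>
  subtract, or they point in opposite ways.\<close>

lemma hgram_0_cases:
  assumes "hgram p q r = 0"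
  shows "dist q r = \<bar>dist p q - dist p r\<bar> \<or>
    minkowski (tangent p q) (tangent p r) = - (sinh (dist p q) * sinh (dist p r))"
proof -
  let ?g = "minkowski (tangent p q) (tangent p r)" and ?s = "sinh (dist p q) * sinh (dist p r)"
  have "?g\<^sup>2 = ?s\<^sup>2"
    using assms by (simp add: hgram_eq power_mult_distrib)
  then consider "?g = ?s" | "?g = - ?s" by (auto simp: power2_eq_iff)
  then show ?thesis
  proof cases
    case 1
    then have "cosh (dist q r) = cosh \<bar>dist p q - dist p r\<bar>"
      by (simp add: minkowski_tangent_tangent cosh_diff)
    then have "dist q r = \<bar>dist p q - dist p r\<bar>"
      by (metis abs_ge_zero cosh_real_nonneg_le_iff order_antisym order_refl zero_le_dist)
    then show ?thesis ..
  qed simp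
qed

text \<open>Three directions at a point of a line cannot be pairwise opposite.\<close>

lemma three_points_on_line:
  assumes "q1 \<noteq> p" "q2 \<noteq> p" "q3 \<noteq> p"
    and "on_line x y p" "on_line x y q1" "on_line x y q2" "on_line x y q3"
  shows "dist q1 q2 = \<bar>dist p q1 - dist p q2\<bar> \<or> dist q1 q3 = \<bar>dist p q1 - dist p q3\<bar> \<or>
    dist q2 q3 = \<bar>dist p q2 - dist p q3\<bar>"
proof (rule ccontr)
  assume neg: "\<not> ?thesis"
  let ?u = "tangent p" and ?s = "\<lambda>q. sinh (dist p q)"
  have g: "minkowski (?u q1) (?u q2) = - (?s q1 * ?s q2)" "minkowski (?u q1) (?u q3) = - (?s q1 * ?s q3)"
    "minkowski (?u q2) (?u q3) = - (?s q2 * ?s q3)"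
    using neg hgram_0_cases[OF on_line_imp_hgram_0] assms(4-) by metis+
  have s: "?s q1 > 0" "?s q2 > 0" "?s q3 > 0" using assms(1-3) by auto
  \<comment> \<open>This combination cancels the two opposite vectors \<open>?u q1\<close> and
    \<open>?u q2\<close>, but both have a negative product with \<open>?u q3\<close>.\<close>
  define w where "w = ?s q2 *\<^sub>R ?u q1 + ?s q1 *\<^sub>R ?u q2"
  have "minkowski w (Rep_hyp3 p) = 0"
    by (simp add: w_def minkowski_bilinear minkowski_tangent_base)
  moreover have "minkowski w w = 0"
    unfolding w_def minkowski_bilinear g minkowski_commute[of "?u q2" "?u q1"] minkowski_tangent_self
    by (simp add: power2_eq_square)
  ultimately have "w = 0" by (rule minkowski_orthogonal_eq_0)
  then have "minkowski w (?u q3) = 0" by (simp add: minkowski_def)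
  moreover have "minkowski w (?u q3) = - (2 * ?s q1 * ?s q2 * ?s q3)"
    unfolding w_def minkowski_bilinear g by simp
  ultimately show False using s by simp
qed

section \<open>Discrete torsion-free groups: proper discontinuity, quotient metric, covering,
  length\<close>

section \<open>The quotient by a discrete torsion-free group\<close>

text \<open>A neighbourhood for pointwise convergence restricts finitely many values only; so
  discreteness of the group becomes a metric condition at finitely many points.\<close>

lemma open_fun_finite_ball:
  fixes f :: "'a \<Rightarrow> 'b::metric_space"
  assumes "open U" "f \<in> U"
  obtains Z e where "finite Z" "e > 0" "\<And>g. \<forall>z\<in>Z. dist (g z) (f z) < e \<Longrightarrow> g \<in> U"
proof -
  obtain X where X: "f \<in> (\<Pi>\<^sub>E i\<in>UNIV. X i)" "\<And>i. open (X i)" "finite {i. X i \<noteq> UNIV}"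
    "(\<Pi>\<^sub>E i\<in>UNIV. X i) \<subseteq> U"
    using product_topology_open_contains_basis[OF assms(1)[unfolded open_fun_def] assms(2)] by auto
  define Z where "Z = {i. X i \<noteq> UNIV}"
  have "\<exists>e>0. ball (f z) e \<subseteq> X z" for z
    using openE[OF X(2)[of z], of "f z"] X(1) by (metis PiE_mem UNIV_I)
  then obtain r where r: "\<And>z. r z > 0" "\<And>z. ball (f z) (r z) \<subseteq> X z"
    by metis
  define e where "e = Min (insert 1 (r ` Z))"
  have fin: "finite (insert 1 (r ` Z))" using X(3) by (simp add: Z_def)
  show thesis
  proof
    show "finite Z" using X(3) by (simp add: Z_def)
    show "e > 0" unfolding e_def using fin r(1) by (subst Min_gr_iff) auto
    fix g assume g: "\<forall>z\<in>Z. dist (g z) (f z) < e"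
    have "g z \<in> X z" for z
    proof (cases "z \<in> Z")
      case True
      then have "e \<le> r z" unfolding e_def using fin by (intro Min_le) auto
      then have "g z \<in> ball (f z) (r z)" using g True by (auto simp: dist_commute)
      then show ?thesis using r(2) by blast
    qed (simp add: Z_def)
    then show "g \<in> U" using X(4) by (auto simp: PiE_def)
  qed
qed

definition poly_length :: "(real \<Rightarrow> 'm) \<Rightarrow> ('m \<Rightarrow> 'm \<Rightarrow> real) \<Rightarrow> real list \<Rightarrow> ennreal" where
  "poly_length p d ts = (\<Sum>i<length ts - 1. ennreal (d (p (ts ! i)) (p (ts ! Suc i))))"

lemma path_length_eq: "path_length d p = (SUP ts\<in>{ts. sorted ts \<and> set ts \<subseteq> {0..1}}. poly_length p d ts)"
  by (simp add: path_length_def poly_length_def)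

text \<open>The side from the last point of \<open>ts\<close> to the first point of
  \<open>us\<close> is dropped on the left.\<close>

lemma poly_length_append:
  "poly_length p d ts + poly_length p d us \<le> poly_length p d (ts @ us)"
proof (cases "ts = [] \<or> us = []")
  case False
  let ?f = "\<lambda>ts i. ennreal (d (p (ts ! i)) (p (ts ! Suc i)))"
  let ?m = "length ts" and ?n = "length us"
  have mn: "?m > 0" "?n > 0" using False by auto
  have "poly_length p d ts = (\<Sum>i<?m - 1. ?f (ts @ us) i)"
    unfolding poly_length_def by (intro sum.cong) (auto simp: nth_append)
  moreover have "poly_length p d us = (\<Sum>i<?n - 1. ?f (ts @ us) (i + ?m))"
    unfolding poly_length_def by (intro sum.cong) (auto simp: nth_append)
  moreover have "(\<Sum>i<?n - 1. ?f (ts @ us) (i + ?m)) = (\<Sum>i\<in>{?m..<?n - 1 + ?m}. ?f (ts @ us) i)"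
    using sum.shift_bounds_nat_ivl[of "?f (ts @ us)" 0 ?m "?n - 1"] by (simp add: atLeast0LessThan)
  moreover have "(\<Sum>i<?m - 1. ?f (ts @ us) i) + (\<Sum>i\<in>{?m..<?n - 1 + ?m}. ?f (ts @ us) i) =
      (\<Sum>i\<in>{..<?m - 1} \<union> {?m..<?n - 1 + ?m}. ?f (ts @ us) i)"
    by (intro sum.union_disjoint[symmetric]) auto
  moreover have "\<dots> \<le> poly_length p d (ts @ us)"
    unfolding poly_length_def using mn by (intro sum_mono2) auto
  ultimately show ?thesis by simp
qed (auto simp: poly_length_def)

abbreviation finv :: "('a \<Rightarrow> 'b) \<Rightarrow> 'b \<Rightarrow> 'a" where
  "finv \<equiv> inv_into UNIV"

locale kleinian =
  fixes \<Gamma> :: "(hyp3 \<Rightarrow> hyp3) set"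
  assumes dtf: "discrete_torsion_free \<Gamma>"
begin

lemma subgroup_isometries: "subgroup \<Gamma> hyp3_isometries"
  using dtf by (simp add: discrete_torsion_free_def)

lemma dist_\<Gamma> [simp]: "\<gamma> \<in> \<Gamma> \<Longrightarrow> dist (\<gamma> x) (\<gamma> y) = dist x y"
  and surj_\<Gamma>: "\<gamma> \<in> \<Gamma> \<Longrightarrow> surj \<gamma>"
  using subgroup.subset[OF subgroup_isometries] by (auto simp: hyp3_isometries_def)

lemma inj_\<Gamma>: "\<gamma> \<in> \<Gamma> \<Longrightarrow> inj \<gamma>"
  by (rule injI) (metis dist_\<Gamma> dist_eq_0_iff)

lemma id_\<Gamma>: "id \<in> \<Gamma>"
  using subgroup.one_closed[OF subgroup_isometries] by (simp add: hyp3_isometries_def)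

lemma comp_\<Gamma>: "\<gamma> \<in> \<Gamma> \<Longrightarrow> \<delta> \<in> \<Gamma> \<Longrightarrow> \<gamma> \<circ> \<delta> \<in> \<Gamma>"
  using subgroup.m_closed[OF subgroup_isometries] by (simp add: hyp3_isometries_def)

lemma inv_\<Gamma>_apply [simp]:
  assumes "\<gamma> \<in> \<Gamma>"
  shows "finv \<gamma> (\<gamma> x) = x" "\<gamma> (finv \<gamma> x) = x"
  using assms inj_\<Gamma> surj_\<Gamma> by (simp_all add: surj_f_inv_f)

lemma dist_inv_\<Gamma> [simp]: "\<gamma> \<in> \<Gamma> \<Longrightarrow> dist (finv \<gamma> x) (finv \<gamma> y) = dist x y"
  using dist_\<Gamma>[of \<gamma> "finv \<gamma> x" "finv \<gamma> y"] by simp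

lemma inv_comp_\<Gamma> [simp]: "\<gamma> \<in> \<Gamma> \<Longrightarrow> finv \<gamma> \<circ> \<gamma> = id" "\<gamma> \<in> \<Gamma> \<Longrightarrow> \<gamma> \<circ> finv \<gamma> = id"
  by (auto simp: fun_eq_iff)

lemma m_inv_\<Gamma>:
  assumes "\<gamma> \<in> \<Gamma>"
  shows "m_inv hyp3_isometries \<gamma> = finv \<gamma>"
  unfolding m_inv_def
proof (rule the_equality)
  have "surj (finv \<gamma>)"
    using assms by (metis inv_\<Gamma>_apply(1) surjI)
  then show "finv \<gamma> \<in> carrier hyp3_isometries \<and> \<gamma> \<otimes>\<^bsub>hyp3_isometries\<^esub> finv \<gamma> = \<one>\<^bsub>hyp3_isometries\<^esub> \<and>
      finv \<gamma> \<otimes>\<^bsub>hyp3_isometries\<^esub> \<gamma> = \<one>\<^bsub>hyp3_isometries\<^esub>"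
    using assms by (simp add: hyp3_isometries_def)
  fix y assume "y \<in> carrier hyp3_isometries \<and> \<gamma> \<otimes>\<^bsub>hyp3_isometries\<^esub> y = \<one>\<^bsub>hyp3_isometries\<^esub> \<and>
      y \<otimes>\<^bsub>hyp3_isometries\<^esub> \<gamma> = \<one>\<^bsub>hyp3_isometries\<^esub>"
  then have "\<gamma> (y z) = z" for z by (simp add: hyp3_isometries_def fun_eq_iff)
  then show "y = finv \<gamma>" using assms by (metis ext inv_\<Gamma>_apply(1))
qed

lemma inv_\<Gamma>: "\<gamma> \<in> \<Gamma> \<Longrightarrow> finv \<gamma> \<in> \<Gamma>"
  using subgroup.m_inv_closed[OF subgroup_isometries, of \<gamma>] by (simp add: m_inv_\<Gamma>)

lemma hseg_\<Gamma>: "\<gamma> \<in> \<Gamma> \<Longrightarrow> t \<in> {0..1} \<Longrightarrow> \<gamma> (hseg x y t) = hseg (\<gamma> x) (\<gamma> y) t"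
  by (rule hseg_isometry) simp_all

lemma continuous_on_\<Gamma>:
  assumes "\<gamma> \<in> \<Gamma>" "continuous_on S f"
  shows "continuous_on S (\<lambda>x. \<gamma> (f x))"
proof -
  have "continuous_on UNIV \<gamma>"
    unfolding continuous_on_iff using assms(1) by auto
  then show ?thesis by (rule continuous_on_compose2) (use assms(2) in auto)
qed

lemma almost_id_imp_id:
  obtains Z e where "finite Z" "e > 0" "\<And>\<gamma>. \<gamma> \<in> \<Gamma> \<Longrightarrow> \<forall>z\<in>Z. dist (\<gamma> z) z < e \<Longrightarrow> \<gamma> = id"
proof -
  have "id isolated_in \<Gamma>"
    using dtf id_\<Gamma> by (auto simp: discrete_torsion_free_def discrete_def)
  then obtain T where T: "open T" "T \<inter> \<Gamma> = {id}" by (elim isolated_inE)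
  then have "id \<in> T" by blast
  obtain Z e where Z: "finite Z" "e > 0" "\<And>g. \<forall>z\<in>Z. dist (g z) (id z) < e \<Longrightarrow> g \<in> T"
    using open_fun_finite_ball[OF T(1) \<open>id \<in> T\<close>] by metis
  show thesis
  proof
    show "\<gamma> = id" if "\<gamma> \<in> \<Gamma>" "\<forall>z\<in>Z. dist (\<gamma> z) z < e" for \<gamma>
      using Z(3)[of \<gamma>] that T(2) by auto
  qed (use Z in auto)
qed

text \<open>Proper discontinuity. Among infinitely many elements of bounded displacement two would
  nearly agree on the finite test set of \<open>almost_id_imp_id\<close>, so that one composed with
  the inverse of the other would be the identity.\<close>

lemma finite_displacement: "finite {\<gamma>\<in>\<Gamma>. dist (\<gamma> y) x \<le> r}"
proof (rule ccontr)
  let ?S = "{\<gamma>\<in>\<Gamma>. dist (\<gamma> y) x \<le> r}"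
  assume inf: "infinite ?S"
  obtain Z e where Z: "finite Z" "e > 0" "\<And>\<gamma>. \<gamma> \<in> \<Gamma> \<Longrightarrow> \<forall>z\<in>Z. dist (\<gamma> z) z < e \<Longrightarrow> \<gamma> = id"
    using almost_id_imp_id by metis
  \<comment> \<open>One test point at a time: its images lie in a compact ball, which finitely many
    small balls cover, and an infinite subfamily has its images near one of the centres.\<close>
  have "\<exists>S'\<subseteq>?S. infinite S' \<and> (\<forall>z\<in>Z'. \<forall>\<gamma>\<in>S'. \<forall>\<delta>\<in>S'. dist (\<gamma> z) (\<delta> z) < e)" if "finite Z'" for Z'
    using that
  proof induction
    case empty
    then show ?case using inf by blast
  next
    case (insert z Z')
    then obtain S' where S': "S' \<subseteq> ?S" "infinite S'" "\<forall>z\<in>Z'. \<forall>\<gamma>\<in>S'. \<forall>\<delta>\<in>S'. dist (\<gamma> z) (\<delta> z) < e"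
      by blast
    have img: "(\<lambda>\<gamma>. \<gamma> z) ` S' \<subseteq> cball x (r + dist y z)"
    proof clarify
      fix \<gamma> assume "\<gamma> \<in> S'"
      then have "\<gamma> \<in> \<Gamma>" "dist (\<gamma> y) x \<le> r" using S'(1) by auto
      then show "\<gamma> z \<in> cball x (r + dist y z)"
        using dist_triangle[of x "\<gamma> z" "\<gamma> y"] by (simp add: dist_commute)
    qed
    have "compact (cball x (r + dist y z))" by (rule compact_cball_hyp3)
    then obtain K where K: "finite K" "cball x (r + dist y z) \<subseteq> (\<Union>k\<in>K. ball k (e / 2))"
      using Z(2) compact_eq_totally_bounded[of "cball x (r + dist y z)"] by (metis half_gt_zero)
    have "\<forall>\<gamma>\<in>S'. \<exists>k\<in>K. dist k (\<gamma> z) < e / 2"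
    proof
      fix \<gamma> assume "\<gamma> \<in> S'"
      then have "\<gamma> z \<in> (\<Union>k\<in>K. ball k (e / 2))" using img K(2) by blast
      then show "\<exists>k\<in>K. dist k (\<gamma> z) < e / 2" by auto
    qed
    from pigeonhole_infinite_rel[OF S'(2) K(1) this]
    obtain k where k: "infinite {\<gamma>\<in>S'. dist k (\<gamma> z) < e / 2}" by blast
    have "dist (\<gamma> z) (\<delta> z) < e" if "dist k (\<gamma> z) < e / 2" "dist k (\<delta> z) < e / 2" for \<gamma> \<delta> :: "hyp3 \<Rightarrow> hyp3"
      using that dist_triangle3[of "\<gamma> z" "\<delta> z" k] by simp
    then show ?case
      using S' k by (intro exI[of _ "{\<gamma>\<in>S'. dist k (\<gamma> z) < e / 2}"]) auto
  qed
  from this[OF Z(1)] obtain S' where S': "S' \<subseteq> ?S" "infinite S'"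
    "\<forall>z\<in>Z. \<forall>\<gamma>\<in>S'. \<forall>\<delta>\<in>S'. dist (\<gamma> z) (\<delta> z) < e" by blast
  obtain \<gamma> where \<gamma>: "\<gamma> \<in> S'" using S'(2) by (metis ex_in_conv finite.emptyI)
  obtain \<delta> where \<delta>: "\<delta> \<in> S'" "\<delta> \<noteq> \<gamma>" using S'(2) by (metis finite.emptyI finite.insertI finite_subset singletonI subsetI insert_iff)
  have \<Gamma>: "\<gamma> \<in> \<Gamma>" "\<delta> \<in> \<Gamma>" using \<gamma> \<delta> S'(1) by auto
  have "finv \<delta> \<circ> \<gamma> = id"
  proof (rule Z(3))
    show "finv \<delta> \<circ> \<gamma> \<in> \<Gamma>" using \<Gamma> by (intro comp_\<Gamma> inv_\<Gamma>)
    have "dist (finv \<delta> (\<gamma> z)) z = dist (\<gamma> z) (\<delta> z)" for z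
      using \<Gamma> dist_inv_\<Gamma>[of \<delta> "\<gamma> z" "\<delta> z"] by simp
    then show "\<forall>z\<in>Z. dist ((finv \<delta> \<circ> \<gamma>) z) z < e" using S'(3) \<gamma> \<delta> by simp
  qed
  then have "\<gamma> z = \<delta> z" for z using \<Gamma> by (metis comp_apply id_apply inv_\<Gamma>_apply(2))
  then show False using \<delta>(2) by auto
qed

lemma funpow_\<Gamma>: "\<gamma> \<in> \<Gamma> \<Longrightarrow> \<gamma> ^^ n \<in> \<Gamma>"
  by (induction n) (auto simp: id_\<Gamma> comp_\<Gamma>)

text \<open>The powers of an element with a fixed point displace that point by 0, so only finitely
  many of them are distinct and the element has finite order.\<close>

lemma free_action:
  assumes "\<gamma> \<in> \<Gamma>" "\<gamma> x = x"
  shows "\<gamma> = id"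
proof -
  have fixed: "(\<gamma> ^^ n) x = x" for n by (induction n) (simp_all add: assms)
  have "range (\<lambda>n. \<gamma> ^^ n) \<subseteq> {\<delta>\<in>\<Gamma>. dist (\<delta> x) x \<le> 0}"
    using fixed funpow_\<Gamma>[OF assms(1)] by auto
  then have "finite (range (\<lambda>n. \<gamma> ^^ n))"
    using finite_displacement finite_subset by blast
  then have "\<not> inj (\<lambda>n. \<gamma> ^^ n)"
    using finite_imageD infinite_UNIV_nat by blast
  then obtain m n where "\<gamma> ^^ m = \<gamma> ^^ n" "m < n"
    unfolding inj_def by (metis linorder_neqE_nat)
  moreover have "\<gamma> ^^ n = \<gamma> ^^ m \<circ> \<gamma> ^^ (n - m)"
    using \<open>m < n\<close> by (simp flip: funpow_add)
  ultimately have "(\<gamma> ^^ m) ((\<gamma> ^^ (n - m)) z) = (\<gamma> ^^ m) z" for z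
    by (metis comp_apply)
  then have "\<gamma> ^^ (n - m) = id"
    using inj_\<Gamma>[OF funpow_\<Gamma>[OF assms(1), of m]] by (auto simp: fun_eq_iff inj_eq)
  then show ?thesis
    using dtf assms(1) \<open>m < n\<close> unfolding discrete_torsion_free_def by (meson zero_less_diff)
qed

lemma injectivity_radius:
  obtains e where "e > 0" "\<And>\<gamma>. \<gamma> \<in> \<Gamma> \<Longrightarrow> dist (\<gamma> x) x < e \<Longrightarrow> \<gamma> = id"
proof -
  let ?F = "(\<lambda>\<gamma>. dist (\<gamma> x) x) ` ({\<gamma>\<in>\<Gamma>. dist (\<gamma> x) x \<le> 1} - {id})"
  \<comment> \<open>Displacements above 1 are left out of \<open>?F\<close> to make it finite; the
    number 1 takes their place in the minimum.\<close>
  define e where "e = Min (insert 1 ?F)"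
  have fin: "finite (insert 1 ?F)" using finite_displacement[of x x 1] by simp
  show thesis
  proof
    have "dist (\<gamma> x) x > 0" if "\<gamma> \<in> \<Gamma>" "\<gamma> \<noteq> id" for \<gamma>
      using that free_action[of \<gamma> x] by auto
    then show "e > 0" unfolding e_def using fin by (subst Min_gr_iff) auto
    show "\<gamma> = id" if "\<gamma> \<in> \<Gamma>" "dist (\<gamma> x) x < e" for \<gamma>
    proof (rule ccontr)
      assume "\<gamma> \<noteq> id"
      have "e \<le> 1" unfolding e_def using fin by (intro Min_le) auto
      then have "dist (\<gamma> x) x \<in> ?F" using that \<open>\<gamma> \<noteq> id\<close> by auto
      then have "e \<le> dist (\<gamma> x) x" unfolding e_def using fin by (intro Min_le) auto
      then show False using that by simp
    qed
  qed
qed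

subsection \<open>Orbits and their distance\<close>

definition orb :: "hyp3 \<Rightarrow> hyp3 set" where
  "orb x = (\<lambda>\<gamma>. \<gamma> x) ` \<Gamma>"

definition odist :: "hyp3 \<Rightarrow> hyp3 \<Rightarrow> real" where
  "odist x y = setdist (orb x) (orb y)"

lemma quotient_eq: "hyp3_quotient \<Gamma> = range orb"
  by (simp add: hyp3_quotient_def orb_def[abs_def])

lemma orb_self: "x \<in> orb x"
  unfolding orb_def using id_\<Gamma> by (intro image_eqI[of _ _ id]) auto

lemma orb_\<Gamma> [simp]: "\<gamma> \<in> \<Gamma> \<Longrightarrow> orb (\<gamma> x) = orb x"
proof (intro equalityI subsetI)
  assume \<gamma>: "\<gamma> \<in> \<Gamma>"
  show "z \<in> orb x" if z: "z \<in> orb (\<gamma> x)" for z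
  proof -
    obtain \<delta> where "\<delta> \<in> \<Gamma>" "z = \<delta> (\<gamma> x)" using z unfolding orb_def by auto
    then show ?thesis
      unfolding orb_def using \<gamma> by (intro image_eqI[of _ _ "\<delta> \<circ> \<gamma>"] comp_\<Gamma>) auto
  qed
  show "z \<in> orb (\<gamma> x)" if z: "z \<in> orb x" for z
  proof -
    obtain \<delta> where "\<delta> \<in> \<Gamma>" "z = \<delta> x" using z by (auto simp: orb_def)
    then show ?thesis
      unfolding orb_def using \<gamma> by (intro image_eqI[of _ _ "\<delta> \<circ> finv \<gamma>"] comp_\<Gamma> inv_\<Gamma>) auto
  qed
qed

lemma orb_eq_iff: "orb x = orb y \<longleftrightarrow> (\<exists>\<gamma>\<in>\<Gamma>. y = \<gamma> x)"
proof
  assume "orb x = orb y"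
  then have "y \<in> orb x" using orb_self by simp
  then show "\<exists>\<gamma>\<in>\<Gamma>. y = \<gamma> x" by (auto simp: orb_def)
qed auto

text \<open>Only finitely many translates of \<open>y\<close> are as close to \<open>x\<close> as
  \<open>y\<close> itself, so the infimum is a minimum.\<close>

lemma odist_attained:
  obtains \<gamma> where "\<gamma> \<in> \<Gamma>" "odist x y = dist x (\<gamma> y)" "\<And>\<delta>. \<delta> \<in> \<Gamma> \<Longrightarrow> dist x (\<gamma> y) \<le> dist x (\<delta> y)"
proof -
  let ?F = "{\<gamma>\<in>\<Gamma>. dist (\<gamma> y) x \<le> dist y x}"
  have fin: "finite ?F" and ne: "?F \<noteq> {}"
    using finite_displacement id_\<Gamma> by auto
  then obtain \<gamma> where \<gamma>: "\<gamma> \<in> ?F" "\<And>\<delta>. \<delta> \<in> ?F \<Longrightarrow> dist x (\<gamma> y) \<le> dist x (\<delta> y)"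
    using ex_is_arg_min_if_finite[of ?F "\<lambda>\<gamma>. dist x (\<gamma> y)"] by (auto simp: is_arg_min_linorder)
  have le: "dist x (\<gamma> y) \<le> dist x (\<delta> y)" if "\<delta> \<in> \<Gamma>" for \<delta>
  proof (cases "\<delta> \<in> ?F")
    case False
    then have "dist x y < dist x (\<delta> y)" using that by (simp add: dist_commute)
    moreover have "dist x (\<gamma> y) \<le> dist x y" using \<gamma>(1) by (simp add: dist_commute)
    ultimately show ?thesis by simp
  qed (use \<gamma>(2) in blast)
  have "odist x y = dist x (\<gamma> y)"
    unfolding odist_def
  proof (rule setdist_unique)
    show "x \<in> orb x" "\<gamma> y \<in> orb y" using \<gamma>(1) orb_self by (auto simp: orb_def)
    fix u v assume "u \<in> orb x \<and> v \<in> orb y"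
    then obtain \<delta> \<delta>' where d: "\<delta> \<in> \<Gamma>" "u = \<delta> x" "\<delta>' \<in> \<Gamma>" "v = \<delta>' y" by (auto simp: orb_def)
    have "dist u v = dist x ((finv \<delta> \<circ> \<delta>') y)"
      using d dist_inv_\<Gamma>[of \<delta> u v] by simp
    then show "dist x (\<gamma> y) \<le> dist u v"
      using le[of "finv \<delta> \<circ> \<delta>'"] d by (simp add: comp_\<Gamma> inv_\<Gamma>)
  qed
  then show thesis using that \<gamma>(1) le by blast
qed

lemma odist_le: "\<gamma> \<in> \<Gamma> \<Longrightarrow> odist x y \<le> dist x (\<gamma> y)"
  using odist_attained[of x y] by metis

lemma odist_le_dist: "odist x y \<le> dist x y"
  using odist_le[OF id_\<Gamma>] by simp

lemma odist_nonneg: "0 \<le> odist x y"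
  by (simp add: odist_def setdist_pos_le)

lemma odist_commute: "odist x y = odist y x"
  by (simp add: odist_def setdist_sym)

lemma odist_eq_0_iff: "odist x y = 0 \<longleftrightarrow> orb x = orb y"
proof
  assume "odist x y = 0"
  then obtain \<gamma> where "\<gamma> \<in> \<Gamma>" "dist x (\<gamma> y) = 0"
    using odist_attained[of x y] by metis
  then show "orb x = orb y" using orb_\<Gamma> by (metis dist_eq_0_iff)
next
  assume "orb x = orb y"
  then obtain \<gamma> where "\<gamma> \<in> \<Gamma>" "x = \<gamma> y" by (metis orb_eq_iff)
  then show "odist x y = 0" using odist_le[of \<gamma> x y] odist_nonneg[of x y] by simp
qed

lemma odist_triangle: "odist x z \<le> odist x y + odist y z"
proof -
  obtain \<gamma> where \<gamma>: "\<gamma> \<in> \<Gamma>" "odist x y = dist x (\<gamma> y)" using odist_attained by metis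
  obtain \<delta> where \<delta>: "\<delta> \<in> \<Gamma>" "odist y z = dist y (\<delta> z)" using odist_attained by metis
  have "odist x z \<le> dist x ((\<gamma> \<circ> \<delta>) z)" using \<gamma> \<delta> by (intro odist_le comp_\<Gamma>)
  also have "\<dots> \<le> dist x (\<gamma> y) + dist (\<gamma> y) (\<gamma> (\<delta> z))" using dist_triangle by simp
  finally show ?thesis using \<gamma> \<delta> by simp
qed

text \<open>The element that realizes the orbit distance displaces \<open>x\<close> by at most twice
  the sum of the distances of \<open>y\<close> and \<open>z\<close> from \<open>x\<close>, which is
  less than \<open>e\<close>. This is the origin of the quarter.\<close>

lemma odist_eq_dist:
  assumes "\<And>\<gamma>. \<gamma> \<in> \<Gamma> \<Longrightarrow> dist (\<gamma> x) x < e \<Longrightarrow> \<gamma> = id" "dist x y < e / 4" "dist x z < e / 4"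
  shows "odist y z = dist y z"
proof -
  obtain \<gamma> where \<gamma>: "\<gamma> \<in> \<Gamma>" "odist y z = dist y (\<gamma> z)" using odist_attained by metis
  have "dist (\<gamma> x) x \<le> dist (\<gamma> x) (\<gamma> z) + dist (\<gamma> z) y + dist y x"
    using dist_triangle[of "\<gamma> x" x y] dist_triangle[of "\<gamma> x" y "\<gamma> z"] by linarith
  also have "\<dots> = dist x z + odist y z + dist x y"
    using \<gamma> by (simp add: dist_commute)
  also have "odist y z \<le> dist y z" by (rule odist_le_dist)
  also have "dist y z \<le> dist x y + dist x z" by (rule dist_triangle3)
  finally have "dist (\<gamma> x) x < e" using assms(2,3) by linarith
  then have "\<gamma> = id" using assms(1) \<gamma>(1) by blast
  then show ?thesis using \<gamma> by simp
qed

sublocale Q: Metric_space "hyp3_quotient \<Gamma>" "setdist :: hyp3 set \<Rightarrow> hyp3 set \<Rightarrow> real"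
proof
  fix A B C :: "hyp3 set"
  show "0 \<le> setdist A B" by (rule setdist_pos_le)
  show "setdist A B = setdist B A" by (rule setdist_sym)
  assume "A \<in> hyp3_quotient \<Gamma>" "B \<in> hyp3_quotient \<Gamma>"
  then obtain x y where xy: "A = orb x" "B = orb y" by (auto simp: quotient_eq)
  show "setdist A B = 0 \<longleftrightarrow> A = B" using odist_eq_0_iff[of x y] by (simp add: xy odist_def)
  assume "C \<in> hyp3_quotient \<Gamma>"
  then obtain z where "C = orb z" by (auto simp: quotient_eq)
  then show "setdist A C \<le> setdist A B + setdist B C"
    using odist_triangle[of x z y] by (simp add: xy odist_def)
qed

abbreviation "QT \<equiv> hyp3_quotient_top \<Gamma>"

lemma QT_eq: "QT = Q.mtopology"
  by (simp add: hyp3_quotient_top_def)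

lemma topspace_QT: "topspace QT = range orb"
  by (metis QT_eq Q.topspace_mtopology quotient_eq)

lemma continuous_map_orb: "continuous_map euclidean QT orb"
  unfolding QT_eq
proof (subst Q.continuous_map_to_metric, intro ballI allI impI)
  fix x :: hyp3 and e :: real assume "e > 0"
  have "setdist (orb x) (orb y) < e" if "dist x y < e" for y
    using odist_le_dist[of x y] that by (simp add: odist_def)
  then show "\<exists>U. openin euclidean U \<and> x \<in> U \<and> (\<forall>y\<in>U. orb y \<in> Q.mball (orb x) e)"
    using \<open>e > 0\<close> unfolding Q.in_mball by (intro exI[of _ "ball x e"]) (auto simp: quotient_eq)
qed

lemma continuous_map_orb_comp:
  assumes "continuous_on S G"
  shows "continuous_map (top_of_set S) QT (\<lambda>u. orb (G u))"
  using continuous_map_compose[of "top_of_set S" euclidean G QT orb] assms continuous_map_orb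
  by (simp add: o_def)

subsection \<open>Lifting\<close>

text \<open>The quotient is embedded in a normed space by the map \<open>x \<mapsto> min 1 (odist \<cdot> x)\<close>, as in the
  Kuratowski embedding, because the library proves lifting theorems for normed spaces only.\<close>

definition kur :: "hyp3 \<Rightarrow> hyp3 \<Rightarrow>\<^sub>C real" where
  "kur x = Bcontfun (\<lambda>z. min 1 (odist z x))"

lemma kur_apply: "apply_bcontfun (kur x) z = min 1 (odist z x)"
proof -
  have lip: "\<bar>odist a x - odist b x\<bar> \<le> dist a b" for a b
    using odist_triangle[of a x b] odist_triangle[of b x a] odist_le_dist[of a b] odist_commute[of a b]
    by linarith
  have "continuous_on UNIV (\<lambda>z. odist z x)"
    unfolding continuous_on_iff
  proof (intro ballI allI impI)
    fix a :: hyp3 and e :: real assume "e > 0"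
    then show "\<exists>d>0. \<forall>b\<in>UNIV. dist b a < d \<longrightarrow> dist (odist b x) (odist a x) < e"
      using le_less_trans[OF lip] by (intro exI[of _ e]) (auto simp: dist_real_def)
  qed
  then have "(\<lambda>z. min 1 (odist z x)) \<in> bcontfun"
    using odist_nonneg by (intro bcontfun_normI[where b = 1] continuous_intros) (auto simp: min_def)
  then show ?thesis by (simp add: kur_def Bcontfun_inverse)
qed

lemma dist_kur: "dist (kur x) (kur y) = min 1 (odist x y)"
proof (rule antisym)
  show "dist (kur x) (kur y) \<le> min 1 (odist x y)"
  proof (rule dist_bound)
    fix z
    have "\<bar>odist z x - odist z y\<bar> \<le> odist x y" 
      using odist_triangle[of z x y] odist_triangle[of z y x] odist_commute[of x y] by linarith
    then show "dist (apply_bcontfun (kur x) z) (apply_bcontfun (kur y) z) \<le> min 1 (odist x y)"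
      using odist_nonneg[of z x] odist_nonneg[of z y] by (auto simp: kur_apply dist_real_def min_def)
  qed
  have "dist (apply_bcontfun (kur x) x) (apply_bcontfun (kur y) x) = min 1 (odist x y)"
    using odist_nonneg[of x y] odist_eq_0_iff[of x x] by (simp add: kur_apply dist_real_def)
  then show "min 1 (odist x y) \<le> dist (kur x) (kur y)"
    using dist_bounded[of "kur x" x "kur y"] by simp
qed

lemma kur_eq_iff: "kur x = kur y \<longleftrightarrow> orb x = orb y"
proof -
  have "kur x = kur y \<longleftrightarrow> min 1 (odist x y) = 0"
    unfolding dist_kur[symmetric] by simp
  also have "\<dots> \<longleftrightarrow> odist x y = 0" by (simp add: min_def)
  finally show ?thesis unfolding odist_eq_0_iff .
qed

text \<open>The source of the covering has to lie in a normed space just like its target, so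
  \<open>hyp3\<close> is replaced by the hyperboloid.\<close>

definition ckur :: "(real ^ 3) \<times> real \<Rightarrow> hyp3 \<Rightarrow>\<^sub>C real" where
  "ckur p = kur (Abs_hyp3 p)"

lemma ckur_Rep [simp]: "ckur (Rep_hyp3 x) = kur x"
  by (simp add: ckur_def Rep_hyp3_inverse)

lemma hyperboloid_eq: "hyperboloid = range Rep_hyp3"
  using type_definition.Rep_range[OF type_definition_hyp3] by simp

lemma continuous_on_kur: "continuous_on UNIV kur"
  unfolding continuous_on_iff
proof (intro ballI allI impI)
  fix x :: hyp3 and e :: real assume "e > 0"
  then show "\<exists>d>0. \<forall>y\<in>UNIV. dist y x < d \<longrightarrow> dist (kur y) (kur x) < e"
    using odist_le_dist by (intro exI[of _ e]) (auto simp: dist_kur min_less_iff_disj intro: le_less_trans)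
qed

lemma homeomorphism_ball_kur:
  assumes inj: "\<And>a b. a \<in> B \<Longrightarrow> b \<in> B \<Longrightarrow> dist (kur a) (kur b) = dist a b"
  shows "\<exists>q. homeomorphism (Rep_hyp3 ` B) (kur ` B) ckur q"
proof -
  have inj_on: "inj_on kur B"
    by (rule inj_onI) (metis inj dist_eq_0_iff)
  define q where "q = Rep_hyp3 \<circ> inv_into B kur"
  have 1: "continuous_on (kur ` B) (inv_into B kur)"
    unfolding continuous_on_iff
  proof (intro ballI allI impI)
    fix s and e :: real assume "s \<in> kur ` B" "e > 0"
    then show "\<exists>d>0. \<forall>s'\<in>kur ` B. dist s' s < d \<longrightarrow> dist (inv_into B kur s') (inv_into B kur s) < e"
      using inj inj_on by (intro exI[of _ e]) (auto simp: inv_into_f_f)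
  qed
  have 2: "continuous_on (Rep_hyp3 ` B) ckur"
    unfolding ckur_def
    by (intro continuous_on_compose2[OF continuous_on_kur] continuous_on_subset[OF continuous_on_Abs_hyp3_hyperboloid])
       (auto simp: hyperboloid_eq)
  have "homeomorphism (Rep_hyp3 ` B) (kur ` B) ckur q"
    unfolding q_def
  proof (rule homeomorphismI)
    show "continuous_on (kur ` B) (Rep_hyp3 \<circ> inv_into B kur)"
      using 1 by (auto intro!: continuous_intros simp: o_def)
  qed (use 2 inj_on in \<open>auto simp: inv_into_f_f\<close>)
  then show ?thesis by blast
qed

text \<open>The sheets over a small ball are the translates of a ball upstairs: they are disjoint,
  and \<open>kur\<close> is isometric on each of them.\<close>

lemma covering_space_ckur: "covering_space hyperboloid ckur (range kur)"
proof
  show "continuous_on hyperboloid ckur"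
    unfolding ckur_def by (intro continuous_on_compose2[OF continuous_on_kur] continuous_on_Abs_hyp3_hyperboloid) auto
  show "ckur ` hyperboloid = range kur"
    unfolding hyperboloid_eq by (auto simp: image_image)
  fix s assume "s \<in> range kur"
  then obtain x where x: "s = kur x" by auto
  obtain e where e: "e > 0" "\<And>\<gamma>. \<gamma> \<in> \<Gamma> \<Longrightarrow> dist (\<gamma> x) x < e \<Longrightarrow> \<gamma> = id"
    using injectivity_radius[of x] by metis
  \<comment> \<open>The bound \<open>e / 4\<close> makes the balls disjoint and the projection
    isometric; the bound \<open>1 / 2\<close> keeps distances inside a ball below 1, where
    \<open>kur\<close> does not truncate.\<close>
  define d where "d = min (e / 4) (1 / 2)"
  have d: "d > 0" "d \<le> e / 4" "d \<le> 1 / 2" using e(1) by (auto simp: d_def)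
  define T where "T = range kur \<inter> ball s d"
  define V where "V = (\<lambda>\<gamma>. Rep_hyp3 ` ball (\<gamma> x) d) ` \<Gamma>"
  have T_iff: "kur y \<in> T \<longleftrightarrow> (\<exists>\<gamma>\<in>\<Gamma>. dist (\<gamma> x) y < d)" for y
  proof -
    have "kur y \<in> T \<longleftrightarrow> odist y x < d"
      using d by (auto simp: T_def x dist_kur odist_commute min_less_iff_disj)
    also have "\<dots> \<longleftrightarrow> (\<exists>\<gamma>\<in>\<Gamma>. dist (\<gamma> x) y < d)"
      using odist_attained[of y x] odist_le[of _ y x] by (metis dist_commute le_less_trans)
    finally show ?thesis .
  qed
  have iso: "dist (kur a) (kur b) = dist a b" if "\<gamma> \<in> \<Gamma>" "a \<in> ball (\<gamma> x) d" "b \<in> ball (\<gamma> x) d" for \<gamma> a b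
  proof -
    \<comment> \<open>Conjugation by \<gamma> transfers the injectivity radius from \<open>x\<close>
      to \<open>\<gamma> x\<close>.\<close>
    have e\<gamma>: "\<delta> = id" if "\<delta> \<in> \<Gamma>" "dist (\<delta> (\<gamma> x)) (\<gamma> x) < e" for \<delta>
    proof -
      have "dist ((finv \<gamma> \<circ> (\<delta> \<circ> \<gamma>)) x) x < e"
        using that \<open>\<gamma> \<in> \<Gamma>\<close> dist_inv_\<Gamma>[of \<gamma> "\<delta> (\<gamma> x)" "\<gamma> x"] by simp
      then have "finv \<gamma> \<circ> (\<delta> \<circ> \<gamma>) = id"
        using that \<open>\<gamma> \<in> \<Gamma>\<close> by (intro e(2) comp_\<Gamma> inv_\<Gamma>)
      then have "\<delta> (\<gamma> x) = \<gamma> x"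
        using \<open>\<gamma> \<in> \<Gamma>\<close> by (metis comp_apply id_apply inv_\<Gamma>_apply(2))
      then show ?thesis using that(1) free_action by blast
    qed
    have "odist a b = dist a b"
      using that d by (intro odist_eq_dist[of "\<gamma> x" e] e\<gamma>) auto
    moreover have "dist a b < 1"
      using that d dist_triangle3[of a b "\<gamma> x"] by simp
    ultimately show ?thesis by (simp add: dist_kur)
  qed
  have img: "kur ` ball (\<gamma> x) d = T" if "\<gamma> \<in> \<Gamma>" for \<gamma>
  proof (intro equalityI subsetI)
    show "t \<in> T" if "t \<in> kur ` ball (\<gamma> x) d" for t
      using that T_iff \<open>\<gamma> \<in> \<Gamma>\<close> by auto
    fix t assume t: "t \<in> T"
    then obtain y where y: "t = kur y" by (auto simp: T_def)
    then obtain \<delta> where \<delta>: "\<delta> \<in> \<Gamma>" "dist (\<delta> x) y < d" using T_iff t by blast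
    have "dist (\<gamma> x) ((\<gamma> \<circ> finv \<delta>) y) < d"
      using \<delta> that dist_inv_\<Gamma>[of \<delta> "\<delta> x" y] by simp
    moreover have "kur ((\<gamma> \<circ> finv \<delta>) y) = t"
      unfolding y kur_eq_iff using \<delta> that by (intro orb_\<Gamma> comp_\<Gamma> inv_\<Gamma>)
    ultimately show "t \<in> kur ` ball (\<gamma> x) d" by (metis imageI mem_ball)
  qed
  show "\<exists>T. s \<in> T \<and> openin (top_of_set (range kur)) T \<and>
      (\<exists>v. \<Union>v = hyperboloid \<inter> ckur -` T \<and> (\<forall>u\<in>v. openin (top_of_set hyperboloid) u) \<and> pairwise disjnt v \<and>
           (\<forall>u\<in>v. \<exists>q. homeomorphism u T ckur q))"
  proof (intro exI[of _ T] conjI exI[of _ V])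
    show "s \<in> T" using d by (auto simp: T_def x)
    show "openin (top_of_set (range kur)) T" unfolding T_def by (rule openin_open_Int) simp
    show "\<Union>V = hyperboloid \<inter> ckur -` T"
    proof (intro equalityI subsetI)
      fix p assume "p \<in> \<Union>V"
      then obtain \<gamma> y where y: "\<gamma> \<in> \<Gamma>" "p = Rep_hyp3 y" "dist (\<gamma> x) y < d"
        unfolding V_def by auto
      then have "kur y \<in> T" unfolding T_iff by blast
      then show "p \<in> hyperboloid \<inter> ckur -` T"
        unfolding hyperboloid_eq y(2) by simp
    next
      fix p assume "p \<in> hyperboloid \<inter> ckur -` T"
      then obtain y where y: "p = Rep_hyp3 y" "kur y \<in> T"
        unfolding hyperboloid_eq by auto
      then obtain \<gamma> where "\<gamma> \<in> \<Gamma>" "y \<in> ball (\<gamma> x) d" unfolding T_iff by auto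
      then show "p \<in> \<Union>V" unfolding V_def y(1) by blast
    qed
    have Rep_ball: "Rep_hyp3 ` ball y r = hyperboloid \<inter> Abs_hyp3 -` ball y r" for y r
      unfolding hyperboloid_eq by (auto simp: Rep_hyp3_inverse)
    show "\<forall>u\<in>V. openin (top_of_set hyperboloid) u"
      unfolding V_def Rep_ball
      by (auto intro!: continuous_openin_preimage_gen continuous_on_Abs_hyp3_hyperboloid)
    show "pairwise disjnt V"
    proof (rule pairwiseI)
      fix u v assume "u \<in> V" "v \<in> V" "u \<noteq> v"
      then obtain \<gamma> \<delta> where \<gamma>\<delta>: "\<gamma> \<in> \<Gamma>" "\<delta> \<in> \<Gamma>" "u = Rep_hyp3 ` ball (\<gamma> x) d" "v = Rep_hyp3 ` ball (\<delta> x) d"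
        by (auto simp: V_def)
      have "y \<notin> ball (\<delta> x) d" if "y \<in> ball (\<gamma> x) d" for y
      proof
        assume "y \<in> ball (\<delta> x) d"
        then have "dist (\<gamma> x) (\<delta> x) < e"
          using that d dist_triangle2[of "\<gamma> x" "\<delta> x" y] e(1) by simp
        then have "dist ((finv \<delta> \<circ> \<gamma>) x) x < e"
          using \<gamma>\<delta> dist_inv_\<Gamma>[of \<delta> "\<gamma> x" "\<delta> x"] by simp
        then have "finv \<delta> \<circ> \<gamma> = id" using \<gamma>\<delta> by (intro e(2) comp_\<Gamma> inv_\<Gamma>)
        then have "\<gamma> x = \<delta> x" using \<gamma>\<delta> by (metis comp_apply id_apply inv_\<Gamma>_apply(2))
        then show False using \<gamma>\<delta> \<open>u \<noteq> v\<close> by simp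
      qed
      then show "disjnt u v"
        by (auto simp: \<gamma>\<delta> disjnt_def Rep_hyp3_inject)
    qed
    show "\<forall>u\<in>V. \<exists>q. homeomorphism u T ckur q"
    proof
      fix u assume "u \<in> V"
      then obtain \<gamma> where "\<gamma> \<in> \<Gamma>" "u = Rep_hyp3 ` ball (\<gamma> x) d" by (auto simp: V_def)
      then show "\<exists>q. homeomorphism u T ckur q"
        using homeomorphism_ball_kur[of "ball (\<gamma> x) d"] iso img by metis
    qed
  qed
qed

lemma orb_inv_orb: "A \<in> range orb \<Longrightarrow> orb (finv orb A) = A"
  by (rule f_inv_into_f)

text \<open>The representatives chosen by \<open>finv orb\<close> need not vary continuously, but
  \<open>kur\<close> depends only on the orbit.\<close>

lemma continuous_on_kur_of:
  assumes F: "continuous_map (top_of_set C) QT F"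
  shows "continuous_on C (\<lambda>u. kur (finv orb (F u)))"
proof -
  have FQ: "orb (finv orb (F u)) = F u" if "u \<in> C" for u
    using continuous_map_image_subset_topspace[OF F] that topspace_QT by (intro orb_inv_orb) auto
  have "continuous_map (top_of_set C) Met_TC.mtopology (\<lambda>u. kur (finv orb (F u)))"
  proof (subst Met_TC.continuous_map_to_metric, intro ballI allI impI)
    fix u and e :: real assume u: "u \<in> topspace (top_of_set C)" and "e > 0"
    then obtain U where U: "openin (top_of_set C) U" "u \<in> U" "\<forall>v\<in>U. F v \<in> Q.mball (F u) e"
      using F unfolding QT_eq Q.continuous_map_to_metric by blast
    have "dist (kur (finv orb (F u))) (kur (finv orb (F v))) < e" if "v \<in> U" for v
    proof -
      have "odist (finv orb (F u)) (finv orb (F v)) < e"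
        using U that FQ[of u] FQ[of v] u openin_imp_subset[OF U(1)] by (auto simp: odist_def Q.mball_def)
      then show ?thesis unfolding dist_kur by simp
    qed
    then show "\<exists>U. openin (top_of_set C) U \<and> u \<in> U \<and>
        (\<forall>v\<in>U. kur (finv orb (F v)) \<in> Met_TC.mball (kur (finv orb (F u))) e)"
      using U by (intro exI[of _ U]) auto
  qed
  then show ?thesis by simp
qed

text \<open>Convex sets are simply connected and locally path connected, as the lifting criterion
  for coverings requires. Intervals and squares are the cases that occur.\<close>

lemma lift_convex:
  fixes C :: "'a::real_normed_vector set"
  assumes C: "convex C" "z \<in> C" and F: "continuous_map (top_of_set C) QT F" and a: "F z = orb a"
  obtains G where "continuous_on C G" "G z = a" "\<And>u. u \<in> C \<Longrightarrow> orb (G u) = F u"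
proof -
  have FQ: "orb (finv orb (F u)) = F u" if "u \<in> C" for u
    using continuous_map_image_subset_topspace[OF F] that topspace_QT by (intro orb_inv_orb) auto
  have a': "kur (finv orb (F z)) = ckur (Rep_hyp3 a)"
    using FQ[OF C(2)] a by (simp add: kur_eq_iff)
  obtain g where g: "continuous_on C g" "g \<in> C \<rightarrow> hyperboloid" "g z = Rep_hyp3 a"
    "\<And>y. y \<in> C \<Longrightarrow> ckur (g y) = kur (finv orb (F y))"
  proof (rule covering_space_lift_strong[OF covering_space_ckur _ C(2) convex_imp_simply_connected[OF C(1)]
      convex_imp_locally_path_connected[OF C(1)] continuous_on_kur_of[OF F] _ a'])
    show "Rep_hyp3 a \<in> hyperboloid" unfolding hyperboloid_eq by simp
  qed auto
  show thesis
  proof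
    show "continuous_on C (\<lambda>u. Abs_hyp3 (g u))"
      using g(1,2) by (intro continuous_on_Abs_hyp3) auto
    show "Abs_hyp3 (g z) = a" using g(3) by (simp add: Rep_hyp3_inverse)
    show "orb (Abs_hyp3 (g u)) = F u" if "u \<in> C" for u
      using g(4)[OF that] FQ[OF that] by (simp add: ckur_def kur_eq_iff)
  qed
qed

lemma lift_unique:
  fixes C :: "'a::topological_space set"
  assumes "Topological_Spaces.connected C" "continuous_on C G" "continuous_on C G'" "z \<in> C" "G z = G' z"
    "\<And>u. u \<in> C \<Longrightarrow> orb (G u) = orb (G' u)" "u \<in> C"
  shows "G u = G' u"
proof -
  have "Rep_hyp3 (G u) = Rep_hyp3 (G' u)"
  proof (rule covering_space_lift_unique[OF covering_space_ckur, where f = "\<lambda>u. kur (G u)" and T = C and a = z])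
    show "continuous_on C (\<lambda>u. kur (G u))"
      by (intro continuous_on_compose2[OF continuous_on_kur assms(2)]) auto
    show "kur (G x) = ckur (Rep_hyp3 (G' x))" if "x \<in> C" for x
      using assms(6)[OF that] by (simp add: kur_eq_iff)
  qed (use assms in \<open>auto intro!: continuous_intros simp: hyperboloid_eq\<close>)
  then show ?thesis by (simp add: Rep_hyp3_inject)
qed

subsection \<open>Length\<close>

text \<open>Distances in the quotient may be smaller than those of the lifts, but not for lifts
  within a quarter of the injectivity radius of a common point. So short pieces are measured by
  their two ends, and bisection puts the polygons together.\<close>

lemma poly_length_ge_dist:
  assumes G: "continuous_on {0..1} G" and st: "0 \<le> s" "s \<le> t" "t \<le> 1"
  obtains ts where "sorted ts" "set ts \<subseteq> {s..t}" "ennreal (dist (G s) (G t)) \<le> poly_length (\<lambda>t. orb (G t)) setdist ts"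
proof -
  let ?P = "\<lambda>s t. 0 \<le> s \<longrightarrow> t \<le> 1 \<longrightarrow> s \<le> t \<longrightarrow>
    (\<exists>ts. sorted ts \<and> set ts \<subseteq> {s..t} \<and> ennreal (dist (G s) (G t)) \<le> poly_length (\<lambda>t. orb (G t)) setdist ts)"
  have "?P s t"
    using st(2)
  proof (induction rule: Bolzano)
    case (trans a b c)
    show ?case
    proof (intro impI)
      assume "0 \<le> a" "c \<le> 1" "a \<le> c"
      then obtain ts us where ts: "sorted ts" "set ts \<subseteq> {a..b}" "ennreal (dist (G a) (G b)) \<le> poly_length (\<lambda>t. orb (G t)) setdist ts"
        and us: "sorted us" "set us \<subseteq> {b..c}" "ennreal (dist (G b) (G c)) \<le> poly_length (\<lambda>t. orb (G t)) setdist us"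
        using trans by fastforce
      have "sorted (ts @ us)" using ts us by (fastforce simp: sorted_append)
      moreover have "set (ts @ us) \<subseteq> {a..c}" using ts us trans(3,4) by fastforce
      moreover have "ennreal (dist (G a) (G c)) \<le> poly_length (\<lambda>t. orb (G t)) setdist (ts @ us)"
      proof -
        have "ennreal (dist (G a) (G c)) \<le> ennreal (dist (G a) (G b)) + ennreal (dist (G b) (G c))"
          by (simp add: dist_triangle flip: ennreal_plus)
        also have "\<dots> \<le> poly_length (\<lambda>t. orb (G t)) setdist ts + poly_length (\<lambda>t. orb (G t)) setdist us"
          using ts us by (intro add_mono)
        also note poly_length_append
        finally show ?thesis .
      qed
      ultimately show "\<exists>ts. sorted ts \<and> set ts \<subseteq> {a..c} \<and> ennreal (dist (G a) (G c)) \<le> poly_length (\<lambda>t. orb (G t)) setdist ts"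
        by blast
    qed
  next
    case (local x)
    have x: "x \<in> {0..1}" using local st by simp
    obtain e where e: "e > 0" "\<And>\<gamma>. \<gamma> \<in> \<Gamma> \<Longrightarrow> dist (\<gamma> (G x)) (G x) < e \<Longrightarrow> \<gamma> = id"
      using injectivity_radius[of "G x"] by metis
    obtain d where d: "d > 0" "\<And>y. y \<in> {0..1} \<Longrightarrow> dist y x < d \<Longrightarrow> dist (G y) (G x) < e / 4"
      using G x e(1) unfolding continuous_on_iff by (metis zero_less_divide_iff zero_less_numeral)
    show ?case
    proof (intro exI[of _ d] conjI allI impI)
      fix a b assume ab: "a \<le> x \<and> x \<le> b \<and> b - a < d" "0 \<le> a" "b \<le> 1" "a \<le> b"
      then have "a \<in> {0..1}" "dist a x < d" "b \<in> {0..1}" "dist b x < d"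
        by (auto simp: dist_real_def)
      then have "dist (G a) (G x) < e / 4" "dist (G b) (G x) < e / 4"
        using d(2) by blast+
      then have "odist (G a) (G b) = dist (G a) (G b)"
        using e(2) by (intro odist_eq_dist[of "G x" e]) (auto simp: dist_commute)
      then have "ennreal (dist (G a) (G b)) \<le> poly_length (\<lambda>t. orb (G t)) setdist [a, b]"
        by (simp add: poly_length_def odist_def)
      then show "\<exists>ts. sorted ts \<and> set ts \<subseteq> {a..b} \<and> ennreal (dist (G a) (G b)) \<le> poly_length (\<lambda>t. orb (G t)) setdist ts"
        using ab by (intro exI[of _ "[a, b]"]) auto
    qed (use d in auto)
  qed
  then show thesis using st that by blast
qed

text \<open>The two intermediate parameters serve the case of equality: a path no longer than the
  distance of its ends is additive at all of them.\<close>

lemma path_length_ge: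
  assumes G: "continuous_on {0..1} G" and st: "0 \<le> s" "s \<le> t" "t \<le> 1"
  shows "ennreal (dist (G 0) (G s) + dist (G s) (G t) + dist (G t) (G 1)) \<le> path_length setdist (\<lambda>t. orb (G t))"
proof -
  obtain ts1 where 1: "sorted ts1" "set ts1 \<subseteq> {0..s}" "ennreal (dist (G 0) (G s)) \<le> poly_length (\<lambda>t. orb (G t)) setdist ts1"
    using poly_length_ge_dist[OF G, of 0 s] st by auto
  obtain ts2 where 2: "sorted ts2" "set ts2 \<subseteq> {s..t}" "ennreal (dist (G s) (G t)) \<le> poly_length (\<lambda>t. orb (G t)) setdist ts2"
    using poly_length_ge_dist[OF G st] by auto
  obtain ts3 where 3: "sorted ts3" "set ts3 \<subseteq> {t..1}" "ennreal (dist (G t) (G 1)) \<le> poly_length (\<lambda>t. orb (G t)) setdist ts3"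
    using poly_length_ge_dist[OF G, of t 1] st by auto
  have "ennreal (dist (G 0) (G s) + dist (G s) (G t) + dist (G t) (G 1)) =
      ennreal (dist (G 0) (G s)) + ennreal (dist (G s) (G t)) + ennreal (dist (G t) (G 1))"
    by (simp add: ennreal_plus)
  also have "\<dots> \<le> poly_length (\<lambda>t. orb (G t)) setdist ts1 + poly_length (\<lambda>t. orb (G t)) setdist ts2 +
      poly_length (\<lambda>t. orb (G t)) setdist ts3"
    using 1 2 3 by (intro add_mono)
  also have "\<dots> \<le> poly_length (\<lambda>t. orb (G t)) setdist (ts1 @ ts2) + poly_length (\<lambda>t. orb (G t)) setdist ts3"
    by (intro add_right_mono poly_length_append)
  also have "\<dots> \<le> poly_length (\<lambda>t. orb (G t)) setdist ((ts1 @ ts2) @ ts3)"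
    by (rule poly_length_append)
  also have "\<dots> \<le> path_length setdist (\<lambda>t. orb (G t))"
    unfolding path_length_eq
  proof (rule SUP_upper)
    have *: "x \<le> s" if "x \<in> set ts1" for x using 1(2) that by auto
    have **: "s \<le> x" "x \<le> t" if "x \<in> set ts2" for x using 2(2) that by auto
    have ***: "t \<le> x" if "x \<in> set ts3" for x using 3(2) that by auto
    have "sorted ((ts1 @ ts2) @ ts3)"
    proof -
      have "x \<le> y" if "x \<in> set ts1" "y \<in> set ts2" for x y using *[OF that(1)] **(1)[OF that(2)] by simp
      moreover have "x \<le> y" if "x \<in> set ts1" "y \<in> set ts3" for x y using *[OF that(1)] ***[OF that(2)] st by simp
      moreover have "x \<le> y" if "x \<in> set ts2" "y \<in> set ts3" for x y using **(2)[OF that(1)] ***[OF that(2)] by simp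
      ultimately show ?thesis using 1(1) 2(1) 3(1) unfolding sorted_append by auto
    qed
    moreover have "set ((ts1 @ ts2) @ ts3) \<subseteq> {0..1}"
      using 1(2) 2(2) 3(2) st by fastforce
    ultimately show "(ts1 @ ts2) @ ts3 \<in> {ts. sorted ts \<and> set ts \<subseteq> {0..1}}" by simp
  qed
  finally show ?thesis .
qed

text \<open>The distances along the segment telescope; distances in the quotient can only be
  smaller.\<close>

lemma path_length_hseg: "path_length setdist (\<lambda>t. orb (hseg x y t)) \<le> ennreal (dist x y)"
  unfolding path_length_eq
proof (rule SUP_least, clarify)
  fix ts :: "real list" assume ts: "sorted ts" "set ts \<subseteq> {0..1}"
  let ?r = "\<lambda>i. seg_dist (dist x y) (ts ! i)"
  have mono: "0 \<le> ts ! i \<and> ts ! i \<le> ts ! j \<and> ts ! j \<le> 1" if "i \<le> j" "j < length ts" for i j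
    using ts that sorted_nth_mono[of ts i j] nth_mem[of i ts] nth_mem[of j ts] by fastforce
  have "poly_length (\<lambda>t. orb (hseg x y t)) setdist ts \<le> (\<Sum>i<length ts - 1. ennreal (?r (Suc i) - ?r i))"
    unfolding poly_length_def
  proof (intro sum_mono ennreal_leI)
    fix i assume "i \<in> {..<length ts - 1}"
    then have "dist (hseg x y (ts ! i)) (hseg x y (ts ! Suc i)) = ?r (Suc i) - ?r i"
      using mono[of i "Suc i"] by (intro dist_hseg_hseg) auto
    then show "setdist (orb (hseg x y (ts ! i))) (orb (hseg x y (ts ! Suc i))) \<le> ?r (Suc i) - ?r i"
      using odist_le_dist[of "hseg x y (ts ! i)" "hseg x y (ts ! Suc i)"] by (simp add: odist_def)
  qed
  also have "\<dots> = ennreal (\<Sum>i<length ts - 1. ?r (Suc i) - ?r i)"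
  proof (rule sum_ennreal)
    fix i assume "i \<in> {..<length ts - 1}"
    then show "0 \<le> ?r (Suc i) - ?r i"
      using mono[of i "Suc i"] seg_dist_mono[of "ts ! i" "ts ! Suc i" "dist x y"] by simp
  qed
  also have "(\<Sum>i<length ts - 1. ?r (Suc i) - ?r i) = ?r (length ts - 1) - ?r 0"
    by (rule sum_lessThan_telescope)
  also have "\<dots> \<le> dist x y"
  proof (cases "ts = []")
    case False
    then have "?r (length ts - 1) \<le> seg_dist (dist x y) 1" "seg_dist (dist x y) 0 \<le> ?r 0"
      using mono[of "length ts - 1" "length ts - 1"] mono[of 0 0] by (intro seg_dist_mono; simp)+
    then show ?thesis by simp
  qed simp
  finally show "poly_length (\<lambda>t. orb (hseg x y t)) setdist ts \<le> ennreal (dist x y)"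
    by (simp add: ennreal_leI)
qed

end

section \<open>Continuity, homotopy and connectedness for realized graphs\<close>

section \<open>Maps from graphs\<close>

lemma edge_point_simps [simp]:
  "edge_point X e 0 = Inl (tail X e)" "edge_point X e 1 = Inl (head X e)"
  by (simp_all add: edge_point_def)

lemma edge_point_interior: "0 < t \<Longrightarrow> t < 1 \<Longrightarrow> edge_point X e t = Inr (e, t)"
  by (simp add: edge_point_def)

lemma edge_point_in_graph_points:
  assumes "wf_digraph X" "e \<in> arcs X"
  shows "edge_point X e t \<in> graph_points X"
proof -
  interpret wf_digraph X by fact
  show ?thesis using assms(2) by (auto simp: edge_point_def graph_points_def)
qed

lemma Inl_in_graph_points [simp]: "Inl v \<in> graph_points X \<longleftrightarrow> v \<in> verts X"
  by (auto simp: graph_points_def)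

lemma graph_points_cases:
  assumes "z \<in> graph_points X"
  obtains v where "v \<in> verts X" "z = Inl v" | e t where "e \<in> arcs X" "0 < t" "t < 1" "z = edge_point X e t"
  using assms by (auto simp: graph_points_def edge_point_interior)

text \<open>The universal property of the quotient topology. The condition on the vertices matters
  for a vertex without edges.\<close>

lemma continuous_map_graph_iff:
  assumes wf: "wf_digraph X"
  shows "continuous_map (graph_top X) T F \<longleftrightarrow>
    (\<forall>v\<in>verts X. F (Inl v) \<in> topspace T) \<and> (\<forall>e\<in>arcs X. pathin T (F \<circ> edge_point X e))"
proof (intro iffI conjI ballI)
  assume F: "continuous_map (graph_top X) T F"
  show "F (Inl v) \<in> topspace T" if "v \<in> verts X" for v
    using continuous_map_image_subset_topspace[OF F] that topspace_graph_top[OF wf] by auto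
  show "pathin T (F \<circ> edge_point X e)" if e: "e \<in> arcs X" for e
  proof -
    have "continuous_map (top_of_set {0..1}) (graph_top X) (edge_point X e)"
      unfolding continuous_map_def
    proof (intro conjI allI impI)
      show "edge_point X e \<in> topspace (top_of_set {0..1}) \<rightarrow> topspace (graph_top X)"
        using edge_point_in_graph_points[OF wf e] topspace_graph_top[OF wf] by auto
      show "openin (top_of_set {0..1}) {t \<in> topspace (top_of_set {0..1}). edge_point X e t \<in> U}"
        if "openin (graph_top X) U" for U
        using that e by (simp add: openin_graph_top)
    qed
    then show ?thesis unfolding pathin_def using F by (rule continuous_map_compose)
  qed
next
  assume R: "(\<forall>v\<in>verts X. F (Inl v) \<in> topspace T) \<and> (\<forall>e\<in>arcs X. pathin T (F \<circ> edge_point X e))"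
  show "continuous_map (graph_top X) T F"
    unfolding continuous_map_def topspace_graph_top[OF wf]
  proof (intro conjI allI impI)
    show "F \<in> graph_points X \<rightarrow> topspace T"
    proof
      fix z assume "z \<in> graph_points X"
      then show "F z \<in> topspace T"
      proof (cases rule: graph_points_cases)
        case (2 e t)
        then have "F \<circ> edge_point X e \<in> {0..1} \<rightarrow> topspace T"
          using R continuous_map_image_subset_topspace[of "top_of_set {0..1}" T "F \<circ> edge_point X e"]
          by (auto simp: pathin_def)
        then show ?thesis using 2 by (auto simp: Pi_iff)
      qed (use R in auto)
    qed
    fix U assume U: "openin T U"
    show "openin (graph_top X) {z \<in> graph_points X. F z \<in> U}"
      unfolding openin_graph_top
    proof (intro conjI ballI)
      fix e assume e: "e \<in> arcs X"
      have "{t \<in> {0..1}. edge_point X e t \<in> {z \<in> graph_points X. F z \<in> U}} =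
          {t \<in> topspace (top_of_set {0..1}). (F \<circ> edge_point X e) t \<in> U}"
        using edge_point_in_graph_points[OF wf e] by auto
      also have "openin (top_of_set {0..1}) \<dots>"
        using R e U unfolding pathin_def continuous_map_def by blast
      finally show "openin (top_of_set {0..1}) {t \<in> {0..1}. edge_point X e t \<in> {z \<in> graph_points X. F z \<in> U}}" .
    qed auto
  qed
qed

lemma pathin_edge_point:
  assumes "wf_digraph X" "e \<in> arcs X"
  shows "pathin (graph_top X) (edge_point X e)"
  using assms continuous_map_graph_iff[OF assms(1), of "graph_top X" id] by simp

lemma continuous_map_discrete_prod:
  assumes "\<And>a. a \<in> A \<Longrightarrow> continuous_map (prod_topology S I) T (\<lambda>(s, t). h (s, (a, t)))"
  shows "continuous_map (prod_topology S (prod_topology (discrete_topology A) I)) T h"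
  unfolding continuous_map_def
proof (intro conjI allI impI)
  let ?P = "prod_topology S (prod_topology (discrete_topology A) I)"
  show "h \<in> topspace ?P \<rightarrow> topspace T"
  proof
    fix z assume "z \<in> topspace ?P"
    then obtain s a t where z: "z = (s, (a, t))" "s \<in> topspace S" "a \<in> A" "t \<in> topspace I" by auto
    then show "h z \<in> topspace T"
      using continuous_map_image_subset_topspace[OF assms[OF z(3)]] by fastforce
  qed
  fix U assume U: "openin T U"
  let ?V = "\<lambda>a. {z \<in> topspace (prod_topology S I). (\<lambda>(s, t). h (s, (a, t))) z \<in> U}"
  have "openin ?P {z \<in> topspace ?P. (fst (snd z), (fst z, snd (snd z))) \<in> {a} \<times> ?V a}" if "a \<in> A" for a
  proof (rule openin_continuous_map_preimage)
    show "continuous_map ?P (prod_topology (discrete_topology A) (prod_topology S I)) (\<lambda>z. (fst (snd z), (fst z, snd (snd z))))"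
      using continuous_map_compose[OF continuous_map_snd continuous_map_fst, of S "discrete_topology A" I]
        continuous_map_compose[OF continuous_map_snd continuous_map_snd, of S "discrete_topology A" I]
      by (intro continuous_map_pairedI continuous_map_fst) (simp_all add: o_def)
    have "openin (prod_topology S I) (?V a)"
      using assms[OF that] U unfolding continuous_map_def by blast
    then show "openin (prod_topology (discrete_topology A) (prod_topology S I)) ({a} \<times> ?V a)"
      using that by (simp add: openin_prod_Times_iff)
  qed
  then have "openin ?P (\<Union>a\<in>A. {z \<in> topspace ?P. (fst (snd z), (fst z, snd (snd z))) \<in> {a} \<times> ?V a})"
    by (intro openin_Union) auto
  moreover have "(\<Union>a\<in>A. {z \<in> topspace ?P. (fst (snd z), (fst z, snd (snd z))) \<in> {a} \<times> ?V a}) = {z \<in> topspace ?P. h z \<in> U}"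
    by force
  ultimately show "openin ?P {z \<in> topspace ?P. h z \<in> U}" by simp
qed

text \<open>Vertices get a copy of the interval as well, so that the disjoint union becomes a
  product with a discrete space.\<close>

definition graph_cover :: "('v, 'e) pre_digraph \<Rightarrow> ('v + 'e) \<times> real \<Rightarrow> 'v + 'e \<times> real" where
  "graph_cover X = (\<lambda>(a, t). case a of Inl v \<Rightarrow> Inl v | Inr e \<Rightarrow> edge_point X e t)"

abbreviation graph_pieces :: "('v, 'e) pre_digraph \<Rightarrow> (('v + 'e) \<times> real) topology" where
  "graph_pieces X \<equiv> prod_topology (discrete_topology (Inl ` verts X \<union> Inr ` arcs X)) (top_of_set {0..1})"

lemma quotient_map_graph_cover:
  assumes wf: "wf_digraph X"
  shows "quotient_map (graph_pieces X) (graph_top X) (graph_cover X)"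
  unfolding quotient_map_def topspace_graph_top[OF wf]
proof (intro conjI allI impI)
  let ?P = "graph_pieces X" and ?q = "graph_cover X"
  show img: "?q ` topspace ?P = graph_points X"
  proof (intro equalityI subsetI)
    fix z assume "z \<in> ?q ` topspace ?P"
    then show "z \<in> graph_points X"
      using edge_point_in_graph_points[OF wf] by (auto simp: graph_cover_def)
  next
    fix z assume "z \<in> graph_points X"
    then show "z \<in> ?q ` topspace ?P"
    proof (cases rule: graph_points_cases)
      case (1 v)
      then show ?thesis by (intro image_eqI[of _ _ "(Inl v, 0)"]) (auto simp: graph_cover_def)
    next
      case (2 e t)
      then show ?thesis by (intro image_eqI[of _ _ "(Inr e, t)"]) (auto simp: graph_cover_def)
    qed
  qed
  fix U assume U: "U \<subseteq> graph_points X"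
  let ?W = "{x \<in> topspace ?P. ?q x \<in> U}"
  show "openin ?P ?W = openin (graph_top X) U"
  proof
    assume W: "openin ?P ?W"
    show "openin (graph_top X) U"
      unfolding openin_graph_top
    proof (intro conjI ballI U)
      fix e assume e: "e \<in> arcs X"
      have "continuous_map (top_of_set {0..1::real}) ?P (\<lambda>t. (Inr e, t))"
        using e by (intro continuous_map_pairedI) auto
      from openin_continuous_map_preimage[OF this W]
      have "openin (top_of_set {0..1}) {t \<in> {0..1}. (Inr e, t) \<in> ?W}" by simp
      also have "{t \<in> {0..1}. (Inr e, t) \<in> ?W} = {t\<in>{0..1}. edge_point X e t \<in> U}"
        using e by (auto simp: graph_cover_def)
      finally show "openin (top_of_set {0..1}) {t\<in>{0..1}. edge_point X e t \<in> U}" .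
    qed
  next
    assume U': "openin (graph_top X) U"
    let ?S = "\<lambda>a. {t \<in> {0..1}. ?q (a, t) \<in> U}"
    have S: "openin (top_of_set {0..1}) (?S a)" if "a \<in> Inl ` verts X \<union> Inr ` arcs X" for a
    proof (cases a)
      case (Inl v)
      then have "?S a = (if Inl v \<in> U then {0..1} else {})" by (auto simp: graph_cover_def)
      then show ?thesis by (simp add: openin_subtopology_self)
    next
      case (Inr e)
      then show ?thesis using that U' by (auto simp: graph_cover_def openin_graph_top)
    qed
    have "openin ?P ({a} \<times> ?S a)" if "a \<in> Inl ` verts X \<union> Inr ` arcs X" for a
      using S[OF that] that by (simp only: openin_prod_Times_iff) simp
    then have "openin ?P (\<Union>a\<in>Inl ` verts X \<union> Inr ` arcs X. {a} \<times> ?S a)"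
      by (intro openin_Union) blast
    also have "(\<Union>a\<in>Inl ` verts X \<union> Inr ` arcs X. {a} \<times> ?S a) = ?W" by auto
    finally show "openin ?P ?W" .
  qed
qed

text \<open>The product of a quotient map with a locally compact Hausdorff space is again a quotient
  map, so continuity of a homotopy can be checked on each vertex and each edge.\<close>

lemma continuous_map_graph_homotopy:
  assumes wf: "wf_digraph X"
    and verts: "\<And>v. v \<in> verts X \<Longrightarrow> pathin T (\<lambda>s. H (s, Inl v))"
    and arcs: "\<And>e. e \<in> arcs X \<Longrightarrow>
      continuous_map (top_of_set ({0..1} \<times> {0..1})) T (\<lambda>(s, t). H (s, edge_point X e t))"
  shows "continuous_map (prod_topology (top_of_set {0..1::real}) (graph_top X)) T H"
proof -
  let ?I = "top_of_set {0..1::real}"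
  have loc: "locally_compact_space ?I"
    by (intro compact_imp_locally_compact_space) (auto simp: compact_space_subtopology)
  have "quotient_map (prod_topology ?I (graph_pieces X)) (prod_topology ?I (graph_top X))
      (\<lambda>(s, y). (s, graph_cover X y))"
    by (rule quotient_map_prod_right[OF loc _ quotient_map_graph_cover[OF wf]])
       (simp add: Hausdorff_space_subtopology)
  moreover have "continuous_map (prod_topology ?I (graph_pieces X)) T (H \<circ> (\<lambda>(s, y). (s, graph_cover X y)))"
  proof (rule continuous_map_discrete_prod)
    fix a assume "a \<in> Inl ` verts X \<union> Inr ` arcs X"
    then consider v where "a = Inl v" "v \<in> verts X" | e where "a = Inr e" "e \<in> arcs X" by auto
    then show "continuous_map (prod_topology ?I ?I) T
        (\<lambda>(s, t). (H \<circ> (\<lambda>(s, y). (s, graph_cover X y))) (s, (a, t)))"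
    proof cases
      case (1 v)
      have "continuous_map (prod_topology ?I ?I) T ((\<lambda>s. H (s, Inl v)) \<circ> fst)"
        using verts[OF 1(2)] unfolding pathin_def by (rule continuous_map_of_fst[THEN iffD2, OF disjI2])
      then show ?thesis by (simp add: 1 graph_cover_def o_def case_prod_unfold)
    next
      case (2 e)
      then show ?thesis using arcs[of e] by (simp add: graph_cover_def o_def case_prod_unfold)
    qed
  qed
  ultimately show ?thesis
    by (simp add: continuous_compose_quotient_map_eq)
qed

definition gmap :: "('v \<Rightarrow> 'p) \<Rightarrow> ('e \<Rightarrow> real \<Rightarrow> 'p) \<Rightarrow> 'v + 'e \<times> real \<Rightarrow> 'p" where
  "gmap u c z = (case z of Inl v \<Rightarrow> u v | Inr (e, t) \<Rightarrow> c e t)"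

lemma gmap_Inl [simp]: "gmap u c (Inl v) = u v"
  by (simp add: gmap_def)

lemma gmap_edge_point:
  assumes "c e 0 = u (tail X e)" "c e 1 = u (head X e)" "t \<in> {0..1}"
  shows "gmap u c (edge_point X e t) = c e t"
  using assms by (auto simp: gmap_def edge_point_def not_le)

text \<open>The two paths agree on the unit interval but not outside it, whence homotopy instead of
  equality.\<close>

lemma path_htpy_gmap:
  assumes "c e 0 = u (tail X e)" "c e 1 = u (head X e)" "pathin T (c e)"
  shows "path_htpy T (gmap u c \<circ> edge_point X e) (c e)"
  using assms by (intro path_htpy_sym[OF path_htpy_cong]) (auto simp: gmap_edge_point)

lemma continuous_map_gmap:
  assumes "wf_digraph X" "\<And>v. v \<in> verts X \<Longrightarrow> u v \<in> topspace T"
    "\<And>e. e \<in> arcs X \<Longrightarrow> pathin T (c e) \<and> c e 0 = u (tail X e) \<and> c e 1 = u (head X e)"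
  shows "continuous_map (graph_top X) T (gmap u c)"
  unfolding continuous_map_graph_iff[OF assms(1)] using assms(2,3) path_htpyD(1)[OF path_htpy_gmap]
  by (metis gmap_Inl)

lemma homotopic_graph_rel_verts:
  assumes wf: "wf_digraph X" and F: "continuous_map (graph_top X) T F"
    and verts: "\<And>v. v \<in> verts X \<Longrightarrow> F (Inl v) = G (Inl v)"
    and arcs: "\<And>e. e \<in> arcs X \<Longrightarrow> path_htpy T (F \<circ> edge_point X e) (G \<circ> edge_point X e)"
  shows "homotopic_with (\<lambda>_. True) (graph_top X) T F G"
proof -
  interpret wf_digraph X by fact
  let ?I2 = "top_of_set ({0..1::real} \<times> {0..1::real})"
  have "\<exists>h. continuous_map ?I2 T h \<and> (\<forall>t. h (0, t) = F (edge_point X e t)) \<and>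
      (\<forall>t. h (1, t) = G (edge_point X e t)) \<and>
      (\<forall>s\<in>{0..1}. h (s, 0) = F (Inl (tail X e)) \<and> h (s, 1) = F (Inl (head X e)))" if e: "e \<in> arcs X" for e
  proof (rule path_htpyE[OF arcs[OF e]])
    fix h :: "real \<times> real \<Rightarrow> 'c"
    assume "continuous_map ?I2 T h" "\<And>t. h (0, t) = (F \<circ> edge_point X e) t"
      "\<And>t. h (1, t) = (G \<circ> edge_point X e) t"
      "\<And>s. s \<in> {0..1} \<Longrightarrow> h (s, 0) = (F \<circ> edge_point X e) 0"
      "\<And>s. s \<in> {0..1} \<Longrightarrow> h (s, 1) = (F \<circ> edge_point X e) 1"
    then show ?thesis by (intro exI[of _ h]) simp
  qed
  then obtain h where h: "\<And>e. e \<in> arcs X \<Longrightarrow> continuous_map ?I2 T (h e)"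
    "\<And>e t. e \<in> arcs X \<Longrightarrow> h e (0, t) = F (edge_point X e t)"
    "\<And>e t. e \<in> arcs X \<Longrightarrow> h e (1, t) = G (edge_point X e t)"
    "\<And>e s. e \<in> arcs X \<Longrightarrow> s \<in> {0..1} \<Longrightarrow> h e (s, 0) = F (Inl (tail X e)) \<and> h e (s, 1) = F (Inl (head X e))"
    by metis
  define H where "H = (\<lambda>(s, z). gmap (\<lambda>v. F (Inl v)) (\<lambda>e t. h e (s, t)) z)"
  have He: "H (s, edge_point X e t) = h e (s, t)" if "e \<in> arcs X" "s \<in> {0..1}" "t \<in> {0..1}" for e s t
    unfolding H_def using that h(4)[OF that(1,2)] by (auto intro!: gmap_edge_point)
  have "continuous_map (prod_topology (top_of_set {0..1}) (graph_top X)) T H"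
  proof (rule continuous_map_graph_homotopy[OF wf])
    show "pathin T (\<lambda>s. H (s, Inl v))" if "v \<in> verts X" for v
      using continuous_map_image_subset_topspace[OF F] that topspace_graph_top[OF wf]
      by (auto simp: H_def)
    show "continuous_map ?I2 T (\<lambda>(s, t). H (s, edge_point X e t))" if "e \<in> arcs X" for e
      using h(1)[OF that] by (rule continuous_map_eq) (auto simp: He that)
  qed
  moreover have "H (0, z) = F z \<and> H (1, z) = G z" if "z \<in> topspace (graph_top X)" for z
    using that unfolding topspace_graph_top[OF wf]
  proof (cases rule: graph_points_cases)
    case (2 e t)
    then show ?thesis using h(2,3)[OF 2(1)] He[OF 2(1), of 0 t] He[OF 2(1), of 1 t] by simp
  qed (simp add: H_def verts)
  ultimately show ?thesis
    by (subst homotopic_with) auto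
qed

text \<open>A homotopy that moves the vertices. Relative to the vertices \<open>F\<close> is first
  deformed to a map that runs along a track, an edge of \<open>G\<close> and a track backwards; then
  the tracks are consumed from both ends.\<close>

lemma homotopic_graph_tracks:
  assumes wf: "wf_digraph X" and F: "continuous_map (graph_top X) T F" and G: "continuous_map (graph_top X) T G"
    and verts: "\<And>v. v \<in> verts X \<Longrightarrow> pathin T (\<tau> v) \<and> \<tau> v 0 = F (Inl v) \<and> \<tau> v 1 = G (Inl v)"
    and arcs: "\<And>e. e \<in> arcs X \<Longrightarrow> path_htpy T (F \<circ> edge_point X e)
      (\<tau> (tail X e) \<star> (G \<circ> edge_point X e) \<star> path_rev (\<tau> (head X e)))"
  shows "homotopic_with (\<lambda>_. True) (graph_top X) T F G"
proof -
  interpret wf_digraph X by fact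
  let ?I2 = "top_of_set ({0..1::real} \<times> {0..1::real})"
  define q where "q e = \<tau> (tail X e) \<star> (G \<circ> edge_point X e) \<star> path_rev (\<tau> (head X e))" for e
  have Ge: "pathin T (G \<circ> edge_point X e)" if "e \<in> arcs X" for e
    using G that unfolding continuous_map_graph_iff[OF wf] by blast
  have q: "pathin T (q e)" if "e \<in> arcs X" for e
    unfolding q_def using that verts Ge by (intro pathin_loop_join pathin_rev) auto
  define F' where "F' = gmap (\<lambda>v. F (Inl v)) q"
  have q01: "q e 0 = F (Inl (tail X e))" "q e 1 = F (Inl (head X e))" if "e \<in> arcs X" for e
    unfolding q_def using that verts by auto
  have F'e: "path_htpy T (F' \<circ> edge_point X e) (q e)" if "e \<in> arcs X" for e
    unfolding F'_def using that q q01 by (intro path_htpy_gmap) auto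
  have cF': "continuous_map (graph_top X) T F'"
    unfolding F'_def using F q q01 continuous_map_graph_iff[OF wf, of T F] by (intro continuous_map_gmap wf) auto
  have 1: "homotopic_with (\<lambda>_. True) (graph_top X) T F F'"
  proof (rule homotopic_graph_rel_verts[OF wf F])
    show "path_htpy T (F \<circ> edge_point X e) (F' \<circ> edge_point X e)" if "e \<in> arcs X" for e
      using path_htpy_trans[OF arcs[OF that, folded q_def] path_htpy_sym[OF F'e[OF that]]] .
  qed (simp add: F'_def)
  \<comment> \<open>For fixed \<open>s\<close> the affine map onto the interval from
    \<open>s / 2\<close> to \<open>1 - s / 4\<close>. These are the parameters at which
    \<open>q e\<close> has followed the track of the tail up to \<open>s\<close>, and is still to
    follow that of the head from \<open>s\<close> back to 0; \<open>s = 1\<close> leaves the quarter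
    occupied by the edge of \<open>G\<close>.\<close>
  define r where "r s t = s / 2 + t * (1 - s / 4 - s / 2)" for s t :: real
  define H where "H = (\<lambda>(s, z). gmap (\<lambda>v. \<tau> v s) (\<lambda>e t. q e (r s t)) z)"
  have r01: "r s t \<in> {0..1}" if "s \<in> {0..1}" "t \<in> {0..1}" for s t
  proof -
    define k where "k = 1 - s / 4 - s / 2"
    have s: "0 \<le> s" "s \<le> 1" and t: "0 \<le> t" "t \<le> 1" using that by auto
    have k: "0 \<le> k" "s / 2 + k \<le> 1" using s by (simp_all add: k_def)
    have "0 \<le> t * k" "t * k \<le> k" using k t by (simp_all add: mult_left_le_one_le)
    then show ?thesis using k s unfolding r_def k_def[symmetric] by simp
  qed
  have qr: "q e (r s 0) = \<tau> (tail X e) s" "q e (r s 1) = \<tau> (head X e) s" if "e \<in> arcs X" "s \<in> {0..1}" for e s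
  proof -
    show "q e (r s 0) = \<tau> (tail X e) s" using that by (simp add: q_def r_def loop_join_def)
    have "r s 1 = 1 - s / 4" by (simp add: r_def)
    moreover have "q e (1 - s / 4) = \<tau> (head X e) s"
    proof (cases "s = 1")
      case True
      then show ?thesis using that verts[of "head X e"] by (simp add: q_def loop_join_def)
    next
      case False
      then show ?thesis using that by (simp add: q_def loop_join_def path_rev_def)
    qed
    ultimately show "q e (r s 1) = \<tau> (head X e) s" by simp
  qed
  have He: "H (s, edge_point X e t) = q e (r s t)" if "e \<in> arcs X" "s \<in> {0..1}" "t \<in> {0..1}" for e s t
    unfolding H_def using that qr by (auto intro!: gmap_edge_point)
  have "continuous_map (prod_topology (top_of_set {0..1}) (graph_top X)) T H"
  proof (rule continuous_map_graph_homotopy[OF wf])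
    show "pathin T (\<lambda>s. H (s, Inl v))" if "v \<in> verts X" for v
      using verts[OF that] by (simp add: H_def)
    show "continuous_map ?I2 T (\<lambda>(s, t). H (s, edge_point X e t))" if e: "e \<in> arcs X" for e
    proof (rule continuous_map_eq)
      have "continuous_map ?I2 (top_of_set {0..1}) (\<lambda>z. r (fst z) (snd z))"
        using r01 by (auto simp: r_def intro!: continuous_intros)
      from continuous_map_compose[OF this q[OF e, unfolded pathin_def]]
      show "continuous_map ?I2 T (\<lambda>(s, t). q e (r s t))" by (simp add: o_def case_prod_unfold)
    qed (auto simp: He e)
  qed
  moreover have "H (0, z) = F' z \<and> H (1, z) = G z" if "z \<in> topspace (graph_top X)" for z
    using that unfolding topspace_graph_top[OF wf]
  proof (cases rule: graph_points_cases)
    case (1 v)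
    then show ?thesis using verts by (simp add: H_def F'_def)
  next
    case (2 e t)
    have "r 0 t = t" "r 1 t = 1/2 + t / 4" by (simp_all add: r_def field_simps)
    moreover have "q e (1/2 + t / 4) = G (edge_point X e t)"
      using 2 by (simp add: q_def loop_join_def)
    ultimately show ?thesis
      using 2 He[OF 2(1), of 0 t] He[OF 2(1), of 1 t] q01[OF 2(1)] by (simp add: F'_def gmap_edge_point)
  qed
  ultimately have "homotopic_with (\<lambda>_. True) (graph_top X) T F' G"
    by (subst homotopic_with) auto
  with 1 show ?thesis by (rule homotopic_with_trans)
qed

text \<open>Connectedness as the absence of a proper nonempty set of vertices that no edge leaves.
  Such sets are easier to transport through the moves below than walks.\<close>

lemma connected_iff_cut:
  assumes wf: "wf_digraph X"
  shows "Digraph_Component.connected X \<longleftrightarrow> verts X \<noteq> {} \<and>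
    (\<forall>A\<subseteq>verts X. A \<noteq> {} \<longrightarrow> (\<forall>e\<in>arcs X. tail X e \<in> A \<longleftrightarrow> head X e \<in> A) \<longrightarrow> A = verts X)"
proof -
  interpret wf_digraph X by fact
  define R where "R = {(u, v). \<exists>e\<in>arcs X. (u = tail X e \<and> v = head X e) \<or> (u = head X e \<and> v = tail X e)}"
  have arcs_ends: "arcs_ends (mk_symmetric X) = R"
    by (auto simp: R_def arcs_ends_conv mk_symmetric_def parcs_mk_symmetric image_iff)
  have reach: "u \<rightarrow>\<^sup>*\<^bsub>mk_symmetric X\<^esub> v \<longleftrightarrow> (u, v) \<in> rtrancl_on (verts X) R" for u v
    unfolding reachable_def arcs_ends by (simp add: mk_symmetric_def)
  show ?thesis
    unfolding connected_def strongly_connected_def reach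
  proof (intro conj_cong iffI allI impI ballI)
    fix A assume c: "\<forall>u\<in>verts (mk_symmetric X). \<forall>v\<in>verts (mk_symmetric X). (u, v) \<in> rtrancl_on (verts X) R"
      and A: "A \<subseteq> verts X" "A \<noteq> {}" "\<forall>e\<in>arcs X. tail X e \<in> A \<longleftrightarrow> head X e \<in> A"
    obtain a where a: "a \<in> A" using A(2) by blast
    have "b \<in> A" if "b \<in> verts X" for b
    proof -
      have "(a, b) \<in> rtrancl_on (verts X) R" using c a A(1) that by (auto simp: mk_symmetric_def)
      then show ?thesis
        using a A(3) by (induction rule: rtrancl_on.induct) (auto simp: R_def)
    qed
    then show "A = verts X" using A(1) by blast
  next
    fix u v
    assume c: "\<forall>A\<subseteq>verts X. A \<noteq> {} \<longrightarrow> (\<forall>e\<in>arcs X. tail X e \<in> A \<longleftrightarrow> head X e \<in> A) \<longrightarrow> A = verts X"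
      and uv: "u \<in> verts (mk_symmetric X)" "v \<in> verts (mk_symmetric X)"
    have uv': "u \<in> verts X" "v \<in> verts X" using uv by (auto simp: mk_symmetric_def)
    let ?A = "{w \<in> verts X. (u, w) \<in> rtrancl_on (verts X) R}"
    have step: "w' \<in> ?A" if "w \<in> ?A" "(w, w') \<in> R" for w w'
      using that by (auto simp: R_def intro: rtrancl_on_into_rtrancl_on)
    have "?A \<noteq> {}" using uv' by auto
    moreover have "\<forall>e\<in>arcs X. tail X e \<in> ?A \<longleftrightarrow> head X e \<in> ?A"
    proof (intro ballI iffI)
      fix e assume e: "e \<in> arcs X"
      have "(tail X e, head X e) \<in> R" "(head X e, tail X e) \<in> R" using e by (auto simp: R_def)
      note * = this
      show "head X e \<in> ?A" if "tail X e \<in> ?A" using step[OF that *(1)] .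
      show "tail X e \<in> ?A" if "head X e \<in> ?A" using step[OF that *(2)] .
    qed
    moreover have "?A \<subseteq> verts X" by simp
    ultimately have "?A = verts X" by (intro c[THEN spec, THEN mp, THEN mp, THEN mp])
    then show "(u, v) \<in> rtrancl_on (verts X) R" using uv' by blast
  qed (auto simp: mk_symmetric_def)
qed

lemma homotopy_equivalence_mapI:
  assumes "continuous_map S T \<eta>" "continuous_map T S \<theta>"
    "homotopic_with (\<lambda>_. True) S S (\<theta> \<circ> \<eta>) id" "homotopic_with (\<lambda>_. True) T T (\<eta> \<circ> \<theta>) id"
  shows "homotopy_equivalence_map S T \<eta>"
  using assms unfolding homotopy_equivalence_map_def by blast

section \<open>Homotopy equivalences given by relabelling, sliding and collapsing edges\<close>

section \<open>Elementary moves on graphs\<close>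

subsection \<open>Relabelling and reversing edges\<close>

text \<open>\<open>D\<close> is the set of edges whose orientation is reversed.\<close>

definition relabel_map :: "('v \<Rightarrow> 'w) \<Rightarrow> ('e \<Rightarrow> 'd) \<Rightarrow> 'e set \<Rightarrow> ('w, 'd) pre_digraph \<Rightarrow>
    'v + 'e \<times> real \<Rightarrow> 'w + 'd \<times> real" where
  "relabel_map i j D Y = gmap (\<lambda>v. Inl (i v)) (\<lambda>e t. edge_point Y (j e) (if e \<in> D then 1 - t else t))"

definition relabels :: "('v, 'e) pre_digraph \<Rightarrow> ('v \<Rightarrow> 'w) \<Rightarrow> ('e \<Rightarrow> 'd) \<Rightarrow> 'e set \<Rightarrow> ('w, 'd) pre_digraph \<Rightarrow> bool" where
  "relabels X i j D Y \<longleftrightarrow> bij_betw i (verts X) (verts Y) \<and> bij_betw j (arcs X) (arcs Y) \<and>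
    (\<forall>e\<in>arcs X. tail Y (j e) = i (if e \<in> D then head X e else tail X e) \<and>
       head Y (j e) = i (if e \<in> D then tail X e else head X e))"

lemma relabel_map_edge_point:
  assumes "relabels X i j D Y" "e \<in> arcs X" "t \<in> {0..1}"
  shows "relabel_map i j D Y (edge_point X e t) = edge_point Y (j e) (if e \<in> D then 1 - t else t)"
  unfolding relabel_map_def using assms by (intro gmap_edge_point) (auto simp: relabels_def)

lemma continuous_relabel_map:
  assumes "wf_digraph X" "wf_digraph Y" "relabels X i j D Y"
  shows "continuous_map (graph_top X) (graph_top Y) (relabel_map i j D Y)"
  unfolding relabel_map_def
proof (rule continuous_map_gmap[OF assms(1)])
  show "Inl (i v) \<in> topspace (graph_top Y)" if "v \<in> verts X" for v
    using assms that by (auto simp: topspace_graph_top relabels_def bij_betw_def)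
  fix e assume e: "e \<in> arcs X"
  then have "j e \<in> arcs Y" using assms(3) by (auto simp: relabels_def bij_betw_def)
  then have "pathin (graph_top Y) (edge_point Y (j e))" using assms(2) by (rule pathin_edge_point[rotated])
  from this pathin_rev[OF this]
  show "pathin (graph_top Y) (\<lambda>t. edge_point Y (j e) (if e \<in> D then 1 - t else t)) \<and>
      edge_point Y (j e) (if e \<in> D then 1 - 0 else 0) = Inl (i (tail X e)) \<and>
      edge_point Y (j e) (if e \<in> D then 1 - 1 else 1) = Inl (i (head X e))"
    using assms(3) e by (cases "e \<in> D") (auto simp: relabels_def path_rev_def)
qed

lemma relabels_inverse:
  assumes "wf_digraph X" "relabels X i j D Y"
  shows "relabels Y (inv_into (verts X) i) (inv_into (arcs X) j) (j ` (D \<inter> arcs X)) X"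
  unfolding relabels_def
proof (intro conjI ballI)
  interpret wf_digraph X by fact
  have i: "bij_betw i (verts X) (verts Y)" and j: "bij_betw j (arcs X) (arcs Y)"
    and ends: "\<And>e. e \<in> arcs X \<Longrightarrow> tail Y (j e) = i (if e \<in> D then head X e else tail X e) \<and>
       head Y (j e) = i (if e \<in> D then tail X e else head X e)"
    using assms(2) by (auto simp: relabels_def)
  show "bij_betw (inv_into (verts X) i) (verts Y) (verts X)" "bij_betw (inv_into (arcs X) j) (arcs Y) (arcs X)"
    using i j by (simp_all add: bij_betw_inv_into)
  fix d assume "d \<in> arcs Y"
  then obtain e where e: "e \<in> arcs X" "d = j e" using j by (auto simp: bij_betw_def)
  have inv: "inv_into (arcs X) j d = e" "\<And>v. v \<in> verts X \<Longrightarrow> inv_into (verts X) i (i v) = v"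
    using e i j by (simp_all add: bij_betw_def inv_into_f_f)
  have "d \<in> j ` (D \<inter> arcs X) \<longleftrightarrow> e \<in> D"
    using e j by (auto simp: bij_betw_def dest: inj_onD)
  then show "tail X (inv_into (arcs X) j d) = inv_into (verts X) i (if d \<in> j ` (D \<inter> arcs X) then head Y d else tail Y d)"
    "head X (inv_into (arcs X) j d) = inv_into (verts X) i (if d \<in> j ` (D \<inter> arcs X) then tail Y d else head Y d)"
    using ends[OF e(1)] e inv by simp_all
qed

lemma relabel_map_inverse:
  assumes "wf_digraph X" "relabels X i j D Y" "z \<in> graph_points X"
  shows "relabel_map (inv_into (verts X) i) (inv_into (arcs X) j) (j ` (D \<inter> arcs X)) X (relabel_map i j D Y z) = z"
  using assms(3)
proof (cases rule: graph_points_cases)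
  case (1 v)
  then show ?thesis
    using assms(2) by (simp add: relabel_map_def relabels_def bij_betw_def inv_into_f_f)
next
  case (2 e t)
  have j: "inj_on j (arcs X)" "j e \<in> arcs Y" using assms(2) 2 by (auto simp: relabels_def bij_betw_def)
  have D: "j e \<in> j ` (D \<inter> arcs X) \<longleftrightarrow> e \<in> D" using 2 j(1) by (auto dest: inj_onD)
  show ?thesis
    using 2 j D relabel_map_edge_point[OF assms(2) 2(1), of t]
      relabel_map_edge_point[OF relabels_inverse[OF assms(1,2)] j(2), of "if e \<in> D then 1 - t else t"]
    by (simp add: inv_into_f_f)
qed

lemma homotopic_id_if_eq:
  assumes "continuous_map S S f" "\<And>z. z \<in> topspace S \<Longrightarrow> f z = z"
  shows "homotopic_with (\<lambda>_. True) S S f id"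
  using assms by (intro homotopic_with_equal) auto

lemma relabel_equivalence:
  assumes X: "wf_digraph X" and Y: "wf_digraph Y" and R: "relabels X i j D Y"
  shows "homotopy_equivalence_map (graph_top X) (graph_top Y) (relabel_map i j D Y)"
proof (rule homotopy_equivalence_mapI)
  let ?i = "inv_into (verts X) i" and ?j = "inv_into (arcs X) j" and ?D = "j ` (D \<inter> arcs X)"
  let ?\<eta> = "relabel_map i j D Y" and ?\<theta> = "relabel_map ?i ?j ?D X"
  note R' = relabels_inverse[OF X R]
  show \<eta>: "continuous_map (graph_top X) (graph_top Y) ?\<eta>"
    by (rule continuous_relabel_map[OF X Y R])
  show \<theta>: "continuous_map (graph_top Y) (graph_top X) ?\<theta>"
    by (rule continuous_relabel_map[OF Y X R'])
  show "homotopic_with (\<lambda>_. True) (graph_top X) (graph_top X) (?\<theta> \<circ> ?\<eta>) id"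
    using relabel_map_inverse[OF X R] topspace_graph_top[OF X]
    by (intro homotopic_id_if_eq continuous_map_compose[OF \<eta> \<theta>]) auto
  have "?\<eta> (?\<theta> z) = z" if "z \<in> graph_points Y" for z
    using that
  proof (cases rule: graph_points_cases)
    case (1 v)
    then show ?thesis
      using R by (auto simp: relabel_map_def relabels_def bij_betw_def f_inv_into_f)
  next
    case (2 d t)
    have "d \<in> j ` arcs X" using 2(1) R by (auto simp: relabels_def bij_betw_def)
    then obtain e where e: "e \<in> arcs X" "d = j e" by blast
    have j: "inj_on j (arcs X)" using R by (auto simp: relabels_def bij_betw_def)
    have D: "d \<in> ?D \<longleftrightarrow> e \<in> D" "?j d = e" using e j by (auto dest: inj_onD simp: inv_into_f_f)
    show ?thesis
      using 2 e D relabel_map_edge_point[OF R' 2(1), of t]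
        relabel_map_edge_point[OF R e(1), of "if e \<in> D then 1 - t else t"] by simp
  qed
  then show "homotopic_with (\<lambda>_. True) (graph_top Y) (graph_top Y) (?\<eta> \<circ> ?\<theta>) id"
    using topspace_graph_top[OF Y] by (intro homotopic_id_if_eq continuous_map_compose[OF \<theta> \<eta>]) auto
qed

lemma relabel_connected:
  assumes "wf_digraph X" "wf_digraph Y" "relabels X i j D Y" "Digraph_Component.connected X"
  shows "Digraph_Component.connected Y"
  unfolding connected_iff_cut[OF assms(2)]
proof (intro conjI allI impI)
  interpret X: wf_digraph X by fact
  have i: "bij_betw i (verts X) (verts Y)" and j: "bij_betw j (arcs X) (arcs Y)"
    and ends: "\<And>e. e \<in> arcs X \<Longrightarrow> tail Y (j e) = i (if e \<in> D then head X e else tail X e) \<and>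
       head Y (j e) = i (if e \<in> D then tail X e else head X e)"
    using assms(3) by (auto simp: relabels_def)
  have cut: "verts X \<noteq> {}" "\<And>A. A \<subseteq> verts X \<Longrightarrow> A \<noteq> {} \<Longrightarrow> \<forall>e\<in>arcs X. tail X e \<in> A \<longleftrightarrow> head X e \<in> A \<Longrightarrow> A = verts X"
    using assms(4) unfolding connected_iff_cut[OF assms(1)] by blast+
  show "verts Y \<noteq> {}" using cut(1) i by (auto simp: bij_betw_def)
  fix B assume B: "B \<subseteq> verts Y" "B \<noteq> {}" "\<forall>d\<in>arcs Y. tail Y d \<in> B \<longleftrightarrow> head Y d \<in> B"
  have "{v \<in> verts X. i v \<in> B} = verts X"
  proof (rule cut(2))
    obtain w where w: "w \<in> B" using B(2) by blast
    then have "w \<in> i ` verts X" using B(1) i by (auto simp: bij_betw_def)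
    then show "{v \<in> verts X. i v \<in> B} \<noteq> {}" using w by blast
    show "\<forall>e\<in>arcs X. tail X e \<in> {v \<in> verts X. i v \<in> B} \<longleftrightarrow> head X e \<in> {v \<in> verts X. i v \<in> B}"
    proof
      fix e assume e: "e \<in> arcs X"
      then have "j e \<in> arcs Y" using j by (auto simp: bij_betw_def)
      then have "i (tail X e) \<in> B \<longleftrightarrow> i (head X e) \<in> B"
        using B(3) ends[OF e] by (cases "e \<in> D") auto
      then show "tail X e \<in> {v \<in> verts X. i v \<in> B} \<longleftrightarrow> head X e \<in> {v \<in> verts X. i v \<in> B}"
        using e by simp
    qed
  qed auto
  then have "i ` verts X \<subseteq> B" by blast
  then show "B = verts Y" using B(1) i by (simp add: bij_betw_def)
qed

subsection \<open>Sliding an edge\<close>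

text \<open>The tail of \<open>e\<close> is meant to slide along an edge \<open>d\<close> with the
  same tail; other positions of the two edges are reduced to this one by reversal.\<close>

definition slide :: "('v, 'e) pre_digraph \<Rightarrow> 'e \<Rightarrow> 'e \<Rightarrow> ('v, 'e) pre_digraph" where
  "slide X d e = X\<lparr>tail := (tail X)(e := head X d)\<rparr>"

lemma slide_simps [simp]:
  "verts (slide X d e) = verts X" "arcs (slide X d e) = arcs X" "head (slide X d e) = head X"
  "tail (slide X d e) e' = (if e' = e then head X d else tail X e')"
  by (simp_all add: slide_def)

definition slide_map :: "('v, 'e) pre_digraph \<Rightarrow> 'e \<Rightarrow> 'e \<Rightarrow> 'v + 'e \<times> real \<Rightarrow> 'v + 'e \<times> real" where
  "slide_map X d e = gmap Inl (\<lambda>e'. if e' = e then edge_point (slide X d e) d \<star> edge_point (slide X d e) e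
     else edge_point (slide X d e) e')"

lemma wf_slide: "wf_digraph X \<Longrightarrow> d \<in> arcs X \<Longrightarrow> wf_digraph (slide X d e)"
  unfolding wf_digraph_def by auto

lemma fin_slide: "fin_digraph X \<Longrightarrow> d \<in> arcs X \<Longrightarrow> fin_digraph (slide X d e)"
  unfolding fin_digraph_def fin_digraph_axioms_def by (simp add: wf_slide)

lemma slide_connected:
  assumes "wf_digraph X" "Digraph_Component.connected X" "d \<in> arcs X" "e \<in> arcs X" "d \<noteq> e" "tail X d = tail X e"
  shows "Digraph_Component.connected (slide X d e)"
proof -
  have "\<forall>e'\<in>arcs X. tail X e' \<in> A \<longleftrightarrow> head X e' \<in> A"
    if "\<forall>e'\<in>arcs X. tail (slide X d e) e' \<in> A \<longleftrightarrow> head X e' \<in> A" for A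
    using that assms(3-6) by (metis slide_simps(4))
  then show ?thesis
    using assms(2) unfolding connected_iff_cut[OF assms(1)] connected_iff_cut[OF wf_slide[OF assms(1,3)]]
    by simp
qed

text \<open>The old \<open>e\<close> is sent to \<open>d\<close> followed by the new
  \<open>e\<close>, and the new \<open>e\<close> to the reverse of \<open>d\<close> followed by the
  old one. In both composites \<open>d\<close> cancels against its reverse.\<close>

lemma slide_equivalence:
  assumes wf: "wf_digraph X" and d: "d \<in> arcs X" and e: "e \<in> arcs X" and de: "d \<noteq> e" "tail X d = tail X e"
  shows "homotopy_equivalence_map (graph_top X) (graph_top (slide X d e)) (slide_map X d e)"
proof (rule homotopy_equivalence_mapI)
  let ?Y = "slide X d e" and ?\<eta> = "slide_map X d e"
  interpret X: wf_digraph X by fact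
  have wf': "wf_digraph ?Y" using wf d by (rule wf_slide)
  define c where "c e' = (if e' = e then edge_point ?Y d \<star> edge_point ?Y e else edge_point ?Y e')" for e'
  define c' where "c' e' = (if e' = e then path_rev (edge_point X d) \<star> edge_point X e else edge_point X e')" for e'
  define \<theta> where "\<theta> = gmap Inl c'"
  have \<eta>_eq: "?\<eta> = gmap Inl c" by (simp add: slide_map_def c_def[abs_def])
  have pX: "pathin (graph_top X) (edge_point X e')" and pY: "pathin (graph_top ?Y) (edge_point ?Y e')"
    if "e' \<in> arcs X" for e'
    using that pathin_edge_point[OF wf] pathin_edge_point[OF wf'] by auto
  have c: "pathin (graph_top ?Y) (c e')" "c e' 0 = Inl (tail X e')" "c e' 1 = Inl (head X e')" if "e' \<in> arcs X" for e'
    using that d e de pY by (auto simp: c_def intro!: pathin_loop_join)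
  have c': "pathin (graph_top X) (c' e')" "c' e' 0 = Inl (tail ?Y e')" "c' e' 1 = Inl (head ?Y e')" if "e' \<in> arcs X" for e'
    using that d e de pX by (auto simp: c'_def intro!: pathin_loop_join pathin_rev)
  show \<eta>: "continuous_map (graph_top X) (graph_top ?Y) ?\<eta>"
    unfolding \<eta>_eq using c topspace_graph_top[OF wf'] by (intro continuous_map_gmap[OF wf]) auto
  show \<theta>: "continuous_map (graph_top ?Y) (graph_top X) \<theta>"
    unfolding \<theta>_def using c' topspace_graph_top[OF wf] by (intro continuous_map_gmap[OF wf']) auto
  have \<eta>e: "path_htpy (graph_top ?Y) (?\<eta> \<circ> edge_point X e') (c e')" if "e' \<in> arcs X" for e'
    unfolding \<eta>_eq using c[OF that] by (intro path_htpy_gmap)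
  have \<theta>e: "path_htpy (graph_top X) (\<theta> \<circ> edge_point ?Y e') (c' e')" if "e' \<in> arcs X" for e'
    unfolding \<theta>_def using c'[OF that] by (intro path_htpy_gmap)
  show "homotopic_with (\<lambda>_. True) (graph_top X) (graph_top X) (\<theta> \<circ> ?\<eta>) id"
  proof (rule homotopic_graph_rel_verts[OF wf continuous_map_compose[OF \<eta> \<theta>]])
    fix e' assume e': "e' \<in> arcs X"
    have "path_htpy (graph_top X) (\<theta> \<circ> ?\<eta> \<circ> edge_point X e') (\<theta> \<circ> c e')"
      using path_htpy_image[OF \<theta> \<eta>e[OF e']] by (simp add: comp_assoc)
    also have "path_htpy (graph_top X) (\<theta> \<circ> c e') (edge_point X e')"
    proof (cases "e' = e")
      case True
      have eq: "\<theta> \<circ> c e' = (\<theta> \<circ> edge_point ?Y d) \<star> (\<theta> \<circ> edge_point ?Y e)"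
        using True by (simp add: c_def comp_loop_join)
      have "path_htpy (graph_top X) (\<theta> \<circ> c e') (c' d \<star> c' e)" unfolding eq
        using d e de \<theta>e by (intro path_htpy_join) (auto simp: \<theta>_def)
      also have "path_htpy (graph_top X) \<dots> (edge_point X e)"
        using d e de pX by (simp add: c'_def path_htpy_cancel_rev)
      finally show ?thesis using True by simp
    next
      case False
      then show ?thesis using \<theta>e[OF e'] by (simp add: c_def c'_def)
    qed
    finally show "path_htpy (graph_top X) (\<theta> \<circ> ?\<eta> \<circ> edge_point X e') (id \<circ> edge_point X e')" by simp
  qed (simp add: \<theta>_def \<eta>_eq)
  show "homotopic_with (\<lambda>_. True) (graph_top ?Y) (graph_top ?Y) (?\<eta> \<circ> \<theta>) id"
  proof (rule homotopic_graph_rel_verts[OF wf' continuous_map_compose[OF \<theta> \<eta>]])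
    fix e' assume "e' \<in> arcs ?Y"
    then have e': "e' \<in> arcs X" by simp
    have "path_htpy (graph_top ?Y) (?\<eta> \<circ> \<theta> \<circ> edge_point ?Y e') (?\<eta> \<circ> c' e')"
      using path_htpy_image[OF \<eta> \<theta>e[OF e']] by (simp add: comp_assoc)
    also have "path_htpy (graph_top ?Y) (?\<eta> \<circ> c' e') (edge_point ?Y e')"
    proof (cases "e' = e")
      case True
      have eq: "?\<eta> \<circ> c' e' = path_rev (?\<eta> \<circ> edge_point X d) \<star> (?\<eta> \<circ> edge_point X e)"
        using True by (simp add: c'_def comp_loop_join comp_path_rev)
      have "path_htpy (graph_top ?Y) (?\<eta> \<circ> c' e') (path_rev (c d) \<star> c e)" unfolding eq
        using d e de \<eta>e by (intro path_htpy_join path_htpy_rev) (auto simp: \<eta>_eq)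
      also have "path_htpy (graph_top ?Y) \<dots> (edge_point ?Y e)"
        using d e de pY by (simp add: c_def path_htpy_cancel_rev')
      finally show ?thesis using True by simp
    next
      case False
      then show ?thesis using \<eta>e[OF e'] by (simp add: c_def c'_def)
    qed
    finally show "path_htpy (graph_top ?Y) (?\<eta> \<circ> \<theta> \<circ> edge_point ?Y e') (id \<circ> edge_point ?Y e')" by simp
  qed (simp add: \<theta>_def \<eta>_eq)
qed

subsection \<open>Collapsing an edge\<close>

definition collapse_vertex :: "('v, 'e) pre_digraph \<Rightarrow> 'e \<Rightarrow> 'v \<Rightarrow> 'v" where
  "collapse_vertex X e v = (if v = head X e then tail X e else v)"

definition collapse :: "('v, 'e) pre_digraph \<Rightarrow> 'e \<Rightarrow> ('v, 'e) pre_digraph" where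
  "collapse X e = \<lparr>verts = verts X - {head X e}, arcs = arcs X - {e},
     tail = (\<lambda>d. collapse_vertex X e (tail X d)), head = (\<lambda>d. collapse_vertex X e (head X d))\<rparr>"

lemma collapse_simps [simp]:
  "verts (collapse X e) = verts X - {head X e}" "arcs (collapse X e) = arcs X - {e}"
  "tail (collapse X e) d = collapse_vertex X e (tail X d)" "head (collapse X e) d = collapse_vertex X e (head X d)"
  by (simp_all add: collapse_def)

definition collapse_map :: "('v, 'e) pre_digraph \<Rightarrow> 'e \<Rightarrow> 'v + 'e \<times> real \<Rightarrow> 'v + 'e \<times> real" where
  "collapse_map X e = gmap (\<lambda>v. Inl (collapse_vertex X e v))
     (\<lambda>d. if d = e then (\<lambda>_. Inl (tail X e)) else edge_point (collapse X e) d)"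

lemma wf_collapse:
  assumes "wf_digraph X" "e \<in> arcs X" "tail X e \<noteq> head X e"
  shows "wf_digraph (collapse X e)"
proof -
  interpret wf_digraph X by fact
  show ?thesis using assms(2,3) by unfold_locales (auto simp: collapse_vertex_def)
qed

lemma fin_collapse:
  assumes "fin_digraph X" "e \<in> arcs X" "tail X e \<noteq> head X e"
  shows "fin_digraph (collapse X e)"
  using assms wf_collapse[of X e] unfolding fin_digraph_def fin_digraph_axioms_def by simp

lemma collapse_connected:
  assumes wf: "wf_digraph X" and "Digraph_Component.connected X" and e: "e \<in> arcs X" "tail X e \<noteq> head X e"
  shows "Digraph_Component.connected (collapse X e)"
  unfolding connected_iff_cut[OF wf_collapse[OF wf e]]
proof (intro conjI allI impI)
  interpret wf_digraph X by fact
  have "tail X e \<in> verts (collapse X e)" using e by simp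
  then show "verts (collapse X e) \<noteq> {}" by blast
  fix A assume A: "A \<subseteq> verts (collapse X e)" "A \<noteq> {}"
    "\<forall>d\<in>arcs (collapse X e). tail (collapse X e) d \<in> A \<longleftrightarrow> head (collapse X e) d \<in> A"
  let ?B = "{u \<in> verts X. collapse_vertex X e u \<in> A}"
  have "?B = verts X"
  proof -
    have "\<forall>d\<in>arcs X. tail X d \<in> ?B \<longleftrightarrow> head X d \<in> ?B"
    proof
      fix d assume d: "d \<in> arcs X"
      show "tail X d \<in> ?B \<longleftrightarrow> head X d \<in> ?B"
      proof (cases "d = e")
        case True
        then show ?thesis using d by (auto simp: collapse_vertex_def)
      next
        case False
        then show ?thesis using A(3) d by simp
      qed
    qed
    moreover have "?B \<noteq> {}" using A(1,2) by (auto simp: collapse_vertex_def)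
    moreover have "?B \<subseteq> verts X" by simp
    ultimately show ?thesis using assms(2) unfolding connected_iff_cut[OF wf] by blast
  qed
  then show "A = verts (collapse X e)"
    using A(1) by (auto simp: collapse_vertex_def set_eq_iff split: if_splits)
qed

text \<open>The inverse lets every edge that was attached to the removed vertex run through
  \<open>e\<close> at that end. On the original graph the homotopy to the identity moves the removed
  vertex along \<open>e\<close>, so it is not relative to the vertices.\<close>

lemma collapse_equivalence:
  assumes wf: "wf_digraph X" and e: "e \<in> arcs X" "tail X e \<noteq> head X e"
  shows "homotopy_equivalence_map (graph_top X) (graph_top (collapse X e)) (collapse_map X e)"
proof (rule homotopy_equivalence_mapI)
  let ?Y = "collapse X e" and ?\<eta> = "collapse_map X e" and ?\<rho> = "collapse_vertex X e"
  interpret X: wf_digraph X by fact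
  have wf': "wf_digraph ?Y" using wf e by (rule wf_collapse)
  have tX: "topspace (graph_top X) = graph_points X" "topspace (graph_top ?Y) = graph_points ?Y"
    by (rule topspace_graph_top[OF wf], rule topspace_graph_top[OF wf'])
  have \<rho>: "?\<rho> v \<in> verts X - {head X e}" if "v \<in> verts X" for v
    using that e by (auto simp: collapse_vertex_def)
  define c where "c d = (if d = e then (\<lambda>_. Inl (tail X e)) else edge_point ?Y d)" for d
  define \<tau> where "\<tau> v = (if v = head X e then edge_point X e else (\<lambda>_. Inl v))" for v
  define c' where "c' d = \<tau> (tail X d) \<star> edge_point X d \<star> path_rev (\<tau> (head X d))" for d
  define \<theta> where "\<theta> = gmap Inl c'"
  have \<eta>_eq: "?\<eta> = gmap (\<lambda>v. Inl (?\<rho> v)) c" by (simp add: collapse_map_def c_def[abs_def])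
  have pX: "pathin (graph_top X) (edge_point X d)" if "d \<in> arcs X" for d
    using that pathin_edge_point[OF wf] by auto
  have pY: "pathin (graph_top ?Y) (edge_point ?Y d)" if "d \<in> arcs X" "d \<noteq> e" for d
    using that pathin_edge_point[OF wf'] by auto
  have c: "pathin (graph_top ?Y) (c d)" "c d 0 = Inl (?\<rho> (tail X d))" "c d 1 = Inl (?\<rho> (head X d))" if "d \<in> arcs X" for d
    using that e pY tX(2) by (auto simp: c_def collapse_vertex_def)
  have \<tau>: "pathin (graph_top X) (\<tau> v)" "\<tau> v 0 = Inl (?\<rho> v)" "\<tau> v 1 = Inl v" if "v \<in> verts X" for v
    using that e pX tX(1) by (auto simp: \<tau>_def collapse_vertex_def)
  have c': "pathin (graph_top X) (c' d)" "c' d 0 = Inl (?\<rho> (tail X d))" "c' d 1 = Inl (?\<rho> (head X d))" if "d \<in> arcs X" for d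
    using that pX \<tau> by (auto simp: c'_def intro!: pathin_loop_join pathin_rev)
  show \<eta>: "continuous_map (graph_top X) (graph_top ?Y) ?\<eta>"
    unfolding \<eta>_eq using c tX \<rho> by (intro continuous_map_gmap[OF wf]) auto
  show \<theta>: "continuous_map (graph_top ?Y) (graph_top X) \<theta>"
    unfolding \<theta>_def using c' tX by (intro continuous_map_gmap[OF wf']) auto
  have \<eta>e: "path_htpy (graph_top ?Y) (?\<eta> \<circ> edge_point X d) (c d)" if "d \<in> arcs X" for d
    unfolding \<eta>_eq using c[OF that] by (intro path_htpy_gmap)
  have \<theta>e: "path_htpy (graph_top X) (\<theta> \<circ> edge_point ?Y d) (c' d)" if "d \<in> arcs X" for d
    unfolding \<theta>_def using c'[OF that] by (intro path_htpy_gmap) simp_all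
  show "homotopic_with (\<lambda>_. True) (graph_top X) (graph_top X) (\<theta> \<circ> ?\<eta>) id"
  proof (rule homotopic_graph_tracks[OF wf continuous_map_compose[OF \<eta> \<theta>] continuous_map_id, where \<tau> = \<tau>])
    show "pathin (graph_top X) (\<tau> v) \<and> \<tau> v 0 = (\<theta> \<circ> ?\<eta>) (Inl v) \<and> \<tau> v 1 = id (Inl v)" if "v \<in> verts X" for v
      using \<tau>[OF that] by (simp add: \<theta>_def \<eta>_eq)
    fix d assume d: "d \<in> arcs X"
    have "path_htpy (graph_top X) (\<theta> \<circ> ?\<eta> \<circ> edge_point X d) (\<theta> \<circ> c d)"
      using path_htpy_image[OF \<theta> \<eta>e[OF d]] by (simp add: comp_assoc)
    also have "path_htpy (graph_top X) (\<theta> \<circ> c d) (c' d)"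
    proof (cases "d = e")
      case True
      have eq: "c' d = (\<lambda>_. Inl (tail X e)) \<star> edge_point X e \<star> path_rev (edge_point X e)"
        using True e(2) by (simp add: c'_def \<tau>_def)
      have "path_htpy (graph_top X) (c' d) (edge_point X e \<star> path_rev (edge_point X e))" unfolding eq
        using pX[OF e(1)] by (intro path_htpy_const_left pathin_loop_join pathin_rev) auto
      also have "path_htpy (graph_top X) \<dots> (\<lambda>_. Inl (tail X e))"
        using path_htpy_rev_right[OF pX[OF e(1)]] by simp
      finally have "path_htpy (graph_top X) (c' d) (\<lambda>_. Inl (tail X e))" .
      from path_htpy_sym[OF this] show ?thesis
        using True by (simp add: c_def \<theta>_def o_def)
    next
      case False
      then show ?thesis using \<theta>e[OF d] by (simp add: c_def)
    qed
    finally show "path_htpy (graph_top X) (\<theta> \<circ> ?\<eta> \<circ> edge_point X d)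
        (\<tau> (tail X d) \<star> (id \<circ> edge_point X d) \<star> path_rev (\<tau> (head X d)))"
      by (simp add: c'_def)
  qed
  show "homotopic_with (\<lambda>_. True) (graph_top ?Y) (graph_top ?Y) (?\<eta> \<circ> \<theta>) id"
  proof (rule homotopic_graph_rel_verts[OF wf' continuous_map_compose[OF \<theta> \<eta>]])
    show "(?\<eta> \<circ> \<theta>) (Inl v) = id (Inl v)" if "v \<in> verts ?Y" for v
      using that by (simp add: \<theta>_def \<eta>_eq collapse_vertex_def)
    fix d assume "d \<in> arcs ?Y"
    then have d: "d \<in> arcs X" "d \<noteq> e" by auto
    have \<eta>\<tau>: "path_htpy (graph_top ?Y) (?\<eta> \<circ> \<tau> v) (\<lambda>_. Inl (?\<rho> v))" if "v \<in> verts X" for v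
    proof (cases "v = head X e")
      case True
      then show ?thesis using \<eta>e[OF e(1)] by (simp add: \<tau>_def c_def collapse_vertex_def)
    next
      case False
      then show ?thesis using that \<rho>[OF that] tX
        by (auto simp: \<tau>_def \<eta>_eq o_def intro!: path_htpy_refl)
    qed
    have "path_htpy (graph_top ?Y) (?\<eta> \<circ> \<theta> \<circ> edge_point ?Y d) (?\<eta> \<circ> c' d)"
      using path_htpy_image[OF \<eta> \<theta>e[OF d(1)]] by (simp add: comp_assoc)
    also have "?\<eta> \<circ> c' d = (?\<eta> \<circ> \<tau> (tail X d)) \<star> (?\<eta> \<circ> edge_point X d) \<star> path_rev (?\<eta> \<circ> \<tau> (head X d))"
      by (simp add: c'_def comp_loop_join comp_path_rev)
    also have "path_htpy (graph_top ?Y) \<dots> ((\<lambda>_. Inl (?\<rho> (tail X d))) \<star> edge_point ?Y d \<star> path_rev (\<lambda>_. Inl (?\<rho> (head X d))))"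
      using d \<eta>\<tau> \<eta>e[OF d(1)] \<tau> by (intro path_htpy_join path_htpy_rev) (auto simp: c_def)
    also have "path_htpy (graph_top ?Y) \<dots> (edge_point ?Y d \<star> path_rev (\<lambda>_. Inl (?\<rho> (head X d))))"
      using pY[OF d] \<rho>[of "head X d"] d(1) tX by (intro path_htpy_const_left pathin_loop_join pathin_rev) auto
    also have "path_htpy (graph_top ?Y) \<dots> (edge_point ?Y d)"
      unfolding path_rev_def using pY[OF d] by (intro path_htpy_const_right) auto
    finally show "path_htpy (graph_top ?Y) (?\<eta> \<circ> \<theta> \<circ> edge_point ?Y d) (id \<circ> edge_point ?Y d)" by (simp add: o_def)
  qed
qed

section \<open>The number of petals of a rose as a lower bound for its rank\<close>

section \<open>The rank of the fundamental group of a rose\<close>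

lemma homogeneous_system_solution:
  fixes M :: "'a \<Rightarrow> 'b \<Rightarrow> 'c::field"
  assumes "finite S" "finite E" "card S < card E"
  shows "\<exists>a. (\<exists>e\<in>E. a e \<noteq> 0) \<and> (\<forall>s\<in>S. (\<Sum>e\<in>E. a e * M s e) = 0)"
  using assms
proof (induction S arbitrary: E M rule: finite_induct)
  case empty
  then obtain e where "e \<in> E" by (metis card.empty ex_in_conv less_irrefl)
  then show ?case by (intro exI[of _ "\<lambda>_. 1"]) auto
next
  case (insert s S)
  show ?case
  proof (cases "\<forall>e\<in>E. M s e = 0")
    case True
    have "card S < card E" using insert.prems insert.hyps by simp
    then obtain a where a: "\<exists>e\<in>E. a e \<noteq> 0" "\<forall>s\<in>S. (\<Sum>e\<in>E. a e * M s e) = 0"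
      using insert.IH[OF insert.prems(1), of M] by blast
    have "(\<Sum>e\<in>E. a e * M s e) = 0" using True by (intro sum.neutral) auto
    with a show ?thesis by (intro exI[of _ a]) auto
  next
    case False
    then obtain d where d: "d \<in> E" "M s d \<noteq> 0" by blast
    \<comment> \<open>Elimination of the unknown \<open>d\<close> with the pivot
      \<open>M s d\<close>; the function \<open>b\<close> below solves the equation of
      \<open>s\<close> for that unknown.\<close>
    define M' where "M' r e = M r e - M r d * M s e / M s d" for r e
    have "card S < card (E - {d})" using insert d by simp
    then obtain a where a: "\<exists>e\<in>E - {d}. a e \<noteq> 0" "\<forall>r\<in>S. (\<Sum>e\<in>E - {d}. a e * M' r e) = 0"
      using insert.IH[of "E - {d}" M'] insert.prems(1) by blast
    define b where "b = a(d := - (\<Sum>e\<in>E - {d}. a e * M s e) / M s d)"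
    have sum_b: "(\<Sum>e\<in>E. b e * M r e) = (\<Sum>e\<in>E - {d}. a e * M' r e)" for r
    proof -
      have "(\<Sum>e\<in>E. b e * M r e) = b d * M r d + (\<Sum>e\<in>E - {d}. b e * M r e)"
        using insert.prems(1) d(1) by (rule sum.remove)
      also have "(\<Sum>e\<in>E - {d}. b e * M r e) = (\<Sum>e\<in>E - {d}. a e * M r e)"
        by (intro sum.cong) (auto simp: b_def)
      also have "b d * M r d = - (\<Sum>e\<in>E - {d}. a e * (M r d * M s e / M s d))"
        by (simp add: b_def sum_distrib_left sum_distrib_right sum_divide_distrib mult_ac)
      finally show ?thesis by (simp add: M'_def algebra_simps sum_subtractf)
    qed
    have "(\<Sum>e\<in>E. b e * M s e) = 0"
      unfolding sum_b using d(2) by (simp add: M'_def)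
    moreover have "\<exists>e\<in>E. b e \<noteq> 0" using a(1) by (auto simp: b_def)
    ultimately show ?thesis
      using a(2) by (intro exI[of _ b]) (auto simp: sum_b)
  qed
qed

lemma path_htpy_homotopic_paths:
  "path_htpy (top_of_set S) p q \<Longrightarrow> homotopic_paths S p q"
  unfolding path_htpy_def homotopic_paths_def pathstart_def pathfinish_def .

locale rose = fin_digraph X for X :: "('v, 'e) pre_digraph" +
  fixes v :: 'v
  assumes verts: "verts X = {v}"
begin

abbreviation "RT \<equiv> graph_top X"
abbreviation "RG \<equiv> fundamental_group RT (Inl v)"

lemma ends [simp]: "e \<in> arcs X \<Longrightarrow> tail X e = v" "e \<in> arcs X \<Longrightarrow> head X e = v"
  using tail_in_verts head_in_verts verts by blast+

lemma topspace_RT: "topspace RT = graph_points X"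
  by (rule topspace_graph_top) unfold_locales

lemma base_point: "Inl v \<in> topspace RT"
  by (simp add: topspace_RT verts)

lemma wf: "wf_digraph X" by unfold_locales

lemma loop_edge: "e \<in> arcs X \<Longrightarrow> loop_in RT (Inl v) (edge_point X e)"
  using pathin_edge_point[OF wf] by (simp add: loop_in_def)

sublocale RG: group RG
  by (rule group_fundamental_group[OF base_point])

subsection \<open>Lower bound\<close>

text \<open>The winding numbers of a loop around the petals are additive, and the petals themselves give the
  unit vectors, so fewer generators than petals would be annihilated by a nonzero linear form.\<close>

definition to_circle :: "'e \<Rightarrow> 'v + 'e \<times> real \<Rightarrow> complex" where
  "to_circle e = gmap (\<lambda>_. 1) (\<lambda>d. if d = e then circlepath 0 1 else (\<lambda>_. 1))"

definition wind :: "'e \<Rightarrow> (real \<Rightarrow> 'v + 'e \<times> real) \<Rightarrow> complex" where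
  "wind e p = winding_number (to_circle e \<circ> p) 0"

lemma pathin_circlepath: "pathin (top_of_set (- {0})) (circlepath 0 1)"
proof -
  have "continuous_on {0..1} (circlepath 0 (1::real))"
    using path_circlepath[of 0 1] by (simp add: path_def)
  moreover have "circlepath 0 1 t \<noteq> 0" for t by (simp add: circlepath)
  ultimately show ?thesis by (auto simp: pathin_def)
qed

lemma continuous_to_circle: "continuous_map RT (top_of_set (- {0})) (to_circle e)"
  unfolding to_circle_def using pathin_circlepath
  by (intro continuous_map_gmap[OF wf]) (auto simp: circlepath)

lemma wind_htpy:
  assumes "path_htpy RT p q"
  shows "wind e p = wind e q"
  unfolding wind_def
  by (intro winding_number_homotopic_paths path_htpy_homotopic_paths
      path_htpy_image[OF continuous_to_circle assms])

lemma to_circle_path: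
  assumes "pathin RT p"
  shows "path (to_circle e \<circ> p)" "0 \<notin> path_image (to_circle e \<circ> p)"
  using pathin_compose_map[OF assms continuous_to_circle[of e]]
  by (auto simp: pathin_def path_def path_image_def image_subset_iff Pi_iff)

lemma wind_join:
  assumes "pathin RT p" "pathin RT q" "p 1 = q 0"
  shows "wind e (p \<star> q) = wind e p + wind e q"
proof -
  have "to_circle e \<circ> (p \<star> q) = (to_circle e \<circ> p) +++ (to_circle e \<circ> q)"
    by (auto simp: joinpaths_def loop_join_def)
  then show ?thesis
    unfolding wind_def using assms to_circle_path[OF assms(1)] to_circle_path[OF assms(2)]
    by (simp add: winding_number_join pathfinish_def pathstart_def)
qed

lemma wind_edge:
  assumes "d \<in> arcs X"
  shows "wind e (edge_point X d) = (if d = e then 1 else 0)"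
proof -
  let ?c = "\<lambda>d. if d = e then circlepath 0 1 else (\<lambda>_. 1::complex)"
  have "path_htpy (top_of_set (- {0})) (to_circle e \<circ> edge_point X d) (?c d)"
    unfolding to_circle_def using pathin_circlepath
    by (intro path_htpy_gmap) (auto simp: circlepath)
  then have "wind e (edge_point X d) = winding_number (?c d) 0"
    unfolding wind_def by (intro winding_number_homotopic_paths path_htpy_homotopic_paths)
  also have "\<dots> = (if d = e then 1 else 0)"
  proof -
    have "(\<lambda>_. 1) = linepath 1 (1::complex)" by (auto simp: linepath_def algebra_simps)
    then show ?thesis
      using winding_number_circlepath_centre[of 1 0] winding_number_trivial[of 0 1] by simp
  qed
  finally show ?thesis .
qed

definition cwind :: "'e \<Rightarrow> (real \<Rightarrow> 'v + 'e \<times> real) set \<Rightarrow> complex" where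
  "cwind e A = wind e (SOME p. p \<in> A)"

lemma cwind_class:
  assumes "loop_in RT (Inl v) p"
  shows "cwind e (loop_class RT (Inl v) p) = wind e p"
proof -
  have "(SOME q. q \<in> loop_class RT (Inl v) p) \<in> loop_class RT (Inl v) p"
    using loop_class_refl[OF assms] some_in_eq[of "loop_class RT (Inl v) p"] by blast
  then have "path_htpy RT p (SOME q. q \<in> loop_class RT (Inl v) p)"
    by (simp only: loop_class_iff[OF assms])
  then show ?thesis unfolding cwind_def by (simp add: wind_htpy)
qed

lemma cwind_mult:
  assumes "A \<in> carrier RG" "B \<in> carrier RG"
  shows "cwind e (A \<otimes>\<^bsub>RG\<^esub> B) = cwind e A + cwind e B"
proof -
  obtain p q where pq: "loop_in RT (Inl v) p" "A = loop_class RT (Inl v) p"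
    "loop_in RT (Inl v) q" "B = loop_class RT (Inl v) q"
    using assms by (auto simp: carrier_fundamental_group)
  then show ?thesis
    using wind_join[of p q e]
    by (simp add: mult_fundamental_group cwind_class loop_in_join) (simp add: loop_in_def)
qed

lemma card_generating_set_ge:
  assumes S: "finite S" "generating_set RG S"
  shows "card (arcs X) \<le> card S"
proof (rule ccontr)
  assume "\<not> card (arcs X) \<le> card S"
  then obtain a where a: "\<exists>e\<in>arcs X. a e \<noteq> 0" "\<forall>s\<in>S. (\<Sum>e\<in>arcs X. a e * cwind e s) = 0"
    using homogeneous_system_solution[of S "arcs X" "\<lambda>s e. cwind e s"] S(1) by auto
  define \<phi> where "\<phi> A = (\<Sum>e\<in>arcs X. a e * cwind e A)" for A
  have \<phi>_mult: "\<phi> (A \<otimes>\<^bsub>RG\<^esub> B) = \<phi> A + \<phi> B" if "A \<in> carrier RG" "B \<in> carrier RG" for A B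
    using that by (simp add: \<phi>_def cwind_mult sum.distrib algebra_simps)
  have \<phi>_one: "\<phi> \<one>\<^bsub>RG\<^esub> = 0"
    using \<phi>_mult[of "\<one>\<^bsub>RG\<^esub>" "\<one>\<^bsub>RG\<^esub>"] by simp
  have S': "S \<subseteq> carrier RG" "generate RG S = carrier RG"
    using S(2) by (simp_all add: generating_set_def)
  have "\<phi> A = 0" if "A \<in> generate RG S" for A
    using that
  proof induction
    case (inv h)
    then have h: "h \<in> carrier RG" using S'(1) by blast
    have "\<phi> (inv\<^bsub>RG\<^esub> h) + \<phi> h = 0"
      using \<phi>_mult[of "inv\<^bsub>RG\<^esub> h" h] h \<phi>_one by simp
    moreover have "\<phi> h = 0" using a(2) inv by (simp add: \<phi>_def)
    ultimately show ?case by simp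
  next
    case (eng h1 h2)
    then show ?case using \<phi>_mult S'(2) by simp
  qed (use a(2) \<phi>_one in \<open>auto simp: \<phi>_def\<close>)
  then have zero: "\<phi> (loop_class RT (Inl v) (edge_point X d)) = 0" if "d \<in> arcs X" for d
    using that S'(2) loop_edge by (simp add: carrier_fundamental_group)
  have "\<phi> (loop_class RT (Inl v) (edge_point X d)) = a d" if "d \<in> arcs X" for d
  proof -
    have "\<phi> (loop_class RT (Inl v) (edge_point X d)) = (\<Sum>e\<in>arcs X. if d = e then a e else 0)"
      unfolding \<phi>_def using that by (intro sum.cong) (auto simp: cwind_class loop_edge wind_edge)
    then show ?thesis using that by simp
  qed
  then show False using a(1) zero by auto
qed

subsection \<open>Finite generation\<close>

text \<open>The map \<open>stretch\<close> is homotopic to the identity and sends a neighbourhood of the vertex to the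
  vertex; so the composition with a path is locally contained in a single closed edge.\<close>

definition clamp :: "real \<Rightarrow> real" where
  "clamp t = max 0 (min 1 (2 * t - 1 / 2))"

definition stretch :: "'v + 'e \<times> real \<Rightarrow> 'v + 'e \<times> real" where
  "stretch = gmap Inl (\<lambda>e t. edge_point X e (clamp t))"

lemma clamp: "clamp t \<in> {0..1}" "clamp 0 = 0" "clamp 1 = 1" "t \<le> 1/4 \<Longrightarrow> clamp t = 0" "3/4 \<le> t \<Longrightarrow> clamp t = 1"
  by (auto simp: clamp_def)

lemma continuous_clamp: "continuous_on A clamp"
  unfolding clamp_def by (intro continuous_intros)

lemma pathin_edge_clamp: "e \<in> arcs X \<Longrightarrow> pathin RT (\<lambda>t. edge_point X e (clamp t))"
  using pathin_reparam[OF pathin_edge_point[OF wf], of e clamp] continuous_clamp clamp(1) by (auto simp: o_def)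

lemma stretch_edge_point:
  assumes "e \<in> arcs X" "t \<in> {0..1}"
  shows "stretch (edge_point X e t) = edge_point X e (clamp t)"
  unfolding stretch_def using assms by (intro gmap_edge_point) (auto simp: clamp)

lemma continuous_stretch: "continuous_map RT RT stretch"
  unfolding stretch_def
  by (intro continuous_map_gmap[OF wf]) (auto simp: base_point pathin_edge_clamp clamp verts)

lemma path_htpy_stretch:
  assumes "loop_in RT (Inl v) p"
  shows "path_htpy RT (stretch \<circ> p) p"
proof -
  have "\<exists>H. continuous_map (prod_topology (top_of_set {0..1::real}) RT) RT H \<and>
     (\<forall>z\<in>graph_points X. H (0, z) = stretch z \<and> H (1, z) = z) \<and> (\<forall>s\<in>{0..1}. H (s, Inl v) = Inl v)"
  proof -
    define H where "H = (\<lambda>(s::real, z). gmap Inl (\<lambda>e t. edge_point X e ((1 - s) * clamp t + s * t)) z)"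
    have He: "H (s, edge_point X e t) = edge_point X e ((1 - s) * clamp t + s * t)" if "e \<in> arcs X" "t \<in> {0..1}" for s e t
      unfolding H_def using that by (auto intro!: gmap_edge_point simp: clamp)
    have "continuous_map (prod_topology (top_of_set {0..1::real}) RT) RT H"
    proof (rule continuous_map_graph_homotopy[OF wf])
      fix e assume e: "e \<in> arcs X"
      show "continuous_map (top_of_set ({0..1} \<times> {0..1})) RT (\<lambda>(s, t). H (s, edge_point X e t))"
      proof (rule continuous_map_eq)
        have "continuous_map (top_of_set ({0..1} \<times> {0..1})) (top_of_set {0..1}) (\<lambda>z. (1 - fst z) * clamp (snd z) + fst z * snd z)"
          using clamp(1) by (auto intro!: continuous_intros continuous_on_compose2[OF continuous_clamp[of UNIV]] add_nonneg_nonneg convex_bound_le)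
        from continuous_map_compose[OF this pathin_edge_point[OF wf e, unfolded pathin_def]]
        show "continuous_map (top_of_set ({0..1} \<times> {0..1})) RT (\<lambda>(s, t). edge_point X e ((1 - s) * clamp t + s * t))"
          by (simp add: o_def case_prod_unfold)
      qed (auto simp: He e)
    qed (use base_point verts in \<open>auto simp: H_def\<close>)
    moreover have "H (0, z) = stretch z \<and> H (1, z) = z" if "z \<in> graph_points X" for z
      using that
    proof (cases rule: graph_points_cases)
      case (2 e t)
      then show ?thesis using He[of e t] stretch_edge_point[of e t] by simp
    qed (simp add: H_def stretch_def)
    ultimately show ?thesis by (intro exI[of _ H]) (simp add: H_def)
  qed
  then obtain H where H: "continuous_map (prod_topology (top_of_set {0..1::real}) RT) RT H"
     "\<And>z. z \<in> graph_points X \<Longrightarrow> H (0, z) = stretch z" "\<And>z. z \<in> graph_points X \<Longrightarrow> H (1, z) = z"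
     "\<And>s. s \<in> {0..1} \<Longrightarrow> H (s, Inl v) = Inl v" by blast
  have p: "continuous_map (top_of_set {0..1}) RT p" using assms by (simp add: loop_in_def pathin_def)
  then have pX: "p t \<in> graph_points X" if "t \<in> {0..1}" for t
    using continuous_map_image_subset_topspace[OF p] that topspace_RT by auto
  show ?thesis
  proof (rule path_htpyI)
    have "continuous_map (top_of_set ({0..1} \<times> {0..1})) (prod_topology (top_of_set {0..1}) RT) (\<lambda>z. (fst z, p (snd z)))"
      by (auto simp: continuous_map_pairwise o_def intro!: continuous_intros
          continuous_map_compose[OF _ p, unfolded o_def])
    from continuous_map_compose[OF this H(1)]
    show "continuous_map (top_of_set ({0..1} \<times> {0..1})) RT (\<lambda>z. H (fst z, p (snd z)))"
      by (simp add: o_def)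
    have "stretch (Inl v) = Inl v" by (simp add: stretch_def)
    then show "H (fst (s, 0), p (snd (s, 0))) = (stretch \<circ> p) 0" "H (fst (s, 1), p (snd (s, 1))) = (stretch \<circ> p) 1"
      if "s \<in> {0..1}" for s :: real
      using that H(4) assms by (simp_all add: loop_in_def)
  qed (use H pX in auto)
qed

definition edge_subgroup :: "(real \<Rightarrow> 'v + 'e \<times> real) set set" where
  "edge_subgroup = generate RG ((\<lambda>e. loop_class RT (Inl v) (edge_point X e)) ` arcs X)"

definition in_edge_subgroup :: "(real \<Rightarrow> 'v + 'e \<times> real) \<Rightarrow> bool" where
  "in_edge_subgroup p \<longleftrightarrow> loop_in RT (Inl v) p \<and> loop_class RT (Inl v) p \<in> edge_subgroup"

lemma in_edge_subgroup_htpy: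
  "in_edge_subgroup p \<Longrightarrow> path_htpy RT p q \<Longrightarrow> in_edge_subgroup q"
  using loop_class_eqI loop_in_htpy unfolding in_edge_subgroup_def by metis

lemma in_edge_subgroup_join: "in_edge_subgroup p \<Longrightarrow> in_edge_subgroup q \<Longrightarrow> in_edge_subgroup (p \<star> q)"
  unfolding in_edge_subgroup_def edge_subgroup_def
  using generate.eng[of "loop_class RT (Inl v) p" RG _ "loop_class RT (Inl v) q"]
  by (simp add: mult_fundamental_group loop_in_join)

lemma edge_classes_in_carrier: "(\<lambda>e. loop_class RT (Inl v) (edge_point X e)) ` arcs X \<subseteq> carrier RG"
  using loop_edge by (auto simp: carrier_fundamental_group)

lemma in_edge_subgroup_const: "in_edge_subgroup (\<lambda>_. Inl v)"
  unfolding in_edge_subgroup_def edge_subgroup_def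
  using generate.one[of RG] loop_in_const[OF base_point] by (simp add: one_fundamental_group)

lemma in_edge_subgroup_edge: "e \<in> arcs X \<Longrightarrow> in_edge_subgroup (edge_point X e)"
  unfolding in_edge_subgroup_def edge_subgroup_def by (simp add: loop_edge generate.incl)

lemma in_edge_subgroup_rev:
  assumes "in_edge_subgroup p"
  shows "in_edge_subgroup (path_rev p)"
proof -
  let ?S = "(\<lambda>e. loop_class RT (Inl v) (edge_point X e)) ` arcs X"
  have p: "loop_in RT (Inl v) p" "loop_class RT (Inl v) p \<in> generate RG ?S"
    using assms by (auto simp: in_edge_subgroup_def edge_subgroup_def)
  have "path_htpy RT (path_rev p \<star> p) (\<lambda>_. Inl v)"
    using path_htpy_rev_left[of RT p] p(1) by (simp add: loop_in_def)
  then have "loop_class RT (Inl v) (path_rev p) \<otimes>\<^bsub>RG\<^esub> loop_class RT (Inl v) p = \<one>\<^bsub>RG\<^esub>"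
    using p(1) loop_class_eqI[of RT "Inl v" "path_rev p \<star> p"]
    by (simp add: mult_fundamental_group loop_in_rev loop_in_join one_fundamental_group)
  then have "loop_class RT (Inl v) (path_rev p) = inv\<^bsub>RG\<^esub> loop_class RT (Inl v) p"
    using p(1) by (intro RG.inv_equality[symmetric]) (auto simp: carrier_fundamental_group loop_in_rev)
  also have "\<dots> \<in> generate RG ?S"
    using RG.generate_m_inv_closed[OF edge_classes_in_carrier p(2)] .
  finally show ?thesis
    using p(1) by (simp add: in_edge_subgroup_def edge_subgroup_def loop_in_rev)
qed

text \<open>In the interval paths are determined up to homotopy by their ends, so the loop is
  constant, the petal or its reverse.\<close>

lemma in_edge_subgroup_edge_path:
  assumes e: "e \<in> arcs X" and \<omega>: "continuous_on {0..1} \<omega>" "\<omega> \<in> {0..1} \<rightarrow> {0..1}"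
    and ends: "\<omega> 0 \<in> {0, 1}" "\<omega> 1 \<in> {0, 1}"
  shows "in_edge_subgroup (edge_point X e \<circ> \<omega>)"
proof -
  note reparam = path_htpy_reparam[OF pathin_edge_point[OF wf e] _ _ \<omega>]
  consider "\<omega> 0 = \<omega> 1" | "\<omega> 0 = 0" "\<omega> 1 = 1" | "\<omega> 0 = 1" "\<omega> 1 = 0" using ends by auto
  then show ?thesis
  proof cases
    case 1
    have eq: "edge_point X e \<circ> (\<lambda>_. \<omega> 0) = (\<lambda>_. Inl v)" using ends(1) e by auto
    have "path_htpy RT (edge_point X e \<circ> (\<lambda>_. \<omega> 0)) (edge_point X e \<circ> \<omega>)"
      using 1 \<omega>(2) by (intro reparam) auto
    then show ?thesis unfolding eq by (rule in_edge_subgroup_htpy[OF in_edge_subgroup_const])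
  next
    case 2
    have "path_htpy RT (edge_point X e \<circ> (\<lambda>t. t)) (edge_point X e \<circ> \<omega>)"
      using 2 by (intro reparam) auto
    then show ?thesis using in_edge_subgroup_edge[OF e] in_edge_subgroup_htpy by (simp add: o_def)
  next
    case 3
    have "path_htpy RT (edge_point X e \<circ> (\<lambda>t. 1 - t)) (edge_point X e \<circ> \<omega>)"
      using 3 by (intro reparam continuous_intros) auto
    then show ?thesis
      using in_edge_subgroup_rev[OF in_edge_subgroup_edge[OF e]] in_edge_subgroup_htpy
      by (simp add: o_def path_rev_def)
  qed
qed

text \<open>A path from the vertex to \<open>z\<close> inside one petal. It closes up pieces of a
  loop, so that they have classes in the fundamental group.\<close>

definition spoke :: "'v + 'e \<times> real \<Rightarrow> real \<Rightarrow> 'v + 'e \<times> real" where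
  "spoke z = (case z of Inl _ \<Rightarrow> (\<lambda>_. Inl v) | Inr (e, t) \<Rightarrow> (\<lambda>s. edge_point X e (s * t)))"

lemma spoke_edge_point:
  assumes "e \<in> arcs X" "t \<in> {0..1}"
  obtains \<omega> where "spoke (edge_point X e t) = edge_point X e \<circ> \<omega>" "continuous_on {0..1} \<omega>"
    "\<omega> \<in> {0..1} \<rightarrow> {0..1}" "\<omega> 0 \<in> {0, 1}" "\<omega> 1 = t"
proof (cases "t = 0 \<or> t = 1")
  case True
  show thesis
  proof
    show "spoke (edge_point X e t) = edge_point X e \<circ> (\<lambda>_. t)" using True assms by (auto simp: spoke_def)
  qed (use True in auto)
next
  case False
  then have t: "0 < t" "t < 1" using assms(2) by auto
  show thesis
  proof
    show "spoke (edge_point X e t) = edge_point X e \<circ> (\<lambda>s. s * t)"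
      using t by (auto simp: spoke_def edge_point_interior)
    show "continuous_on {0..1} (\<lambda>s. s * t)" by (intro continuous_intros)
    show "(\<lambda>s. s * t) \<in> {0..1} \<rightarrow> {0..1}" using t by (auto intro!: mult_le_one)
  qed (use t in auto)
qed

lemma spoke:
  assumes "z \<in> graph_points X"
  shows "pathin RT (spoke z)" "spoke z 0 = Inl v" "spoke z 1 = z"
proof -
  have "pathin RT (spoke z) \<and> spoke z 0 = Inl v \<and> spoke z 1 = z"
    using assms
  proof (cases rule: graph_points_cases)
    case (1 u)
    then show ?thesis using verts base_point by (simp add: spoke_def)
  next
    case (2 e t)
    then have t: "t \<in> {0..1}" by simp
    have "(\<lambda>s. s * t) \<in> {0..1} \<rightarrow> {0..1}" using 2 by (auto intro!: mult_le_one)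
    then have "pathin RT (edge_point X e \<circ> (\<lambda>s. s * t))"
      by (intro pathin_reparam[OF pathin_edge_point[OF wf 2(1)]] continuous_intros)
    then show ?thesis
      using 2 by (auto simp: spoke_def edge_point_interior o_def)
  qed
  then show "pathin RT (spoke z)" "spoke z 0 = Inl v" "spoke z 1 = z" by auto
qed

definition segment :: "(real \<Rightarrow> 'v + 'e \<times> real) \<Rightarrow> real \<Rightarrow> real \<Rightarrow> real \<Rightarrow> 'v + 'e \<times> real" where
  "segment p a b = p \<circ> (\<lambda>s. a + s * (b - a))"

lemma affine_in_interval:
  assumes "0 \<le> a" "a \<le> b" "b \<le> 1" "s \<in> {0..1}"
  shows "a \<le> a + s * (b - a)" "a + s * (b - a) \<le> b" "a + s * (b - a) \<in> {0..1::real}"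
proof -
  have "0 \<le> s * (b - a)" "s * (b - a) \<le> b - a" using assms by (auto intro: mult_left_le_one_le)
  then show "a \<le> a + s * (b - a)" "a + s * (b - a) \<le> b" "a + s * (b - a) \<in> {0..1::real}" using assms by auto
qed

lemma pathin_segment:
  assumes "pathin T p" "0 \<le> a" "a \<le> b" "b \<le> 1"
  shows "pathin T (p \<circ> (\<lambda>s. a + s * (b - a)))"
  using assms affine_in_interval[OF assms(2-4)] by (intro pathin_reparam continuous_intros) auto

definition closed_up :: "(real \<Rightarrow> 'v + 'e \<times> real) \<Rightarrow> real \<Rightarrow> real \<Rightarrow> real \<Rightarrow> 'v + 'e \<times> real" where
  "closed_up p a b = spoke (p a) \<star> segment p a b \<star> path_rev (spoke (p b))"

text \<open>The spoke to \<open>p b\<close> is run backwards at the end of the first piece and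
  forwards at the start of the second, and cancels.\<close>

lemma closed_up_trans:
  assumes p: "pathin RT p" and abc: "0 \<le> a" "a \<le> b" "b \<le> c" "c \<le> 1"
    and "in_edge_subgroup (closed_up p a b)" "in_edge_subgroup (closed_up p b c)"
  shows "in_edge_subgroup (closed_up p a c)"
proof (rule in_edge_subgroup_htpy[OF in_edge_subgroup_join[OF assms(6,7)]])
  have pX: "p t \<in> graph_points X" if "t \<in> {0..1}" for t
    using continuous_map_image_subset_topspace[OF p[unfolded pathin_def]] that topspace_RT by auto
  have P: "p a \<in> graph_points X" "p b \<in> graph_points X" "p c \<in> graph_points X" using pX abc by auto
  note s = spoke[OF P(1)] spoke[OF P(2)] spoke[OF P(3)]
  have seg: "pathin RT (segment p a b)" "pathin RT (segment p b c)" "pathin RT (segment p a c)"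
    unfolding segment_def using p abc by (auto intro!: pathin_segment)
  have ends: "segment p a b 0 = p a" "segment p a b 1 = p b" "segment p b c 0 = p b" "segment p b c 1 = p c"
    "segment p a c 0 = p a" "segment p a c 1 = p c"
    by (simp_all add: segment_def)
  have join: "path_htpy RT (segment p a b \<star> segment p b c) (segment p a c)"
  proof -
    have "path_htpy (top_of_set {0..1}) ((\<lambda>s. a + s * (b - a)) \<star> (\<lambda>s. b + s * (c - b))) (\<lambda>s. a + s * (c - a))"
      using abc pathin_segment[of "top_of_set {0..1}" "\<lambda>t. t"]
      by (intro path_htpy_convex pathin_loop_join) (auto simp: o_def pathin_def)
    from path_htpy_image[OF p[unfolded pathin_def] this]
    show ?thesis by (simp add: segment_def comp_loop_join)
  qed
  have "path_htpy RT (closed_up p a b \<star> closed_up p b c)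
      (spoke (p a) \<star> (segment p a b \<star> path_rev (spoke (p b))) \<star> closed_up p b c)"
    unfolding closed_up_def using s seg ends by (intro path_htpy_assoc pathin_loop_join pathin_rev) simp_all
  also have "path_htpy RT \<dots> (spoke (p a) \<star> segment p a b \<star> path_rev (spoke (p b)) \<star> closed_up p b c)"
    unfolding closed_up_def using s seg ends
    by (intro path_htpy_join path_htpy_refl path_htpy_assoc pathin_loop_join pathin_rev) simp_all
  also have "path_htpy RT \<dots> (spoke (p a) \<star> segment p a b \<star> segment p b c \<star> path_rev (spoke (p c)))"
    unfolding closed_up_def using s seg ends
    by (intro path_htpy_join path_htpy_refl path_htpy_cancel_rev' pathin_loop_join pathin_rev) simp_all
  also have "path_htpy RT \<dots> (spoke (p a) \<star> (segment p a b \<star> segment p b c) \<star> path_rev (spoke (p c)))"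
    using s seg ends
    by (intro path_htpy_join path_htpy_refl path_htpy_sym[OF path_htpy_assoc] pathin_loop_join pathin_rev) simp_all
  also have "path_htpy RT \<dots> (closed_up p a c)"
    unfolding closed_up_def using s seg ends join
    by (intro path_htpy_join path_htpy_refl pathin_rev) simp_all
  finally show "path_htpy RT (closed_up p a b \<star> closed_up p b c) (closed_up p a c)" .
qed

text \<open>The piece and both its spokes lie in the same closed petal, so the whole loop is the
  image of one path in the interval.\<close>

lemma closed_up_edge:
  assumes e: "e \<in> arcs X" and \<beta>: "continuous_on {a..b} \<beta>" "\<beta> \<in> {a..b} \<rightarrow> {0..1}"
    and p: "\<And>t. t \<in> {a..b} \<Longrightarrow> p t = edge_point X e (\<beta> t)" and ab: "0 \<le> a" "a \<le> b" "b \<le> 1"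
  shows "in_edge_subgroup (closed_up p a b)"
proof -
  have pa: "\<beta> a \<in> {0..1}" "p a = edge_point X e (\<beta> a)" using p[of a] \<beta>(2) ab by auto
  obtain \<omega>a where \<omega>a: "spoke (p a) = edge_point X e \<circ> \<omega>a" "continuous_on {0..1} \<omega>a"
    "\<omega>a \<in> {0..1} \<rightarrow> {0..1}" "\<omega>a 0 \<in> {0, 1}" "\<omega>a 1 = \<beta> a"
    unfolding pa(2) by (rule spoke_edge_point[OF e pa(1)])
  have pb: "\<beta> b \<in> {0..1}" "p b = edge_point X e (\<beta> b)" using p[of b] \<beta>(2) ab by auto
  obtain \<omega>b where \<omega>b: "spoke (p b) = edge_point X e \<circ> \<omega>b" "continuous_on {0..1} \<omega>b"
    "\<omega>b \<in> {0..1} \<rightarrow> {0..1}" "\<omega>b 0 \<in> {0, 1}" "\<omega>b 1 = \<beta> b"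
    unfolding pb(2) by (rule spoke_edge_point[OF e pb(1)])
  define \<sigma> where "\<sigma> = \<beta> \<circ> (\<lambda>s. a + s * (b - a))"
  have aff: "(\<lambda>s. a + s * (b - a)) \<in> {0..1} \<rightarrow> {a..b}"
    using affine_in_interval[OF ab] by auto
  have \<sigma>: "continuous_on {0..1} \<sigma>" "\<sigma> \<in> {0..1} \<rightarrow> {0..1}" "\<sigma> 0 = \<beta> a" "\<sigma> 1 = \<beta> b"
    unfolding \<sigma>_def using aff \<beta> by (auto intro!: continuous_on_compose2[OF \<beta>(1)] continuous_intros simp: o_def Pi_iff)
  have seg: "path_htpy RT (edge_point X e \<circ> \<sigma>) (segment p a b)"
  proof (rule path_htpy_cong)
    show "pathin RT (edge_point X e \<circ> \<sigma>)" using \<sigma> by (intro pathin_reparam pathin_edge_point[OF wf e])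
    show "(edge_point X e \<circ> \<sigma>) t = segment p a b t" if "t \<in> {0..1}" for t
      using p[OF funcset_mem[OF aff that]] by (simp add: \<sigma>_def segment_def)
  qed
  let ?I = "top_of_set {0..1::real}"
  have P: "pathin ?I (\<omega>a \<star> \<sigma> \<star> path_rev \<omega>b)"
    using \<omega>a \<omega>b \<sigma> by (intro pathin_loop_join pathin_rev) (auto simp: pathin_def)
  have "in_edge_subgroup (edge_point X e \<circ> (\<omega>a \<star> \<sigma> \<star> path_rev \<omega>b))"
    using P \<omega>a(4) \<omega>b(4) by (intro in_edge_subgroup_edge_path[OF e]) (auto simp: pathin_def)
  moreover have "path_htpy RT (edge_point X e \<circ> (\<omega>a \<star> \<sigma> \<star> path_rev \<omega>b)) (closed_up p a b)"
    unfolding closed_up_def \<omega>a(1) \<omega>b(1) comp_loop_join comp_path_rev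
    using \<omega>a \<omega>b \<sigma> seg
    by (intro path_htpy_join path_htpy_refl pathin_rev pathin_reparam pathin_edge_point[OF wf e]) simp_all
  ultimately show ?thesis by (rule in_edge_subgroup_htpy)
qed

lemma open_edge: "e \<in> arcs X \<Longrightarrow> open W \<Longrightarrow> openin RT (Inr ` ({e} \<times> (W \<inter> {0<..<1})))"
proof -
  assume e: "e \<in> arcs X" and W: "open W"
  have "{t \<in> {0..1}. edge_point X d t \<in> Inr ` ({e} \<times> (W \<inter> {0<..<1}))} =
      (if d = e then W \<inter> {0<..<1} else {})" for d
    by (auto simp: edge_point_def)
  moreover have "openin (top_of_set {0..1}) (W \<inter> {0<..<1::real})"
    using W by (intro open_subset) auto
  ultimately show ?thesis using e by (auto simp: openin_graph_top graph_points_def)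
qed

text \<open>The neighbourhood of the vertex that \<open>stretch\<close> maps to the vertex; the
  quarters are those of \<open>clamp\<close>.\<close>

definition star :: "('v + 'e \<times> real) set" where
  "star = insert (Inl v) (Inr ` (arcs X \<times> ({0<..<1/4} \<union> {3/4<..<1})))"

lemma open_star: "openin RT star"
proof -
  have "{t \<in> {0..1}. edge_point X d t \<in> star} = {0..1} \<inter> ({..<1/4} \<union> {3/4<..})" if "d \<in> arcs X" for d
    using that by (auto simp: edge_point_def star_def)
  moreover have "openin (top_of_set {0..1}) ({0..1} \<inter> ({..<1/4} \<union> {3/4<..} :: real set))"
    by (intro openin_open_Int open_Un) auto
  ultimately show ?thesis by (auto simp: openin_graph_top graph_points_def star_def verts)
qed

lemma stretch_star: "z \<in> star \<Longrightarrow> stretch z = Inl v"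
proof -
  assume "z \<in> star"
  then consider "z = Inl v" | e t where "z = Inr (e, t)" "e \<in> arcs X" "(0 < t \<and> t < 1/4) \<or> (3/4 < t \<and> t < 1)"
    by (auto simp: star_def)
  then show ?thesis
  proof cases
    case (2 e t)
    then have "clamp t = 0 \<or> clamp t = 1" using clamp(4)[of t] clamp(5)[of t] by auto
    then show ?thesis using 2 by (auto simp: stretch_def gmap_def)
  qed (simp add: stretch_def)
qed

lemma in_edge_subgroup_loop:
  assumes "loop_in RT (Inl v) p"
  shows "in_edge_subgroup p"
proof -
  have p: "continuous_map (top_of_set {0..1}) RT p" and p01: "p 0 = Inl v" "p 1 = Inl v"
    using assms by (auto simp: loop_in_def pathin_def)
  have pX: "p t \<in> graph_points X" if "t \<in> {0..1}" for t
    using continuous_map_image_subset_topspace[OF p] that topspace_RT by auto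
  define p' where "p' = stretch \<circ> p"
  have p': "pathin RT p'" unfolding p'_def pathin_def using p continuous_stretch by (rule continuous_map_compose)
  have nbhd: "\<exists>d>0. \<forall>t\<in>{0..1}. \<bar>t - x\<bar> < d \<longrightarrow> p t \<in> U" if "openin RT U" "p x \<in> U" "x \<in> {0..1}" for U x
  proof -
    have "openin (top_of_set {0..1}) {t \<in> {0..1}. p t \<in> U}"
      using openin_continuous_map_preimage[OF p that(1)] by simp
    then show ?thesis
      using that(2,3) unfolding openin_euclidean_subtopology_iff
      by (fastforce simp: dist_real_def abs_minus_commute)
  qed
  \<comment> \<open>The bounds stand inside \<open>?P\<close>, because the local claim of the
    bisection principle is about all small intervals around a point, even those that leave the unit
    interval.\<close>
  let ?P = "\<lambda>a b. 0 \<le> a \<longrightarrow> b \<le> 1 \<longrightarrow> in_edge_subgroup (closed_up p' a b)"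
  have "?P 0 1"
  proof (rule Bolzano[where P = ?P])
    show "?P a c" if "?P a b" "?P b c" "a \<le> b" "b \<le> c" for a b c
      using that closed_up_trans[OF p', of a b c] by auto
  next
    fix x :: real assume "0 \<le> x" "x \<le> 1"
    then have x: "x \<in> {0..1}" by simp
    consider "p x \<in> star" | e t where "e \<in> arcs X" "p x = Inr (e, t)" "0 < t" "t < 1"
      using pX[OF x] verts by (auto simp: star_def graph_points_def)
    then show "\<exists>d>0. \<forall>a b. a \<le> x \<and> x \<le> b \<and> b - a < d \<longrightarrow> ?P a b"
    proof cases
      case 1
      obtain d where d: "d > 0" "\<And>t. t \<in> {0..1} \<Longrightarrow> \<bar>t - x\<bar> < d \<Longrightarrow> p t \<in> star"
        using nbhd[OF open_star 1 x] by blast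
      have "in_edge_subgroup (closed_up p' a b)" if ab: "a \<le> x" "x \<le> b" "b - a < d" "0 \<le> a" "b \<le> 1" for a b
      proof -
        have *: "p' t = Inl v" if "t \<in> {a..b}" for t
        proof -
          have "t \<in> {0..1}" "\<bar>t - x\<bar> < d" using that ab by (auto simp: abs_if)
          then show ?thesis unfolding p'_def using d(2) by (simp add: stretch_star)
        qed
        have seg: "path_htpy RT (\<lambda>_. Inl v) (segment p' a b)"
          using ab base_point affine_in_interval[of a b] *
          by (intro path_htpy_cong) (auto simp: segment_def)
        have "path_htpy RT ((\<lambda>_. Inl v) \<star> (\<lambda>_. Inl v) \<star> path_rev (\<lambda>_. Inl v)) (closed_up p' a b)"
          unfolding closed_up_def using *[of a] *[of b] ab seg base_point
          by (intro path_htpy_join) (auto simp: spoke_def path_rev_def intro!: path_htpy_refl)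
        moreover have eq: "(\<lambda>_. Inl v) \<star> (\<lambda>_. Inl v) \<star> path_rev (\<lambda>_. Inl v) = (\<lambda>_. Inl v)"
          by (simp add: loop_join_def path_rev_def)
        ultimately show ?thesis unfolding eq by (intro in_edge_subgroup_htpy[OF in_edge_subgroup_const])
      qed
      then show ?thesis using d(1) by blast
    next
      case (2 e t0)
      let ?U = "Inr ` ({e} \<times> (UNIV \<inter> {0<..<1})) :: ('v + 'e \<times> real) set"
      obtain d where d: "d > 0" "\<And>t. t \<in> {0..1} \<Longrightarrow> \<bar>t - x\<bar> < d \<Longrightarrow> p t \<in> ?U"
        using nbhd[OF open_edge[OF 2(1) open_UNIV], of x] 2 x by auto
      have "in_edge_subgroup (closed_up p' a b)" if ab: "a \<le> x" "x \<le> b" "b - a < d" "0 \<le> a" "b \<le> 1" for a b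
      proof -
        \<comment> \<open>The coordinate along the petal. It is continuous because the points of the
          open petal with coordinate in an open set form an open subset of the graph.\<close>
        define \<beta> where "\<beta> t = snd (projr (p t))" for t
        have U: "p t \<in> ?U" if "t \<in> {a..b}" for t
        proof (rule d(2))
          show "t \<in> {0..1}" "\<bar>t - x\<bar> < d" using that ab by (auto simp: abs_if)
        qed
        have \<beta>: "p t = edge_point X e (\<beta> t)" "\<beta> t \<in> {0<..<1}" if "t \<in> {a..b}" for t
          using U[OF that] by (auto simp: \<beta>_def edge_point_interior)
        have "continuous_on {a..b} \<beta>"
          unfolding continuous_openin_preimage_eq
        proof (intro allI impI)
          fix W :: "real set" assume W: "open W"
          have "{a..b} \<subseteq> {0..1}" using ab by auto
          from openin_continuous_map_preimage[OF continuous_map_from_subtopology_mono[OF p this] open_edge[OF 2(1) W]]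
          have "openin (top_of_set {a..b}) {t \<in> {a..b}. p t \<in> Inr ` ({e} \<times> (W \<inter> {0<..<1}))}"
            by simp
          also have "{t \<in> {a..b}. p t \<in> Inr ` ({e} \<times> (W \<inter> {0<..<1}))} = {a..b} \<inter> \<beta> -` W"
          proof -
            have "p t = Inr (e, \<beta> t)" if "t \<in> {a..b}" for t
              using \<beta>[OF that] by (simp add: edge_point_interior)
            then show ?thesis using \<beta>(2) by auto
          qed
          finally show "openin (top_of_set {a..b}) ({a..b} \<inter> \<beta> -` W)" .
        qed
        then have c: "continuous_on {a..b} (\<lambda>t. clamp (\<beta> t))"
          by (intro continuous_on_compose2[OF continuous_clamp[of UNIV]]) auto
        have p'e: "p' t = edge_point X e (clamp (\<beta> t))" if "t \<in> {a..b}" for t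
          using \<beta>[OF that] stretch_edge_point[OF 2(1), of "\<beta> t"] by (simp add: p'_def)
        show ?thesis
          using clamp(1) ab by (intro closed_up_edge[OF 2(1) c _ p'e]) auto
      qed
      then show ?thesis using d(1) by blast
    qed
  qed simp
  then have "in_edge_subgroup (closed_up p' 0 1)" by simp
  moreover have "path_htpy RT (closed_up p' 0 1) p'"
  proof -
    have p'01: "p' 0 = Inl v" "p' 1 = Inl v" by (simp_all add: p'_def p01 stretch_def)
    have "closed_up p' 0 1 = (\<lambda>_. Inl v) \<star> p' \<star> (\<lambda>_. Inl v)"
      by (simp add: closed_up_def p'01 spoke_def segment_def path_rev_def o_def)
    moreover have "path_htpy RT ((\<lambda>_. Inl v) \<star> p' \<star> (\<lambda>_. Inl v)) (p' \<star> (\<lambda>_. Inl v))"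
      using p' p'01 base_point by (intro path_htpy_const_left pathin_loop_join) auto
    moreover have "path_htpy RT (p' \<star> (\<lambda>_. Inl v)) p'"
      using p' p'01 by (intro path_htpy_const_right)
    ultimately show ?thesis using path_htpy_trans by metis
  qed
  ultimately have "in_edge_subgroup p'" by (rule in_edge_subgroup_htpy)
  then show ?thesis
    using path_htpy_stretch[OF assms] unfolding p'_def by (rule in_edge_subgroup_htpy)
qed

text \<open>The rank is a \<open>LEAST\<close>, so the bound for finite generating sets says
  something about it only once such a set is known to exist; the petals provide one.\<close>

lemma group_rank_ge: "card (arcs X) \<le> group_rank RG"
proof -
  let ?S = "(\<lambda>e. loop_class RT (Inl v) (edge_point X e)) ` arcs X"
  have "carrier RG \<subseteq> generate RG ?S"
    using in_edge_subgroup_loop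
    by (auto simp: carrier_fundamental_group in_edge_subgroup_def edge_subgroup_def)
  then have "generating_set RG ?S"
    using RG.generate_incl[OF edge_classes_in_carrier] edge_classes_in_carrier
    by (auto simp: generating_set_def)
  then have "\<exists>S. finite S \<and> generating_set RG S \<and> card S = card ?S"
    by (intro exI[of _ ?S]) simp
  from LeastI[of "\<lambda>n. \<exists>S. finite S \<and> generating_set RG S \<and> card S = n", OF this]
  obtain S where "finite S" "generating_set RG S" "card S = group_rank RG"
    unfolding group_rank_def by blast
  then show ?thesis using card_generating_set_ge by metis
qed

end

section \<open>Homotopy classes of maps of graphs, described by deck transformations on the
  edges\<close>

section \<open>Graphs with deck transformations\<close>

lemma path_length_cong:
  assumes "\<And>t. t \<in> {0..1} \<Longrightarrow> p t = q t"
  shows "path_length d p = path_length d q"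
  unfolding path_length_eq poly_length_def
proof (intro SUP_cong sum.cong refl)
  fix ts :: "real list" and i
  assume "ts \<in> {ts. sorted ts \<and> set ts \<subseteq> {0..1}}" "i \<in> {..<length ts - 1}"
  then have ts: "set ts \<subseteq> {0..1}" "i < length ts" "Suc i < length ts" by auto
  then have "ts ! i \<in> {0..1}" "ts ! Suc i \<in> {0..1}"
    using nth_mem[OF ts(2)] nth_mem[OF ts(3)] by blast+
  then show "ennreal (d (p (ts ! i)) (p (ts ! Suc i))) = ennreal (d (q (ts ! i)) (q (ts ! Suc i)))"
    using assms by simp
qed

text \<open>The geodesic homotopy: corresponding points are joined by segments.\<close>

lemma path_htpy_hyp3:
  fixes P Q :: "real \<Rightarrow> hyp3"
  assumes P: "continuous_on {0..1} P" and Q: "continuous_on {0..1} Q" and "P 0 = Q 0" "P 1 = Q 1"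
  shows "path_htpy euclidean P Q"
proof (rule path_htpyI)
  have "continuous_on ({0..1} \<times> {0..1}) (\<lambda>z. hseg (P (snd z)) (Q (snd z)) (fst z))"
    by (intro continuous_on_hseg continuous_intros continuous_on_compose2[OF P] continuous_on_compose2[OF Q]) auto
  then show "continuous_map (top_of_set ({0..1} \<times> {0..1})) euclidean (\<lambda>z. hseg (P (snd z)) (Q (snd z)) (fst z))"
    by simp
qed (use assms in auto)

context kleinian
begin

text \<open>The map \<open>F\<close> has edges that lift to paths in \<open>hyp3\<close> from \<open>b (tail e)\<close> to \<open>lab e (b (head e))\<close>.
  So \<open>lab\<close> describes the homotopy class of \<open>F\<close>, and \<open>b\<close> the images of the vertices.\<close>

definition lifts_to :: "('v, 'e) pre_digraph \<Rightarrow> ('v + 'e \<times> real \<Rightarrow> hyp3 set) \<Rightarrow> ('e \<Rightarrow> hyp3 \<Rightarrow> hyp3) \<Rightarrow> ('v \<Rightarrow> hyp3) \<Rightarrow> bool" where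
  "lifts_to X F lab b \<longleftrightarrow> (\<forall>v\<in>verts X. F (Inl v) = orb (b v)) \<and>
     (\<forall>e\<in>arcs X. lab e \<in> \<Gamma> \<and> (\<exists>P. continuous_on {0..1} P \<and> P 0 = b (tail X e) \<and> P 1 = lab e (b (head X e)) \<and>
        (\<forall>t\<in>{0..1}. F (edge_point X e t) = orb (P t))))"

definition straight :: "('v, 'e) pre_digraph \<Rightarrow> ('e \<Rightarrow> hyp3 \<Rightarrow> hyp3) \<Rightarrow> ('v \<Rightarrow> hyp3) \<Rightarrow> 'v + 'e \<times> real \<Rightarrow> hyp3 set" where
  "straight X lab b = gmap (\<lambda>v. orb (b v)) (\<lambda>e t. orb (hseg (b (tail X e)) (lab e (b (head X e))) t))"

definition elen :: "('v, 'e) pre_digraph \<Rightarrow> ('e \<Rightarrow> hyp3 \<Rightarrow> hyp3) \<Rightarrow> ('v \<Rightarrow> hyp3) \<Rightarrow> 'e \<Rightarrow> real" where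
  "elen X lab b e = dist (b (tail X e)) (lab e (b (head X e)))"

lemma elen_nonneg [simp]: "0 \<le> elen X lab b e"
  by (simp add: elen_def)

lemma straight_edge_point:
  assumes "lab e \<in> \<Gamma>" "t \<in> {0..1}"
  shows "straight X lab b (edge_point X e t) = orb (hseg (b (tail X e)) (lab e (b (head X e))) t)"
  unfolding straight_def using assms by (intro gmap_edge_point) auto

lemma straight_Inl [simp]: "straight X lab b (Inl v) = orb (b v)"
  by (simp add: straight_def)

lemma lifts_to_straight:
  assumes "\<And>e. e \<in> arcs X \<Longrightarrow> lab e \<in> \<Gamma>"
  shows "lifts_to X (straight X lab b) lab b"
  unfolding lifts_to_def
proof (intro conjI ballI)
  fix e assume e: "e \<in> arcs X"
  show "\<exists>P. continuous_on {0..1} P \<and> P 0 = b (tail X e) \<and> P 1 = lab e (b (head X e)) \<and>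
        (\<forall>t\<in>{0..1}. straight X lab b (edge_point X e t) = orb (P t))"
    using straight_edge_point[where lab = lab and e = e and X = X and b = b, OF assms[OF e]]
    by (intro exI[of _ "hseg (b (tail X e)) (lab e (b (head X e)))"]) (auto intro!: continuous_intros)
qed (use assms in auto)

lemma continuous_map_lifts_to:
  assumes wf: "wf_digraph X" and F: "lifts_to X F lab b"
  shows "continuous_map (graph_top X) QT F"
  unfolding continuous_map_graph_iff[OF wf]
proof (intro conjI ballI)
  show "F (Inl v) \<in> topspace QT" if "v \<in> verts X" for v
    using F that by (simp add: lifts_to_def topspace_QT)
  show "pathin QT (F \<circ> edge_point X e)" if e: "e \<in> arcs X" for e
  proof -
    obtain P where P: "continuous_on {0..1} P" "\<forall>t\<in>{0..1}. F (edge_point X e t) = orb (P t)"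
      using F e unfolding lifts_to_def by blast
    show ?thesis
      unfolding pathin_def by (rule continuous_map_eq[OF continuous_map_orb_comp[OF P(1)]]) (use P(2) in auto)
  qed
qed

text \<open>Corresponding lifts are joined by segments. At the head of an edge both lifts are
  translated by the same label, and isometries map segments to segments, so the homotopies on the
  edges fit together.\<close>

lemma lifts_to_homotopic:
  assumes wf: "wf_digraph X" and F: "lifts_to X F lab b" and G: "lifts_to X G lab c"
  shows "homotopic_with (\<lambda>_. True) (graph_top X) QT F G"
proof -
  interpret wf_digraph X by fact
  have "\<exists>P. continuous_on {0..1} P \<and> P 0 = b (tail X e) \<and> P 1 = lab e (b (head X e)) \<and>
        (\<forall>t\<in>{0..1}. F (edge_point X e t) = orb (P t))" if "e \<in> arcs X" for e
    using F that unfolding lifts_to_def by blast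
  then obtain P where P: "\<And>e. e \<in> arcs X \<Longrightarrow> continuous_on {0..1} (P e) \<and> P e 0 = b (tail X e) \<and> P e 1 = lab e (b (head X e)) \<and>
        (\<forall>t\<in>{0..1}. F (edge_point X e t) = orb (P e t))" by metis
  have "\<exists>P. continuous_on {0..1} P \<and> P 0 = c (tail X e) \<and> P 1 = lab e (c (head X e)) \<and>
        (\<forall>t\<in>{0..1}. G (edge_point X e t) = orb (P t))" if "e \<in> arcs X" for e
    using G that unfolding lifts_to_def by blast
  then obtain Q where Q: "\<And>e. e \<in> arcs X \<Longrightarrow> continuous_on {0..1} (Q e) \<and> Q e 0 = c (tail X e) \<and> Q e 1 = lab e (c (head X e)) \<and>
        (\<forall>t\<in>{0..1}. G (edge_point X e t) = orb (Q e t))" by metis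
  have lab: "lab e \<in> \<Gamma>" if "e \<in> arcs X" for e using F that unfolding lifts_to_def by blast
  define H where "H = (\<lambda>(s, z). gmap (\<lambda>v. orb (hseg (b v) (c v) s)) (\<lambda>e t. orb (hseg (P e t) (Q e t) s)) z)"
  have He: "H (s, edge_point X e t) = orb (hseg (P e t) (Q e t) s)" if "e \<in> arcs X" "s \<in> {0..1}" "t \<in> {0..1}" for s e t
    unfolding H_def using P[OF that(1)] Q[OF that(1)] lab[OF that(1)] that
    by (simp add: gmap_edge_point hseg_\<Gamma>[symmetric])
  have "continuous_map (prod_topology (top_of_set {0..1::real}) (graph_top X)) QT H"
  proof (rule continuous_map_graph_homotopy[OF wf])
    show "pathin QT (\<lambda>s. H (s, Inl v))" if "v \<in> verts X" for v
      unfolding pathin_def H_def by (simp, intro continuous_map_orb_comp continuous_intros) auto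
    fix e assume e: "e \<in> arcs X"
    have snd: "continuous_on ({0..1} \<times> {0..1}) (\<lambda>z. R (snd z))" if "continuous_on {0..1::real} R"
      for R :: "real \<Rightarrow> hyp3"
      by (rule continuous_on_compose2[OF that]) (auto intro!: continuous_intros)
    have "continuous_on ({0..1} \<times> {0..1}) (\<lambda>z. hseg (P e (snd z)) (Q e (snd z)) (fst z))"
      using P[OF e] Q[OF e] snd[of "P e"] snd[of "Q e"] by (intro continuous_on_hseg) (auto intro!: continuous_intros)
    from continuous_map_orb_comp[OF this]
    show "continuous_map (top_of_set ({0..1} \<times> {0..1})) QT (\<lambda>(s, t). H (s, edge_point X e t))"
      by (rule continuous_map_eq) (auto simp: He[OF e])
  qed
  moreover have "H (0, z) = F z \<and> H (1, z) = G z" if "z \<in> topspace (graph_top X)" for z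
    using that unfolding topspace_graph_top[OF wf]
  proof (cases rule: graph_points_cases)
    case (1 v)
    then show ?thesis using F G by (simp add: H_def lifts_to_def)
  next
    case (2 e t)
    then show ?thesis using He[OF 2(1), of 0 t] He[OF 2(1), of 1 t] P[OF 2(1)] Q[OF 2(1)] by simp
  qed
  ultimately show ?thesis by (subst homotopic_with) auto
qed

lemma lifts_to_exists:
  assumes wf: "wf_digraph X" and F: "continuous_map (graph_top X) QT F"
  obtains lab b where "lifts_to X F lab b"
proof -
  interpret wf_digraph X by fact
  have cont: "F (Inl v) \<in> range orb" "e \<in> arcs X \<Longrightarrow> pathin QT (F \<circ> edge_point X e)" if "v \<in> verts X" for v e
    using F that unfolding continuous_map_graph_iff[OF wf] topspace_QT by blast+
  define b where "b v = (SOME x. orb x = F (Inl v))" for v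
  have b: "orb (b v) = F (Inl v)" if "v \<in> verts X" for v
    unfolding b_def using cont(1)[OF that] by (intro someI_ex[of "\<lambda>x. orb x = F (Inl v)"]) auto
  have "\<exists>\<gamma>\<in>\<Gamma>. \<exists>P. continuous_on {0..1} P \<and> P 0 = b (tail X e) \<and> P 1 = \<gamma> (b (head X e)) \<and>
        (\<forall>t\<in>{0..1}. F (edge_point X e t) = orb (P t))" if e: "e \<in> arcs X" for e
  proof -
    have "continuous_map (top_of_set {0..1}) QT (F \<circ> edge_point X e)"
      using cont(2)[of "tail X e" e] e by (simp add: pathin_def)
    then obtain P where P: "continuous_on {0..1} P" "P 0 = b (tail X e)"
      "\<And>t. t \<in> {0..1} \<Longrightarrow> orb (P t) = (F \<circ> edge_point X e) t"
      using lift_convex[of "{0..1::real}" 0 "F \<circ> edge_point X e" "b (tail X e)"] b e by auto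
    have "orb (b (head X e)) = orb (P 1)" using P(3)[of 1] b e by simp
    then obtain \<gamma> where "\<gamma> \<in> \<Gamma>" "P 1 = \<gamma> (b (head X e))" unfolding orb_eq_iff by blast
    then show ?thesis using P by (intro bexI[of _ \<gamma>] exI[of _ P]) auto
  qed
  then obtain lab where "\<And>e. e \<in> arcs X \<Longrightarrow> lab e \<in> \<Gamma> \<and> (\<exists>P. continuous_on {0..1} P \<and> P 0 = b (tail X e) \<and> P 1 = lab e (b (head X e)) \<and>
        (\<forall>t\<in>{0..1}. F (edge_point X e t) = orb (P t)))" by metis
  then have "lifts_to X F lab b" unfolding lifts_to_def using b by auto
  then show thesis by (rule that)
qed

text \<open>Labels do not change along a homotopy. Its lift to the square over an edge has, on the
  side of the head, a lift of the track of that vertex that starts at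
  \<open>lab e (b (head X e))\<close>; by uniqueness this is the translate by \<open>lab e\<close>
  of the lift chosen for the vertex.\<close>

lemma lifts_to_homotopy:
  assumes wf: "wf_digraph X" and F: "lifts_to X F lab b" and hom: "homotopic_with (\<lambda>_. True) (graph_top X) QT F G"
  obtains c where "lifts_to X G lab c"
proof -
  interpret wf_digraph X by fact
  let ?I = "{0..1::real}"
  obtain H :: "real \<times> _ \<Rightarrow> _" where H: "continuous_map (prod_topology (top_of_set ?I) (graph_top X)) QT H"
    "\<And>z. H (0, z) = F z" "\<And>z. H (1, z) = G z"
    using hom unfolding homotopic_with_def by auto
  have "\<exists>\<tau>. continuous_on ?I \<tau> \<and> \<tau> 0 = b v \<and> (\<forall>s\<in>?I. orb (\<tau> s) = H (s, Inl v))" if v: "v \<in> verts X" for v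
  proof -
    have "continuous_map (top_of_set ?I) (prod_topology (top_of_set ?I) (graph_top X)) (\<lambda>s. (s, Inl v))"
      using v topspace_graph_top[OF wf] by (intro continuous_map_pairedI) auto
    from continuous_map_compose[OF this H(1)]
    have c: "continuous_map (top_of_set ?I) QT (\<lambda>s. H (s, Inl v))" by (simp add: o_def)
    have "H (0, Inl v) = orb (b v)" using F v H(2) by (simp add: lifts_to_def)
    then show ?thesis using lift_convex[OF _ _ c, of 0 "b v"] by (metis atLeastAtMost_iff convex_real_interval(5) order_refl zero_le_one)
  qed
  then obtain \<tau> where \<tau>: "\<And>v. v \<in> verts X \<Longrightarrow> continuous_on ?I (\<tau> v) \<and> \<tau> v 0 = b v \<and> (\<forall>s\<in>?I. orb (\<tau> v s) = H (s, Inl v))"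
    by metis
  define c where "c v = \<tau> v 1" for v
  have "lab e \<in> \<Gamma> \<and> (\<exists>Q. continuous_on ?I Q \<and> Q 0 = c (tail X e) \<and> Q 1 = lab e (c (head X e)) \<and>
        (\<forall>t\<in>?I. G (edge_point X e t) = orb (Q t)))" if e: "e \<in> arcs X" for e
  proof
    show lab: "lab e \<in> \<Gamma>" using F e by (simp add: lifts_to_def)
    obtain P where P: "continuous_on ?I P" "P 0 = b (tail X e)" "P 1 = lab e (b (head X e))"
      "\<And>t. t \<in> ?I \<Longrightarrow> F (edge_point X e t) = orb (P t)"
      using F e unfolding lifts_to_def by blast
    have "continuous_map (top_of_set (?I \<times> ?I)) (prod_topology (top_of_set ?I) (graph_top X)) (\<lambda>z. (fst z, edge_point X e (snd z)))"
      using pathin_edge_point[OF wf e, unfolded pathin_def]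
      by (auto simp: continuous_map_pairwise o_def intro!: continuous_intros
          continuous_map_compose[where g = "edge_point X e" and f = snd, unfolded o_def])
    from continuous_map_compose[OF this H(1)]
    have c': "continuous_map (top_of_set (?I \<times> ?I)) QT (\<lambda>z. H (fst z, edge_point X e (snd z)))" by (simp add: o_def)
    have "H (fst (0, 0::real), edge_point X e (snd (0::real, 0))) = orb (b (tail X e))"
      using F e H(2) by (simp add: lifts_to_def)
    then obtain K where K: "continuous_on (?I \<times> ?I) K" "K (0, 0) = b (tail X e)"
      "\<And>z. z \<in> ?I \<times> ?I \<Longrightarrow> orb (K z) = H (fst z, edge_point X e (snd z))"
      using lift_convex[OF _ _ c', of "(0, 0)" "b (tail X e)"] by (auto intro: convex_Times)
    have side: "continuous_on ?I (\<lambda>s. K (s, t))" "continuous_on ?I (\<lambda>s. K (t, s))" if "t \<in> ?I" for t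
      using that by (auto intro!: continuous_on_compose2[OF K(1)] continuous_intros)
    have con: "Topological_Spaces.connected ?I" by simp
    have K0: "K (0, t) = P t" if "t \<in> ?I" for t
    proof (rule lift_unique[OF con _ P(1) _ _ _ that, where z = 0 and G = "\<lambda>t. K (0, t)"])
      show "orb (K (0, u)) = orb (P u)" if "u \<in> ?I" for u
        using K(3)[of "(0, u)"] P(4)[OF that] H(2) that by simp
    qed (use K(2) P(2) side(2)[of 0] in auto)
    have Kt: "K (s, 0) = \<tau> (tail X e) s" if "s \<in> ?I" for s
    proof (rule lift_unique[OF con _ _ _ _ _ that, where z = 0 and G = "\<lambda>s. K (s, 0)"])
      show "orb (K (u, 0)) = orb (\<tau> (tail X e) u)" if "u \<in> ?I" for u
        using K(3)[of "(u, 0)"] \<tau>[of "tail X e"] e that by simp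
    qed (use K(2) \<tau>[of "tail X e"] e side(1)[of 0] in auto)
    have Kh: "K (s, 1) = lab e (\<tau> (head X e) s)" if "s \<in> ?I" for s
    proof (rule lift_unique[OF con _ _ _ _ _ that, where z = 0 and G = "\<lambda>s. K (s, 1)" and G' = "\<lambda>s. lab e (\<tau> (head X e) s)"])
      show "continuous_on ?I (\<lambda>s. lab e (\<tau> (head X e) s))"
        using \<tau>[of "head X e"] e by (intro continuous_on_\<Gamma>[OF lab]) auto
      show "orb (K (u, 1)) = orb (lab e (\<tau> (head X e) u))" if "u \<in> ?I" for u
        using K(3)[of "(u, 1)"] \<tau>[of "head X e"] e lab that by simp
      show "K (0, 1) = lab e (\<tau> (head X e) 0)"
        using K0[of 1] P(3) \<tau>[of "head X e"] e by simp
    qed (use side(1)[of 1] in auto)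
    show "\<exists>Q. continuous_on ?I Q \<and> Q 0 = c (tail X e) \<and> Q 1 = lab e (c (head X e)) \<and>
        (\<forall>t\<in>?I. G (edge_point X e t) = orb (Q t))"
      using side(2)[of 1] Kt[of 1] Kh[of 1] K(3) H(3) by (intro exI[of _ "\<lambda>t. K (1, t)"]) (auto simp: c_def)
  qed
  moreover have "G (Inl v) = orb (c v)" if "v \<in> verts X" for v
    using \<tau>[OF that] H(3) by (simp add: c_def)
  ultimately have "lifts_to X G lab c" unfolding lifts_to_def by blast
  then show thesis by (rule that)
qed

lemma edge_length_ge:
  assumes "lifts_to X F lab b" "e \<in> arcs X"
  shows "ennreal (elen X lab b e) \<le> edge_length X F e"
proof -
  obtain P where P: "continuous_on {0..1} P" "P 0 = b (tail X e)" "P 1 = lab e (b (head X e))"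
    "\<And>t. t \<in> {0..1} \<Longrightarrow> F (edge_point X e t) = orb (P t)"
    using assms unfolding lifts_to_def by blast
  have "edge_length X F e = path_length setdist (\<lambda>t. orb (P t))"
    unfolding edge_length_def using P(4) by (intro path_length_cong) simp
  then show ?thesis
    using path_length_ge[OF P(1), of 0 1] P(2,3) by (simp add: elen_def)
qed

lemma edge_length_straight:
  assumes "lab e \<in> \<Gamma>"
  shows "edge_length X (straight X lab b) e \<le> ennreal (elen X lab b e)"
proof -
  have "edge_length X (straight X lab b) e = path_length setdist (\<lambda>t. orb (hseg (b (tail X e)) (lab e (b (head X e))) t))"
    unfolding edge_length_def using straight_edge_point[where lab = lab and e = e and X = X and b = b, OF assms]
    by (intro path_length_cong) simp
  then show ?thesis using path_length_hseg by (simp add: elen_def)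
qed

lemma graph_length_straight:
  assumes "\<And>e. e \<in> arcs X \<Longrightarrow> lab e \<in> \<Gamma>"
  shows "graph_length X (straight X lab b) \<le> ennreal (\<Sum>e\<in>arcs X. elen X lab b e)"
proof -
  have "graph_length X (straight X lab b) \<le> (\<Sum>e\<in>arcs X. ennreal (elen X lab b e))"
    unfolding graph_length_def by (intro sum_mono edge_length_straight assms)
  also have "\<dots> = ennreal (\<Sum>e\<in>arcs X. elen X lab b e)" by (rule sum_ennreal) simp
  finally show ?thesis .
qed

subsection \<open>Carrier graphs given by deck transformations\<close>

definition carrier_labels :: "('v, 'e) pre_digraph \<Rightarrow> ('v + 'e \<times> real \<Rightarrow> hyp3 set) \<Rightarrow> ('w, 'd) pre_digraph \<Rightarrow> ('d \<Rightarrow> hyp3 \<Rightarrow> hyp3) \<Rightarrow> bool" where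
  "carrier_labels X f Y lab \<longleftrightarrow> fin_digraph Y \<and> Digraph_Component.connected Y \<and> (\<forall>e\<in>arcs Y. lab e \<in> \<Gamma>) \<and>
     (\<forall>b. carrier_graph \<Gamma> Y (straight Y lab b) \<and> equivalent_carrier_graphs \<Gamma> X f Y (straight Y lab b))"

text \<open>One placement suffices, since straight maps with the same labels are homotopic.\<close>

lemma carrier_labelsI:
  assumes f: "carrier_graph \<Gamma> X f" and Y: "fin_digraph Y" "Digraph_Component.connected Y"
    and lab: "\<And>e. e \<in> arcs Y \<Longrightarrow> lab e \<in> \<Gamma>"
    and \<eta>: "homotopy_equivalence_map (graph_top X) (graph_top Y) \<eta>"
    and hom: "homotopic_with (\<lambda>_. True) (graph_top X) QT f (straight Y lab b \<circ> \<eta>)"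
  shows "carrier_labels X f Y lab"
  unfolding carrier_labels_def
proof (intro conjI ballI allI)
  fix c
  have wfX: "wf_digraph X" using f by (simp add: carrier_graph_def fin_digraph_def)
  have wf: "wf_digraph Y" using Y(1) by (simp add: fin_digraph_def)
  have c\<eta>: "continuous_map (graph_top X) (graph_top Y) \<eta>"
    using \<eta> by (simp add: homotopy_equivalence_map_def)
  have "homotopic_with (\<lambda>_. True) (graph_top Y) QT (straight Y lab b) (straight Y lab c)"
    by (intro lifts_to_homotopic[OF wf, where lab = lab and b = b and c = c] lifts_to_straight lab)
  then have "homotopic_with (\<lambda>_. True) (graph_top X) QT (straight Y lab b \<circ> \<eta>) (straight Y lab c \<circ> \<eta>)"
    using c\<eta> by (intro homotopic_with_compose_continuous_map_right[where p = "\<lambda>_. True"]) auto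
  then have hom': "homotopic_with (\<lambda>_. True) (graph_top X) QT f (straight Y lab c \<circ> \<eta>)"
    using hom homotopic_with_trans by blast
  then show "equivalent_carrier_graphs \<Gamma> X f Y (straight Y lab c)"
    using \<eta> unfolding equivalent_carrier_graphs_def by blast
  have cont: "continuous_map (graph_top Y) QT (straight Y lab c)"
    by (intro continuous_map_lifts_to[OF wf, where lab = lab and b = c] lifts_to_straight lab)
  have "edge_length Y (straight Y lab c) e < \<infinity>" if "e \<in> arcs Y" for e
    using edge_length_straight[where lab = lab and e = e and X = Y and b = c, OF lab[OF that]] by (metis ennreal_less_top infinity_ennreal_def le_less_trans)
  moreover have "\<forall>x\<in>topspace (graph_top X).
        induced_hom QT f x ` carrier (fundamental_group (graph_top X) x) = carrier (fundamental_group QT (f x)) \<and>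
        group_rank (fundamental_group (graph_top X) x) = group_rank (fundamental_group QT (f x))"
    using f topspace_graph_top[OF wfX] by (simp add: carrier_graph_def)
  from pi1_onto_homotopy_equivalence[OF \<eta> cont hom' this]
  have "\<forall>x\<in>graph_points Y. induced_hom QT (straight Y lab c) x ` carrier (fundamental_group (graph_top Y) x) =
          carrier (fundamental_group QT (straight Y lab c x)) \<and>
        group_rank (fundamental_group (graph_top Y) x) = group_rank (fundamental_group QT (straight Y lab c x))"
    using topspace_graph_top[OF wf] by simp
  ultimately show "carrier_graph \<Gamma> Y (straight Y lab c)"
    using Y cont by (simp add: carrier_graph_def)
qed (use Y lab in auto)

lemma carrier_labels_self:
  assumes f: "carrier_graph \<Gamma> X f" and lift: "lifts_to X f lab b"
  shows "carrier_labels X f X lab"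
proof (rule carrier_labelsI[OF f, where \<eta> = id and b = b])
  have wf: "wf_digraph X" using f by (simp add: carrier_graph_def fin_digraph_def)
  show "homotopy_equivalence_map (graph_top X) (graph_top X) id"
    by (rule homotopy_equivalence_mapI[where \<theta> = id]) simp_all
  show lab: "lab e \<in> \<Gamma>" if "e \<in> arcs X" for e using lift that by (simp add: lifts_to_def)
  then have "homotopic_with (\<lambda>_. True) (graph_top X) QT f (straight X lab b)"
    by (intro lifts_to_homotopic[OF wf lift, where c = b] lifts_to_straight)
  then show "homotopic_with (\<lambda>_. True) (graph_top X) QT f (straight X lab b \<circ> id)" by simp
qed (use f in \<open>auto simp: carrier_graph_def\<close>)

lemma carrier_labels_step:
  assumes f: "carrier_graph \<Gamma> X f" and adm: "carrier_labels X f Y lab"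
    and Z: "fin_digraph Z" "Digraph_Component.connected Z" and lab': "\<And>e. e \<in> arcs Z \<Longrightarrow> lab' e \<in> \<Gamma>"
    and \<eta>: "homotopy_equivalence_map (graph_top Y) (graph_top Z) \<eta>"
    and lift: "lifts_to Y (straight Z lab' b \<circ> \<eta>) lab c"
  shows "carrier_labels X f Z lab'"
proof -
  have wf: "wf_digraph Y" using adm by (simp add: carrier_labels_def fin_digraph_def)
  obtain \<zeta> where \<zeta>: "homotopy_equivalence_map (graph_top X) (graph_top Y) \<zeta>"
    "homotopic_with (\<lambda>_. True) (graph_top X) QT f (straight Y lab c \<circ> \<zeta>)"
    using adm unfolding carrier_labels_def equivalent_carrier_graphs_def by blast
  have "homotopic_with (\<lambda>_. True) (graph_top Y) QT (straight Y lab c) (straight Z lab' b \<circ> \<eta>)"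
    using adm by (intro lifts_to_homotopic[OF wf _ lift, where b = c] lifts_to_straight) (simp add: carrier_labels_def)
  then have "homotopic_with (\<lambda>_. True) (graph_top X) QT (straight Y lab c \<circ> \<zeta>) (straight Z lab' b \<circ> \<eta> \<circ> \<zeta>)"
    using \<zeta>(1) unfolding homotopy_equivalence_map_def
    by (intro homotopic_with_compose_continuous_map_right[where p = "\<lambda>_. True"]) auto
  then have "homotopic_with (\<lambda>_. True) (graph_top X) QT f (straight Z lab' b \<circ> (\<eta> \<circ> \<zeta>))"
    using \<zeta>(2) homotopic_with_trans by (metis comp_assoc)
  then show ?thesis
    using homotopy_equivalence_map_compose[OF \<zeta>(1) \<eta>] by (intro carrier_labelsI[OF f Z lab'])
qed

text \<open>A reversed edge gets the inverse label, because its lift has to be translated so that it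
  starts at the lift chosen for its new tail.\<close>

lemma carrier_labels_relabel:
  assumes f: "carrier_graph \<Gamma> X f" and adm: "carrier_labels X f Y lab" and Z: "fin_digraph Z" and R: "relabels Y i j D Z"
    and lab': "\<And>e. e \<in> arcs Y \<Longrightarrow> lab' (j e) = (if e \<in> D then finv (lab e) else lab e)"
  shows "carrier_labels X f Z lab'"
proof (rule carrier_labels_step[OF f adm Z])
  have wfY: "wf_digraph Y" using adm by (simp add: carrier_labels_def fin_digraph_def)
  interpret Y: wf_digraph Y by fact
  have wfZ: "wf_digraph Z" using Z by (simp add: fin_digraph_def)
  show "Digraph_Component.connected Z"
    using relabel_connected[OF wfY wfZ R] adm by (simp add: carrier_labels_def)
  show "homotopy_equivalence_map (graph_top Y) (graph_top Z) (relabel_map i j D Z)"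
    by (rule relabel_equivalence[OF wfY wfZ R])
  have lab: "lab e \<in> \<Gamma>" if "e \<in> arcs Y" for e using adm that by (simp add: carrier_labels_def)
  have j: "j e \<in> arcs Z" if "e \<in> arcs Y" for e using R that by (auto simp: relabels_def bij_betw_def)
  show lab'\<Gamma>: "lab' d \<in> \<Gamma>" if "d \<in> arcs Z" for d
  proof -
    have "d \<in> j ` arcs Y" using R that by (auto simp: relabels_def bij_betw_def)
    then show ?thesis using lab' lab inv_\<Gamma> by auto
  qed
  \<comment> \<open>An arbitrary placement: \<open>carrier_labels_step\<close> asks for a single
    one.\<close>
  let ?b = "\<lambda>w. undefined :: hyp3"
  have ends: "tail Z (j e) = i (if e \<in> D then head Y e else tail Y e)" "head Z (j e) = i (if e \<in> D then tail Y e else head Y e)"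
    if "e \<in> arcs Y" for e using R that by (auto simp: relabels_def)
  show "lifts_to Y (straight Z lab' ?b \<circ> relabel_map i j D Z) lab (\<lambda>v. ?b (i v))"
    unfolding lifts_to_def
  proof (intro conjI ballI)
    fix e assume e: "e \<in> arcs Y"
    show "lab e \<in> \<Gamma>" by (rule lab[OF e])
    let ?F = "straight Z lab' ?b \<circ> relabel_map i j D Z"
    have F: "?F (edge_point Y e t) = orb (hseg (?b (tail Z (j e))) (lab' (j e) (?b (head Z (j e)))) (if e \<in> D then 1 - t else t))"
      if "t \<in> {0..1}" for t
      using relabel_map_edge_point[OF R e that] lab'\<Gamma>[OF j[OF e]] that
      by (simp add: straight_edge_point[where lab = lab' and X = Z])
    show "\<exists>P. continuous_on {0..1} P \<and> P 0 = ?b (i (tail Y e)) \<and> P 1 = lab e (?b (i (head Y e))) \<and>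
        (\<forall>t\<in>{0..1}. ?F (edge_point Y e t) = orb (P t))"
    proof (cases "e \<in> D")
      case True
      show ?thesis
      proof (intro exI[of _ "\<lambda>t. lab e (hseg (?b (i (head Y e))) (finv (lab e) (?b (i (tail Y e)))) (1 - t))"] conjI ballI)
        show "continuous_on {0..1} (\<lambda>t. lab e (hseg (?b (i (head Y e))) (finv (lab e) (?b (i (tail Y e)))) (1 - t)))"
          by (intro continuous_on_\<Gamma>[OF lab[OF e]] continuous_intros) auto
        show "?F (edge_point Y e t) = orb (lab e (hseg (?b (i (head Y e))) (finv (lab e) (?b (i (tail Y e)))) (1 - t)))"
          if "t \<in> {0..1}" for t
          using F[OF that] True lab[OF e] lab'[OF e] ends[OF e] by simp
      qed (use lab[OF e] in auto)
    next
      case False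
      then show ?thesis
        using F lab'[OF e] ends[OF e]
        by (intro exI[of _ "hseg (?b (i (tail Y e))) (lab e (?b (i (head Y e))))"]) (auto intro!: continuous_intros)
    qed
  qed (simp add: relabel_map_def)
qed

text \<open>The lift of \<open>d\<close> followed by the new \<open>e\<close> ends where the old
  \<open>e\<close> ended, and the new edge is seen from the translate by \<open>lab d\<close>; this
  gives its label.\<close>

lemma carrier_labels_slide:
  assumes f: "carrier_graph \<Gamma> X f" and adm: "carrier_labels X f Y lab"
    and d: "d \<in> arcs Y" and e: "e \<in> arcs Y" and de: "d \<noteq> e" "tail Y d = tail Y e"
  shows "carrier_labels X f (slide Y d e) (lab(e := finv (lab d) \<circ> lab e))"
proof (rule carrier_labels_step[OF f adm])
  have fin: "fin_digraph Y" using adm by (simp add: carrier_labels_def)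
  have wf: "wf_digraph Y" using fin by (simp add: fin_digraph_def)
  let ?Z = "slide Y d e" and ?lab' = "lab(e := finv (lab d) \<circ> lab e)"
  show "fin_digraph ?Z" by (rule fin_slide[OF fin d])
  show "Digraph_Component.connected ?Z"
    using adm by (intro slide_connected[OF wf _ d e de]) (simp add: carrier_labels_def)
  show "homotopy_equivalence_map (graph_top Y) (graph_top ?Z) (slide_map Y d e)"
    by (rule slide_equivalence[OF wf d e de])
  have lab: "lab e \<in> \<Gamma>" if "e \<in> arcs Y" for e using adm that by (simp add: carrier_labels_def)
  show lab': "?lab' e' \<in> \<Gamma>" if "e' \<in> arcs ?Z" for e'
    using that lab d e by (auto intro: comp_\<Gamma> inv_\<Gamma>)
  let ?b = "\<lambda>w. undefined :: hyp3"
  let ?F = "straight ?Z ?lab' ?b \<circ> slide_map Y d e"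
  show "lifts_to Y ?F lab ?b"
    unfolding lifts_to_def
  proof (intro conjI ballI)
    fix e' assume e': "e' \<in> arcs Y"
    show "lab e' \<in> \<Gamma>" by (rule lab[OF e'])
    have S: "straight ?Z ?lab' ?b (edge_point ?Z e'' t) = orb (hseg (?b (tail ?Z e'')) (?lab' e'' (?b (head ?Z e''))) t)"
      if "t \<in> {0..1}" "e'' \<in> arcs Y" for t e''
      using that lab'[of e''] by (intro straight_edge_point) auto
    show "\<exists>P. continuous_on {0..1} P \<and> P 0 = ?b (tail Y e') \<and> P 1 = lab e' (?b (head Y e')) \<and>
        (\<forall>t\<in>{0..1}. ?F (edge_point Y e' t) = orb (P t))"
    proof (cases "e' = e")
      case True
      let ?p = "hseg (?b (tail Y d)) (lab d (?b (head Y d)))"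
      let ?q = "\<lambda>t. lab d (hseg (?b (head Y d)) (finv (lab d) (lab e (?b (head Y e)))) t)"
      have "continuous_on {0..1} ?p" "continuous_on {0..1} ?q"
        by (intro continuous_on_\<Gamma>[OF lab[OF d]] continuous_on_hseg; auto)+
      then have "pathin euclidean (?p \<star> ?q)"
        using lab[OF d] by (intro pathin_loop_join) (auto simp: pathin_def)
      then have "continuous_on {0..1} (?p \<star> ?q)" by (simp add: pathin_def)
      moreover have "?F (edge_point Y e t) = orb ((?p \<star> ?q) t)" if t: "t \<in> {0..1}" for t
      proof -
        have "slide_map Y d e (edge_point Y e t) = (edge_point ?Z d \<star> edge_point ?Z e) t"
          unfolding slide_map_def using t d e de by (subst gmap_edge_point) auto
        then show ?thesis
          using S[of "2 * t" d] S[of "2 * t - 1" e] t de d e lab[OF d] by (auto simp: loop_join_def)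
      qed
      ultimately show ?thesis using True de lab[OF d] by (intro exI[of _ "?p \<star> ?q"]) auto
    next
      case False
      have "slide_map Y d e (edge_point Y e' t) = edge_point ?Z e' t" if "t \<in> {0..1}" for t
        unfolding slide_map_def using False that by (subst gmap_edge_point) auto
      then show ?thesis
        using S[OF _ e'] False
        by (intro exI[of _ "hseg (?b (tail Y e')) (lab e' (?b (head Y e')))"]) (auto intro!: continuous_intros)
    qed
  qed (simp add: slide_map_def)
qed

text \<open>Collapsing identifies the ends of \<open>e\<close>, so the lift chosen for the head is
  replaced by its translate under \<open>lab e\<close>, where the lifted edge ends.\<close>

definition vertex_gauge :: "('v, 'e) pre_digraph \<Rightarrow> ('e \<Rightarrow> hyp3 \<Rightarrow> hyp3) \<Rightarrow> 'e \<Rightarrow> 'v \<Rightarrow> hyp3 \<Rightarrow> hyp3" where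
  "vertex_gauge Y lab e v = (if v = head Y e then lab e else id)"

text \<open>The effect of the new choice of lifts on the labels; that of \<open>e\<close> itself
  would become the identity if \<open>e\<close> is not a loop.\<close>

definition collapse_lab :: "('v, 'e) pre_digraph \<Rightarrow> ('e \<Rightarrow> hyp3 \<Rightarrow> hyp3) \<Rightarrow> 'e \<Rightarrow> 'e \<Rightarrow> hyp3 \<Rightarrow> hyp3" where
  "collapse_lab Y lab e d = vertex_gauge Y lab e (tail Y d) \<circ> lab d \<circ> finv (vertex_gauge Y lab e (head Y d))"

lemma carrier_labels_collapse:
  assumes f: "carrier_graph \<Gamma> X f" and adm: "carrier_labels X f Y lab"
    and e: "e \<in> arcs Y" "tail Y e \<noteq> head Y e"
  shows "carrier_labels X f (collapse Y e) (collapse_lab Y lab e)"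
proof (rule carrier_labels_step[OF f adm])
  have fin: "fin_digraph Y" using adm by (simp add: carrier_labels_def)
  have wf: "wf_digraph Y" using fin by (simp add: fin_digraph_def)
  let ?Z = "collapse Y e" and ?lab' = "collapse_lab Y lab e" and ?g = "vertex_gauge Y lab e" and ?\<rho> = "collapse_vertex Y e"
  show "fin_digraph ?Z" by (rule fin_collapse[OF fin e])
  show "Digraph_Component.connected ?Z"
    using adm by (intro collapse_connected[OF wf _ e]) (simp add: carrier_labels_def)
  show "homotopy_equivalence_map (graph_top Y) (graph_top ?Z) (collapse_map Y e)"
    by (rule collapse_equivalence[OF wf e])
  have lab: "lab e \<in> \<Gamma>" if "e \<in> arcs Y" for e using adm that by (simp add: carrier_labels_def)
  have g: "?g v \<in> \<Gamma>" for v using lab[OF e(1)] id_\<Gamma> by (simp add: vertex_gauge_def)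
  show lab': "?lab' d \<in> \<Gamma>" if "d \<in> arcs ?Z" for d
    unfolding collapse_lab_def using that g lab by (intro comp_\<Gamma> inv_\<Gamma>) auto
  let ?b = "\<lambda>w. undefined :: hyp3"
  let ?c = "\<lambda>v. finv (?g v) (?b (?\<rho> v))"
  let ?F = "straight ?Z ?lab' ?b \<circ> collapse_map Y e"
  show "lifts_to Y ?F lab ?c"
    unfolding lifts_to_def
  proof (intro conjI ballI)
    show "?F (Inl v) = orb (?c v)" if "v \<in> verts Y" for v
      using orb_\<Gamma>[OF inv_\<Gamma>[OF g]] by (simp add: collapse_map_def)
    fix d assume d: "d \<in> arcs Y"
    show "lab d \<in> \<Gamma>" by (rule lab[OF d])
    show "\<exists>P. continuous_on {0..1} P \<and> P 0 = ?c (tail Y d) \<and> P 1 = lab d (?c (head Y d)) \<and>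
        (\<forall>t\<in>{0..1}. ?F (edge_point Y d t) = orb (P t))"
    proof (cases "d = e")
      case True
      have "collapse_map Y e (edge_point Y e t) = Inl (tail Y e)" if "t \<in> {0..1}" for t
        unfolding collapse_map_def using that e by (subst gmap_edge_point) (auto simp: collapse_vertex_def)
      then show ?thesis
        using True e lab[OF e(1)]
        by (intro exI[of _ "\<lambda>_. ?b (tail Y e)"]) (auto simp: vertex_gauge_def collapse_vertex_def)
    next
      case False
      let ?h = "hseg (?b (?\<rho> (tail Y d))) (?lab' d (?b (?\<rho> (head Y d))))"
      have F: "?F (edge_point Y d t) = orb (?h t)" if "t \<in> {0..1}" for t
      proof -
        have "collapse_map Y e (edge_point Y d t) = edge_point ?Z d t"
          unfolding collapse_map_def using that False by (subst gmap_edge_point) auto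
        then show ?thesis using straight_edge_point[where lab = ?lab' and e = d and t = t and X = ?Z and b = ?b] lab'[of d] False d that by simp
      qed
      show ?thesis
      proof (intro exI[of _ "\<lambda>t. finv (?g (tail Y d)) (?h t)"] conjI ballI)
        show "continuous_on {0..1} (\<lambda>t. finv (?g (tail Y d)) (?h t))"
          by (intro continuous_on_\<Gamma>[OF inv_\<Gamma>[OF g]] continuous_intros) auto
        show "?F (edge_point Y d t) = orb (finv (?g (tail Y d)) (?h t))" if "t \<in> {0..1}" for t
          using F[OF that] orb_\<Gamma>[OF inv_\<Gamma>[OF g]] by simp
        show "finv (?g (tail Y d)) (?h 1) = lab d (?c (head Y d))"
          using g by (simp add: collapse_lab_def)
      qed simp
    qed
  qed
qed

end

section \<open>Deck transformations as homotopy classes, and loops with trivial label\<close>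

section \<open>Null-homotopic loops\<close>

lemma group_hyp3_isometries: "group hyp3_isometries"
proof (rule groupI)
  fix x assume x: "x \<in> carrier hyp3_isometries"
  then have d: "\<And>a b. dist (x a) (x b) = dist a b" and s: "surj x" by (auto simp: hyp3_isometries_def)
  have "inj x" by (rule injI) (metis d dist_eq_0_iff)
  have "surj (finv x)" using \<open>inj x\<close> by (metis inv_f_f surjI)
  moreover have "dist (finv x a) (finv x b) = dist a b" for a b
    using d[of "finv x a" "finv x b"] s by (simp add: surj_f_inv_f)
  ultimately show "\<exists>y\<in>carrier hyp3_isometries. y \<otimes>\<^bsub>hyp3_isometries\<^esub> x = \<one>\<^bsub>hyp3_isometries\<^esub>"
    using \<open>inj x\<close> by (intro bexI[of _ "finv x"]) (auto simp: hyp3_isometries_def)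
next
  fix x y assume "x \<in> carrier hyp3_isometries" "y \<in> carrier hyp3_isometries"
  then show "x \<otimes>\<^bsub>hyp3_isometries\<^esub> y \<in> carrier hyp3_isometries"
    using comp_surj[of y x] by (simp add: hyp3_isometries_def)
qed (auto simp: hyp3_isometries_def comp_assoc)

context kleinian
begin

text \<open>Makes lifting available for the intermediate quotient by a subgroup.\<close>

lemma kleinian_generate:
  assumes "S \<subseteq> \<Gamma>"
  shows "kleinian (generate hyp3_isometries S)" "generate hyp3_isometries S \<subseteq> \<Gamma>"
proof -
  interpret I: group hyp3_isometries by (rule group_hyp3_isometries)
  have S: "S \<subseteq> carrier hyp3_isometries" using assms subgroup.subset[OF subgroup_isometries] by blast
  show sub: "generate hyp3_isometries S \<subseteq> \<Gamma>"
    using I.generate_subgroup_incl[OF assms subgroup_isometries] .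
  show "kleinian (generate hyp3_isometries S)"
    using dtf sub I.generate_is_subgroup[OF S] discrete_subset[OF _ sub]
    unfolding kleinian_def discrete_torsion_free_def by blast
qed

text \<open>The element of the fundamental group that belongs to a deck transformation, for the lift
  \<open>x\<close> of the base point.\<close>

definition deck_class :: "hyp3 \<Rightarrow> (hyp3 \<Rightarrow> hyp3) \<Rightarrow> (real \<Rightarrow> hyp3 set) set" where
  "deck_class x \<gamma> = loop_class QT (orb x) (orb \<circ> hseg x (\<gamma> x))"

lemma loop_deck:
  assumes "\<gamma> \<in> \<Gamma>"
  shows "loop_in QT (orb x) (orb \<circ> hseg x (\<gamma> x))"
proof -
  have "continuous_on {0..1} (hseg x (\<gamma> x))"
    by (rule continuous_on_hseg) auto
  then show ?thesis
    using assms continuous_map_orb_comp[of "{0..1}" "hseg x (\<gamma> x)"] by (auto simp: loop_in_def pathin_def o_def)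
qed

lemma path_htpy_orb:
  assumes "continuous_on {0..1} P" "continuous_on {0..1} Q" "P 0 = Q 0" "P 1 = Q 1"
  shows "path_htpy QT (orb \<circ> P) (orb \<circ> Q)"
  by (rule path_htpy_image[OF continuous_map_orb path_htpy_hyp3[OF assms]])

lemma deck_class_mult:
  assumes "\<gamma> \<in> \<Gamma>" "\<delta> \<in> \<Gamma>"
  shows "deck_class x (\<gamma> \<circ> \<delta>) = deck_class x \<gamma> \<otimes>\<^bsub>fundamental_group QT (orb x)\<^esub> deck_class x \<delta>"
proof -
  let ?p = "hseg x (\<gamma> x)" and ?q = "\<lambda>t. \<gamma> (hseg x (\<delta> x) t)"
  have c: "continuous_on {0..1} ?p" "continuous_on {0..1} ?q"
    by (intro continuous_on_\<Gamma>[OF assms(1)] continuous_on_hseg; auto)+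
  then have "pathin euclidean (?p \<star> ?q)"
    by (intro pathin_loop_join) (auto simp: pathin_def)
  then have "path_htpy QT (orb \<circ> (?p \<star> ?q)) (orb \<circ> hseg x ((\<gamma> \<circ> \<delta>) x))"
    by (intro path_htpy_orb continuous_on_hseg) (auto simp: pathin_def)
  moreover have "orb \<circ> (?p \<star> ?q) = (orb \<circ> ?p) \<star> (orb \<circ> hseg x (\<delta> x))"
    unfolding comp_loop_join using assms(1) by (simp add: o_def)
  ultimately have "loop_class QT (orb x) ((orb \<circ> ?p) \<star> (orb \<circ> hseg x (\<delta> x))) = deck_class x (\<gamma> \<circ> \<delta>)"
    unfolding deck_class_def using loop_deck[OF assms(1)] loop_deck[OF assms(2)]
    by (intro loop_class_eqI loop_in_join) simp_all
  then show ?thesis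
    unfolding deck_class_def using loop_deck[OF assms(1)] loop_deck[OF assms(2)]
    by (simp add: mult_fundamental_group)
qed

lemma deck_class_in_carrier: "\<gamma> \<in> \<Gamma> \<Longrightarrow> deck_class x \<gamma> \<in> carrier (fundamental_group QT (orb x))"
  unfolding deck_class_def carrier_fundamental_group using loop_deck by blast

lemma deck_class_id: "deck_class x id = \<one>\<^bsub>fundamental_group QT (orb x)\<^esub>"
proof -
  have "path_htpy QT (orb \<circ> (\<lambda>_. x)) (orb \<circ> hseg x x)"
    by (intro path_htpy_orb continuous_on_hseg) auto
  then show ?thesis
    unfolding deck_class_def one_fundamental_group
    using loop_class_eqI[of QT "orb x" "\<lambda>_. orb x"] loop_in_const[of "orb x" QT] by (simp add: topspace_QT o_def)
qed

lemma deck_class_generate: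
  assumes S: "S \<subseteq> \<Gamma>" and \<gamma>: "\<gamma> \<in> generate hyp3_isometries S"
  shows "deck_class x \<gamma> \<in> generate (fundamental_group QT (orb x)) (deck_class x ` S)"
proof -
  let ?G = "fundamental_group QT (orb x)"
  interpret G: group ?G by (rule group_fundamental_group) (simp add: topspace_QT)
  show ?thesis
    using \<gamma>
  proof induction
    case one
    have "\<one>\<^bsub>hyp3_isometries\<^esub> = id" by (simp add: hyp3_isometries_def)
    then show ?case using generate.one[of ?G] deck_class_id[of x] by metis
  next
    case (incl h)
    then show ?case by (intro generate.incl) auto
  next
    case (inv h)
    then have h: "h \<in> \<Gamma>" using S by auto
    have "deck_class x (finv h) \<otimes>\<^bsub>?G\<^esub> deck_class x h = \<one>\<^bsub>?G\<^esub>"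
      using deck_class_mult[OF inv_\<Gamma>[OF h] h] deck_class_id h by simp
    then have "deck_class x (finv h) = inv\<^bsub>?G\<^esub> deck_class x h"
      using h inv_\<Gamma> by (intro G.inv_equality[symmetric] deck_class_in_carrier)
    then show ?case
      using generate.inv[of "deck_class x h" "deck_class x ` S" ?G] inv m_inv_\<Gamma>[OF h] by simp
  next
    case (eng h1 h2)
    then have "h1 \<in> \<Gamma>" "h2 \<in> \<Gamma>" using kleinian_generate(2)[OF S] by auto
    moreover have "h1 \<otimes>\<^bsub>hyp3_isometries\<^esub> h2 = h1 \<circ> h2" by (simp add: hyp3_isometries_def)
    ultimately show ?case
      using generate.eng[OF eng.IH] deck_class_mult[of h1 h2 x] by metis
  qed
qed

text \<open>All labels lie in the subgroup generated by \<open>S\<close>, so the map factors through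
  the intermediate quotient by that subgroup. Each class contains the image of a loop of the graph;
  its lift ends at a translate under the subgroup, so the class is that of a word in
  \<open>S\<close>.\<close>

lemma surjective_labels_generate:
  assumes wf: "wf_digraph Y" and v: "v \<in> verts Y" and b: "\<And>u. u \<in> verts Y \<Longrightarrow> b u = b v"
    and S: "S \<subseteq> \<Gamma>" "\<And>e. e \<in> arcs Y \<Longrightarrow> lab e \<in> generate hyp3_isometries S"
    and onto: "induced_hom QT (straight Y lab b) (Inl v) ` carrier (fundamental_group (graph_top Y) (Inl v)) =
      carrier (fundamental_group QT (orb (b v)))"
  shows "generating_set (fundamental_group QT (orb (b v))) (deck_class (b v) ` S)"
proof -
  let ?H = "generate hyp3_isometries S" and ?G = "fundamental_group QT (orb (b v))"
  interpret G: group ?G by (rule group_fundamental_group) (simp add: topspace_QT)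
  interpret sub: kleinian ?H by (rule kleinian_generate(1)[OF S(1)])
  have H: "?H \<subseteq> \<Gamma>" by (rule kleinian_generate(2)[OF S(1)])
  have lab: "lab e \<in> \<Gamma>" if "e \<in> arcs Y" for e using S(2)[OF that] H by blast
  let ?F = "straight Y lab b" and ?F' = "sub.straight Y lab b"
  have cF: "continuous_map (graph_top Y) QT ?F"
    by (intro continuous_map_lifts_to[OF wf, where lab = lab and b = b] lifts_to_straight lab)
  have cF': "continuous_map (graph_top Y) sub.QT ?F'"
    by (intro sub.continuous_map_lifts_to[OF wf, where lab = lab and b = b] sub.lifts_to_straight S(2))
  have FF': "orb x = ?F z" if "sub.orb x = ?F' z" "z \<in> graph_points Y" for x z
  proof -
    have *: "orb x = orb y" if "sub.orb x = sub.orb y" for x y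
      using that H unfolding sub.orb_eq_iff orb_eq_iff by blast
    show ?thesis
      using that(2)
    proof (cases rule: graph_points_cases)
      case (1 u)
      then show ?thesis using that(1) *[of x "b u"] by simp
    next
      case (2 e t)
      then show ?thesis
        using that(1) *[of x "hseg (b (tail Y e)) (lab e (b (head Y e))) t"] straight_edge_point[where lab = lab and e = e and t = t and X = Y and b = b, OF lab[OF 2(1)]]
          sub.straight_edge_point[where lab = lab and e = e and t = t and X = Y and b = b, OF S(2)[OF 2(1)]] by simp
    qed
  qed
  have "A \<in> generate ?G (deck_class (b v) ` S)" if A: "A \<in> carrier ?G" for A
  proof -
    obtain q where q: "loop_in QT (orb (b v)) q" "A = loop_class QT (orb (b v)) q"
      using A by (auto simp: carrier_fundamental_group)
    have "\<forall>q. loop_in QT (?F (Inl v)) q \<longrightarrow> (\<exists>p. loop_in (graph_top Y) (Inl v) p \<and> path_htpy QT (?F \<circ> p) q)"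
      using onto unfolding induced_hom_onto_iff[OF cF, symmetric] by simp
    then obtain p where p: "loop_in (graph_top Y) (Inl v) p" "path_htpy QT (?F \<circ> p) q"
      using q(1) by auto
    have pc: "continuous_map (top_of_set {0..1}) (graph_top Y) p" and p01: "p 0 = Inl v" "p 1 = Inl v"
      using p(1) by (auto simp: loop_in_def pathin_def)
    have pY: "p t \<in> graph_points Y" if "t \<in> {0..1}" for t
      using continuous_map_image_subset_topspace[OF pc] that topspace_graph_top[OF wf] by auto
    \<comment> \<open>The lift is taken from the intermediate quotient, so that its end is a
      translate by an element of \<open>?H\<close>.\<close>
    obtain P where P: "continuous_on {0..1} P" "P 0 = b v" "\<And>t. t \<in> {0..1} \<Longrightarrow> sub.orb (P t) = ?F' (p t)"
      using sub.lift_convex[of "{0..1::real}" 0 "?F' \<circ> p" "b v"] continuous_map_compose[OF pc cF'] p01 by auto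
    have "sub.orb (b v) = sub.orb (P 1)" using P(3)[of 1] p01 by simp
    then obtain \<gamma> where \<gamma>: "\<gamma> \<in> ?H" "P 1 = \<gamma> (b v)" unfolding sub.orb_eq_iff by blast
    then have \<gamma>\<Gamma>: "\<gamma> \<in> \<Gamma>" using H by blast
    have "path_htpy QT (orb \<circ> hseg (b v) (\<gamma> (b v))) (orb \<circ> P)"
      using P \<gamma> by (intro path_htpy_orb continuous_on_hseg) auto
    also have "path_htpy QT (orb \<circ> P) (?F \<circ> p)"
      using P(1) FF'[OF P(3) pY] continuous_map_orb_comp[OF P(1)]
      by (intro path_htpy_cong) (auto simp: pathin_def o_def)
    also have "path_htpy QT (?F \<circ> p) q" by (rule p(2))
    finally have "deck_class (b v) \<gamma> = A"
      unfolding deck_class_def q(2) by (intro loop_class_eqI loop_deck[OF \<gamma>\<Gamma>])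
    then show ?thesis using deck_class_generate[OF S(1) \<gamma>(1)] by metis
  qed
  moreover have "deck_class (b v) ` S \<subseteq> carrier ?G" using S(1) deck_class_in_carrier by auto
  ultimately show ?thesis
    unfolding generating_set_def using G.generate_incl by blast
qed

text \<open>After collapsing the edges that are not loops, the graph is a rose. The labels of the remaining petals then
  generate the fundamental group of the quotient, and there are fewer of them than the rank.\<close>

lemma no_trivial_loop:
  fixes Y :: "('w, 'd) pre_digraph"
  assumes f: "carrier_graph \<Gamma> X f"
  shows "carrier_labels X f Y lab \<Longrightarrow> e \<in> arcs Y \<Longrightarrow> tail Y e = head Y e \<Longrightarrow> lab e = id \<Longrightarrow> False"
proof (induction "card (verts Y)" arbitrary: Y lab rule: less_induct)
  case less
  note adm = less.prems(1) and e = less.prems(2-4)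
  have fin: "fin_digraph Y" and con: "Digraph_Component.connected Y" and lab: "\<And>d. d \<in> arcs Y \<Longrightarrow> lab d \<in> \<Gamma>"
    and carrier: "\<And>b. carrier_graph \<Gamma> Y (straight Y lab b)"
    using adm by (auto simp: carrier_labels_def)
  interpret fin_digraph Y by (rule fin)
  have wf: "wf_digraph Y" by unfold_locales
  show False
  proof (cases "\<exists>d\<in>arcs Y. tail Y d \<noteq> head Y d")
    case True
    then obtain d where d: "d \<in> arcs Y" "tail Y d \<noteq> head Y d" by blast
    have "verts (collapse Y d) \<subset> verts Y" using head_in_verts[OF d(1)] by auto
    from psubset_card_mono[OF finite_verts this]
    show False
    proof (rule less.hyps[OF _ carrier_labels_collapse[OF f adm d]])
      show "e \<in> arcs (collapse Y d)" using d(2) e(1,2) by auto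
      have g: "vertex_gauge Y lab d (head Y e) \<in> \<Gamma>"
        using lab[OF d(1)] id_\<Gamma> by (simp add: vertex_gauge_def)
      \<comment> \<open>The label of a loop is conjugated by the gauge of its vertex, so a trivial
        label stays trivial.\<close>
      show "collapse_lab Y lab d e = id"
        unfolding collapse_lab_def e(2,3) using inv_comp_\<Gamma>(2)[OF g] by simp
      show "tail (collapse Y d) e = head (collapse Y d) e" using e(2) by simp
    qed
  next
    case False
    define v where "v = tail Y e"
    have "{v} = verts Y"
      using con e(1) False unfolding connected_iff_cut[OF wf] by (auto simp: v_def)
    then interpret rose Y v by unfold_locales simp
    define b :: "'w \<Rightarrow> hyp3" where "b = (\<lambda>_. undefined)"
    \<comment> \<open>The label of \<open>e\<close> is the identity, so \<open>e\<close> can be left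
      out without losing generators.\<close>
    let ?S = "lab ` (arcs Y - {e})"
    let ?G = "fundamental_group QT (orb (b v))"
    have S: "?S \<subseteq> \<Gamma>" using lab by auto
    have "lab d \<in> generate hyp3_isometries ?S" if "d \<in> arcs Y" for d
      using that e(3) generate.one[of hyp3_isometries ?S]
      by (cases "d = e") (auto simp: hyp3_isometries_def intro: generate.incl)
    moreover have onto: "induced_hom QT (straight Y lab b) (Inl v) ` carrier (fundamental_group (graph_top Y) (Inl v)) = carrier ?G"
      and rank: "group_rank (fundamental_group (graph_top Y) (Inl v)) = group_rank ?G"
      using carrier[of b] verts unfolding carrier_graph_def by auto
    ultimately have "generating_set ?G (deck_class (b v) ` ?S)"
      using verts by (intro surjective_labels_generate[OF wf _ _ S]) (auto simp: b_def)
    then have "\<exists>T. finite T \<and> generating_set ?G T \<and> card T = card (deck_class (b v) ` ?S)"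
      by (intro exI[of _ "deck_class (b v) ` ?S"]) simp
    then have "group_rank ?G \<le> card (deck_class (b v) ` ?S)"
      unfolding group_rank_def by (rule Least_le)
    also have "\<dots> \<le> card (arcs Y - {e})"
      by (meson card_image_le finite_Diff finite_arcs finite_imageI le_trans)
    also have "\<dots> < card (arcs Y)" by (rule card_Diff1_less[OF finite_arcs e(1)])
    also have "\<dots> \<le> group_rank ?G" using group_rank_ge rank by simp
    finally show False by simp
  qed
qed

end

section \<open>Equality in convexity, and shortening by a slide\<close>

section \<open>Rigidity of minimal carrier graphs\<close>

text \<open>The ends of edges at \<open>v\<close>, with \<open>True\<close> for a tail and
  \<open>False\<close> for a head; so a loop occurs twice.\<close>

definition half_edges :: "('v, 'e) pre_digraph \<Rightarrow> 'v \<Rightarrow> ('e \<times> bool) set" where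
  "half_edges Y v = {h. fst h \<in> arcs Y \<and> v = (if snd h then tail Y (fst h) else head Y (fst h))}"

lemma half_edges_cases:
  assumes "h \<in> half_edges Y v"
  obtains e where "h = (e, True)" "e \<in> arcs Y" "tail Y e = v" | e where "h = (e, False)" "e \<in> arcs Y" "head Y e = v"
  using assms unfolding half_edges_def by (cases h; cases "snd h") auto

lemma finite_half_edges:
  assumes "fin_digraph Y"
  shows "finite (half_edges Y v)"
proof -
  interpret fin_digraph Y by fact
  have "half_edges Y v \<subseteq> arcs Y \<times> UNIV" by (auto simp: half_edges_def)
  then show ?thesis by (rule finite_subset) simp
qed

lemma card_half_edges:
  assumes "fin_digraph Y"
  shows "card (half_edges Y v) = valence Y v"
proof -
  interpret fin_digraph Y by fact
  have "half_edges Y v = (\<lambda>e. (e, True)) ` out_arcs Y v \<union> (\<lambda>e. (e, False)) ` in_arcs Y v"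
    by (auto simp: half_edges_def image_iff)
  moreover have "card ((\<lambda>e. (e, True)) ` out_arcs Y v \<union> (\<lambda>e. (e, False)) ` in_arcs Y v) =
      card (out_arcs Y v) + card (in_arcs Y v)"
    by (subst card_Un_disjoint) (auto simp: card_image inj_on_def finite_out_arcs finite_in_arcs)
  ultimately show ?thesis by (simp add: valence_def in_degree_def out_degree_def)
qed

text \<open>The merged vertex loses only the two ends of \<open>e\<close>, and
  \<open>3 + 3 - 2\<close> is still at least 3.\<close>

lemma half_edges_collapse:
  assumes fin: "fin_digraph Y" and e: "e \<in> arcs Y" "tail Y e \<noteq> head Y e"
    and val: "\<And>v. v \<in> verts Y \<Longrightarrow> 3 \<le> card (half_edges Y v)" and v: "v \<in> verts Y" "v \<noteq> head Y e"
  shows "3 \<le> card (half_edges (collapse Y e) v)"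
proof (cases "v = tail Y e")
  case False
  then have "half_edges (collapse Y e) v = half_edges Y v"
    using v by (auto simp: half_edges_def collapse_vertex_def split: if_splits)
  then show ?thesis using val v(1) by simp
next
  case True
  interpret fin_digraph Y by fact
  let ?A = "half_edges Y (tail Y e)" and ?B = "half_edges Y (head Y e)"
  have eq: "half_edges (collapse Y e) v = (?A \<union> ?B) - {(e, True), (e, False)}"
  proof -
    have "(d, s) \<in> half_edges (collapse Y e) v \<longleftrightarrow> (d, s) \<in> (?A \<union> ?B) - {(e, True), (e, False)}" for d s
      using True by (cases s; cases "d = e") (auto simp: half_edges_def collapse_vertex_def)
    then show ?thesis by auto
  qed
  have "?A \<inter> ?B = {}" using e(2) by (auto simp: half_edges_def split: if_splits)
  then have "card (?A \<union> ?B) = card ?A + card ?B"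
    using finite_half_edges[OF fin] by (intro card_Un_disjoint) auto
  moreover have "3 \<le> card ?A" "3 \<le> card ?B" using val e(1) by auto
  moreover have "card (?A \<union> ?B) - card {(e, True), (e, False)} \<le> card (?A \<union> ?B - {(e, True), (e, False)})"
    by (rule diff_card_le_card_Diff) simp
  ultimately show ?thesis by (simp add: eq)
qed

context kleinian
begin

text \<open>The other end of the lift of a half-edge that starts at the chosen lift of its
  vertex.\<close>

definition far_end :: "('v, 'e) pre_digraph \<Rightarrow> ('e \<Rightarrow> hyp3 \<Rightarrow> hyp3) \<Rightarrow> ('v \<Rightarrow> hyp3) \<Rightarrow> 'e \<times> bool \<Rightarrow> hyp3" where
  "far_end Y lab b h = (if snd h then lab (fst h) (b (head Y (fst h))) else finv (lab (fst h)) (b (tail Y (fst h))))"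

lemma dist_far_end:
  assumes "h \<in> half_edges Y v" "\<And>e. e \<in> arcs Y \<Longrightarrow> lab e \<in> \<Gamma>"
  shows "dist (b v) (far_end Y lab b h) = elen Y lab b (fst h)"
  using assms(1)
proof (cases rule: half_edges_cases)
  case (2 e)
  have "dist (b v) (finv (lab e) (b (tail Y e))) = dist (lab e (b v)) (lab e (finv (lab e) (b (tail Y e))))"
    using dist_\<Gamma>[OF assms(2)[OF 2(2)]] by simp
  also have "\<dots> = elen Y lab b e"
    using assms(2)[OF 2(2)] 2 by (simp add: elen_def dist_commute)
  finally show ?thesis using 2 by (simp add: far_end_def)
qed (simp add: far_end_def elen_def)

text \<open>The edge \<open>e\<close> overlaps the edge \<open>d\<close> near \<open>v\<close>; sliding the end of \<open>e\<close> along \<open>d\<close> removes the overlap.\<close>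

lemma shorten_overlap:
  fixes Y :: "('w, 'd) pre_digraph"
  assumes f: "carrier_graph \<Gamma> X f" and adm: "carrier_labels X f Y lab"
    and h: "h1 \<in> half_edges Y v" "h2 \<in> half_edges Y v" "fst h1 \<noteq> fst h2"
    and pos: "0 < elen Y lab b (fst h1)"
    and overlap: "dist (far_end Y lab b h1) (far_end Y lab b h2) = elen Y lab b (fst h2) - elen Y lab b (fst h1)"
  obtains Z :: "('w, 'd) pre_digraph" and lab' where "carrier_labels X f Z lab'"
    "(\<Sum>e\<in>arcs Z. elen Z lab' b e) < (\<Sum>e\<in>arcs Y. elen Y lab b e)"
proof -
  have fin: "fin_digraph Y" using adm by (simp add: carrier_labels_def)
  interpret fin_digraph Y by fact
  have lab: "lab e \<in> \<Gamma>" if "e \<in> arcs Y" for e using adm that by (simp add: carrier_labels_def)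
  let ?d = "fst h1" and ?e = "fst h2"
  \<comment> \<open>The edges that enter \<open>v\<close> with the given half-edge are reversed, so
    that both start at \<open>v\<close>. As the two edges differ, the choices do not
    conflict.\<close>
  define D where "D = {e. (e, False) \<in> {h1, h2}}"
  define Z where "Z = Y\<lparr>tail := \<lambda>e. if e \<in> D then head Y e else tail Y e, head := \<lambda>e. if e \<in> D then tail Y e else head Y e\<rparr>"
  define lab1 where "lab1 e = (if e \<in> D then finv (lab e) else lab e)" for e
  have Z: "verts Z = verts Y" "arcs Z = arcs Y" "\<And>e. tail Z e = (if e \<in> D then head Y e else tail Y e)"
    "\<And>e. head Z e = (if e \<in> D then tail Y e else head Y e)"
    by (simp_all add: Z_def)
  have finZ: "fin_digraph Z" by unfold_locales (auto simp: Z)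
  have adm1: "carrier_labels X f Z lab1"
    by (rule carrier_labels_relabel[OF f adm finZ, where i = id and j = id and D = D]) (auto simp: relabels_def Z lab1_def)
  have D: "?d \<in> D \<longleftrightarrow> \<not> snd h1" "?e \<in> D \<longleftrightarrow> \<not> snd h2"
    using h(3) by (cases h1; cases h2; auto simp: D_def)+
  have tails: "tail Z ?d = v" "tail Z ?e = v" and arcs: "?d \<in> arcs Y" "?e \<in> arcs Y"
    using h(1,2) by (auto simp: Z D half_edges_def)
  have far: "lab1 ?d (b (head Z ?d)) = far_end Y lab b h1" "lab1 ?e (b (head Z ?e)) = far_end Y lab b h2"
    by (auto simp: Z D far_end_def lab1_def)
  have elen: "elen Z lab1 b e = elen Y lab b e" if e: "e \<in> arcs Y" for e
  proof (cases "e \<in> D")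
    case True
    have "dist (b (head Y e)) (finv (lab e) (b (tail Y e))) = dist (lab e (b (head Y e))) (lab e (finv (lab e) (b (tail Y e))))"
      using dist_\<Gamma>[OF lab[OF e]] by simp
    then show ?thesis using True lab[OF e] by (simp add: elen_def Z lab1_def dist_commute)
  qed (simp add: elen_def Z lab1_def)
  let ?lab' = "lab1(?e := finv (lab1 ?d) \<circ> lab1 ?e)"
  have lab1: "lab1 ?d \<in> \<Gamma>" using lab[OF arcs(1)] by (simp add: lab1_def inv_\<Gamma>)
  have adm2: "carrier_labels X f (slide Z ?d ?e) ?lab'"
    using arcs tails h(3) by (intro carrier_labels_slide[OF f adm1]) (simp_all add: Z(2))
  \<comment> \<open>After the slide a translate of \<open>e\<close> joins the two far ends, whose
    distance is known from the overlap.\<close>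
  have "elen (slide Z ?d ?e) ?lab' b ?e = dist (lab1 ?d (b (head Z ?d))) (lab1 ?d (finv (lab1 ?d) (lab1 ?e (b (head Z ?e)))))"
    using dist_\<Gamma>[OF lab1] by (simp add: elen_def)
  also have "\<dots> = elen Y lab b ?e - elen Y lab b ?d"
    using lab1 overlap by (simp add: far)
  finally have e: "elen (slide Z ?d ?e) ?lab' b ?e < elen Y lab b ?e" using pos by simp
  have other: "elen (slide Z ?d ?e) ?lab' b e' = elen Y lab b e'" if "e' \<in> arcs Y" "e' \<noteq> ?e" for e'
    using elen[OF that(1)] that(2) by (simp add: elen_def)
  have "(\<Sum>e'\<in>arcs Y. elen (slide Z ?d ?e) ?lab' b e') < (\<Sum>e\<in>arcs Y. elen Y lab b e)"
    using arcs(2) e other by (intro sum_strict_mono_ex1) (metis finite_arcs, metis less_imp_le order.refl, blast)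
  then show ?thesis using that[OF adm2] by (simp add: Z(2))
qed

lemma collapse_vertex_gauge:
  assumes "c (tail Y e) = lab e (c (head Y e))"
  shows "c (collapse_vertex Y e u) = vertex_gauge Y lab e u (c u)"
  using assms by (simp add: collapse_vertex_def vertex_gauge_def)

text \<open>If \<open>e\<close> has length 0, the new lift of the removed vertex is already the
  position of the tail, so the same placement serves for the collapsed graph.\<close>

lemma elen_collapse:
  assumes "lab e \<in> \<Gamma>" "lab d \<in> \<Gamma>" "elen Y lab c e = 0"
  shows "elen (collapse Y e) (collapse_lab Y lab e) c d = elen Y lab c d"
proof -
  have g: "vertex_gauge Y lab e u \<in> \<Gamma>" for u using assms(1) by (simp add: vertex_gauge_def id_\<Gamma>)
  have c: "c (collapse_vertex Y e u) = vertex_gauge Y lab e u (c u)" for u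
    using assms(3) by (intro collapse_vertex_gauge) (simp add: elen_def)
  show ?thesis
    using g dist_\<Gamma>[OF g] by (simp add: elen_def collapse_lab_def c)
qed

text \<open>The midpoints of the displaced vertices give another shortest graph. At a displaced vertex, the equality
  case of the midpoint inequality puts all its edges on the line of the displacement, so of three half-edges
  two leave in the same direction.\<close>

lemma displaced_vertex_contradiction:
  fixes Y :: "('w, 'd) pre_digraph" and a a' :: "'w \<Rightarrow> hyp3"
  defines "m \<equiv> \<lambda>v. hmid (a v) (a' v)"
  assumes f: "carrier_graph \<Gamma> X f"
    and least: "\<And>(Z :: ('w, 'd) pre_digraph) lab b. carrier_labels X f Z lab \<Longrightarrow> L \<le> (\<Sum>e\<in>arcs Z. elen Z lab b e)"
  shows "\<lbrakk>carrier_labels X f Y lab; \<And>v. v \<in> verts Y \<Longrightarrow> 3 \<le> card (half_edges Y v);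
    \<And>e. e \<in> arcs Y \<Longrightarrow> 2 * elen Y lab m e = elen Y lab a e + elen Y lab a' e;
    (\<Sum>e\<in>arcs Y. elen Y lab m e) \<le> L; v \<in> verts Y; a v \<noteq> a' v\<rbrakk> \<Longrightarrow> False"
proof (induction "card (arcs Y)" arbitrary: Y lab v rule: less_induct)
  case less
  note adm = less.prems(1) and val = less.prems(2) and mid = less.prems(3) and le = less.prems(4) and v = less.prems(5,6)
  have fin: "fin_digraph Y" using adm by (simp add: carrier_labels_def)
  interpret fin_digraph Y by fact
  have lab: "lab e \<in> \<Gamma>" if "e \<in> arcs Y" for e using adm that by (simp add: carrier_labels_def)
  show False
  proof (cases "\<exists>e\<in>arcs Y. elen Y lab m e = 0")
    case True
    then obtain e where e: "e \<in> arcs Y" "elen Y lab m e = 0" by blast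
    \<comment> \<open>The equality \<open>mid\<close> passes degeneracy on to both original
      placements, so the collapse leaves all three placements meaningful.\<close>
    then have 0: "elen Y lab a e = 0" "elen Y lab a' e = 0"
      using mid[OF e(1)] elen_nonneg[of Y lab a e] elen_nonneg[of Y lab a' e] by linarith+
    show False
    proof (cases "tail Y e = head Y e")
      case True
      then have "lab e (m (head Y e)) = m (head Y e)" using e(2) by (simp add: elen_def)
      then have "lab e = id" by (rule free_action[OF lab[OF e(1)]])
      then show False using no_trivial_loop[OF f adm e(1) True] by simp
    next
      case False
      let ?Y = "collapse Y e" and ?lab = "collapse_lab Y lab e"
      have sum: "(\<Sum>d\<in>arcs ?Y. elen ?Y ?lab m d) \<le> (\<Sum>d\<in>arcs Y. elen Y lab m d)"
        using elen_collapse[OF lab[OF e(1)] lab e(2)] by (simp add: sum_mono2)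
      have g: "vertex_gauge Y lab e v \<in> \<Gamma>" using lab[OF e(1)] by (simp add: vertex_gauge_def id_\<Gamma>)
      \<comment> \<open>Both positions are moved by the same gauge, so the vertex remains
        displaced.\<close>
      have "a (collapse_vertex Y e v) = vertex_gauge Y lab e v (a v)" "a' (collapse_vertex Y e v) = vertex_gauge Y lab e v (a' v)"
        using 0 by (intro collapse_vertex_gauge; simp add: elen_def)+
      then have ne: "a (collapse_vertex Y e v) \<noteq> a' (collapse_vertex Y e v)"
        using dist_\<Gamma>[OF g, of "a v" "a' v"] v(2) by (metis dist_eq_0_iff)
      show False
      proof (rule less.hyps[of ?Y ?lab "collapse_vertex Y e v"])
        show "card (arcs ?Y) < card (arcs Y)" using card_Diff1_less[OF finite_arcs e(1)] by simp
        show "carrier_labels X f ?Y ?lab" by (rule carrier_labels_collapse[OF f adm e(1) False])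
        show "3 \<le> card (half_edges ?Y u)" if "u \<in> verts ?Y" for u
          using that by (intro half_edges_collapse[OF fin e(1) False val]) auto
        show "2 * elen ?Y ?lab m d = elen ?Y ?lab a d + elen ?Y ?lab a' d" if "d \<in> arcs ?Y" for d
        proof -
          have d: "d \<in> arcs Y" using that by simp
          show ?thesis
            using mid[OF d] elen_collapse[OF lab[OF e(1)] lab[OF d] e(2)] elen_collapse[OF lab[OF e(1)] lab[OF d] 0(1)]
              elen_collapse[OF lab[OF e(1)] lab[OF d] 0(2)] by simp
        qed
        show "(\<Sum>d\<in>arcs ?Y. elen ?Y ?lab m d) \<le> L" using sum le by linarith
        show "collapse_vertex Y e v \<in> verts ?Y" using v(1) e(1) False by (auto simp: collapse_vertex_def)
      qed (rule ne)
    qed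
  next
    case False
    then have pos: "0 < elen Y lab m e" if "e \<in> arcs Y" for e
      using that elen_nonneg[of Y lab m e] by (metis less_eq_real_def)
    let ?q = "far_end Y lab m"
    have dist_q: "dist (m v) (?q h) = elen Y lab m (fst h)" if "h \<in> half_edges Y v" for h
      using dist_far_end[where lab = lab, OF that lab] by simp
    have arc: "fst h \<in> arcs Y" if "h \<in> half_edges Y v" for h using that by (simp add: half_edges_def)
    have no_overlap: False if h: "h1 \<in> half_edges Y v" "h2 \<in> half_edges Y v" "fst h1 \<noteq> fst h2"
      "dist (?q h1) (?q h2) = elen Y lab m (fst h2) - elen Y lab m (fst h1)" for h1 h2
    proof -
      obtain Z :: "('w, 'd) pre_digraph" and lab' where "carrier_labels X f Z lab'"
        "(\<Sum>e\<in>arcs Z. elen Z lab' m e) < (\<Sum>e\<in>arcs Y. elen Y lab m e)"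
        using shorten_overlap[OF f adm h(1-3) pos[OF arc[OF h(1)]] h(4)] by blast
      then show False using least[of Z lab' m] le by linarith
    qed
    have distinct: "dist (?q h1) (?q h2) \<noteq> \<bar>dist (m v) (?q h1) - dist (m v) (?q h2)\<bar>"
      if h: "h1 \<in> half_edges Y v" "h2 \<in> half_edges Y v" "h1 \<noteq> h2" for h1 h2
    proof
      assume eq: "dist (?q h1) (?q h2) = \<bar>dist (m v) (?q h1) - dist (m v) (?q h2)\<bar>"
      show False
      proof (cases "fst h1 = fst h2")
        case True
        let ?e = "fst h1"
        \<comment> \<open>Two ends of one loop in the same direction have the same far end, so the
          label and its inverse agree at \<open>m v\<close>; the square of the label has a fixed
          point.\<close>
        have "?q h1 = ?q h2" using eq h(1,2) by (simp add: dist_q True)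
        moreover have "snd h1 \<noteq> snd h2" using True h(3) by (simp add: prod_eq_iff)
        moreover have ends: "tail Y ?e = v" "head Y ?e = v"
          using True h(1,2) \<open>snd h1 \<noteq> snd h2\<close> by (auto simp: half_edges_def split: if_splits)
        ultimately have "lab ?e (m v) = finv (lab ?e) (m v)"
          using True by (auto simp: far_end_def split: if_splits)
        moreover have e: "lab ?e \<in> \<Gamma>" using lab arc h(1) by blast
        ultimately have "(lab ?e \<circ> lab ?e) (m v) = m v" by simp
        then have "lab ?e \<circ> lab ?e = id" using free_action comp_\<Gamma>[OF e e] by blast
        then have "lab ?e ^^ 2 = id" by (simp add: numeral_2_eq_2)
        then have "lab ?e = id" using dtf e unfolding discrete_torsion_free_def by (meson zero_less_numeral)
        then show False using no_trivial_loop[OF f adm arc[OF h(1)]] ends by simp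
      next
        case False
        \<comment> \<open>The sign tells which of the two edges is the shorter one; the other slides
          along it.\<close>
        consider "dist (?q h1) (?q h2) = elen Y lab m (fst h2) - elen Y lab m (fst h1)" |
          "dist (?q h2) (?q h1) = elen Y lab m (fst h1) - elen Y lab m (fst h2)"
          using eq h(1,2) by (simp add: dist_q dist_commute abs_if split: if_splits)
        then show False using no_overlap[OF h(1,2) False] no_overlap[OF h(2,1)] False by cases auto
      qed
    qed
    have line: "on_line (a v) (a' v) (?q h)" if h: "h \<in> half_edges Y v" for h
    proof -
      let ?p = "far_end Y lab a h" and ?p' = "far_end Y lab a' h"
      \<comment> \<open>Labels are isometries and preserve midpoints, so the half-edge of the
        midpoint graph is the midline of a quadrangle and the case of equality applies to
        it.\<close>
      have q: "?q h = hmid ?p ?p'"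
        using lab[OF arc[OF h]] inv_\<Gamma>[OF lab[OF arc[OF h]]] by (simp add: far_end_def m_def hseg_\<Gamma>)
      have "dist (hmid (a v) (a' v)) (hmid ?p ?p') = (dist (a v) ?p + dist (a' v) ?p') / 2"
        using mid[OF arc[OF h]] dist_q[OF h] dist_far_end[where lab = lab, OF h lab] unfolding q by (simp add: m_def)
      then have "hgram (a v) (a' v) ?p' = 0 \<and> hgram (a' v) (a v) ?p = 0" by (rule dist_hmid_quadrangle(2))
      then have "on_line (a v) (a' v) ?p'" "on_line (a v) (a' v) ?p"
        using v(2) hgram_0_imp_on_line[of "a v" "a' v"] hgram_0_imp_on_line[of "a' v" "a v"] on_line_commute[of "a v" "a' v" ?p]
        by auto
      then show ?thesis unfolding q by (intro on_line_hmid)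
    qed
    have line_v: "on_line (a v) (a' v) (m v)" unfolding m_def by (intro on_line_hmid on_line_self)
    obtain S where S: "S \<subseteq> half_edges Y v" "card S = 3" using val[OF v(1)] by (meson obtain_subset_with_card_n)
    then obtain h1 h2 h3 where h: "S = {h1, h2, h3}" "h1 \<noteq> h2" "h2 \<noteq> h3" "h1 \<noteq> h3" unfolding card_3_iff by blast
    then have hv: "h1 \<in> half_edges Y v" "h2 \<in> half_edges Y v" "h3 \<in> half_edges Y v" using S(1) by auto
    have ne: "?q h \<noteq> m v" if "h \<in> half_edges Y v" for h
      using dist_q[OF that] pos[OF arc[OF that]] by (metis dist_self less_irrefl)
    show False
      using three_points_on_line[OF ne[OF hv(1)] ne[OF hv(2)] ne[OF hv(3)] line_v line[OF hv(1)] line[OF hv(2)] line[OF hv(3)]]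
        distinct hv h(2-4) by blast
  qed
qed

end

section \<open>Comparison of parameterizations by arc length, and the conclusion\<close>

subsection \<open>Parameterization of the edges\<close>

lemma reparametrization_homeomorphism:
  fixes X :: "('v, 'e) pre_digraph" and \<phi> :: "'e \<Rightarrow> real \<Rightarrow> real"
  assumes wf: "wf_digraph X"
    and cont: "\<And>e. e \<in> arcs X \<Longrightarrow> continuous_on {0..1} (\<phi> e)" and mono: "\<And>e. e \<in> arcs X \<Longrightarrow> strict_mono_on {0..1} (\<phi> e)"
    and onto: "\<And>e. e \<in> arcs X \<Longrightarrow> \<phi> e ` {0..1} = {0..1}"
    and ends: "\<And>e. e \<in> arcs X \<Longrightarrow> \<phi> e 0 = 0 \<and> \<phi> e 1 = 1"
  defines "\<eta> \<equiv> gmap Inl (\<lambda>e t. edge_point X e (\<phi> e t))"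
  shows "homeomorphic_map (graph_top X) (graph_top X) \<eta>"
    and "\<And>e t. e \<in> arcs X \<Longrightarrow> t \<in> {0..1} \<Longrightarrow> \<eta> (edge_point X e t) = edge_point X e (\<phi> e t)"
proof -
  let ?\<psi> = "\<lambda>e. inv_into {0..1} (\<phi> e)"
  let ?\<theta> = "gmap Inl (\<lambda>e t. edge_point X e (?\<psi> e t))"
  have inj: "inj_on (\<phi> e) {0..1}" if "e \<in> arcs X" for e
    using mono[OF that] by (rule strict_mono_on_imp_inj_on)
  have inv: "?\<psi> e (\<phi> e t) = t" "\<phi> e (?\<psi> e t) = t" "\<phi> e t \<in> {0..1}" "?\<psi> e t \<in> {0..1}"
    if "e \<in> arcs X" "t \<in> {0..1}" for e t
    using inv_into_f_f[OF inj[OF that(1)] that(2)] onto[OF that(1)] that(2)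
      f_inv_into_f[of t "\<phi> e" "{0..1}"] inv_into_into[of t "\<phi> e" "{0..1}"] by blast+
  have ends': "?\<psi> e 0 = 0" "?\<psi> e 1 = 1" if "e \<in> arcs X" for e
    using inv(1)[OF that, of 0] inv(1)[OF that, of 1] ends[OF that] by auto
  have cont': "continuous_on {0..1} (?\<psi> e)" if "e \<in> arcs X" for e
  proof (rule continuous_on_eq)
    show "continuous_on {0..1} (the_inv_into {0..1} (\<phi> e))"
      using continuous_on_inv_into[OF cont[OF that] _ inj[OF that]] onto[OF that] by simp
    show "the_inv_into {0..1} (\<phi> e) t = ?\<psi> e t" if "t \<in> {0..1}" for t
      using inv(2,4)[OF \<open>e \<in> arcs X\<close> that] by (rule the_inv_into_f_eq[OF inj[OF \<open>e \<in> arcs X\<close>]])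
  qed
  have reparam: "continuous_map (graph_top X) (graph_top X) (gmap Inl (\<lambda>e t. edge_point X e (\<rho> e t)))"
    if \<rho>: "\<And>e. e \<in> arcs X \<Longrightarrow> continuous_on {0..1} (\<rho> e) \<and> \<rho> e \<in> {0..1} \<rightarrow> {0..1} \<and> \<rho> e 0 = 0 \<and> \<rho> e 1 = 1"
    for \<rho> :: "'e \<Rightarrow> real \<Rightarrow> real"
  proof (rule continuous_map_gmap[OF wf])
    fix e assume e: "e \<in> arcs X"
    show "pathin (graph_top X) (\<lambda>t. edge_point X e (\<rho> e t)) \<and> edge_point X e (\<rho> e 0) = Inl (tail X e) \<and>
        edge_point X e (\<rho> e 1) = Inl (head X e)"
      using pathin_reparam[OF pathin_edge_point[OF wf e], of "\<rho> e"] \<rho>[OF e] by (simp add: o_def)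
  qed (simp add: topspace_graph_top[OF wf])
  show \<eta>: "\<eta> (edge_point X e t) = edge_point X e (\<phi> e t)" if "e \<in> arcs X" "t \<in> {0..1}" for e t
    unfolding \<eta>_def using that ends by (intro gmap_edge_point) auto
  have \<theta>: "?\<theta> (edge_point X e t) = edge_point X e (?\<psi> e t)" if "e \<in> arcs X" "t \<in> {0..1}" for e t
    using that ends' by (intro gmap_edge_point) auto
  have "homeomorphic_maps (graph_top X) (graph_top X) \<eta> ?\<theta>"
    unfolding homeomorphic_maps_def topspace_graph_top[OF wf]
  proof (intro conjI ballI)
    show "continuous_map (graph_top X) (graph_top X) \<eta>"
      unfolding \<eta>_def using cont ends inv(3) by (intro reparam) auto
    show "continuous_map (graph_top X) (graph_top X) ?\<theta>"
      using cont' ends' inv(4) by (intro reparam) auto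
    fix z assume "z \<in> graph_points X"
    then have "?\<theta> (\<eta> z) = z \<and> \<eta> (?\<theta> z) = z"
    proof (cases rule: graph_points_cases)
      case (2 e t)
      then have t: "t \<in> {0..1}" by simp
      show ?thesis
        unfolding 2(4) \<eta>[OF 2(1) t] \<theta>[OF 2(1) t] \<eta>[OF 2(1) inv(4)[OF 2(1) t]] \<theta>[OF 2(1) inv(3)[OF 2(1) t]]
          inv(1,2)[OF 2(1) t] by simp
    qed (simp add: \<eta>_def)
    then show "?\<theta> (\<eta> z) = z" "\<eta> (?\<theta> z) = z" by simp_all
  qed
  then show "homeomorphic_map (graph_top X) (graph_top X) \<eta>" by (rule homeomorphic_maps_map[THEN iffD1, THEN conjunct1])
qed

text \<open>The path runs monotonically along a segment, with any speed and possibly with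
  pauses.\<close>

definition geodesic_path :: "(real \<Rightarrow> hyp3) \<Rightarrow> bool" where
  "geodesic_path P \<longleftrightarrow> continuous_on {0..1} P \<and>
     (\<forall>s t. 0 \<le> s \<and> s \<le> t \<and> t \<le> 1 \<longrightarrow> dist (P 0) (P s) + dist (P s) (P t) + dist (P t) (P 1) = dist (P 0) (P 1))"

lemma geodesic_path_dist:
  assumes "geodesic_path P" "0 \<le> s" "s \<le> t" "t \<le> 1"
  shows "dist (P 0) (P t) = dist (P 0) (P s) + dist (P s) (P t)"
  using assms unfolding geodesic_path_def
  by (smt (verit) dist_self)

text \<open>Without pauses the path leaves its value inside every interval, and by additivity it
  never comes back; so the arc length is strictly increasing.\<close>

lemma geodesic_path_arclength:
  assumes P: "geodesic_path P" and ne: "P 0 \<noteq> P 1"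
    and np: "\<And>s t. 0 \<le> s \<Longrightarrow> s < t \<Longrightarrow> t \<le> 1 \<Longrightarrow> \<not> P constant_on {s..t}"
  shows "continuous_on {0..1} (\<lambda>t. dist (P 0) (P t))" "strict_mono_on {0..1} (\<lambda>t. dist (P 0) (P t))"
    "(\<lambda>t. dist (P 0) (P t)) ` {0..1} = {0..dist (P 0) (P 1)}"
proof -
  let ?\<alpha> = "\<lambda>t. dist (P 0) (P t)"
  show cont: "continuous_on {0..1} ?\<alpha>"
    using P by (intro continuous_intros) (simp add: geodesic_path_def)
  show mono: "strict_mono_on {0..1} ?\<alpha>"
  proof (rule strict_mono_onI)
    fix s t :: real assume st: "s \<in> {0..1}" "t \<in> {0..1}" "s < t"
    obtain u where u: "u \<in> {s..t}" "P u \<noteq> P s"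
      using np[of s t] st unfolding constant_on_def by (metis atLeastAtMost_iff)
    have "?\<alpha> u = ?\<alpha> s + dist (P s) (P u)" "?\<alpha> t = ?\<alpha> u + dist (P u) (P t)"
      using st u by (auto intro!: geodesic_path_dist[OF P])
    moreover have "0 < dist (P s) (P u)" using u(2) by simp
    ultimately show "?\<alpha> s < ?\<alpha> t" using zero_le_dist[of "P u" "P t"] by linarith
  qed
  show "?\<alpha> ` {0..1} = {0..?\<alpha> 1}"
  proof (intro equalityI subsetI)
    fix r assume "r \<in> ?\<alpha> ` {0..1}"
    then obtain t where t: "t \<in> {0..1}" "r = ?\<alpha> t" by blast
    then show "r \<in> {0..?\<alpha> 1}"
      using geodesic_path_dist[OF P, of t 1] by simp
  next
    fix r assume "r \<in> {0..?\<alpha> 1}"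
    then have "\<exists>t\<ge>0. t \<le> 1 \<and> ?\<alpha> t = r"
      by (intro IVT' cont) auto
    then show "r \<in> ?\<alpha> ` {0..1}" by auto
  qed
qed

text \<open>\<phi> is the arc length of \<open>P\<close> followed by the inverse of the arc length
  of \<open>Q\<close>. If the ends coincide, both paths are constant and the identity
  serves.\<close>

lemma geodesic_reparametrization:
  assumes P: "geodesic_path P" and Q: "geodesic_path Q" and ends: "P 0 = Q 0" "P 1 = Q 1"
    and np: "\<And>s t. P 0 \<noteq> P 1 \<Longrightarrow> 0 \<le> s \<Longrightarrow> s < t \<Longrightarrow> t \<le> 1 \<Longrightarrow> \<not> P constant_on {s..t}"
      "\<And>s t. P 0 \<noteq> P 1 \<Longrightarrow> 0 \<le> s \<Longrightarrow> s < t \<Longrightarrow> t \<le> 1 \<Longrightarrow> \<not> Q constant_on {s..t}"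
  obtains \<phi> where "continuous_on {0..1} \<phi>" "strict_mono_on {0..1} \<phi>" "\<phi> ` {0..1} = {0..1}" "\<phi> 0 = 0" "\<phi> 1 = 1"
    "\<And>t. t \<in> {0..1} \<Longrightarrow> P t = Q (\<phi> t)"
proof (cases "P 0 = P 1")
  case True
  have const: "R t = R 0" if "geodesic_path R" "R 0 = R 1" "t \<in> {0..1}" for R t
  proof -
    have "0 = dist (R 0) (R t) + dist (R t) (R 1)"
      using geodesic_path_dist[OF that(1), of t 1] that(2,3) by simp
    then have "dist (R 0) (R t) = 0" using zero_le_dist[of "R t" "R 1"] zero_le_dist[of "R 0" "R t"] by linarith
    then show ?thesis by simp
  qed
  have "P t = P 0" "Q t = Q 0" if "t \<in> {0..1}" for t
    using const[OF P _ that] const[OF Q _ that] True ends by simp_all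
  then have "P t = Q t" if "t \<in> {0..1}" for t using that ends by metis
  then show ?thesis
    by (intro that[of id]) (auto simp: strict_mono_on_def)
next
  case False
  let ?\<alpha> = "\<lambda>t. dist (P 0) (P t)" and ?\<beta> = "\<lambda>t. dist (Q 0) (Q t)"
  let ?\<psi> = "the_inv_into {0..1} ?\<beta>"
  note \<alpha> = geodesic_path_arclength[OF P False np(1)[OF False]]
  have "Q 0 \<noteq> Q 1" using False ends by simp
  note \<beta> = geodesic_path_arclength[OF Q this np(2)[OF False]]
  have inj: "inj_on ?\<beta> {0..1}" by (rule strict_mono_on_imp_inj_on[OF \<beta>(2)])
  have img: "?\<beta> ` {0..1} = ?\<alpha> ` {0..1}" using \<alpha>(3) \<beta>(3) ends by simp
  have \<psi>: "?\<beta> (?\<psi> (?\<alpha> t)) = ?\<alpha> t" "?\<psi> (?\<alpha> t) \<in> {0..1}" if "t \<in> {0..1}" for t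
    using f_the_inv_into_f[OF inj, of "?\<alpha> t"] the_inv_into_into[OF inj, of "?\<alpha> t" "{0..1}"] img that by auto
  have eq: "?\<psi> (?\<alpha> t) = u" if "u \<in> {0..1}" "?\<beta> u = ?\<alpha> t" for t u
    using that(2,1) by (rule the_inv_into_f_eq[OF inj])
  show ?thesis
  proof (rule that[of "\<lambda>t. ?\<psi> (?\<alpha> t)"])
    have "continuous_on (?\<beta> ` {0..1}) ?\<psi>" by (rule continuous_on_inv_into[OF \<beta>(1) compact_Icc inj])
    then show "continuous_on {0..1} (\<lambda>t. ?\<psi> (?\<alpha> t))"
      by (rule continuous_on_compose2[OF _ \<alpha>(1) equalityD2[OF img]])
    show "strict_mono_on {0..1} (\<lambda>t. ?\<psi> (?\<alpha> t))"
    proof (rule strict_mono_onI)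
      fix s t :: real assume st: "s \<in> {0..1}" "t \<in> {0..1}" "s < t"
      then have "?\<beta> (?\<psi> (?\<alpha> s)) < ?\<beta> (?\<psi> (?\<alpha> t))"
        using strict_mono_onD[OF \<alpha>(2)] by (simp only: \<psi>(1))
      then show "?\<psi> (?\<alpha> s) < ?\<psi> (?\<alpha> t)"
        using \<psi>(2)[OF st(1)] \<psi>(2)[OF st(2)] strict_mono_on_less[OF \<beta>(2)] by blast
    qed
    show "(\<lambda>t. ?\<psi> (?\<alpha> t)) ` {0..1} = {0..1}"
    proof (intro equalityI subsetI)
      fix u :: real assume u: "u \<in> {0..1}"
      have "?\<beta> u \<in> ?\<alpha> ` {0..1}" using imageI[OF u, of ?\<beta>] unfolding img .
      then obtain t where t: "t \<in> {0..1}" "?\<beta> u = ?\<alpha> t" by (rule imageE)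
      show "u \<in> (\<lambda>t. ?\<psi> (?\<alpha> t)) ` {0..1}" using eq[OF u t(2)] t(1) by (intro image_eqI[of _ _ t]) simp_all
    qed (use \<psi>(2) in blast)
    show "?\<psi> (?\<alpha> 0) = 0" by (rule eq) simp_all
    show "?\<psi> (?\<alpha> 1) = 1" by (rule eq) (simp_all add: ends)
    show "P t = Q (?\<psi> (?\<alpha> t))" if t: "t \<in> {0..1}" for t
    proof (rule geodesic_point_unique[of "Q 0" _ "Q 1"])
      let ?u = "?\<psi> (?\<alpha> t)"
      show u: "dist (Q 0) (Q ?u) + dist (Q ?u) (Q 1) = dist (Q 0) (Q 1)"
        using geodesic_path_dist[OF Q, of ?u 1] \<psi>(2)[OF t] by simp
      show 1: "dist (Q 0) (P t) = dist (Q 0) (Q ?u)" using \<psi>(1)[OF t] ends by simp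
      show "dist (P t) (Q 1) = dist (Q ?u) (Q 1)"
      proof -
        have "dist (Q 0) (Q 1) = dist (Q 0) (P t) + dist (P t) (Q 1)"
          using geodesic_path_dist[OF P, of t 1] t by (simp add: ends)
        then show ?thesis using u 1 by linarith
      qed
    qed
  qed
qed

context kleinian
begin

lemma geodesic_lift:
  assumes P: "continuous_on {0..1} P" and len: "path_length setdist (\<lambda>t. orb (P t)) \<le> ennreal (dist (P 0) (P 1))"
  shows "geodesic_path P"
  unfolding geodesic_path_def
proof (intro conjI allI impI)
  fix s t :: real assume st: "0 \<le> s \<and> s \<le> t \<and> t \<le> 1"
  have "ennreal (dist (P 0) (P s) + dist (P s) (P t) + dist (P t) (P 1)) \<le> ennreal (dist (P 0) (P 1))"
    using path_length_ge[OF P, of s t] st len by (meson order_trans)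
  then have "dist (P 0) (P s) + dist (P s) (P t) + dist (P t) (P 1) \<le> dist (P 0) (P 1)"
    by (simp add: ennreal_le_iff del: ennreal_plus)
  moreover have "dist (P 0) (P 1) \<le> dist (P 0) (P s) + dist (P s) (P t) + dist (P t) (P 1)"
    using dist_triangle[of "P 0" "P 1" "P s"] dist_triangle[of "P s" "P 1" "P t"] by linarith
  ultimately show "dist (P 0) (P s) + dist (P s) (P t) + dist (P t) (P 1) = dist (P 0) (P 1)" by linarith
qed (rule P)

text \<open>The definition of minimality compares with graphs on natural numbers only; an injective
  relabelling brings \<open>Y\<close> into this form.\<close>

lemma minimal_le_carrier_labels:
  fixes X :: "('v, 'e) pre_digraph" and Y :: "('w, 'd) pre_digraph"
  assumes min: "minimal_length_in_class \<Gamma> X f" and adm: "carrier_labels X f Y lab"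
  shows "graph_length X f \<le> ennreal (\<Sum>e\<in>arcs Y. elen Y lab b e)"
proof -
  have f: "carrier_graph \<Gamma> X f" using min by (simp add: minimal_length_in_class_def)
  have "fin_digraph Y" using adm by (simp add: carrier_labels_def)
  then interpret fin_digraph Y .
  obtain i :: "'w \<Rightarrow> nat" where i: "inj_on i (verts Y)" using finite_imp_inj_to_nat_seg[OF finite_verts] by blast
  obtain j :: "'d \<Rightarrow> nat" where j: "inj_on j (arcs Y)" using finite_imp_inj_to_nat_seg[OF finite_arcs] by blast
  let ?j = "inv_into (arcs Y) j"
  define N where "N = \<lparr>verts = i ` verts Y, arcs = j ` arcs Y, tail = i \<circ> tail Y \<circ> ?j, head = i \<circ> head Y \<circ> ?j\<rparr>"
  have fin: "fin_digraph N"
    by unfold_locales (auto simp: N_def inv_into_f_f[OF j])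
  have rel: "relabels Y i j {} N"
    using i j by (auto simp: relabels_def bij_betw_def N_def inv_into_f_f)
  have "carrier_labels X f N (lab \<circ> ?j)"
    by (rule carrier_labels_relabel[OF f adm fin rel]) (simp add: inv_into_f_f[OF j])
  then have adm': "carrier_graph \<Gamma> N (straight N (lab \<circ> ?j) c)" "equivalent_carrier_graphs \<Gamma> X f N (straight N (lab \<circ> ?j) c)"
    "\<And>e. e \<in> arcs N \<Longrightarrow> (lab \<circ> ?j) e \<in> \<Gamma>" for c
    unfolding carrier_labels_def by blast+
  let ?b = "b \<circ> inv_into (verts Y) i"
  have "graph_length X f \<le> graph_length N (straight N (lab \<circ> ?j) ?b)"
    using min adm'(1,2)[of ?b] unfolding minimal_length_in_class_def by blast
  also have "\<dots> \<le> ennreal (\<Sum>e\<in>arcs N. elen N (lab \<circ> ?j) ?b e)"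
    by (rule graph_length_straight) (rule adm'(3))
  also have "(\<Sum>e\<in>arcs N. elen N (lab \<circ> ?j) ?b e) = (\<Sum>e\<in>arcs Y. elen Y lab b e)"
    unfolding N_def pre_digraph.simps sum.reindex[OF j]
    by (intro sum.cong refl) (simp add: elen_def inv_into_f_f[OF j] inv_into_f_f[OF i])
  finally show ?thesis .
qed

text \<open>The straight map with the same vertices competes with \<open>f\<close>, so the edge
  lengths sum to at most the sum of the distances; as none of them is smaller than its distance, all
  are equal.\<close>

lemma minimal_edge_length:
  assumes min: "minimal_length_in_class \<Gamma> X f" and lift: "lifts_to X f lab a"
  shows "\<And>e. e \<in> arcs X \<Longrightarrow> edge_length X f e = ennreal (elen X lab a e)"
    and "graph_length X f = ennreal (\<Sum>e\<in>arcs X. elen X lab a e)"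
proof -
  have f: "carrier_graph \<Gamma> X f" using min by (simp add: minimal_length_in_class_def)
  interpret fin_digraph X using f by (simp add: carrier_graph_def)
  let ?l = "\<lambda>e. enn2real (edge_length X f e)"
  have l: "edge_length X f e = ennreal (?l e)" if "e \<in> arcs X" for e
    using f that unfolding carrier_graph_def by (simp add: ennreal_enn2real)
  have le: "elen X lab a e \<le> ?l e" if "e \<in> arcs X" for e
  proof -
    have "ennreal (elen X lab a e) \<le> ennreal (?l e)" using edge_length_ge[OF lift that] l[OF that] by metis
    then show ?thesis by (simp add: ennreal_le_iff)
  qed
  have len: "graph_length X f = ennreal (\<Sum>e\<in>arcs X. ?l e)"
  proof -
    have "graph_length X f = (\<Sum>e\<in>arcs X. ennreal (?l e))"
      unfolding graph_length_def by (intro sum.cong refl l)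
    also have "\<dots> = ennreal (\<Sum>e\<in>arcs X. ?l e)" by (rule sum_ennreal) simp
    finally show ?thesis .
  qed
  have "(\<Sum>e\<in>arcs X. ?l e) \<le> (\<Sum>e\<in>arcs X. elen X lab a e)"
    using minimal_le_carrier_labels[OF min carrier_labels_self[OF f lift], of a] unfolding len by (simp add: ennreal_le_iff sum_nonneg)
  moreover have "(\<Sum>e\<in>arcs X. elen X lab a e) \<le> (\<Sum>e\<in>arcs X. ?l e)" by (rule sum_mono) (rule le)
  ultimately have eq: "(\<Sum>e\<in>arcs X. elen X lab a e) = (\<Sum>e\<in>arcs X. ?l e)" by simp
  then have "elen X lab a e = ?l e" if "e \<in> arcs X" for e
    using sum_mono_inv[OF eq le that finite_arcs] by simp
  then show "edge_length X f e = ennreal (elen X lab a e)" if "e \<in> arcs X" for e using l that by simp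
  show "graph_length X f = ennreal (\<Sum>e\<in>arcs X. elen X lab a e)" using len eq by simp
qed

lemma minimal_lifts_agree:
  assumes val: "\<And>v. v \<in> verts X \<Longrightarrow> 3 \<le> valence X v"
    and minf: "minimal_length_in_class \<Gamma> X f" and ming: "minimal_length_in_class \<Gamma> X g"
    and lift: "lifts_to X f lab a" "lifts_to X g lab a'" and v: "v \<in> verts X"
  shows "a v = a' v"
proof (rule ccontr)
  assume ne: "a v \<noteq> a' v"
  have f: "carrier_graph \<Gamma> X f" and g: "carrier_graph \<Gamma> X g"
    using minf ming by (simp_all add: minimal_length_in_class_def)
  have fin: "fin_digraph X" using f by (simp add: carrier_graph_def)
  interpret fin_digraph X by fact
  let ?S = "\<lambda>b. \<Sum>e\<in>arcs X. elen X lab b e" and ?m = "\<lambda>v. hmid (a v) (a' v)"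
  have adm: "carrier_labels X f X lab" "carrier_labels X g X lab" using carrier_labels_self f g lift by blast+
  have least: "?S a \<le> (\<Sum>e\<in>arcs Z. elen Z lab' b e)" if "carrier_labels X f Z lab'" for Z :: "('a, 'b) pre_digraph" and lab' b
    using minimal_le_carrier_labels[OF minf that, of b] minimal_edge_length(2)[OF minf lift(1)] by (simp add: ennreal_le_iff sum_nonneg)
  \<comment> \<open>The placement \<open>a\<close> competes with \<open>g\<close> as well, because
    \<open>f\<close> and \<open>g\<close> have the same labels; so both lengths are the least
    one.\<close>
  have "?S a' \<le> ?S a"
    using minimal_le_carrier_labels[OF ming adm(2), of a] minimal_edge_length(2)[OF ming lift(2)] by (simp add: ennreal_le_iff sum_nonneg)
  then have sum: "?S a' = ?S a" using least[OF adm(1), of a'] by simp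
  have le: "2 * elen X lab ?m e \<le> elen X lab a e + elen X lab a' e" if "e \<in> arcs X" for e
  proof -
    have "lab e \<in> \<Gamma>" using lift(1) that by (simp add: lifts_to_def)
    then show ?thesis
      using dist_hmid_quadrangle(1)[of "a (tail X e)" "a' (tail X e)" "lab e (a (head X e))" "lab e (a' (head X e))"]
      by (simp add: elen_def hseg_\<Gamma>)
  qed
  \<comment> \<open>By minimality the midpoint placement is no shorter than the average. Against the
    inequality \<open>le\<close> this forces equality for every single edge.\<close>
  have "(\<Sum>e\<in>arcs X. elen X lab a e + elen X lab a' e) \<le> (\<Sum>e\<in>arcs X. 2 * elen X lab ?m e)"
    using least[OF adm(1), of ?m] sum by (simp add: sum.distrib flip: sum_distrib_left)
  moreover have "(\<Sum>e\<in>arcs X. 2 * elen X lab ?m e) \<le> (\<Sum>e\<in>arcs X. elen X lab a e + elen X lab a' e)"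
    by (rule sum_mono) (rule le)
  ultimately have eq: "(\<Sum>e\<in>arcs X. 2 * elen X lab ?m e) = (\<Sum>e\<in>arcs X. elen X lab a e + elen X lab a' e)" by linarith
  have "?S ?m \<le> ?S a"
    using eq sum by (simp add: sum.distrib flip: sum_distrib_left)
  moreover have "2 * elen X lab ?m e = elen X lab a e + elen X lab a' e" if "e \<in> arcs X" for e
    using sum_mono_inv[OF eq le that finite_arcs] .
  ultimately show False
    using val card_half_edges[OF fin] v ne
    by (intro displaced_vertex_contradiction[where L = "?S a" and a = a and a' = a' and v = v, OF f least adm(1)]) simp_all
qed

lemma minimal_essentially_equivalent:
  assumes val: "\<And>v. v \<in> verts X \<Longrightarrow> 3 \<le> valence X v"
    and minf: "minimal_length_in_class \<Gamma> X f" and ming: "minimal_length_in_class \<Gamma> X g"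
    and np: "no_pauses X f" "no_pauses X g"
    and hom: "homotopic_with (\<lambda>_. True) (graph_top X) QT f g"
  shows "essentially_equivalent X f g"
proof -
  have f: "carrier_graph \<Gamma> X f" using minf by (simp add: minimal_length_in_class_def)
  have wf: "wf_digraph X" using f by (simp add: carrier_graph_def fin_digraph_def)
  interpret wf_digraph X by fact
  obtain lab a where a: "lifts_to X f lab a" using lifts_to_exists[OF wf] f unfolding carrier_graph_def by blast
  obtain a' where a': "lifts_to X g lab a'" using lifts_to_homotopy[OF wf a hom] .
  have agree: "a v = a' v" if "v \<in> verts X" for v by (rule minimal_lifts_agree[OF val minf ming a a' that])
  \<comment> \<open>\<open>no_pauses\<close> is about the path in the quotient. If that path is
    constant on the whole edge, so is its lift by uniqueness; a lift with different ends therefore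
    has no pause.\<close>
  have no_constant: "\<not> P constant_on {s..t}"
    if "no_pauses X F" "continuous_on {0..1} P" "e \<in> arcs X" and P: "\<And>t. t \<in> {0..1} \<Longrightarrow> F (edge_point X e t) = orb (P t)"
      and "P 0 \<noteq> P 1" "0 \<le> s" "s < t" "t \<le> 1" for P F e s t
  proof
    assume "P constant_on {s..t}"
    then have "(F \<circ> edge_point X e) constant_on {s..t}"
      using P that(6-8) unfolding constant_on_def by fastforce
    then have "(F \<circ> edge_point X e) constant_on {0..1}"
      using that(1,3,6-8) unfolding no_pauses_def by blast
    then obtain y where y: "\<And>u. u \<in> {0..1} \<Longrightarrow> orb (P u) = y"
      using P unfolding constant_on_def by auto
    have "P 1 = P 0"
    proof (rule lift_unique[where C = "{0..1::real}" and G = P and G' = "\<lambda>_. P 0" and z = 0])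
      show "orb (P u) = orb (P 0)" if "u \<in> {0..1}" for u using y[OF that] y[of 0] by simp
    qed (use that(2) in auto)
    then show False using that(5) by simp
  qed
  have ex: "\<exists>\<phi>. continuous_on {0..1} \<phi> \<and> strict_mono_on {0..1} \<phi> \<and> \<phi> ` {0..1} = {0..1} \<and> \<phi> 0 = 0 \<and> \<phi> 1 = (1::real) \<and>
      (\<forall>t\<in>{0..1}. f (edge_point X e t) = g (edge_point X e (\<phi> t)))" if e: "e \<in> arcs X" for e
  proof -
    obtain P where P: "continuous_on {0..1} P" "P 0 = a (tail X e)" "P 1 = lab e (a (head X e))"
      "\<And>t. t \<in> {0..1} \<Longrightarrow> f (edge_point X e t) = orb (P t)"
      using a e unfolding lifts_to_def by blast
    obtain Q where Q: "continuous_on {0..1} Q" "Q 0 = a' (tail X e)" "Q 1 = lab e (a' (head X e))"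
      "\<And>t. t \<in> {0..1} \<Longrightarrow> g (edge_point X e t) = orb (Q t)"
      using a' e unfolding lifts_to_def by blast
    have "path_length setdist (\<lambda>t. orb (P t)) = edge_length X f e"
      unfolding edge_length_def using P(4) by (intro path_length_cong) simp
    then have gP: "geodesic_path P"
      using minimal_edge_length(1)[OF minf a e] P(2,3) by (intro geodesic_lift P(1)) (simp add: elen_def)
    have "path_length setdist (\<lambda>t. orb (Q t)) = edge_length X g e"
      unfolding edge_length_def using Q(4) by (intro path_length_cong) simp
    then have gQ: "geodesic_path Q"
      using minimal_edge_length(1)[OF ming a' e] Q(2,3) by (intro geodesic_lift Q(1)) (simp add: elen_def)
    have ends: "P 0 = Q 0" "P 1 = Q 1" using agree e by (simp_all add: P Q)
    obtain \<phi> where \<phi>: "continuous_on {0..1} \<phi>" "strict_mono_on {0..1} \<phi>" "\<phi> ` {0..1} = {0..1}" "\<phi> 0 = 0" "\<phi> 1 = 1"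
      "\<And>t. t \<in> {0..1} \<Longrightarrow> P t = Q (\<phi> t)"
    proof (rule geodesic_reparametrization[OF gP gQ ends])
      show "\<not> P constant_on {s..t}" if "P 0 \<noteq> P 1" "0 \<le> s" "s < t" "t \<le> 1" for s t
        by (rule no_constant[OF np(1) P(1) e P(4) that])
      show "\<not> Q constant_on {s..t}" if "P 0 \<noteq> P 1" "0 \<le> s" "s < t" "t \<le> 1" for s t
        using that(1) by (intro no_constant[OF np(2) Q(1) e Q(4) _ that(2-4)]) (simp_all add: ends)
    qed (rule that)
    have "f (edge_point X e t) = g (edge_point X e (\<phi> t))" if "t \<in> {0..1}" for t
    proof -
      have "\<phi> t \<in> {0..1}" using \<phi>(3) that by blast
      then show ?thesis using P(4)[OF that] Q(4) \<phi>(6)[OF that] by simp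
    qed
    then show ?thesis using \<phi>(1-5) by (intro exI[of _ \<phi>]) blast
  qed
  obtain \<phi> where \<phi>: "\<And>e. e \<in> arcs X \<Longrightarrow> continuous_on {0..1} (\<phi> e) \<and> strict_mono_on {0..1} (\<phi> e) \<and> \<phi> e ` {0..1} = {0..1} \<and>
      \<phi> e 0 = 0 \<and> \<phi> e 1 = (1::real) \<and> (\<forall>t\<in>{0..1}. f (edge_point X e t) = g (edge_point X e (\<phi> e t)))"
    using ex by metis
  define \<eta> :: "'a + 'b \<times> real \<Rightarrow> 'a + 'b \<times> real" where "\<eta> = gmap Inl (\<lambda>e t. edge_point X e (\<phi> e t))"
  have hom: "homeomorphic_map (graph_top X) (graph_top X) \<eta>"
    and \<eta>: "\<And>e t. e \<in> arcs X \<Longrightarrow> t \<in> {0..1} \<Longrightarrow> \<eta> (edge_point X e t) = edge_point X e (\<phi> e t)"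
    unfolding \<eta>_def using \<phi> by (intro reparametrization_homeomorphism[OF wf]; blast)+
  have "f x = g (\<eta> x)" if "x \<in> graph_points X" for x
    using that
  proof (cases rule: graph_points_cases)
    case (1 v)
    then show ?thesis using a a' agree by (simp add: \<eta>_def lifts_to_def)
  next
    case (2 e t)
    then show ?thesis using \<eta>[of e t] \<phi>[of e] by simp
  qed
  moreover have "\<exists>\<rho> :: real \<Rightarrow> real. strict_mono_on {0..1} \<rho> \<and> \<rho> ` {0..1} = {0..1} \<and>
      (\<forall>t\<in>{0..1}. \<eta> (edge_point X e t) = edge_point X e (\<rho> t))" if "e \<in> arcs X" for e
    using \<phi>[OF that] \<eta>[OF that] by (intro exI[of _ "\<phi> e"]) blast
  moreover have "\<eta> (Inl v) = Inl v" for v by (simp add: \<eta>_def)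
  ultimately show ?thesis
    unfolding essentially_equivalent_def using hom by blast
qed

end

theorem theorem1:
  fixes \<Gamma> :: "(hyp3 \<Rightarrow> hyp3) set"
    and X :: "('v, 'e) pre_digraph"
    and f g :: "'v + 'e \<times> real \<Rightarrow> hyp3 set"
  assumes "discrete_torsion_free \<Gamma>"
    and "\<forall>x\<in>hyp3_quotient \<Gamma>. finitely_generated (fundamental_group (hyp3_quotient_top \<Gamma>) x)"
    and "\<forall>v\<in>verts X. 3 \<le> valence X v"
    and "carrier_graph \<Gamma> X f" "no_pauses X f"
    and "carrier_graph \<Gamma> X g" "no_pauses X g"
    and "minimal_length_in_class \<Gamma> X f \<and> minimal_length_in_class \<Gamma> X g \<or>
         minimal_length_carrier_graph \<Gamma> X f \<and> minimal_length_carrier_graph \<Gamma> X g"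
    and "homotopic_with (\<lambda>_. True) (graph_top X) (hyp3_quotient_top \<Gamma>) f g"
  shows "essentially_equivalent X f g"
proof -
  interpret kleinian \<Gamma> by unfold_locales (rule assms(1))
  have "minimal_length_in_class \<Gamma> X f" "minimal_length_in_class \<Gamma> X g"
    using assms(8) unfolding minimal_length_in_class_def minimal_length_carrier_graph_def by blast+
  then show ?thesis
    using assms(3) by (intro minimal_essentially_equivalent assms(5,7,9)) simp_all
qed

end
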